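(* Let $(\Sigma,g,\phi,\lambda)$ be a complete shrinking gradient Ricci soliton of dimension $n\ge 3$ with scalar curvature $R$ such that $\lambda R\le|\mathrm{Ric}|^2$. Assume that there exists a sequence of compactly supported piecewise smooth functions $\{\psi_i\}_i$ on $\Sigma$ such that $0\le\psi_i\le 1$ in $\Sigma$, the compact sets $\Omega_i:=\psi_i^{-1}(1)$ form an increasing exhaustion of $\Sigma$, and the sequence of weighted energies $\left\{\int_\Sigma|\nabla\psi_i|^2R^2e^\phi\,dv_\Sigma\right\}_i$ is bounded. Then $(\Sigma,g)$ has constant scalar curvature and $\lambda R=|\mathrm{Ric}|^2$.
   Context: Manifolds are smooth, connected, orientable and without boundary. A gradient Ricci soliton $(\Sigma,g,\phi,\lambda)$ is a Riemannian manifold $(\Sigma,g)$ with $\phi\in C^\infty(\Sigma)$ and $\lambda\in\mathbb R$ such that $\mathrm{Ric}-\nabla^2\phi=\lambda g$ (note the sign convention for $\phi$), where $\nabla^2\phi$ is the Hessian; it is shrinking if $\lambda>0$. $\mathrm{Ric}$ is the Ricci tensor of $g$, $|\cdot|$ the norm induced by $g$, and $dv_\Sigma$ the Riemannian volume measure. *)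

theory Defs
  imports "HOL-Analysis.Analysis"
begin

section \<open>Smooth functions on open subsets of Euclidean space\<close>

definition pd :: "'n \<Rightarrow> (real^'n \<Rightarrow> real) \<Rightarrow> real^'n \<Rightarrow> real" where
  "pd i f u = frechet_derivative f (at u) (axis i 1)"

text \<open>The next two notions are only meant for open \<open>S\<close>.\<close>

primrec Ck_on :: "nat \<Rightarrow> (real^'n) set \<Rightarrow> (real^'n \<Rightarrow> real) \<Rightarrow> bool" where
  "Ck_on 0 S f \<longleftrightarrow> continuous_on S f"
| "Ck_on (Suc k) S f \<longleftrightarrow> f differentiable_on S \<and> (\<forall>i. Ck_on k S (pd i f))"

definition Cinf_on :: "(real^'n) set \<Rightarrow> (real^'n \<Rightarrow> real) \<Rightarrow> bool" where
  "Cinf_on S f \<longleftrightarrow> (\<forall>k. Ck_on k S f)"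


section \<open>Manifolds\<close>

text \<open>The points of the manifold are all elements of the type \<open>'a\<close>, which carries the topology of
  the manifold. A chart \<open>(U, x)\<close> consists of its domain and its coordinate map; values of \<open>x\<close>
  outside \<open>U\<close> are irrelevant. The dimension is \<open>CARD('n)\<close>.\<close>

type_synonym ('a, 'n) chart = "'a set \<times> ('a \<Rightarrow> real^'n)"

definition cdom :: "('a, 'n::finite) chart \<Rightarrow> 'a set" where
  "cdom c = fst c"

definition cmap :: "('a, 'n::finite) chart \<Rightarrow> 'a \<Rightarrow> real^'n" where
  "cmap c = snd c"

definition cinv :: "('a, 'n::finite) chart \<Rightarrow> real^'n \<Rightarrow> 'a" where
  "cinv c = inv_into (cdom c) (cmap c)"

definition is_chart :: "('a::topological_space, 'n::finite) chart \<Rightarrow> bool" where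
  "is_chart c \<longleftrightarrow> open (cdom c) \<and> open (cmap c ` cdom c) \<and>
     homeomorphism (cdom c) (cmap c ` cdom c) (cmap c) (cinv c)"

definition smooth_atlas :: "('a::topological_space, 'n::finite) chart set \<Rightarrow> bool" where
  "smooth_atlas A \<longleftrightarrow> (\<forall>c\<in>A. is_chart c) \<and> (\<Union>c\<in>A. cdom c) = UNIV \<and>
     (\<forall>c\<in>A. \<forall>d\<in>A. \<forall>k.
        Cinf_on (cmap c ` (cdom c \<inter> cdom d)) (\<lambda>u. cmap d (cinv c u) $ k))"

text \<open>The atlas \<open>A\<close> need not be maximal, so an oriented atlas of the smooth structure
  it generates is an oriented atlas \<open>B\<close> compatible with \<open>A\<close>.\<close>

definition orientable :: "('a::topological_space, 'n::finite) chart set \<Rightarrow> bool" where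
  "orientable A \<longleftrightarrow> (\<exists>B. smooth_atlas (A \<union> B) \<and> (\<Union>c\<in>B. cdom c) = UNIV \<and>
     (\<forall>c\<in>B. \<forall>d\<in>B. \<forall>p\<in>cdom c \<inter> cdom d.
        det (\<chi> i j. pd j (\<lambda>u. cmap d (cinv c u) $ i) (cmap c p)) > 0))"

definition smooth_manifold ::
  "('a::{t2_space,second_countable_topology}, 'n::finite) chart set \<Rightarrow> bool" where
  "smooth_manifold A \<longleftrightarrow> smooth_atlas A \<and> connected (UNIV :: 'a set) \<and> orientable A"

definition smooth_fun :: "('a, 'n::finite) chart set \<Rightarrow> ('a \<Rightarrow> real) \<Rightarrow> bool" where
  "smooth_fun A f \<longleftrightarrow> (\<forall>c\<in>A. Cinf_on (cmap c ` cdom c) (f \<circ> cinv c))"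


section \<open>Tangent vectors and Riemannian metrics\<close>

text \<open>Tangent vectors at \<open>p\<close> are the derivations at \<open>p\<close> of the algebra of smooth functions,
  represented as functionals on all functions that vanish on the non-smooth ones.\<close>

type_synonym 'a tvec = "('a \<Rightarrow> real) \<Rightarrow> real"

definition tangent_space :: "('a, 'n::finite) chart set \<Rightarrow> 'a \<Rightarrow> 'a tvec set" where
  "tangent_space A p = {v.
     (\<forall>f h. smooth_fun A f \<longrightarrow> smooth_fun A h \<longrightarrow>
        v (\<lambda>q. f q + h q) = v f + v h \<and>
        v (\<lambda>q. f q * h q) = f p * v h + h p * v f) \<and>
     (\<forall>f a. smooth_fun A f \<longrightarrow> v (\<lambda>q. a * f q) = a * v f) \<and>
     (\<forall>f. \<not> smooth_fun A f \<longrightarrow> v f = 0)}"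

definition coord_vec ::
  "('a, 'n::finite) chart set \<Rightarrow> ('a, 'n) chart \<Rightarrow> 'a \<Rightarrow> 'n \<Rightarrow> 'a tvec" where
  "coord_vec A c p i = (\<lambda>f. if smooth_fun A f then pd i (f \<circ> cinv c) (cmap c p) else 0)"

definition velocity ::
  "('a, 'n::finite) chart set \<Rightarrow> (real \<Rightarrow> 'a) \<Rightarrow> real \<Rightarrow> 'a tvec" where
  "velocity A \<gamma> t = (\<lambda>f. if smooth_fun A f then vector_derivative (f \<circ> \<gamma>) (at t) else 0)"

type_synonym 'a metric_tensor = "'a \<Rightarrow> 'a tvec \<Rightarrow> 'a tvec \<Rightarrow> real"

text \<open>The matrix \<open>(g\<^sub>i\<^sub>j)\<close> of the metric in a chart, as a function of the coordinates.\<close>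

definition gmat ::
  "('a, 'n::finite) chart set \<Rightarrow> 'a metric_tensor \<Rightarrow> ('a, 'n) chart \<Rightarrow> real^'n \<Rightarrow> real^'n^'n" where
  "gmat A g c u =
     (\<chi> i j. g (cinv c u) (coord_vec A c (cinv c u) i) (coord_vec A c (cinv c u) j))"

definition riemannian_metric ::
  "('a, 'n::finite) chart set \<Rightarrow> 'a metric_tensor \<Rightarrow> bool" where
  "riemannian_metric A g \<longleftrightarrow>
     (\<forall>p. \<forall>v\<in>tangent_space A p. \<forall>w\<in>tangent_space A p.
        g p v w = g p w v \<and>
        (\<forall>z\<in>tangent_space A p. g p (\<lambda>f. v f + w f) z = g p v z + g p w z) \<and>
        (\<forall>a. g p (\<lambda>f. a * v f) w = a * g p v w) \<and>
        (v \<noteq> (\<lambda>f. 0) \<longrightarrow> g p v v > 0)) \<and>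
     (\<forall>c\<in>A. \<forall>i j. Cinf_on (cmap c ` cdom c) (\<lambda>u. gmat A g c u $ i $ j))"

definition riemannian_manifold ::
  "('a::{t2_space,second_countable_topology}, 'n::finite) chart set \<Rightarrow> 'a metric_tensor \<Rightarrow> bool"
  where
  "riemannian_manifold A g \<longleftrightarrow> smooth_manifold A \<and> riemannian_metric A g"


section \<open>Riemannian distance and completeness\<close>

text \<open>Singularities of the derivative are allowed at finitely many parameters. This does not change
  the distance: such curves are rectifiable with length given by the integral, or have infinite
  length.\<close>

definition piecewise_C1_path ::
  "('a::topological_space, 'n::finite) chart set \<Rightarrow> (real \<Rightarrow> 'a) \<Rightarrow> bool" where
  "piecewise_C1_path A \<gamma> \<longleftrightarrow> path \<gamma> \<and>
     (\<exists>S. finite S \<and>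
       (\<forall>c\<in>A. (cmap c \<circ> \<gamma>) C1_differentiable_on {t. 0 < t \<and> t < 1 \<and> t \<notin> S \<and> \<gamma> t \<in> cdom c}))"

definition path_length ::
  "('a, 'n::finite) chart set \<Rightarrow> 'a metric_tensor \<Rightarrow> (real \<Rightarrow> 'a) \<Rightarrow> ennreal" where
  "path_length A g \<gamma> =
     (\<integral>\<^sup>+ t\<in>{0..1}. ennreal (sqrt (g (\<gamma> t) (velocity A \<gamma> t) (velocity A \<gamma> t))) \<partial>lborel)"

definition riem_dist ::
  "('a::topological_space, 'n::finite) chart set \<Rightarrow> 'a metric_tensor \<Rightarrow> 'a \<Rightarrow> 'a \<Rightarrow> real" where
  "riem_dist A g p q = enn2real
     (INF \<gamma>\<in>{\<gamma>. piecewise_C1_path A \<gamma> \<and> pathstart \<gamma> = p \<and> pathfinish \<gamma> = q}. path_length A g \<gamma>)"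

definition riem_complete ::
  "('a::topological_space, 'n::finite) chart set \<Rightarrow> 'a metric_tensor \<Rightarrow> bool" where
  "riem_complete A g \<longleftrightarrow> Metric_space.mcomplete UNIV (riem_dist A g)"


section \<open>The Riemannian volume measure\<close>

text \<open>The unique Borel measure which in every chart has density \<open>sqrt (det g\<^sub>i\<^sub>j)\<close> with respect to
  Lebesgue measure.\<close>

definition riem_volume ::
  "('a::topological_space, 'n::finite) chart set \<Rightarrow> 'a metric_tensor \<Rightarrow> 'a measure" where
  "riem_volume A g = (THE \<mu>. sets \<mu> = sets borel \<and>
     (\<forall>c\<in>A. \<forall>B\<in>sets borel. B \<subseteq> cdom c \<longrightarrow>
        emeasure \<mu> B = (\<integral>\<^sup>+ u\<in>cmap c ` B. ennreal (sqrt (det (gmat A g c u))) \<partial>lborel)))"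


section \<open>Curvature, Hessian and gradient in coordinates\<close>

text \<open>In this section \<open>G\<close> is the matrix-valued function \<open>(g\<^sub>i\<^sub>j)\<close> on an open subset of
  Euclidean space.\<close>

definition christoffel ::
  "(real^'n \<Rightarrow> real^'n^'n) \<Rightarrow> 'n \<Rightarrow> 'n \<Rightarrow> 'n \<Rightarrow> real^'n::finite \<Rightarrow> real" where
  "christoffel G k i j u = (\<Sum>l\<in>UNIV. matrix_inv (G u) $ k $ l *
     (pd i (\<lambda>y. G y $ j $ l) u + pd j (\<lambda>y. G y $ i $ l) u - pd l (\<lambda>y. G y $ i $ j) u)) / 2"

text \<open>The component \<open>dx\<^sup>l (R(\<partial>\<^sub>i, \<partial>\<^sub>j) \<partial>\<^sub>k)\<close> of the curvature
  \<open>R(X,Y)Z = \<nabla>\<^sub>X\<nabla>\<^sub>YZ - \<nabla>\<^sub>Y\<nabla>\<^sub>XZ - \<nabla>\<^bsub>[X,Y]\<^esub>Z\<close>. With this convention the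
  Ricci tensor below is positive on round spheres.\<close>

definition riem_curv ::
  "(real^'n \<Rightarrow> real^'n^'n) \<Rightarrow> 'n \<Rightarrow> 'n \<Rightarrow> 'n \<Rightarrow> 'n \<Rightarrow> real^'n::finite \<Rightarrow> real" where
  "riem_curv G l k i j u =
     pd i (christoffel G l j k) u - pd j (christoffel G l i k) u +
     (\<Sum>m\<in>UNIV. christoffel G l i m u * christoffel G m j k u -
                christoffel G l j m u * christoffel G m i k u)"

definition ricci :: "(real^'n \<Rightarrow> real^'n^'n) \<Rightarrow> 'n \<Rightarrow> 'n \<Rightarrow> real^'n::finite \<Rightarrow> real" where
  "ricci G j k u = (\<Sum>i\<in>UNIV. riem_curv G i k i j u)"

definition hessian ::
  "(real^'n \<Rightarrow> real^'n^'n) \<Rightarrow> (real^'n \<Rightarrow> real) \<Rightarrow> 'n \<Rightarrow> 'n \<Rightarrow> real^'n::finite \<Rightarrow> real" where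
  "hessian G f i j u = pd i (pd j f) u - (\<Sum>k\<in>UNIV. christoffel G k i j u * pd k f u)"

definition scal_loc :: "(real^'n \<Rightarrow> real^'n^'n) \<Rightarrow> real^'n::finite \<Rightarrow> real" where
  "scal_loc G u = (\<Sum>i\<in>UNIV. \<Sum>j\<in>UNIV. matrix_inv (G u) $ i $ j * ricci G i j u)"

definition ricci_norm_sq_loc :: "(real^'n \<Rightarrow> real^'n^'n) \<Rightarrow> real^'n::finite \<Rightarrow> real" where
  "ricci_norm_sq_loc G u = (\<Sum>i\<in>UNIV. \<Sum>j\<in>UNIV. \<Sum>k\<in>UNIV. \<Sum>l\<in>UNIV.
     matrix_inv (G u) $ i $ k * matrix_inv (G u) $ j $ l * ricci G i j u * ricci G k l u)"

definition grad_norm_sq_loc ::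
  "(real^'n \<Rightarrow> real^'n^'n) \<Rightarrow> (real^'n \<Rightarrow> real) \<Rightarrow> real^'n::finite \<Rightarrow> real" where
  "grad_norm_sq_loc G f u =
     (\<Sum>i\<in>UNIV. \<Sum>j\<in>UNIV. matrix_inv (G u) $ i $ j * pd i f u * pd j f u)"


section \<open>Scalar quantities on the manifold\<close>

text \<open>The local expressions above are invariant under changes of coordinates, so that any chart
  around the point may be used for their evaluation.\<close>

definition chart_at :: "('a, 'n::finite) chart set \<Rightarrow> 'a \<Rightarrow> ('a, 'n) chart" where
  "chart_at A p = (SOME c. c \<in> A \<and> p \<in> cdom c)"

definition scalar_curvature ::
  "('a, 'n::finite) chart set \<Rightarrow> 'a metric_tensor \<Rightarrow> 'a \<Rightarrow> real" where
  "scalar_curvature A g p = (let c = chart_at A p in scal_loc (gmat A g c) (cmap c p))"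

definition ricci_norm_sq ::
  "('a, 'n::finite) chart set \<Rightarrow> 'a metric_tensor \<Rightarrow> 'a \<Rightarrow> real" where
  "ricci_norm_sq A g p = (let c = chart_at A p in ricci_norm_sq_loc (gmat A g c) (cmap c p))"

text \<open>Piecewise smooth functions are locally Lipschitz and hence differentiable almost everywhere;
  on the remaining null set the value is set to 0.\<close>

definition grad_norm_sq ::
  "('a, 'n::finite) chart set \<Rightarrow> 'a metric_tensor \<Rightarrow> ('a \<Rightarrow> real) \<Rightarrow> 'a \<Rightarrow> real" where
  "grad_norm_sq A g f p = (let c = chart_at A p in
     if (f \<circ> cinv c) differentiable (at (cmap c p))
     then grad_norm_sq_loc (gmat A g c) (f \<circ> cinv c) (cmap c p) else 0)"


section \<open>Gradient Ricci solitons\<close>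

definition gradient_ricci_soliton ::
  "('a::{t2_space,second_countable_topology}, 'n::finite) chart set \<Rightarrow> 'a metric_tensor \<Rightarrow>
   ('a \<Rightarrow> real) \<Rightarrow> real \<Rightarrow> bool" where
  "gradient_ricci_soliton A g \<phi> lam \<longleftrightarrow> riemannian_manifold A g \<and> smooth_fun A \<phi> \<and>
     (\<forall>c\<in>A. \<forall>u\<in>cmap c ` cdom c. \<forall>i j.
        ricci (gmat A g c) i j u - hessian (gmat A g c) (\<phi> \<circ> cinv c) i j u =
        lam * gmat A g c u $ i $ j)"


section \<open>Test functions\<close>

text \<open>A function is piecewise smooth if the manifold is a locally finite union of closed pieces on
  each of which the function is the restriction of a smooth one. No regularity of the pieces is
  required, so this includes e.g. functions that are smooth on the simplices of a triangulation.
  Continuity of the function is a consequence.\<close>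

definition piecewise_smooth ::
  "('a::topological_space, 'n::finite) chart set \<Rightarrow> ('a \<Rightarrow> real) \<Rightarrow> bool" where
  "piecewise_smooth A \<psi> \<longleftrightarrow> (\<exists>\<K>. locally_finite_in euclidean \<K> \<and> \<Union>\<K> = UNIV \<and>
     (\<forall>K\<in>\<K>. closed K \<and> (\<exists>f. smooth_fun A f \<and> (\<forall>p\<in>K. \<psi> p = f p))))"

definition compactly_supported :: "('a::topological_space \<Rightarrow> real) \<Rightarrow> bool" where
  "compactly_supported \<psi> \<longleftrightarrow> compact (closure {p. \<psi> p \<noteq> 0})"

definition weighted_energy ::
  "('a::topological_space, 'n::finite) chart set \<Rightarrow> 'a metric_tensor \<Rightarrow> ('a \<Rightarrow> real) \<Rightarrow>
   ('a \<Rightarrow> real) \<Rightarrow> ennreal" where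
  "weighted_energy A g \<phi> \<psi> =
     (\<integral>\<^sup>+ p. ennreal (grad_norm_sq A g \<psi> p * (scalar_curvature A g p)\<^sup>2 * exp (\<phi> p))
        \<partial>riem_volume A g)"

end

theory Submission
 imports Defs "HOL-Analysis.Analysis"
begin

text \<open>
 By the contracted Bianchi identity the scalar curvature of a gradient Ricci soliton satisfies
 \<open>\<Delta>R + \<langle>\<nabla>\<phi>, \<nabla>R\<rangle> = 2 (\<lambda> R - |Ric|\<^sup>2)\<close>, so under the pinching assumption \<open>R\<close> is a supersolution of the
 drift Laplacian \<open>L = \<Delta> + \<langle>\<nabla>\<phi>, \<nabla>\<cdot>\<rangle>\<close>. It suffices to show that \<open>R\<close> attains its minimum: then it is
 constant by the strong maximum principle, and the identity gives \<open>\<lambda> R = |Ric|\<^sup>2\<close>. Let \<open>d\<close> be the distance from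
 a point. Varying minimizing geodesics by parallel fields yields, in the barrier sense,
 \<open>L (d\<^sup>2 / 2) \<le> a\<^sub>0 + a\<^sub>1 d - \<lambda> d\<^sup>2\<close>, because the Hessian of \<open>\<phi>\<close> in the second variation cancels against the
 Ricci curvature up to \<open>\<lambda>\<close>. Comparison with functions of \<open>d\<close> then shows first that \<open>R\<close> is bounded below and
 then that its minimum is attained. In place of the exponential map the argument uses metric geodesics, which
 exist by completeness and are of class \<open>C\<^sup>1\<close>, and upper barriers for \<open>d\<^sup>2\<close> that are propagated along them from
 chart to chart.
\<close>

text \<open>The obstacle is that d^2 is not smooth and that a variation lives in one chart only.
  Both are met by working with 2-jets: a barrier is an upper bound up to o(s^2) along all curves
  with a prescribed velocity and covariant acceleration, which is a chart-independent notion. Bounds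
  on consecutive arcs add up because of (x + y)^2 <= (a + b) (x^2/a + y^2/b), a weighted triangle
  inequality for squared distances. The variation fields are h E_i with E a parallel frame. Each
  curve also gets the covariant acceleration h^2/n times the gradient of \<phi>; summed over i these
  contribute h^2 Hess \<phi>(v,v), and together with -h^2 Ric(v,v) only -\<lambda> h^2 |v|^2
  survives. The factor h rises from 0 to 1 close to the base point, where the gradient of \<phi> is
  bounded, and is 1 afterwards, so nothing about \<phi> far away enters. For the lower bound, the
  barrier (1 - d^2/a^2)^(-2) has the exponent for which its second derivatives are of the size of
  its square, matching the term R^2/n.\<close>

abbreviation (input) sumU :: "('i::finite => 'b::comm_monoid_add) => 'b"  (binder "SU " 10) where
 "sumU f \<equiv> sum f UNIV"

section \<open>Calculus of smooth functions\<close>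

lemma linear_axis_expand:
 fixes L :: "real^'n::finite => 'b::real_vector"
 assumes "linear L"
 shows "L v = (SU i. v $ i *\<^sub>R L (axis i 1))"
proof -
 have "L v = L (SU i. v $ i *\<^sub>R axis i 1)"
  by (simp only: scalar_mult_eq_scaleR[symmetric] basis_expansion)
 also have "... = (SU i. v $ i *\<^sub>R L (axis i 1))"
  by (simp add: linear_sum[OF assms] linear_cmul[OF assms])
 finally show ?thesis .
qed

lemma pd_has_derivative:
 fixes f :: "real^'n::finite => real"
 assumes "f differentiable (at u)"
 shows "(f has_derivative (%h. SU i. h $ i * pd i f u)) (at u)"
proof -
 have "(f has_derivative frechet_derivative f (at u)) (at u)"
  using assms by (rule frechet_derivative_works[THEN iffD1])
 moreover have "frechet_derivative f (at u) = (%h. SU i. h $ i * pd i f u)"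
  unfolding pd_def
  by (rule ext) (rule linear_axis_expand[OF linear_frechet_derivative[OF assms], unfolded real_scaleR_def])
 ultimately show ?thesis by simp
qed

lemma pd_eqI:
 assumes "(f has_derivative D) (at u)" "D (axis i 1) = c"
 shows "pd i f u = c"
 unfolding pd_def frechet_derivative_at[OF assms(1), symmetric] by (rule assms(2))

text \<open>\<open>frechet_derivative\<close> chooses from the set of all derivatives at the point.
  Functions that agree near \<open>u\<close> have the same set, so the choice agrees even where
  neither is differentiable.\<close>

lemma pd_cong_open:
 assumes "open S" "u \<in> S" "!!x. x \<in> S ==> f x = h x"
 shows "pd i f u = pd i h u"
proof -
 have "(f has_derivative D) (at u) \<longleftrightarrow> (h has_derivative D) (at u)" for D
  using has_derivative_transform_within_open[OF _ assms(1,2), of f D UNIV h]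
   has_derivative_transform_within_open[OF _ assms(1,2), of h D UNIV f] assms(3) by auto
 then have "(%D. (f has_derivative D) (at u)) = (%D. (h has_derivative D) (at u))" by blast
 then have "frechet_derivative f (at u) = frechet_derivative h (at u)"
  unfolding frechet_derivative_def by (rule arg_cong)
 then show ?thesis unfolding pd_def by (rule fun_cong)
qed

lemma differentiable_at_open:
 "open S ==> f differentiable_on S ==> u \<in> S ==> f differentiable (at u)"
 by (metis at_within_open differentiable_on_def)

lemma Ck_on_cong:
 assumes "open S" "!!x. x \<in> S ==> f x = h x"
 shows "Ck_on k S f = Ck_on k S h"
 using assms(2)
proof (induction k arbitrary: f h)
 case 0 then show ?case by (simp cong: continuous_on_cong)
next
 case (Suc k)
 have "Ck_on k S (pd i f) = Ck_on k S (pd i h)" for i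
  by (rule Suc.IH) (metis pd_cong_open assms(1) Suc.prems)
 moreover have "f differentiable_on S \<longleftrightarrow> h differentiable_on S"
  unfolding differentiable_on_def differentiable_def
  using has_derivative_transform[of _ S h f] has_derivative_transform[of _ S f h] Suc.prems by metis
 ultimately show ?case by simp
qed

lemma Ck_on_subset:
 assumes "Ck_on k S f" "T \<subseteq> S"
 shows "Ck_on k T f"
 using assms
proof (induction k arbitrary: f)
 case 0 then show ?case using continuous_on_subset by auto
next
 case (Suc k) then show ?case using differentiable_on_subset by auto
qed

lemma Ck_on_Suc: "Ck_on (Suc k) S f ==> Ck_on k S f"
proof (induction k arbitrary: f)
 case 0 then show ?case by (simp add: differentiable_imp_continuous_on)
next
 case (Suc k) then show ?case by (metis Ck_on.simps(2))
qed

lemma Cinf_on_cong: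
 "open S ==> (!!x. x \<in> S ==> f x = h x) ==> Cinf_on S f = Cinf_on S h"
 unfolding Cinf_on_def using Ck_on_cong by blast

lemma Cinf_on_subset: "Cinf_on S f ==> T \<subseteq> S ==> Cinf_on T f"
 unfolding Cinf_on_def using Ck_on_subset by blast

lemma Cinf_on_pd: "Cinf_on S f ==> Cinf_on S (pd i f)"
 unfolding Cinf_on_def by (metis Ck_on.simps(2))

lemma Cinf_on_differentiable: "Cinf_on S f ==> f differentiable_on S"
 unfolding Cinf_on_def by (metis Ck_on.simps(2))

lemma Cinf_on_continuous: "Cinf_on S f ==> continuous_on S f"
 unfolding Cinf_on_def by (metis Ck_on.simps(1))

lemma Cinf_on_differentiable_at:
 "Cinf_on S f ==> open S ==> u \<in> S ==> f differentiable (at u)"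
 using Cinf_on_differentiable differentiable_at_open by blast

lemma Cinf_on_has_derivative:
 "Cinf_on S f ==> open S ==> u \<in> S ==>
  (f has_derivative (%h. SU i. h $ i * pd i f u)) (at u)"
 using Cinf_on_differentiable_at pd_has_derivative by blast

lemma Cinf_on_local:
 assumes "open S" "!!u. u \<in> S ==> \<exists>T. open T & u \<in> T & Cinf_on T f"
 shows "Cinf_on S f"
proof -
 have "Ck_on k S f" if "!!u. u \<in> S ==> \<exists>T. open T & u \<in> T & Ck_on k T f" for k
  using that
 proof (induction k arbitrary: f)
  case 0
  have "continuous (at u) f" if "u \<in> S" for u
   using 0[OF that] by (auto simp: continuous_on_eq_continuous_at)
  then show ?case
   by (simp add: continuous_at_imp_continuous_on)
 next
  case (Suc k)
  have "f differentiable (at u)" if "u \<in> S" for u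
   using Suc.prems[OF that] differentiable_at_open by auto
  then have "f differentiable_on S"
   by (simp add: differentiable_at_imp_differentiable_on)
  moreover have "Ck_on k S (pd i f)" for i
  proof (rule Suc.IH)
   fix u assume "u \<in> S"
   then show "\<exists>T. open T & u \<in> T & Ck_on k T (pd i f)"
    using Suc.prems[of u] by auto
  qed
  ultimately show ?case by simp
 qed
 then show ?thesis using assms(2) unfolding Cinf_on_def by blast
qed

lemma pd_const [simp]: "pd i (%u. c) = (%u. 0)"
 by (intro ext pd_eqI[where D="%h. 0"]) auto

lemma Ck_on_const: "Ck_on k S (%u. c)"
 by (induction k arbitrary: c) auto

lemma pd_add:
 assumes "f differentiable (at u)" "h differentiable (at u)"
 shows "pd i (%x. f x + h x) u = pd i f u + pd i h u"
 by (rule pd_eqI[OF has_derivative_add[OF pd_has_derivative[OF assms(1)] pd_has_derivative[OF assms(2)]]])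
   (simp add: axis_def if_distrib if_distribR cong: if_cong)

lemma pd_mult:
 assumes "f differentiable (at u)" "h differentiable (at u)"
 shows "pd i (%x. f x * h x) u = pd i f u * h u + f u * pd i h u"
 by (rule pd_eqI[OF has_derivative_mult[OF pd_has_derivative[OF assms(1)] pd_has_derivative[OF assms(2)]]])
   (simp add: axis_def if_distrib if_distribR cong: if_cong)

lemma Ck_on_add:
 assumes "open S" "Ck_on k S f" "Ck_on k S h"
 shows "Ck_on k S (%u. f u + h u)"
 using assms(2,3)
proof (induction k arbitrary: f h)
 case 0 then show ?case by (simp add: continuous_on_add)
next
 case (Suc k)
 have "pd i (%u. f u + h u) x = pd i f x + pd i h x" if "x \<in> S" for i x
  using Suc.prems that by (intro pd_add differentiable_at_open[OF assms(1)]) auto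
 then have "Ck_on k S (pd i (%u. f u + h u))" for i
  using Ck_on_cong[OF assms(1), of "pd i (%u. f u + h u)" "%u. pd i f u + pd i h u" k] Suc
  by simp
 then show ?case using Suc.prems by (simp add: differentiable_on_add)
qed

lemma Ck_on_mult:
 assumes "open S" "Ck_on k S f" "Ck_on k S h"
 shows "Ck_on k S (%u. f u * h u)"
 using assms(2,3)
proof (induction k arbitrary: f h)
 case 0 then show ?case by (simp add: continuous_on_mult)
next
 case (Suc k)
 have "Ck_on k S (%u. pd i f u * h u + f u * pd i h u)" for i
  using Suc.prems Ck_on_Suc[OF Suc.prems(1)] Ck_on_Suc[OF Suc.prems(2)]
  by (intro Ck_on_add Suc.IH assms(1)) auto
 moreover have "pd i (%u. f u * h u) x = pd i f x * h x + f x * pd i h x" if "x \<in> S" for i x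
  using Suc.prems that by (intro pd_mult differentiable_at_open[OF assms(1)]) auto
 ultimately have "Ck_on k S (pd i (%u. f u * h u))" for i
  using Ck_on_cong[OF assms(1), of "pd i (%u. f u * h u)" "%u. pd i f u * h u + f u * pd i h u" k]
  by simp
 then show ?case using Suc.prems by (simp add: differentiable_on_mult)
qed

lemma Ck_on_sum:
 assumes "open S" "!!a. a \<in> I ==> Ck_on k S (f a)"
 shows "Ck_on k S (%u. \<Sum>a\<in>I. f a u)"
 using assms(2) by (induction I rule: infinite_finite_induct) (auto simp: Ck_on_const Ck_on_add assms(1))

lemma Cinf_on_const: "Cinf_on S (%u. c)"
 by (simp add: Cinf_on_def Ck_on_const)

lemma Cinf_on_if: "Cinf_on S f ==> Cinf_on S h ==> Cinf_on S (%u. if b then f u else h u)"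
 by (cases b) auto

lemma Cinf_on_add: "open S ==> Cinf_on S f ==> Cinf_on S h ==> Cinf_on S (%u. f u + h u)"
 by (simp add: Cinf_on_def Ck_on_add)

lemma Cinf_on_mult: "open S ==> Cinf_on S f ==> Cinf_on S h ==> Cinf_on S (%u. f u * h u)"
 by (simp add: Cinf_on_def Ck_on_mult)

lemma Cinf_on_minus: "open S ==> Cinf_on S f ==> Cinf_on S (%u. - f u)"
 using Cinf_on_mult[of S "%u. -1" f] Cinf_on_const by auto

lemma Cinf_on_diff: "open S ==> Cinf_on S f ==> Cinf_on S h ==> Cinf_on S (%u. f u - h u)"
 using Cinf_on_add[of S f "%u. - h u"] Cinf_on_minus by auto

lemma Cinf_on_sum:
 "open S ==> (!!a. a \<in> I ==> Cinf_on S (f a)) ==> Cinf_on S (%u. \<Sum>a\<in>I. f a u)"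
 by (simp add: Cinf_on_def Ck_on_sum)

lemma Cinf_on_prod:
 assumes "open S" "!!a. a \<in> I ==> Cinf_on S (f a)"
 shows "Cinf_on S (%u. \<Prod>a\<in>I. f a u)"
 using assms(2)
 by (induction I rule: infinite_finite_induct) (auto simp: Cinf_on_const Cinf_on_mult assms(1))

lemma pd_component: "pd i (%u::real^'n::finite. u $ j) u = (if i = j then 1 else 0)"
 by (rule pd_eqI[where D="%h. h $ j"])
   (auto simp: axis_def intro!: bounded_linear_imp_has_derivative bounded_linear_vec_nth)

lemma Cinf_on_component: "Cinf_on S (%u::real^'n::finite. u $ j)"
 unfolding Cinf_on_def
proof
 fix k show "Ck_on k S (%u::real^'n. u $ j)"
 proof (cases k)
  case 0 then show ?thesis by (simp add: continuous_on_component)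
 next
  case (Suc m)
  have "pd i (%u::real^'n. u $ j) = (%u. if i = j then 1 else 0)" for i
   by (simp add: fun_eq_iff pd_component)
  moreover have "(%u::real^'n. u $ j) differentiable_on S"
   by (simp add: linear_imp_differentiable_on bounded_linear.linear bounded_linear_vec_nth)
  ultimately show ?thesis using Suc by (simp add: Ck_on_const)
 qed
qed

lemma has_derivative_vec:
 fixes f :: "'a::real_normed_vector => real^'n::finite"
 assumes "!!k. ((%x. f x $ k) has_derivative (%h. D h $ k)) (at x within S)"
 shows "(f has_derivative D) (at x within S)"
 using assms
 by (subst has_derivative_componentwise_within) (auto simp: Basis_vec_def inner_axis)

section \<open>Smooth maps, inverse matrices and symmetry of second derivatives\<close>

definition smap :: "(real^'n::finite) set => (real^'n => real^'m::finite) => bool" where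
 "smap S T \<longleftrightarrow> (\<forall>k. Cinf_on S (%u. T u $ k))"

definition jac :: "(real^'n::finite => real^'m::finite) => real^'n => real^'n => real^'m" where
 "jac T u h = (\<chi> k. SU i. h $ i * pd i (%u. T u $ k) u)"

lemma smap_has_derivative:
 assumes "smap S T" "open S" "u \<in> S"
 shows "(T has_derivative jac T u) (at u)"
 by (rule has_derivative_vec)
   (use assms Cinf_on_has_derivative in \<open>auto simp: jac_def smap_def\<close>)

lemma smap_continuous_on: "smap S T ==> continuous_on S T"
 using continuous_on_vec_lambda[of S "%i u. T u $ i"] by (simp add: smap_def Cinf_on_continuous)

lemma pd_compose:
 fixes T :: "real^'n::finite => real^'m::finite"
 assumes "f differentiable (at (T u))" "!!k. (%u. T u $ k) differentiable (at u)"
 shows "pd i (%x. f (T x)) u = (SU k. pd k f (T u) * pd i (%x. T x $ k) u)"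
proof -
 have T: "(T has_derivative jac T u) (at u)"
  by (rule has_derivative_vec) (use assms(2) pd_has_derivative in \<open>auto simp: jac_def\<close>)
 show ?thesis
  by (rule pd_eqI[OF has_derivative_compose[OF T pd_has_derivative[OF assms(1)]]])
    (simp add: jac_def axis_def if_distrib if_distribR mult.commute cong: if_cong)
qed

lemma Ck_on_compose:
 fixes T :: "real^'n::finite => real^'m::finite"
 assumes "open S" "open S'" "smap S T" "T ` S \<subseteq> S'" "Ck_on k S' f"
 shows "Ck_on k S (%u. f (T u))"
 using assms(5)
proof (induction k arbitrary: f)
 case 0
 then show ?case
  using continuous_on_compose2[OF _ smap_continuous_on[OF assms(3)] assms(4)] by simp
next
 case (Suc k)
 have *: "f differentiable (at (T u))" "(%u. T u $ l) differentiable (at u)" if "u \<in> S" for u l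
  using that assms Suc.prems differentiable_at_open[of S' f "T u"] Cinf_on_differentiable_at[of S "%u. T u $ l" u]
  by (auto simp: smap_def image_subset_iff)
 have "Ck_on k S (%u. SU l. pd l f (T u) * pd i (%x. T x $ l) u)" for i
  using Suc assms(3) Cinf_on_pd[of S "%x. T x $ l" i for l]
  by (intro Ck_on_sum Ck_on_mult assms(1)) (auto simp: smap_def Cinf_on_def)
 then have "Ck_on k S (pd i (%u. f (T u)))" for i
  using Ck_on_cong[OF assms(1), of "pd i (%u. f (T u))"
    "%u. SU l. pd l f (T u) * pd i (%x. T x $ l) u" k] pd_compose[OF *]
  by simp
 moreover have "(%u. f (T u)) differentiable_on S"
 proof (rule differentiable_at_imp_differentiable_on)
  fix u assume u: "u \<in> S"
  show "(%u. f (T u)) differentiable (at u)"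
   using has_derivative_compose[OF smap_has_derivative[OF assms(3,1) u] pd_has_derivative[OF *(1)[OF u]]]
   by (auto simp: differentiable_def)
 qed
 ultimately show ?case by simp
qed

lemma Cinf_on_compose:
 "open S ==> open S' ==> smap S T ==> T ` S \<subseteq> S' ==> Cinf_on S' f ==> Cinf_on S (%u. f (T u))"
 unfolding Cinf_on_def using Ck_on_compose by blast

text \<open>\<open>F\<close> lists all derivatives of the outer function, and the induction over the
  order keeps \<open>n\<close> arbitrary. This avoids a separate notion of smooth functions of one
  real variable.\<close>

lemma Cinf_on_real_compose:
 fixes F :: "nat => real => real"
 assumes "open S" "Cinf_on S p" "!!u. u \<in> S ==> p u \<in> D"
  and F: "!!n x. x \<in> D ==> (F n has_real_derivative F (Suc n) x) (at x)"
 shows "Cinf_on S (%u. F n (p u))"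
proof -
 have "Ck_on k S (%u. F n (p u))" for k n
 proof (induction k arbitrary: n)
  case 0
  have "continuous_on D (F n)"
   using F[THEN DERIV_isCont] by (auto intro!: continuous_at_imp_continuous_on)
  then show ?case
   using continuous_on_compose2[OF _ Cinf_on_continuous[OF assms(2)]] assms(3) by auto
 next
  case (Suc k)
  have hd: "((%u. F n (p u)) has_derivative
    (%h. F (Suc n) (p u) * (SU i. h $ i * pd i p u))) (at u)" if "u \<in> S" for u
   using has_derivative_compose[OF Cinf_on_has_derivative[OF assms(2,1) that]
     F[OF assms(3)[OF that], unfolded has_field_derivative_def]] .
  have "pd i (%u. F n (p u)) u = F (Suc n) (p u) * pd i p u" if "u \<in> S" for i u
   by (rule pd_eqI[OF hd[OF that]]) (simp add: axis_def if_distrib if_distribR cong: if_cong)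
  moreover have "Ck_on k S (%u. F (Suc n) (p u) * pd i p u)" for i
   using Suc Cinf_on_pd[OF assms(2)] by (intro Ck_on_mult assms(1)) (auto simp: Cinf_on_def)
  ultimately have "Ck_on k S (pd i (%u. F n (p u)))" for i
   using Ck_on_cong[OF assms(1), of "pd i (%u. F n (p u))" "%u. F (Suc n) (p u) * pd i p u" k]
   by simp
  moreover have "(%u. F n (p u)) differentiable_on S"
   using hd by (intro differentiable_at_imp_differentiable_on) (auto simp: differentiable_def)
  ultimately show ?case by simp
 qed
 then show ?thesis by (simp add: Cinf_on_def)
qed

lemma Cinf_on_inverse:
 assumes "open S" "Cinf_on S p" "!!u. u \<in> S ==> p u ~= 0"
 shows "Cinf_on S (%u. inverse (p u))"
proof -
 define F where "F n x = (-1) ^ n * fact n * inverse x ^ Suc n" for n and x :: real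
 have "(F n has_real_derivative F (Suc n) x) (at x)" if "x \<in> - {0}" for n x
  using DERIV_cmult[OF DERIV_power_Suc[OF DERIV_inverse], of x "(-1) ^ n * fact n" n UNIV] that
  unfolding F_def by (simp add: algebra_simps)
 note Cinf_on_real_compose[where F = F and n = 0 and D = "- {0}", OF assms(1,2) _ this]
 then have "Cinf_on S (%u. F 0 (p u))" using assms(3) by blast
 then show ?thesis by (simp add: F_def)
qed

lemma Cinf_on_divide:
 "open S ==> Cinf_on S f ==> Cinf_on S p ==> (!!u. u \<in> S ==> p u ~= 0) ==>
  Cinf_on S (%u. f u / p u)"
 using Cinf_on_mult[of S f "%u. inverse (p u)"] Cinf_on_inverse[of S p] by (simp add: divide_inverse)

lemma Cinf_on_det:
 assumes "open S" "!!i j. Cinf_on S (%u. M u $ i $ j)"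
 shows "Cinf_on S (%u. det (M u :: real^'m::finite^'m))"
 unfolding det_def using assms
 by (intro Cinf_on_sum Cinf_on_mult Cinf_on_const Cinf_on_prod) auto

lemma matrix_inv_mult:
 fixes A :: "real^'m::finite^'m"
 assumes "det A ~= 0"
 shows "A ** matrix_inv A = mat 1" "matrix_inv A ** A = mat 1"
proof -
 have "invertible A" using assms by (simp add: invertible_det_nz)
 then have "\<exists>B. A ** B = mat 1 & B ** A = mat 1" by (simp add: invertible_def)
 from someI_ex[OF this] show "A ** matrix_inv A = mat 1" "matrix_inv A ** A = mat 1"
  by (simp_all add: matrix_inv_def)
qed

text \<open>Cramer's rule: the entries are quotients of polynomials in the entries of
  \<open>A\<close>, which is what makes the inverse of a smooth matrix smooth.\<close>

lemma matrix_inv_entry: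
 fixes A :: "real^'m::finite^'m"
 assumes "det A ~= 0"
 shows "matrix_inv A $ k $ l = det (\<chi> i j. if j = k then axis l 1 $ i else A $ i $ j) / det A"
proof -
 have "A *v (matrix_inv A *v axis l 1) = axis l 1"
  by (simp add: matrix_vector_mul_assoc matrix_inv_mult[OF assms])
 then have "matrix_inv A *v axis l 1 =
   (\<chi> k. det (\<chi> i j. if j = k then axis l 1 $ i else A $ i $ j) / det A)"
  using cramer[OF assms] by blast
 then show ?thesis
  by (simp add: matrix_vector_mult_basis column_def vec_eq_iff)
qed

lemma Cinf_on_matrix_inv:
 fixes M :: "real^'n::finite => real^'m::finite^'m"
 assumes "open S" "!!i j. Cinf_on S (%u. M u $ i $ j)" "!!u. u \<in> S ==> det (M u) ~= 0"
 shows "Cinf_on S (%u. matrix_inv (M u) $ k $ l)"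
proof -
 have "Cinf_on S (%u. det (\<chi> i j. if j = k then axis l 1 $ i else M u $ i $ j) / det (M u))"
  using assms by (intro Cinf_on_divide Cinf_on_det) (auto intro: Cinf_on_if Cinf_on_const)
 then show ?thesis
  using Cinf_on_cong[OF assms(1), of "%u. matrix_inv (M u) $ k $ l"
    "%u. det (\<chi> i j. if j = k then axis l 1 $ i else M u $ i $ j) / det (M u)"]
   matrix_inv_entry[OF assms(3)] by simp
qed

lemma has_real_derivative_line:
 assumes "f differentiable (at (u + s *\<^sub>R axis i 1))"
 shows "((%s. f (u + s *\<^sub>R axis i 1)) has_real_derivative pd i f (u + s *\<^sub>R axis i 1)) (at s)"
proof -
 have "((%s. u + s *\<^sub>R axis i 1) has_derivative (%h. h *\<^sub>R axis i 1)) (at s)"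
  by (auto intro!: derivative_eq_intros)
 from has_derivative_compose[OF this pd_has_derivative[OF assms]]
 have "((%s. f (u + s *\<^sub>R axis i 1)) has_derivative
   (%h. SU j. (h *\<^sub>R axis i 1) $ j * pd j f (u + s *\<^sub>R axis i 1))) (at s)" .
 moreover have "(SU j. (h *\<^sub>R axis i 1) $ j * pd j f x) = h * pd i f x" for h x
  by (simp add: axis_def if_distrib if_distribR cong: if_cong)
 ultimately show ?thesis
  by (simp add: has_field_derivative_def mult.commute[of _ "pd i f _"] mult_commute_abs)
qed

text \<open>The mean value theorem, first in \<open>s\<close> for the increment of \<open>f\<close>
  in direction \<open>j\<close>, then in \<open>t\<close> for \<open>pd i f\<close>.\<close>

lemma mixed_difference:
 assumes S: "open S" "Cinf_on S f" and r: "0 < r"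
  and in_S: "!!s t. 0 <= s ==> s <= r ==> 0 <= t ==> t <= r ==> u + s *\<^sub>R axis i 1 + t *\<^sub>R axis j 1 \<in> S"
 shows "\<exists>s t. 0 < s & s < r & 0 < t & t < r &
  f (u + r *\<^sub>R axis i 1 + r *\<^sub>R axis j 1) - f (u + r *\<^sub>R axis i 1) - (f (u + r *\<^sub>R axis j 1) - f u)
   = r * (r * pd j (pd i f) (u + s *\<^sub>R axis i 1 + t *\<^sub>R axis j 1))"
proof -
 let ?p = "%s t. u + s *\<^sub>R axis i 1 + t *\<^sub>R axis j (1::real)"
 have ds: "((%s. f (?p s t)) has_real_derivative pd i f (?p s t)) (at s)"
  and dt: "((%t. pd i f (?p s t)) has_real_derivative pd j (pd i f) (?p s t)) (at t)"
  if "0 <= s" "s <= r" "0 <= t" "t <= r" for s t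
  using has_real_derivative_line[of f "u + t *\<^sub>R axis j 1" s i]
   has_real_derivative_line[of "pd i f" "u + s *\<^sub>R axis i 1" t j]
   Cinf_on_differentiable_at[OF S(2,1) in_S[OF that]] Cinf_on_differentiable_at[OF Cinf_on_pd[OF S(2)] S(1) in_S[OF that]]
  by (simp_all add: add_ac)
 have "\<exists>s>0. s < r & (f (?p r r) - f (?p r 0)) - (f (?p 0 r) - f (?p 0 0)) = (r - 0) * (pd i f (?p s r) - pd i f (?p s 0))"
  by (rule MVT2[OF r], intro DERIV_diff ds) (use r in auto)
 then obtain s where s: "0 < s" "s < r" "(f (?p r r) - f (?p r 0)) - (f (?p 0 r) - f (?p 0 0)) = r * (pd i f (?p s r) - pd i f (?p s 0))"
  by auto
 have "\<exists>t>0. t < r & pd i f (?p s r) - pd i f (?p s 0) = (r - 0) * pd j (pd i f) (?p s t)"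
  by (rule MVT2[OF r], intro dt) (use s in auto)
 then show ?thesis using s by auto
qed

text \<open>The double increment of \<open>mixed_difference\<close> is symmetric in the two
  directions. So the two mixed derivatives take a common value at points arbitrarily close to
  \<open>u\<close>, and by continuity they cannot differ at \<open>u\<close>.\<close>

lemma pd_commute:
 fixes f :: "real^'n::finite => real"
 assumes S: "open S" "Cinf_on S f" "u \<in> S"
 shows "pd i (pd j f) u = pd j (pd i f) u"
proof (rule ccontr)
 let ?p = "%i j s t. u + s *\<^sub>R axis i 1 + t *\<^sub>R axis j (1::real)"
 assume "pd i (pd j f) u ~= pd j (pd i f) u"
 then have e: "0 < \<bar>pd i (pd j f) u - pd j (pd i f) u\<bar> / 2" (is "0 < ?e") by simp
 have c: "continuous_on S (pd i (pd j f))" for i j by (intro Cinf_on_continuous Cinf_on_pd S)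
 obtain d where d: "d > 0" "ball u d \<subseteq> S" using S openE by blast
 obtain d1 where d1: "d1 > 0" "!!v. v \<in> S ==> dist v u < d1 ==> dist (pd i (pd j f) v) (pd i (pd j f) u) < ?e"
  using c[of i j] S(3) e unfolding continuous_on_iff by meson
 obtain d2 where d2: "d2 > 0" "!!v. v \<in> S ==> dist v u < d2 ==> dist (pd j (pd i f) v) (pd j (pd i f) u) < ?e"
  using c[of j i] S(3) e unfolding continuous_on_iff by meson
 define r where "r = min d (min d1 d2) / 3"
 have r: "0 < r" "3 * r <= d" "3 * r <= d1" "3 * r <= d2" using d d1 d2 by (auto simp: r_def)
 have near: "dist (?p i j s t) u < 3 * r" if "0 <= s" "s <= r" "0 <= t" "t <= r" for s t i j
  using norm_triangle_ineq[of "s *\<^sub>R axis i (1::real)" "t *\<^sub>R axis j (1::real)"] that r(1)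
  by (simp add: dist_norm add.assoc)
 have in_S: "?p i j s t \<in> S" if "0 <= s" "s <= r" "0 <= t" "t <= r" for s t i j
  using near[OF that, of i j] r(2) d(2) by (auto simp: dist_commute)
 obtain s t where st: "0 < s" "s < r" "0 < t" "t < r" "f (?p i j r r) - f (u + r *\<^sub>R axis i 1) - (f (u + r *\<^sub>R axis j 1) - f u)
   = r * (r * pd j (pd i f) (?p i j s t))"
  using mixed_difference[OF S(1,2) r(1) in_S, of i j] by blast
 obtain s' t' where st': "0 < s'" "s' < r" "0 < t'" "t' < r" "f (?p j i r r) - f (u + r *\<^sub>R axis j 1) - (f (u + r *\<^sub>R axis i 1) - f u)
   = r * (r * pd i (pd j f) (?p j i s' t'))"
  using mixed_difference[OF S(1,2) r(1) in_S, of j i] by blast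
 have "f (?p i j r r) = f (?p j i r r)" by (simp add: add_ac)
 then have "r * (r * pd j (pd i f) (?p i j s t)) = r * (r * pd i (pd j f) (?p j i s' t'))"
  using st(5) st'(5) by linarith
 then have "pd j (pd i f) (?p i j s t) = pd i (pd j f) (?p j i s' t')" using r(1) by simp
 moreover have "dist (pd j (pd i f) (?p i j s t)) (pd j (pd i f) u) < ?e"
  by (rule d2(2)[OF in_S less_le_trans[OF near r(4)]]) (use st in auto)
 moreover have "dist (pd i (pd j f) (?p j i s' t')) (pd i (pd j f) u) < ?e"
  by (rule d1(2)[OF in_S less_le_trans[OF near r(3)]]) (use st' in auto)
 moreover have False if "x = y" "dist x b < \<bar>a - b\<bar> / 2" "dist y a < \<bar>a - b\<bar> / 2" for x y a b :: real
  using that by (auto simp: dist_real_def abs_if split: if_splits)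
 ultimately show False by blast
qed


section \<open>A smooth cutoff function\<close>

definition flat_fun :: "real poly => real => real" where
 "flat_fun P x = (if x > 0 then poly P (inverse x) * exp (- inverse x) else 0)"

lemma poly_mult_exp_tendsto_0: "((%y. poly P y * exp (- y)) \<longlongrightarrow> (0::real)) at_top"
proof -
 have "((%y. \<Sum>i\<le>degree P. coeff P i * (y ^ i / exp y)) \<longlongrightarrow> (\<Sum>i\<le>degree P. coeff P i * 0)) at_top"
  by (intro tendsto_intros tendsto_power_div_exp_0)
 then show ?thesis
  by (simp add: poly_altdef sum_distrib_right exp_minus divide_inverse mult.assoc)
qed

text \<open>With y = 1/x one has d/dx = - y^2 d/dy, so the derivative of P(y) e^(-y) is y^2 (P - P')
  e^(-y): the class is closed under differentiation, and \<open>Cinf_on_real_compose\<close> applies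
  with an explicit sequence of derivatives. At 0 the difference quotient has the same form with the
  polynomial y P(y), which the exponential beats.\<close>

lemma flat_fun_derivative:
 "(flat_fun P has_real_derivative flat_fun ([:0, 0, 1:] * (P - pderiv P)) x) (at x)"
proof -
 consider "x > 0" | "x < 0" | "x = 0" by linarith
 then show ?thesis
 proof cases
  case 1
  have "((%x. poly P (inverse x) * exp (- inverse x)) has_real_derivative
    flat_fun ([:0, 0, 1:] * (P - pderiv P)) x) (at x)"
   using 1 unfolding flat_fun_def
   by (auto intro!: derivative_eq_intros poly_DERIV[THEN DERIV_chain2] simp: algebra_simps)
  then show ?thesis
   by (rule has_field_derivative_transform_within_open[of _ _ _ "{0<..}"])
    (use 1 in \<open>auto simp: flat_fun_def\<close>)
 next
  case 2
  have "((%x. 0) has_real_derivative flat_fun ([:0, 0, 1:] * (P - pderiv P)) x) (at x)"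
   using 2 by (simp add: flat_fun_def)
  then show ?thesis
   by (rule has_field_derivative_transform_within_open[of _ _ _ "{..<0}"])
    (use 2 in \<open>auto simp: flat_fun_def\<close>)
 next
  case 3
  have "((%h. flat_fun P h / h) \<longlongrightarrow> 0) (at_right 0)"
  proof (rule Lim_transform_eventually)
   show "((%h. poly ([:0, 1:] * P) (inverse h) * exp (- inverse h)) \<longlongrightarrow> 0) (at_right (0::real))"
    using filterlim_compose[OF poly_mult_exp_tendsto_0 filterlim_inverse_at_top_right] .
   show "\<forall>\<^sub>F h in at_right 0. poly ([:0, 1:] * P) (inverse h) * exp (- inverse h) = flat_fun P h / h"
    using eventually_at_right_less[of "0::real"]
    by eventually_elim (simp add: flat_fun_def field_simps)
  qed
  moreover have "((%h. flat_fun P h / h) \<longlongrightarrow> 0) (at_left 0)"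
  proof (rule Lim_transform_eventually[OF tendsto_const])
   show "\<forall>\<^sub>F h in at_left 0. 0 = flat_fun P h / h"
    unfolding eventually_at_filter by (intro always_eventually) (auto simp: flat_fun_def)
  qed
  ultimately have "((%h. flat_fun P h / h) \<longlongrightarrow> 0) (at 0)"
   using filterlim_split_at by blast
  then show ?thesis using 3 by (simp add: has_field_derivative_iff flat_fun_def)
 qed
qed

text \<open>Tangent vectors only act on globally smooth functions, so that functions given in a chart have to be
 cut off.\<close>

definition bump :: "real^'n::finite => real => real^'n => real" where
 "bump u0 r u = flat_fun 1 (r^2 - (SU i. (u $ i - u0 $ i) * (u $ i - u0 $ i)))"

lemma Cinf_on_bump: "open S ==> Cinf_on S (bump u0 r)"
proof -
 assume S: "open S"
 define P where "P = rec_nat (1::real poly) (%_ P. [:0, 0, 1:] * (P - pderiv P))"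
 have "(flat_fun (P n) has_real_derivative flat_fun (P (Suc n)) x) (at x)" for n x
  using flat_fun_derivative by (simp add: P_def)
 then have "Cinf_on S (%u. flat_fun (P 0) (r^2 - (SU i. (u $ i - u0 $ i) * (u $ i - u0 $ i))))"
  using S by (intro Cinf_on_real_compose[where D = UNIV and F = "%n. flat_fun (P n)"]
   Cinf_on_diff Cinf_on_const Cinf_on_sum Cinf_on_mult Cinf_on_component) auto
 then show ?thesis by (simp add: P_def bump_def[abs_def])
qed

lemma bump_zero_outside: "u \<notin> ball u0 r ==> r > 0 ==> bump u0 r u = 0"
proof -
 assume *: "u \<notin> ball u0 r" "r > 0"
 have "(SU i. (u $ i - u0 $ i) * (u $ i - u0 $ i)) = (norm (u - u0))^2"
  unfolding power2_norm_eq_inner by (simp add: inner_vec_def)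
 moreover have "r^2 <= (norm (u - u0))^2"
  using * by (intro power_mono) (auto simp: dist_norm norm_minus_commute)
 ultimately show ?thesis by (simp add: bump_def flat_fun_def)
qed

lemma bump_center_pos: "r > 0 ==> bump u0 r u0 > 0"
 by (simp add: bump_def flat_fun_def)

section \<open>Charts and smooth functions\<close>

abbreviation cimg :: "('a, 'n::finite) chart => (real^'n) set" where
 "cimg c \<equiv> cmap c ` cdom c"

abbreviation trans_map :: "('a, 'n::finite) chart => ('a, 'n) chart => real^'n => real^'n" where
 "trans_map c d \<equiv> %u. cmap d (cinv c u)"

locale atlas =
 fixes A :: "('a::t2_space, 'n::finite) chart set"
 assumes atlas: "smooth_atlas A"
begin

lemma is_chart: "c \<in> A ==> is_chart c"
 using atlas by (simp add: smooth_atlas_def)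

lemma open_cdom: "c \<in> A ==> open (cdom c)" and open_cimg: "c \<in> A ==> open (cimg c)"
 using is_chart by (auto simp: is_chart_def)

lemma cinv_cmap [simp]: "c \<in> A ==> p \<in> cdom c ==> cinv c (cmap c p) = p"
 using is_chart by (auto simp: is_chart_def homeomorphism_def)

lemma cmap_cinv [simp]: "c \<in> A ==> u \<in> cimg c ==> cmap c (cinv c u) = u"
 using is_chart by (auto simp: is_chart_def homeomorphism_def)

lemma cinv_in [simp]: "c \<in> A ==> u \<in> cimg c ==> cinv c u \<in> cdom c"
 using cinv_cmap by auto

lemma continuous_cmap: "c \<in> A ==> continuous_on (cdom c) (cmap c)"
 and continuous_cinv: "c \<in> A ==> continuous_on (cimg c) (cinv c)"
 using is_chart by (auto simp: is_chart_def homeomorphism_def)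

lemma chart_ex: "\<exists>c\<in>A. p \<in> cdom c"
 using atlas by (auto simp: smooth_atlas_def)

lemma open_cmap_image: "c \<in> A ==> open U ==> U \<subseteq> cdom c ==> open (cmap c ` U)"
proof -
 assume c: "c \<in> A" and U: "open U" "U \<subseteq> cdom c"
 have "open (cimg c \<inter> cinv c -` U)"
  using continuous_open_preimage[OF continuous_cinv[OF c] open_cimg[OF c] U(1)] .
 moreover have "cimg c \<inter> cinv c -` U = cmap c ` U" using c U(2) by auto
 ultimately show ?thesis by simp
qed

lemma open_cinv_image: "c \<in> A ==> open V ==> V \<subseteq> cimg c ==> open (cinv c ` V)"
proof -
 assume c: "c \<in> A" and V: "open V" "V \<subseteq> cimg c"
 have "open (cdom c \<inter> cmap c -` V)"
  using continuous_open_preimage[OF continuous_cmap[OF c] open_cdom[OF c] V(1)] .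
 moreover have "cdom c \<inter> cmap c -` V = cinv c ` V"
 proof
  show "cdom c \<inter> cmap c -` V \<subseteq> cinv c ` V"
  proof
   fix p assume "p \<in> cdom c \<inter> cmap c -` V"
   then show "p \<in> cinv c ` V" using cinv_cmap[OF c, of p] by (intro image_eqI[of _ _ "cmap c p"]) auto
  qed
  show "cinv c ` V \<subseteq> cdom c \<inter> cmap c -` V"
  proof (rule image_subsetI)
   fix u assume u: "u \<in> V"
   then have "u \<in> cimg c" using V(2) by blast
   then show "cinv c u \<in> cdom c \<inter> cmap c -` V" using c u by simp
  qed
 qed
 ultimately show ?thesis by simp
qed

lemma open_overlap: "c \<in> A ==> d \<in> A ==> open (cmap c ` (cdom c \<inter> cdom d))"
 by (intro open_cmap_image open_Int open_cdom) auto

lemma smap_trans: "c \<in> A ==> d \<in> A ==> smap (cmap c ` (cdom c \<inter> cdom d)) (trans_map c d)"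
 using atlas by (auto simp: smooth_atlas_def smap_def)

lemma trans_map_image:
 "c \<in> A ==> d \<in> A ==> trans_map c d ` cmap c ` (cdom c \<inter> cdom d) = cmap d ` (cdom c \<inter> cdom d)"
 by (force simp: image_image)

lemma smooth_funD: "smooth_fun A f ==> c \<in> A ==> Cinf_on (cimg c) (f \<circ> cinv c)"
 by (auto simp: smooth_fun_def)

lemma smooth_fun_const: "smooth_fun A (%p. a)"
 by (simp add: smooth_fun_def o_def Cinf_on_const)

lemma smooth_fun_add: "smooth_fun A f ==> smooth_fun A h ==> smooth_fun A (%p. f p + h p)"
 and smooth_fun_mult: "smooth_fun A f ==> smooth_fun A h ==> smooth_fun A (%p. f p * h p)"
 unfolding smooth_fun_def o_def by (simp_all add: Cinf_on_add Cinf_on_mult open_cimg)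

text \<open>The points outside the domain of \<open>c\<close> are the difficulty: as the topology is
  Hausdorff, the compact image of \<open>K\<close> is closed, so each of them has a neighbourhood on
  which the extension vanishes.\<close>

lemma smooth_fun_extend:
 assumes c: "c \<in> A" and h: "!!S. open S ==> Cinf_on S h"
  and K: "compact K" "K \<subseteq> cimg c" "!!u. u \<notin> K ==> h u = 0"
 shows "smooth_fun A (%p. if p \<in> cdom c then h (cmap c p) else 0)" (is "smooth_fun A ?f")
 unfolding smooth_fun_def
proof
 fix d assume d: "d \<in> A"
 have "compact (cinv c ` K)"
  using compact_continuous_image[OF continuous_on_subset[OF continuous_cinv[OF c] K(2)] K(1)] .
 then have cl: "closed (cinv c ` K)" by (rule compact_imp_closed)
 show "Cinf_on (cimg d) (?f \<circ> cinv d)"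
 proof (rule Cinf_on_local[OF open_cimg[OF d]])
  fix w assume w: "w \<in> cimg d"
  then obtain q where q: "q \<in> cdom d" "w = cmap d q" by auto
  show "\<exists>T. open T & w \<in> T & Cinf_on T (?f \<circ> cinv d)"
  proof (cases "q \<in> cdom c")
   case True
   let ?T = "cmap d ` (cdom d \<inter> cdom c)"
   have eq: "h (trans_map d c u) = (?f \<circ> cinv d) u" if u: "u \<in> ?T" for u
   proof -
    obtain p where "u = cmap d p" "p \<in> cdom d" "p \<in> cdom c" using u by blast
    then show ?thesis using d by simp
   qed
   have "Cinf_on ?T (%u. h (trans_map d c u))"
    by (rule Cinf_on_compose[OF open_overlap[OF d c] open_UNIV smap_trans[OF d c] _ h]) auto
   then have "Cinf_on ?T (?f \<circ> cinv d)"
    using Cinf_on_cong[OF open_overlap[OF d c], of "%u. h (trans_map d c u)" "?f \<circ> cinv d"] eq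
    by simp
   then show ?thesis using open_overlap[OF d c] q True by blast
  next
   case False
   let ?T = "cmap d ` (cdom d - cinv c ` K)"
   have T: "open ?T" using cl d by (intro open_cmap_image open_Diff open_cdom) auto
   have "(?f \<circ> cinv d) u = 0" if u: "u \<in> ?T" for u
   proof -
    obtain p where p: "u = cmap d p" "p \<in> cdom d" "p \<notin> cinv c ` K" using u by blast
    have "cmap c p \<notin> K" if "p \<in> cdom c"
     using p(3) cinv_cmap[OF c that] by (metis imageI)
    then show ?thesis using p d K(3) by simp
   qed
   then have "Cinf_on ?T (?f \<circ> cinv d)"
    using Cinf_on_cong[OF T, of "?f \<circ> cinv d" "%_. 0"] Cinf_on_const by blast
   moreover have "q \<notin> cinv c ` K" using False K(2) cinv_in[OF c] by blast
   then have "w \<in> ?T" using q by blast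
   ultimately show ?thesis using T by blast
  qed
 qed
qed

end

section \<open>The metric in charts\<close>

definition coord_comb ::
 "('a, 'n::finite) chart set => ('a, 'n) chart => 'a => real^'n => 'a tvec" where
 "coord_comb A c p v =
  (%f. if smooth_fun A f then SU i. v $ i * pd i (f \<circ> cinv c) (cmap c p) else 0)"

lemma coord_comb_axis: "coord_comb A c p (axis i 1) = coord_vec A c p i"
 by (auto simp: coord_comb_def coord_vec_def axis_def if_distrib if_distribR cong: if_cong)

lemma coord_comb_add: "coord_comb A c p (v + w) = (%f. coord_comb A c p v f + coord_comb A c p w f)"
 by (auto simp: coord_comb_def algebra_simps sum.distrib)

lemma coord_comb_scale: "coord_comb A c p (a *\<^sub>R v) = (%f. a * coord_comb A c p v f)"
 by (auto simp: coord_comb_def sum_distrib_left mult.assoc)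

context atlas
begin

lemma smooth_fun_differentiable:
 "smooth_fun A f ==> c \<in> A ==> u \<in> cimg c ==> (f \<circ> cinv c) differentiable (at u)"
 using Cinf_on_differentiable_at[OF smooth_funD open_cimg] .

lemma coord_comb_in_tangent_space:
 assumes c: "c \<in> A" "p \<in> cdom c"
 shows "coord_comb A c p v \<in> tangent_space A p"
proof -
 have d: "(f \<circ> cinv c) differentiable (at (cmap c p))" if "smooth_fun A f" for f
  using smooth_fun_differentiable[OF that c(1)] c(2) by blast
 have add: "pd i ((%q. f q + h q) \<circ> cinv c) (cmap c p)
   = pd i (f \<circ> cinv c) (cmap c p) + pd i (h \<circ> cinv c) (cmap c p)"
  if "smooth_fun A f" "smooth_fun A h" for f h i
  using pd_add[OF d[OF that(1)] d[OF that(2)], of i] by (simp add: o_def)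
 have mult: "pd i ((%q. f q * h q) \<circ> cinv c) (cmap c p)
   = f p * pd i (h \<circ> cinv c) (cmap c p) + h p * pd i (f \<circ> cinv c) (cmap c p)"
  if "smooth_fun A f" "smooth_fun A h" for f h i
  using pd_mult[OF d[OF that(1)] d[OF that(2)], of i] c by (simp add: o_def)
 have scale: "pd i ((%q. a * f q) \<circ> cinv c) (cmap c p) = a * pd i (f \<circ> cinv c) (cmap c p)"
  if "smooth_fun A f" for f i a
  using mult[OF smooth_fun_const that, of i a] pd_const by (simp add: o_def)
 show ?thesis
  unfolding tangent_space_def coord_comb_def
  by (auto simp: smooth_fun_add smooth_fun_mult smooth_fun_mult[OF smooth_fun_const] add mult scale
    sum_distrib_left sum.distrib algebra_simps intro!: sum.cong)
qed

text \<open>Positivity of the metric is assumed for nonzero functionals only, and these act on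
  globally smooth functions. The witness is the i-th coordinate centred at \<open>p\<close>, cut off
  by a bump; its differential at \<open>p\<close> is a positive multiple of that of the
  coordinate.\<close>

lemma coord_comb_nonzero:
 assumes c: "c \<in> A" "p \<in> cdom c" and v: "v ~= 0"
 shows "coord_comb A c p v ~= (%f. 0)"
proof
 assume z: "coord_comb A c p v = (%f. 0)"
 let ?u = "cmap c p"
 obtain i where i: "v $ i ~= 0" using v by (auto simp: vec_eq_iff)
 obtain r where r: "r > 0" "cball ?u r \<subseteq> cimg c"
  using open_contains_cball open_cimg[OF c(1)] c(2) by blast
 define h where "h u = bump ?u r u * (u $ i - ?u $ i)" for u
 have h: "Cinf_on S h" if "open S" for S
  unfolding h_def[abs_def]
  by (intro Cinf_on_mult Cinf_on_bump Cinf_on_diff Cinf_on_const Cinf_on_component that)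
 define f where "f q = (if q \<in> cdom c then h (cmap c q) else 0)" for q
 have f: "smooth_fun A f"
  unfolding f_def[abs_def]
  by (rule smooth_fun_extend[OF c(1) h compact_cball r(2)]) 
    (use r in \<open>auto simp: h_def intro!: bump_zero_outside\<close>)
 have "pd j (f \<circ> cinv c) ?u = pd j h ?u" for j
  by (rule pd_cong_open[OF open_cimg[OF c(1)]]) (use c in \<open>auto simp: f_def\<close>)
 also have "pd j h ?u = bump ?u r ?u * (if j = i then 1 else 0)" for j
 proof -
  have b: "bump ?u r differentiable (at ?u)"
   using Cinf_on_differentiable_at[OF Cinf_on_bump[OF open_UNIV] open_UNIV] by blast
  have l: "((%u. u $ i - ?u $ i) has_derivative (%h. h $ i)) (at ?u)"
   by (auto intro!: derivative_eq_intros bounded_linear_imp_has_derivative bounded_linear_vec_nth)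
  then have "pd j (%u. u $ i - ?u $ i) ?u = (if j = i then 1 else 0)"
   by (intro pd_eqI[OF l]) (auto simp: axis_def)
  then show ?thesis
   unfolding h_def[abs_def]
   using pd_mult[OF b differentiableI[OF l], of j] by simp
 qed
 finally have e: "pd j (f \<circ> cinv c) ?u = bump ?u r ?u * (if j = i then 1 else 0)" for j .
 have "coord_comb A c p v f = v $ i * bump ?u r ?u"
  using f by (simp add: coord_comb_def e if_distrib cong: if_cong)
 then show False using z i bump_center_pos[OF r(1), of ?u] by simp
qed

lemma coord_comb_change:
 assumes c: "c \<in> A" "d \<in> A" "p \<in> cdom c" "p \<in> cdom d"
 shows "coord_comb A c p v = coord_comb A d p (jac (trans_map c d) (cmap c p) v)"
proof
 fix f
 let ?O = "cmap c ` (cdom c \<inter> cdom d)" and ?T = "trans_map c d" and ?u = "cmap c p"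
 have u: "?u \<in> ?O" using c by blast
 show "coord_comb A c p v f = coord_comb A d p (jac ?T ?u v) f"
 proof (cases "smooth_fun A f")
  case True
  have Tu: "?T ?u = cmap d p" using c by simp
  have eq: "(f \<circ> cinv c) x = (f \<circ> cinv d) (?T x)" if x: "x \<in> ?O" for x
  proof -
   obtain q where "x = cmap c q" "q \<in> cdom c" "q \<in> cdom d" using x by blast
   then show ?thesis using c by simp
  qed
  have "pd i (f \<circ> cinv c) ?u = pd i (%x. (f \<circ> cinv d) (?T x)) ?u" for i
   using pd_cong_open[OF open_overlap[OF c(1,2)] u eq] .
  also have "pd i (%x. (f \<circ> cinv d) (?T x)) ?u
    = (SU k. pd k (f \<circ> cinv d) (?T ?u) * pd i (%x. ?T x $ k) ?u)" for i
  proof (rule pd_compose)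
   show "(f \<circ> cinv d) differentiable (at (?T ?u))"
    using smooth_fun_differentiable[OF True c(2)] c by (simp add: Tu)
   show "(%x. ?T x $ k) differentiable (at ?u)" for k
    using smap_trans[OF c(1,2)] u open_overlap[OF c(1,2)] Cinf_on_differentiable_at
    unfolding smap_def by blast
  qed
  finally have "(SU i. v $ i * pd i (f \<circ> cinv c) ?u)
    = (SU i. SU k. v $ i * (pd k (f \<circ> cinv d) (?T ?u) * pd i (%x. ?T x $ k) ?u))"
   by (simp add: sum_distrib_left)
  also have "... = (SU k. SU i. v $ i * (pd k (f \<circ> cinv d) (?T ?u) * pd i (%x. ?T x $ k) ?u))"
   by (rule sum.swap)
  also have "... = (SU k. jac ?T ?u v $ k * pd k (f \<circ> cinv d) (cmap d p))"
   unfolding Tu by (simp add: jac_def sum_distrib_left sum_distrib_right mult_ac)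
  finally show ?thesis using True by (simp add: coord_comb_def)
 qed (simp add: coord_comb_def)
qed

lemma velocity_chart:
 assumes c: "c \<in> A" and x: "((cmap c \<circ> \<gamma>) has_vector_derivative x') (at t)"
  and g: "open I" "t \<in> I" "\<gamma> ` I \<subseteq> cdom c"
 shows "velocity A \<gamma> t = coord_comb A c (\<gamma> t) x'"
proof
 fix f
 show "velocity A \<gamma> t f = coord_comb A c (\<gamma> t) x' f"
 proof (cases "smooth_fun A f")
  case True
  have "(f \<circ> cinv c) differentiable (at ((cmap c \<circ> \<gamma>) t))"
   using smooth_fun_differentiable[OF True c] g(2,3) by auto
  from has_derivative_compose[OF x[unfolded has_vector_derivative_def] pd_has_derivative[OF this]]
  have "((%s. (f \<circ> cinv c) ((cmap c \<circ> \<gamma>) s)) has_vector_derivative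
    (SU i. x' $ i * pd i (f \<circ> cinv c) (cmap c (\<gamma> t)))) (at t)"
   by (simp add: has_vector_derivative_def sum_distrib_left mult.assoc)
  moreover have "(f \<circ> cinv c) ((cmap c \<circ> \<gamma>) s) = (f \<circ> \<gamma>) s" if "s \<in> I" for s
   using that g(3) c by auto
  ultimately have "((f \<circ> \<gamma>) has_vector_derivative
    (SU i. x' $ i * pd i (f \<circ> cinv c) (cmap c (\<gamma> t)))) (at t)"
   using has_vector_derivative_transform_within_open[OF _ g(1,2)] by blast
  then show ?thesis using True
   by (simp add: velocity_def coord_comb_def vector_derivative_at)
 qed (simp add: velocity_def coord_comb_def)
qed

end

definition gin :: "(real^'n::finite => real^'n^'n) => real^'n => real^'n => real^'n => real" where
 "gin G u v w = v \<bullet> (G u *v w)"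

lemma gin_sum: "gin G u v w = (SU i. SU j. v $ i * (w $ j * G u $ i $ j))"
 by (simp add: gin_def inner_vec_def matrix_vector_mult_def sum_distrib_left mult_ac)

locale riem_mfd =
 fixes A :: "('a::{t2_space,second_countable_topology}, 'n::finite) chart set"
  and g :: "'a metric_tensor"
 assumes mfd: "riemannian_manifold A g"

sublocale riem_mfd \<subseteq> atlas A
 using mfd by unfold_locales (auto simp: riemannian_manifold_def smooth_manifold_def)

context riem_mfd
begin

lemma metric: "riemannian_metric A g"
 using mfd by (simp add: riemannian_manifold_def)

lemma connected_mfd: "connected (UNIV :: 'a set)"
 using mfd by (simp add: riemannian_manifold_def smooth_manifold_def)

abbreviation "G \<equiv> gmat A g"

lemma G_smooth: "c \<in> A ==> Cinf_on (cimg c) (%u. G c u $ i $ j)"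
 using metric by (simp add: riemannian_metric_def)

lemma metric_coord_comb:
 assumes c: "c \<in> A" "p \<in> cdom c"
 shows "g p (coord_comb A c p v) (coord_comb A c p w) = gin (G c) (cmap c p) v w"
proof -
 note T = coord_comb_in_tangent_space[OF c]
 have sym: "g p (coord_comb A c p v) (coord_comb A c p w) = g p (coord_comb A c p w) (coord_comb A c p v)" for v w
  using metric T by (simp add: riemannian_metric_def)
 have lin: "linear (%v. g p (coord_comb A c p v) (coord_comb A c p w))" for w
  by (rule linearI)
   (use metric T in \<open>simp_all add: riemannian_metric_def coord_comb_add coord_comb_scale\<close>)
 have entry: "g p (coord_comb A c p (axis i 1)) (coord_comb A c p (axis j 1)) = G c (cmap c p) $ i $ j" for i j
  using c by (simp add: gmat_def coord_comb_axis)
 have "g p (coord_comb A c p (axis i 1)) (coord_comb A c p w)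
   = (SU j. w $ j * G c (cmap c p) $ i $ j)" for i
  unfolding sym[of "axis i 1" w] linear_axis_expand[OF lin, of w "axis i 1"]
  by (simp add: sym[of _ "axis i 1"] entry)
 then show ?thesis
  unfolding linear_axis_expand[OF lin, of v w] gin_sum by (simp add: sum_distrib_left)
qed

lemma G_sym: "c \<in> A ==> u \<in> cimg c ==> gin (G c) u v w = gin (G c) u w v"
proof -
 assume c: "c \<in> A" and u: "u \<in> cimg c"
 then obtain p where p: "u = cmap c p" "p \<in> cdom c" by blast
 have "g p (coord_comb A c p v) (coord_comb A c p w) = g p (coord_comb A c p w) (coord_comb A c p v)"
  using metric coord_comb_in_tangent_space[OF c p(2)] by (simp add: riemannian_metric_def)
 then show ?thesis using metric_coord_comb[OF c p(2)] p(1) by simp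
qed

lemma G_pos: "c \<in> A ==> u \<in> cimg c ==> v ~= 0 ==> gin (G c) u v v > 0"
proof -
 assume c: "c \<in> A" and u: "u \<in> cimg c" and v: "v ~= 0"
 then obtain p where p: "u = cmap c p" "p \<in> cdom c" by blast
 have "g p (coord_comb A c p v) (coord_comb A c p v) > 0"
  using metric coord_comb_in_tangent_space[OF c p(2)] coord_comb_nonzero[OF c p(2) v]
  unfolding riemannian_metric_def by blast
 then show ?thesis using metric_coord_comb[OF c p(2)] p(1) by simp
qed

lemma G_change:
 assumes c: "c \<in> A" "d \<in> A" and u: "u \<in> cmap c ` (cdom c \<inter> cdom d)"
 shows "gin (G c) u v w =
  gin (G d) (trans_map c d u) (jac (trans_map c d) u v) (jac (trans_map c d) u w)"
proof -
 obtain p where p: "u = cmap c p" "p \<in> cdom c" "p \<in> cdom d" using u by blast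
 show ?thesis
  using metric_coord_comb[OF c(1) p(2), of v w] metric_coord_comb[OF c(2) p(3)]
   coord_comb_change[OF c p(2,3)] p c by simp
qed

lemma speed_chart:
 assumes c: "c \<in> A" and x: "((cmap c \<circ> \<gamma>) has_vector_derivative x') (at t)"
  and I: "open I" "t \<in> I" "\<gamma> ` I \<subseteq> cdom c"
 shows "g (\<gamma> t) (velocity A \<gamma> t) (velocity A \<gamma> t) = gin (G c) (cmap c (\<gamma> t)) x' x'"
 using velocity_chart[OF assms] metric_coord_comb[OF c, of "\<gamma> t"] I by auto

end

section \<open>Local Riemannian geometry\<close>

definition dir :: "(real^'n::finite => real) => real^'n => real^'n => real" where
 "dir f u z = (SU l. z $ l * pd l f u)"

lemma jac_nth: "jac T u h $ k = dir (%x. T x $ k) u h"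
 by (simp add: jac_def dir_def)

lemma dir_add: "dir f u (a + b) = dir f u a + dir f u b"
 and dir_scale: "dir f u (s *\<^sub>R a) = s * dir f u a"
 and dir_minus: "dir f u (- a) = - dir f u a"
 and dir_diff: "dir f u (a - b) = dir f u a - dir f u b"
 and dir_zero: "dir f u 0 = 0"
 by (simp_all add: dir_def algebra_simps sum.distrib sum_distrib_left sum_negf sum_subtractf)

lemma jac_add: "jac T u (a + b) = jac T u a + jac T u b"
 and jac_scale: "jac T u (s *\<^sub>R a) = s *\<^sub>R jac T u a"
 and jac_minus: "jac T u (- a) = - jac T u a"
 by (simp_all add: vec_eq_iff jac_nth dir_add dir_scale dir_minus dir_diff dir_zero)

lemma linear_jac: "linear (jac T u)"
 by (intro linearI jac_add jac_scale)

lemma dir_eqI: "(f has_derivative D) (at u) ==> dir f u z = D z"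
proof -
 assume D: "(f has_derivative D) (at u)"
 have "D z = (SU l. z $ l *\<^sub>R D (axis l 1))"
  by (rule linear_axis_expand[OF has_derivative_linear[OF D]])
 then show ?thesis by (simp add: dir_def pd_eqI[OF D])
qed

lemma jac_eqI:
 assumes "(T has_derivative D) (at u)"
 shows "jac T u z = D z"
proof -
 have "((%x. T x $ k) has_derivative (%h. D h $ k)) (at u)" for k
  using bounded_linear.has_derivative[OF bounded_linear_vec_nth assms] .
 then have "dir (%x. T x $ k) u z = D z $ k" for k by (rule dir_eqI)
 then show ?thesis by (simp add: vec_eq_iff jac_nth)
qed

lemma dir_has_derivative: "Cinf_on S f ==> open S ==> u \<in> S ==> (f has_derivative dir f u) (at u)"
 using Cinf_on_has_derivative by (simp add: dir_def[abs_def])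

lemma dir_cong_open: "open S ==> u \<in> S ==> (!!x. x \<in> S ==> f x = h x) ==> dir f u z = dir h u z"
 unfolding dir_def using pd_cong_open[of S u f h] by simp

lemma Cinf_on_dir: "open S ==> Cinf_on S f ==> smap S F ==> Cinf_on S (%x. dir f x (F x))"
 unfolding dir_def smap_def by (intro Cinf_on_sum Cinf_on_mult Cinf_on_pd) auto

lemma smap_const: "smap S (%x. a)"
 by (simp add: smap_def Cinf_on_const)

lemma smap_jac: "open S ==> smap S T ==> smap S F ==> smap S (%x. jac T x (F x))"
 unfolding smap_def[of S T] by (simp add: smap_def[of S "%x. jac T x (F x)"] jac_nth Cinf_on_dir)

lemma smap_add: "open S ==> smap S F ==> smap S K ==> smap S (%x. F x + K x)"
 and smap_diff: "open S ==> smap S F ==> smap S K ==> smap S (%x. F x - K x)"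
 by (simp_all add: smap_def Cinf_on_add Cinf_on_diff)

lemma dir_commute:
 assumes "open S" "Cinf_on S f" "u \<in> S"
 shows "dir (%x. dir f x a) u b = dir (%x. dir f x b) u a"
proof -
 have *: "dir (%x. dir f x a) u b = (SU l. SU k. b $ l * (a $ k * pd l (pd k f) u))" for a b
 proof -
  have "((%x. dir f x a) has_derivative (%h. SU k. a $ k * dir (pd k f) u h)) (at u)"
   unfolding dir_def[of f]
   using assms by (intro has_derivative_sum has_derivative_mult_right dir_has_derivative[of S] Cinf_on_pd)
  then have "dir (%x. dir f x a) u b = (SU k. a $ k * dir (pd k f) u b)"
   by (rule dir_eqI)
  also have "... = (SU k. SU l. b $ l * (a $ k * pd l (pd k f) u))"
   by (simp add: dir_def sum_distrib_left mult_ac)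
  finally show ?thesis by (subst sum.swap)
 qed
 have "dir (%x. dir f x a) u b = (SU l. SU k. b $ l * (a $ k * pd k (pd l f) u))"
  unfolding * by (intro sum.cong refl) (simp only: pd_commute[OF assms])
 also have "... = (SU k. SU l. a $ k * (b $ l * pd k (pd l f) u))"
  by (subst sum.swap) (simp add: mult_ac)
 finally show ?thesis unfolding * .
qed

definition bil :: "('n => 'n => real^'n::finite => real) => real^'n => real^'n => real^'n => real" where
 "bil c u a b = (SU i. SU j. c i j u * (a $ i * b $ j))"

definition dbil :: "('n => 'n => real^'n::finite => real) => real^'n => real^'n => real^'n => real^'n => real" where
 "dbil c u z a b = bil (%i j x. dir (c i j) x z) u a b"

lemma bil_add1: "bil c u (a + b) d = bil c u a d + bil c u b d"
 and bil_add2: "bil c u d (a + b) = bil c u d a + bil c u d b"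
 and bil_scale1: "bil c u (s *\<^sub>R a) d = s * bil c u a d"
 and bil_scale2: "bil c u d (s *\<^sub>R a) = s * bil c u d a"
 by (simp_all add: bil_def algebra_simps sum.distrib sum_distrib_left)

lemma sum_axis: "(SU i. axis k (1::real) $ i * f i) = f (k :: 'n::finite)"
 by (simp add: axis_def if_distrib if_distribR cong: if_cong)

lemma bil_axis: "bil c u (axis i 1) (axis j 1) = c i j u"
proof -
 have "bil c u (axis i 1) (axis j 1) =
   (SU k. axis i (1::real) $ k * (SU l. axis j (1::real) $ l * c k l u))"
  unfolding bil_def sum_distrib_left by (intro sum.cong refl) (simp only: mult_ac)
 then show ?thesis by (simp only: sum_axis)
qed

lemma bil_has_derivative:
 assumes c: "!!i j. c i j differentiable (at (u t))"
  and u: "(u has_derivative u') (at t within S)"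
  and a: "(a has_derivative a') (at t within S)"
  and b: "(b has_derivative b') (at t within S)"
 shows "((%t. bil c (u t) (a t) (b t)) has_derivative
  (%h. dbil c (u t) (u' h) (a t) (b t) + bil c (u t) (a' h) (b t) + bil c (u t) (a t) (b' h))) (at t within S)"
proof -
 have cu: "((%t. c i j (u t)) has_derivative (%h. dir (c i j) (u t) (u' h))) (at t within S)" for i j
  using has_derivative_compose[OF u pd_has_derivative[OF c]] by (simp add: dir_def)
 have ai: "((%t. a t $ i) has_derivative (%h. a' h $ i)) (at t within S)" for i
  using bounded_linear.has_derivative[OF bounded_linear_vec_nth a] .
 have bi: "((%t. b t $ i) has_derivative (%h. b' h $ i)) (at t within S)" for i
  using bounded_linear.has_derivative[OF bounded_linear_vec_nth b] .
 show ?thesis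
  unfolding bil_def
  by (rule has_derivative_eq_rhs, (rule has_derivative_sum has_derivative_mult cu ai bi)+)
   (simp add: dbil_def bil_def fun_eq_iff algebra_simps sum.distrib)
qed

lemma Cinf_on_bil:
 assumes "open S" "!!i j. Cinf_on S (c i j)" "smap S F" "smap S K"
 shows "Cinf_on S (%x. bil c x (F x) (K x))"
 using assms unfolding bil_def smap_def by (intro Cinf_on_sum Cinf_on_mult) auto

lemma Cinf_on_dbil:
 assumes "open S" "!!i j. Cinf_on S (c i j)" "smap S Z" "smap S F" "smap S K"
 shows "Cinf_on S (%x. dbil c x (Z x) (F x) (K x))"
 using assms unfolding dbil_def bil_def
 by (intro Cinf_on_sum Cinf_on_mult Cinf_on_dir) (auto simp: smap_def)

lemma dbil_eq_dir:
 assumes "open S" "!!i j. Cinf_on S (c i j)" "u \<in> S"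
 shows "dbil c u z a b = dir (%x. bil c x a b) u z"
proof -
 have "((%x. bil c x a b) has_derivative (%h. dbil c u h a b + bil c u 0 b + bil c u a 0)) (at u)"
  using assms by (intro bil_has_derivative[where u = "%x. x" and u' = "%h. h"] Cinf_on_differentiable_at[of S])
   (auto intro!: derivative_intros)
 from dir_eqI[OF this] show ?thesis by (simp add: bil_def)
qed

definition Gam :: "(real^'n::finite => real^'n^'n) => real^'n => real^'n => real^'n => real^'n" where
 "Gam G u a b = (\<chi> k. bil (christoffel G k) u a b)"

definition dGam :: "(real^'n::finite => real^'n^'n) => real^'n => real^'n => real^'n => real^'n => real^'n" where
 "dGam G u z a b = (\<chi> k. dbil (christoffel G k) u z a b)"

definition dgin :: "(real^'n::finite => real^'n^'n) => real^'n => real^'n => real^'n => real^'n => real" where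
 "dgin G u z a b = dbil (%i j x. G x $ i $ j) u z a b"

definition Rm :: "(real^'n::finite => real^'n^'n) => real^'n => real^'n => real^'n => real^'n => real^'n" where
 "Rm G u a b c = dGam G u a b c - dGam G u b a c + Gam G u a (Gam G u b c) - Gam G u b (Gam G u a c)"

definition Ric :: "(real^'n::finite => real^'n^'n) => real^'n => real^'n => real^'n => real" where
 "Ric G u a b = bil (ricci G) u a b"

definition Hess :: "(real^'n::finite => real^'n^'n) => (real^'n => real) => real^'n => real^'n => real^'n => real" where
 "Hess G f u a b = bil (hessian G f) u a b"

lemma gin_bil: "gin G u a b = bil (%i j x. G x $ i $ j) u a b"
 by (simp add: gin_sum bil_def mult_ac)

lemma Gam_add1: "Gam G u (a + b) d = Gam G u a d + Gam G u b d"
 and Gam_add2: "Gam G u d (a + b) = Gam G u d a + Gam G u d b"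
 and Gam_scale1: "Gam G u (s *\<^sub>R a) d = s *\<^sub>R Gam G u a d"
 and Gam_scale2: "Gam G u d (s *\<^sub>R a) = s *\<^sub>R Gam G u d a"
 by (simp_all add: Gam_def vec_eq_iff bil_add1 bil_add2 bil_scale1 bil_scale2)

lemma dbil_add0: "dbil c u (y + z) a d = dbil c u y a d + dbil c u z a d"
 and dbil_add1: "dbil c u z (a + b) d = dbil c u z a d + dbil c u z b d"
 and dbil_add2: "dbil c u z d (a + b) = dbil c u z d a + dbil c u z d b"
 and dbil_scale0: "dbil c u (s *\<^sub>R z) a d = s * dbil c u z a d"
 and dbil_scale1: "dbil c u z (s *\<^sub>R a) d = s * dbil c u z a d"
 and dbil_scale2: "dbil c u z d (s *\<^sub>R a) = s * dbil c u z d a"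
 unfolding dbil_def bil_def dir_add dir_scale
 by (simp_all add: algebra_simps sum.distrib sum_distrib_left)

lemma dGam_add0: "dGam G u (y + z) a d = dGam G u y a d + dGam G u z a d"
 and dGam_add1: "dGam G u z (a + b) d = dGam G u z a d + dGam G u z b d"
 and dGam_add2: "dGam G u z d (a + b) = dGam G u z d a + dGam G u z d b"
 and dGam_scale0: "dGam G u (s *\<^sub>R z) a d = s *\<^sub>R dGam G u z a d"
 and dGam_scale1: "dGam G u z (s *\<^sub>R a) d = s *\<^sub>R dGam G u z a d"
 and dGam_scale2: "dGam G u z d (s *\<^sub>R a) = s *\<^sub>R dGam G u z d a"
 by (simp_all add: dGam_def vec_eq_iff dbil_add0 dbil_add1 dbil_add2 dbil_scale0 dbil_scale1 dbil_scale2)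

lemma gin_add1: "gin G u (a + b) d = gin G u a d + gin G u b d"
 and gin_add2: "gin G u d (a + b) = gin G u d a + gin G u d b"
 and gin_scale1: "gin G u (s *\<^sub>R a) d = s * gin G u a d"
 and gin_scale2: "gin G u d (s *\<^sub>R a) = s * gin G u d a"
 by (simp_all add: gin_bil bil_add1 bil_add2 bil_scale1 bil_scale2)

lemma gin_diff1: "gin G u (a - b) d = gin G u a d - gin G u b d"
 and gin_diff2: "gin G u d (a - b) = gin G u d a - gin G u d b"
 and gin_minus1: "gin G u (- a) d = - gin G u a d"
 and gin_minus2: "gin G u d (- a) = - gin G u d a"
 and gin_zero1: "gin G u 0 d = 0"
 and gin_zero2: "gin G u d 0 = 0"
 using gin_add1[of G u a "- b" d] gin_scale1[of G u "-1" b d] gin_scale1[of G u "-1" a d]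
  gin_add2[of G u d a "- b"] gin_scale2[of G u d "-1" b] gin_scale2[of G u d "-1" a]
  gin_scale1[of G u 0 0 d] gin_scale2[of G u d 0 0]
 by auto

lemma Gam_diff1: "Gam G u (a - b) d = Gam G u a d - Gam G u b d"
 and Gam_diff2: "Gam G u d (a - b) = Gam G u d a - Gam G u d b"
 and Gam_minus1: "Gam G u (- a) d = - Gam G u a d"
 and Gam_minus2: "Gam G u d (- a) = - Gam G u d a"
 and Gam_zero1: "Gam G u 0 d = 0"
 and Gam_zero2: "Gam G u d 0 = 0"
 using Gam_add1[of G u a "- b" d] Gam_scale1[of G u "-1" b d] Gam_scale1[of G u "-1" a d]
  Gam_add2[of G u d a "- b"] Gam_scale2[of G u d "-1" b] Gam_scale2[of G u d "-1" a]
  Gam_scale1[of G u 0 0 d] Gam_scale2[of G u d 0 0]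
 by auto

lemma Rm_add1: "Rm G u (a + a') b c = Rm G u a b c + Rm G u a' b c"
 and Rm_add2: "Rm G u a (b + b') c = Rm G u a b c + Rm G u a b' c"
 and Rm_add3: "Rm G u a b (c + c') = Rm G u a b c + Rm G u a b c'"
 and Rm_scale1: "Rm G u (s *\<^sub>R a) b c = s *\<^sub>R Rm G u a b c"
 and Rm_scale2: "Rm G u a (s *\<^sub>R b) c = s *\<^sub>R Rm G u a b c"
 and Rm_scale3: "Rm G u a b (s *\<^sub>R c) = s *\<^sub>R Rm G u a b c"
 by (simp_all add: Rm_def Gam_add1 Gam_add2 dGam_add0 dGam_add1 dGam_add2 Gam_scale1 Gam_scale2
   dGam_scale0 dGam_scale1 dGam_scale2 algebra_simps)

lemma Rm_antisym: "Rm G u b a c = - Rm G u a b c"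
 by (simp add: Rm_def)

lemma vec_axis_expansion: "(SU i. v $ i *\<^sub>R axis i 1) = (v :: real^'n::finite)"
 using basis_expansion[of v] by (simp only: scalar_mult_eq_scaleR)

lemma sum_axis2: "(SU i. f i * axis k (1::real) $ i) = f (k :: 'n::finite)"
 by (simp only: mult.commute[of "f _"] sum_axis)

definition onb :: "(real^'n::finite => real^'n^'n) => real^'n => ('n => real^'n) => bool" where
 "onb G u E \<longleftrightarrow> (\<forall>i j. gin G u (E i) (E j) = (if i = j then 1 else 0))"

lemma gin_sum1: "gin G u (\<Sum>i\<in>I. a i) d = (\<Sum>i\<in>I. gin G u (a i) d)"
 and gin_sum2: "gin G u d (\<Sum>i\<in>I. a i) = (\<Sum>i\<in>I. gin G u d (a i))"
 by (induction I rule: infinite_finite_induct) (auto simp: gin_add1 gin_add2 gin_zero1 gin_zero2)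

lemma dgin_axis:
 "dgin G u a b (axis l 1) = (SU i. SU j. a $ i * (b $ j * pd i (%x. G x $ j $ l) u))"
 "dgin G u (axis l 1) a b = (SU i. SU j. a $ i * (b $ j * pd l (%x. G x $ i $ j) u))"
proof -
 have "dgin G u a b (axis l 1)
   = (SU j. SU k. axis l (1::real) $ k * (b $ j * dir (%x. G x $ j $ k) u a))"
  unfolding dgin_def dbil_def bil_def by (intro sum.cong refl) (simp only: mult_ac)
 also have "... = (SU j. SU i. a $ i * (b $ j * pd i (%x. G x $ j $ l) u))"
  unfolding sum_axis by (simp add: dir_def sum_distrib_left mult_ac)
 finally show "dgin G u a b (axis l 1) = (SU i. SU j. a $ i * (b $ j * pd i (%x. G x $ j $ l) u))"
  by (subst sum.swap)
 show "dgin G u (axis l 1) a b = (SU i. SU j. a $ i * (b $ j * pd l (%x. G x $ i $ j) u))"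
  unfolding dgin_def dbil_def bil_def dir_def sum_axis by (intro sum.cong refl) (simp only: mult_ac)
qed

lemma dgin_add0: "dgin G u (y + z) a d = dgin G u y a d + dgin G u z a d"
 and dgin_add2: "dgin G u z d (a + b) = dgin G u z d a + dgin G u z d b"
 and dgin_scale0: "dgin G u (s *\<^sub>R z) a d = s * dgin G u z a d"
 and dgin_scale1: "dgin G u z (s *\<^sub>R a) d = s * dgin G u z a d"
 and dgin_scale2: "dgin G u z d (s *\<^sub>R a) = s * dgin G u z d a"
 by (simp_all add: dgin_def dbil_add0 dbil_add1 dbil_add2 dbil_scale0 dbil_scale1 dbil_scale2)

lemma Ric_eq_trace: "Ric G u b c = (SU i. Rm G u (axis i 1) b c $ i)"
proof -
 have bas: "Rm G u (axis i 1) (axis j 1) (axis k 1) $ l = riem_curv G l k i j u" for i j k l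
 proof -
  have G1: "Gam G u (axis i 1) v $ l = (SU m. christoffel G l i m u * v $ m)" for i l v
  proof -
   have "Gam G u (axis i 1) v $ l
     = (SU k. axis i (1::real) $ k * (SU m. christoffel G l k m u * v $ m))"
    unfolding Gam_def bil_def by (simp add: sum_distrib_left mult_ac)
   then show ?thesis unfolding sum_axis .
  qed
  have G2: "Gam G u (axis j 1) (axis k 1) $ m = christoffel G m j k u" for j k m
   by (simp add: Gam_def bil_axis)
  have G3: "dGam G u (axis i 1) (axis j 1) (axis k 1) $ l = pd i (christoffel G l j k) u" for i j k l
   by (simp add: dGam_def dbil_def bil_axis dir_def sum_axis)
  show ?thesis
   by (simp add: Rm_def G1 G2 G3 riem_curv_def sum_subtractf sum_axis2)
 qed
 have lin3: "linear (%c. Rm G u a b c $ i)" and lin2: "linear (%b. Rm G u a b c $ i)" for a b c i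
  by (rule linearI; simp add: Rm_add2 Rm_add3 Rm_scale2 Rm_scale3)+
 have "Rm G u (axis i 1) b c $ i
   = (SU j. SU k. riem_curv G i k i j u * (b $ j * c $ k))" for i
  unfolding linear_axis_expand[OF lin2, of _ b c i]
  unfolding linear_axis_expand[OF lin3, of _ _ c i]
  by (simp add: bas sum_distrib_left mult_ac)
 then have "(SU i. Rm G u (axis i 1) b c $ i)
   = (SU i. SU j. SU k. riem_curv G i k i j u * (b $ j * c $ k))" by simp
 also have "... = (SU j. SU i. SU k. riem_curv G i k i j u * (b $ j * c $ k))"
  by (rule sum.swap)
 also have "... = (SU j. SU k. SU i. riem_curv G i k i j u * (b $ j * c $ k))"
  by (intro sum.cong refl sum.swap)
 finally show ?thesis by (simp add: Ric_def bil_def ricci_def sum_distrib_right)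
qed

lemma Hess_eq:
 assumes "open S" "Cinf_on S f" "u \<in> S"
 shows "Hess G f u a b = dir (%x. dir f x b) u a - dir f u (Gam G u a b)"
proof -
 have "((%x. dir f x b) has_derivative (%h. SU k. b $ k * dir (pd k f) u h)) (at u)"
  unfolding dir_def[of f]
  using assms by (intro has_derivative_sum has_derivative_mult_right dir_has_derivative[of S] Cinf_on_pd)
 then have "dir (%x. dir f x b) u a = (SU k. b $ k * dir (pd k f) u a)"
  by (rule dir_eqI)
 also have "... = (SU i. SU j. pd i (pd j f) u * (a $ i * b $ j))"
  by (subst sum.swap) (simp add: dir_def sum_distrib_left mult_ac)
 finally have 1: "dir (%x. dir f x b) u a = (SU i. SU j. pd i (pd j f) u * (a $ i * b $ j))" .
 have "dir f u (Gam G u a b)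
   = (SU k. SU i. SU j. christoffel G k i j u * pd k f u * (a $ i * b $ j))"
  by (simp add: dir_def Gam_def bil_def sum_distrib_right sum_distrib_left mult_ac)
 also have "... = (SU i. SU k. SU j. christoffel G k i j u * pd k f u * (a $ i * b $ j))"
  by (rule sum.swap)
 also have "... = (SU i. SU j. SU k. christoffel G k i j u * pd k f u * (a $ i * b $ j))"
  by (intro sum.cong refl sum.swap)
 finally show ?thesis unfolding 1
  by (simp add: Hess_def bil_def hessian_def sum_subtractf[symmetric] sum_distrib_right left_diff_distrib)
qed

section \<open>Levi-Civita connection, curvature and orthonormal frames of a metric on an open
  set\<close>

locale local_metric =
 fixes U :: "(real^'n::finite) set" and G :: "real^'n => real^'n^'n"
 assumes U_open: "open U"
  and smooth_G: "!!i j. Cinf_on U (%u. G u $ i $ j)"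
  and sym_G: "!!u v w. u \<in> U ==> gin G u v w = gin G u w v"
  and pos_G: "!!u v. u \<in> U ==> v ~= 0 ==> gin G u v v > 0"
begin

lemma gin_nonneg: "u \<in> U ==> gin G u v v >= 0"
 using pos_G[of u v] by (cases "v = 0") (auto simp: gin_zero1)

lemma det_nz: assumes "u \<in> U" shows "det (G u) ~= 0"
proof -
 have "v = 0" if "G u *v v = 0" for v
  using pos_G[OF assms, of v] that by (auto simp: gin_def)
 then have "\<exists>B. B ** G u = mat 1" by (subst matrix_left_invertible_ker) blast
 then have "invertible (G u)"
  using matrix_left_right_inverse by (auto simp: invertible_def)
 then show ?thesis by (simp add: invertible_det_nz)
qed

lemma entry_sym: "u \<in> U ==> G u $ i $ j = G u $ j $ i"
 using sym_G[of u "axis i 1" "axis j 1"] by (simp add: gin_bil bil_axis)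

lemma pd_entry_sym: "u \<in> U ==> pd l (%x. G x $ i $ j) u = pd l (%x. G x $ j $ i) u"
 by (rule pd_cong_open[OF U_open]) (auto intro: entry_sym)

lemma smooth_christoffel: "Cinf_on U (christoffel G k i j)"
proof -
 have "Cinf_on U (%u. (SU l. matrix_inv (G u) $ k $ l *
   (pd i (%y. G y $ j $ l) u + pd j (%y. G y $ i $ l) u - pd l (%y. G y $ i $ j) u)) / 2)"
  by (intro Cinf_on_divide Cinf_on_sum Cinf_on_mult Cinf_on_matrix_inv Cinf_on_add Cinf_on_diff
    Cinf_on_pd smooth_G U_open Cinf_on_const det_nz) auto
 then show ?thesis by (simp add: christoffel_def[abs_def])
qed

lemma christoffel_sym: "u \<in> U ==> christoffel G k i j u = christoffel G k j i u"
 using pd_entry_sym[of u _ i j] by (simp add: christoffel_def add.commute)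

lemma Gam_sym: "u \<in> U ==> Gam G u a b = Gam G u b a"
 unfolding Gam_def bil_def by (subst sum.swap) (simp add: christoffel_sym mult_ac)

lemma dGam_sym: assumes u: "u \<in> U" shows "dGam G u z a b = dGam G u z b a"
proof -
 have "dir (christoffel G k i j) u z = dir (christoffel G k j i) u z" for k i j
  by (rule dir_cong_open[OF U_open u]) (rule christoffel_sym)
 then have "dbil (christoffel G k) u z a b = dbil (christoffel G k) u z b a" for k
  unfolding dbil_def bil_def by (subst sum.swap) (simp add: mult_ac)
 then show ?thesis by (simp add: dGam_def)
qed

lemma dgin_sym: assumes u: "u \<in> U" shows "dgin G u z a b = dgin G u z b a"
proof -
 have "dir (%x. G x $ i $ j) u z = dir (%x. G x $ j $ i) u z" for i j
  by (rule dir_cong_open[OF U_open u]) (rule entry_sym)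
 then show ?thesis
  unfolding dgin_def dbil_def bil_def by (subst sum.swap) (simp add: mult_ac)
qed

text \<open>Koszul formula for constant vector fields: contraction with the metric cancels the
  inverse matrix in the Christoffel symbols. Metric compatibility and the transformation law of the
  connection are read off from it.\<close>

lemma Gam_lower:
 assumes u: "u \<in> U"
 shows "gin G u (Gam G u a b) d = (dgin G u a b d + dgin G u b a d - dgin G u d a b) / 2"
proof -
 define w where "w = (\<chi> l. dgin G u a b (axis l 1) + dgin G u b a (axis l 1) - dgin G u (axis l 1) a b)"
 have w: "w $ l = (SU i. SU j. a $ i * (b $ j *
   (pd i (%x. G x $ j $ l) u + pd j (%x. G x $ i $ l) u - pd l (%x. G x $ i $ j) u)))" for l
 proof -
  have "dgin G u b a (axis l 1) = (SU i. SU j. a $ i * (b $ j * pd j (%x. G x $ i $ l) u))"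
   unfolding dgin_axis by (subst sum.swap) (simp add: mult_ac)
  then show ?thesis
   by (simp add: w_def dgin_axis algebra_simps sum.distrib sum_subtractf)
 qed
 have "Gam G u a b $ k = ((1/2) *\<^sub>R (matrix_inv (G u) *v w)) $ k" for k
 proof -
  have "Gam G u a b $ k = (SU i. SU j. SU l. matrix_inv (G u) $ k $ l * (a $ i * (b $ j *
   (pd i (%x. G x $ j $ l) u + pd j (%x. G x $ i $ l) u - pd l (%x. G x $ i $ j) u)))) / 2"
   by (simp add: Gam_def bil_def christoffel_def sum_distrib_left sum_distrib_right sum_divide_distrib mult_ac)
  also have "... = (SU i. SU l. SU j. matrix_inv (G u) $ k $ l * (a $ i * (b $ j *
   (pd i (%x. G x $ j $ l) u + pd j (%x. G x $ i $ l) u - pd l (%x. G x $ i $ j) u)))) / 2"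
   by (intro arg_cong2[where f = "(/)"] sum.cong refl sum.swap)
  also have "... = (SU l. SU i. SU j. matrix_inv (G u) $ k $ l * (a $ i * (b $ j *
   (pd i (%x. G x $ j $ l) u + pd j (%x. G x $ i $ l) u - pd l (%x. G x $ i $ j) u)))) / 2"
   by (intro arg_cong2[where f = "(/)"] refl sum.swap)
  also have "... = (SU l. matrix_inv (G u) $ k $ l * w $ l) / 2"
   by (simp only: w sum_distrib_left)
  finally show ?thesis by (simp add: matrix_vector_mult_def)
 qed
 then have "Gam G u a b = (1/2) *\<^sub>R (matrix_inv (G u) *v w)" by (simp add: vec_eq_iff)
 then have "G u *v Gam G u a b = (1/2) *\<^sub>R w"
  by (simp add: matrix_vector_mult_scaleR matrix_vector_mul_assoc matrix_inv_mult[OF det_nz[OF u]])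
 then have "gin G u d (Gam G u a b) = (SU l. d $ l * w $ l) / 2"
  by (simp add: gin_def inner_vec_def sum_divide_distrib)
 also have "(SU l. d $ l * w $ l) = dgin G u a b d + dgin G u b a d - dgin G u d a b"
 proof -
  have lin: "linear (%d. dgin G u a b d + dgin G u b a d - dgin G u d a b)"
   by (rule linearI) (simp_all add: dgin_add0 dgin_add2 dgin_scale0 dgin_scale2 algebra_simps)
  show ?thesis unfolding linear_axis_expand[OF lin, of d] by (simp add: w_def)
 qed
 finally show ?thesis using sym_G[OF u] by simp
qed

lemma compat: "u \<in> U ==> dgin G u z a b = gin G u (Gam G u z a) b + gin G u a (Gam G u z b)"
 using Gam_lower[of u z a b] Gam_lower[of u z b a] sym_G[of u a "Gam G u z b"]
  dgin_sym[of u z b a] dgin_sym[of u a z b] dgin_sym[of u b z a] by (simp add: field_simps)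

lemma gin_has_derivative:
 assumes "x t \<in> U" "(x has_derivative x') (at t within S)"
  "(a has_derivative a') (at t within S)" "(b has_derivative b') (at t within S)"
 shows "((%t. gin G (x t) (a t) (b t)) has_derivative
  (%h. dgin G (x t) (x' h) (a t) (b t) + gin G (x t) (a' h) (b t) + gin G (x t) (a t) (b' h))) (at t within S)"
 unfolding gin_bil dgin_def
 by (rule bil_has_derivative[OF _ assms(2-4)]) (rule Cinf_on_differentiable_at[OF smooth_G U_open assms(1)])

lemma dgin_has_derivative:
 assumes "x t \<in> U" "(x has_derivative x') (at t within S)"
  "(a has_derivative a') (at t within S)" "(b has_derivative b') (at t within S)"
 shows "((%t. dgin G (x t) z (a t) (b t)) has_derivative
  (%h. dbil (%i j y. dir (%y. G y $ i $ j) y z) (x t) (x' h) (a t) (b t)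
   + dgin G (x t) z (a' h) (b t) + dgin G (x t) z (a t) (b' h))) (at t within S)"
 unfolding dgin_def dbil_def[of _ _ z]
 by (rule bil_has_derivative[OF _ assms(2-4)])
  (rule Cinf_on_differentiable_at[OF Cinf_on_dir[OF U_open smooth_G smap_const] U_open assms(1)])

lemma Gam_has_derivative:
 assumes "x t \<in> U" "(x has_derivative x') (at t within S)"
  "(a has_derivative a') (at t within S)" "(b has_derivative b') (at t within S)"
 shows "((%t. Gam G (x t) (a t) (b t)) has_derivative
  (%h. dGam G (x t) (x' h) (a t) (b t) + Gam G (x t) (a' h) (b t) + Gam G (x t) (a t) (b' h))) (at t within S)"
 by (rule has_derivative_vec, simp add: Gam_def dGam_def, rule bil_has_derivative[OF _ assms(2-4)])
  (rule Cinf_on_differentiable_at[OF smooth_christoffel U_open assms(1)])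

lemma smooth_gin: "smap U F ==> smap U K ==> Cinf_on U (%x. gin G x (F x) (K x))"
 unfolding gin_bil by (rule Cinf_on_bil[OF U_open smooth_G])

lemma smooth_Gam: "smap U F ==> smap U K ==> smap U (%x. Gam G x (F x) (K x))"
 unfolding smap_def[of U "%x. Gam G x (F x) (K x)"]
 by (simp add: Gam_def Cinf_on_bil[OF U_open smooth_christoffel])

lemma smooth_dGam: "smap U Z ==> smap U F ==> smap U K ==> smap U (%x. dGam G x (Z x) (F x) (K x))"
 unfolding smap_def[of U "%x. dGam G x (Z x) (F x) (K x)"]
 by (simp add: dGam_def Cinf_on_dbil[OF U_open smooth_christoffel])

lemma smooth_Rm: "smap U (%x. Rm G x a b c)"
 unfolding Rm_def by (intro smap_add smap_diff smooth_dGam smooth_Gam smap_const U_open)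

lemma dgin_dir: "u \<in> U ==> dgin G u z a b = dir (%x. gin G x a b) u z"
 unfolding dgin_def gin_bil by (rule dbil_eq_dir[OF U_open smooth_G])

lemma dGam_jac: "u \<in> U ==> dGam G u z a b = jac (%x. Gam G x a b) u z"
 by (simp add: vec_eq_iff jac_nth dGam_def Gam_def dbil_eq_dir[OF U_open smooth_christoffel])

text \<open>The second derivatives of the function <c, d> commute. Expanding both orders by metric
  compatibility, the products of two first covariant terms cancel and the curvature terms
  remain.\<close>

lemma Rm_skew:
 assumes u: "u \<in> U"
 shows "gin G u (Rm G u a b c) d = - gin G u c (Rm G u a b d)"
proof -
 let ?f = "%x. gin G x c d"
 have D: "dir (%x. dir ?f x a) u b
   = dgin G u b (Gam G u a c) d + gin G u (dGam G u b a c) d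
    + dgin G u b c (Gam G u a d) + gin G u c (dGam G u b a d)" for a b
 proof -
  have "dir (%x. dir ?f x a) u b = dir (%x. gin G x (Gam G x a c) d + gin G x c (Gam G x a d)) u b"
   by (rule dir_cong_open[OF U_open u]) (simp add: dgin_dir[symmetric] compat)
  also have "... = dgin G u b (Gam G u a c) d + gin G u (dGam G u b a c) d
    + dgin G u b c (Gam G u a d) + gin G u c (dGam G u b a d)"
  proof (subst dir_eqI)
   show "((%x. gin G x (Gam G x a c) d + gin G x c (Gam G x a d)) has_derivative
     (%h. (dgin G u h (Gam G u a c) d + gin G u (dGam G u h a c + Gam G u 0 c + Gam G u a 0) d + gin G u (Gam G u a c) 0)
      + (dgin G u h c (Gam G u a d) + gin G u 0 (Gam G u a d) + gin G u c (dGam G u h a d + Gam G u 0 d + Gam G u a 0)))) (at u)"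
    by (intro has_derivative_add gin_has_derivative[where x = "%x. x" and x' = "%h. h"]
     Gam_has_derivative[where x = "%x. x" and x' = "%h. h"] has_derivative_ident has_derivative_const u)
  qed (simp add: gin_zero1 gin_zero2 Gam_zero1 Gam_zero2)
  finally show ?thesis .
 qed
 have "dir (%x. dir ?f x a) u b = dir (%x. dir ?f x b) u a"
  by (rule dir_commute[OF U_open _ u]) (intro smooth_gin smap_const)
 then show ?thesis
  unfolding D compat[OF u] by (simp add: Rm_def gin_add1 gin_add2 gin_diff1 gin_diff2)
qed

context
 fixes u and E :: "'n => real^'n"
 assumes u: "u \<in> U" and E: "onb G u E"
begin

lemma onb_expand: "z = (SU i. gin G u (E i) z *\<^sub>R E i)"
 and onb_matrix_inv: "matrix_inv (G u) $ i $ j = (SU k. E k $ i * E k $ j)"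
proof -
 \<comment> \<open>The columns of \<open>F\<close> are the frame. Orthonormality reads F^T G F = 1;
   a left inverse of a square matrix is also a right inverse, hence F F^T G = 1, which contains both
   claims.\<close>
 define F :: "real^'n^'n" where "F = (\<chi> r i. E i $ r)"
 have Fz: "(transpose F ** G u) *v z = (\<chi> i. gin G u (E i) z)" for z
  unfolding matrix_vector_mul_assoc[symmetric]
  by (simp add: vec_eq_iff F_def transpose_def gin_def inner_vec_def matrix_vector_mult_def)
 have FE: "F *v c = (SU i. c $ i *\<^sub>R E i)" for c
  by (simp add: vec_eq_iff F_def matrix_vector_mult_def mult.commute)
 have "(transpose F ** G u) ** F = mat 1"
 proof -
  have "((transpose F ** G u) ** F) $ i $ j = ((transpose F ** G u) *v E j) $ i" for i j
   unfolding matrix_matrix_mult_def[of "transpose F ** G u"] matrix_vector_mult_def by (simp add: F_def)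
  then show ?thesis using E by (simp add: Fz vec_eq_iff mat_def onb_def)
 qed
 then have *: "F ** (transpose F ** G u) = mat 1" by (simp add: matrix_left_right_inverse)
 then have "z = F *v ((transpose F ** G u) *v z)" by (simp add: matrix_vector_mul_assoc)
 then show "z = (SU i. gin G u (E i) z *\<^sub>R E i)" by (simp add: Fz FE)
 have "matrix_inv (G u) = (F ** (transpose F ** G u)) ** matrix_inv (G u)" by (simp add: *)
 also have "... = F ** transpose F"
  by (simp add: matrix_mul_assoc[symmetric] matrix_inv_mult[OF det_nz[OF u]])
 finally show "matrix_inv (G u) $ i $ j = (SU k. E k $ i * E k $ j)"
  by (simp add: F_def transpose_def matrix_matrix_mult_def)
qed

lemma onb_trace:
 assumes "linear L"
 shows "(SU k. L (axis k 1) $ k) = (SU i. gin G u (L (E i)) (E i))"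
proof -
 have "L (axis k 1) = (SU i. gin G u (E i) (axis k 1) *\<^sub>R L (E i))" for k
  by (subst onb_expand[of "axis k 1"]) (simp add: linear_sum[OF assms] linear_cmul[OF assms])
 then have "(SU k. L (axis k 1) $ k) = (SU k. SU i. gin G u (E i) (axis k 1) * L (E i) $ k)"
  by simp
 also have "... = (SU i. SU k. L (E i) $ k * gin G u (E i) (axis k 1))"
  by (subst sum.swap) (simp add: mult.commute)
 also have "... = (SU i. gin G u (E i) (SU k. L (E i) $ k *\<^sub>R axis k 1))"
  by (simp only: gin_sum2 gin_scale2)
 finally show ?thesis by (simp add: vec_axis_expansion sym_G[OF u])
qed

lemma onb_trace_inv:
 assumes "!!b. linear (%a. \<beta> a b)" "!!a. linear (\<beta> a)"
 shows "(SU i. SU j. matrix_inv (G u) $ i $ j * \<beta> (axis i 1) (axis j 1)) = (SU k. \<beta> (E k) (E k) :: real)"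
proof -
 have "\<beta> (E k) (E k) = (SU i. SU j. (E k $ i * E k $ j) * \<beta> (axis i 1) (axis j 1))" for k
 proof -
  have "\<beta> (E k) (E k) = (SU i. E k $ i * \<beta> (axis i 1) (E k))"
   using linear_axis_expand[where L = "%a. \<beta> a (E k)" and v = "E k", OF assms(1)] by simp
  moreover have "\<beta> (axis i 1) (E k) = (SU j. E k $ j * \<beta> (axis i 1) (axis j 1))" for i
   using linear_axis_expand[where L = "\<beta> (axis i 1)" and v = "E k", OF assms(2)] by simp
  ultimately show ?thesis by (simp only: sum_distrib_left mult.assoc)
 qed
 then have "(SU k. \<beta> (E k) (E k)) = (SU k. SU i. SU j. (E k $ i * E k $ j) * \<beta> (axis i 1) (axis j 1))"
  by (simp only:)
 also have "... = (SU i. SU k. SU j. (E k $ i * E k $ j) * \<beta> (axis i 1) (axis j 1))"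
  by (rule sum.swap)
 also have "... = (SU i. SU j. SU k. (E k $ i * E k $ j) * \<beta> (axis i 1) (axis j 1))"
  by (intro sum.cong refl sum.swap)
 finally show ?thesis by (simp add: onb_matrix_inv sum_distrib_right)
qed

lemma linear_Ric1: "linear (%a. Ric G u a b)" and linear_Ric2: "linear (Ric G u a)"
 by (rule linearI; simp add: Ric_def bil_add1 bil_add2 bil_scale1 bil_scale2)+

lemma scal_onb: "scal_loc G u = (SU k. Ric G u (E k) (E k))"
 using onb_trace_inv[of "Ric G u", OF linear_Ric1 linear_Ric2]
 by (simp add: scal_loc_def Ric_def bil_axis)

lemma ricci_norm_onb: "ricci_norm_sq_loc G u = (SU k. SU l. (Ric G u (E k) (E l))^2)"
proof -
 have lin: "linear (%b. Ric G u a b * c)" "linear (%b. c * Ric G u a b)"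
  "linear (%a. Ric G u a b * c)" "linear (%a. c * Ric G u a b)" for a b c
  by (rule linearI; simp add: Ric_def bil_add1 bil_add2 bil_scale1 bil_scale2 algebra_simps)+
 have inner: "(SU j. SU l. matrix_inv (G u) $ j $ l * (Ric G u a (axis j 1) * Ric G u b (axis l 1)))
   = (SU p. Ric G u a (E p) * Ric G u b (E p))" for a b
  by (rule onb_trace_inv[of "%x y. Ric G u a x * Ric G u b y"]) (rule lin)+
 have "ricci_norm_sq_loc G u = (SU i. SU j. SU k. SU l. matrix_inv (G u) $ i $ k *
   (matrix_inv (G u) $ j $ l * (Ric G u (axis i 1) (axis j 1) * Ric G u (axis k 1) (axis l 1))))"
  by (simp add: ricci_norm_sq_loc_def Ric_def bil_axis mult.assoc)
 also have "... = (SU i. SU k. SU j. SU l. matrix_inv (G u) $ i $ k *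
   (matrix_inv (G u) $ j $ l * (Ric G u (axis i 1) (axis j 1) * Ric G u (axis k 1) (axis l 1))))"
  by (intro sum.cong refl sum.swap)
 also have "... = (SU i. SU k. matrix_inv (G u) $ i $ k *
   (SU p. Ric G u (axis i 1) (E p) * Ric G u (axis k 1) (E p)))"
  by (simp only: sum_distrib_left[symmetric] inner)
 also have "... = (SU m. SU p. Ric G u (E m) (E p) * Ric G u (E m) (E p))"
  by (rule onb_trace_inv[of "%x y. SU p. Ric G u x (E p) * Ric G u y (E p)"])
   (intro linear_compose_sum ballI lin)+
 finally show ?thesis by (simp add: power2_eq_square)
qed

lemma Ric_onb: "Ric G u b c = (SU i. gin G u (Rm G u (E i) b c) (E i))"
 unfolding Ric_eq_trace by (rule onb_trace, rule linearI) (simp_all add: Rm_add1 Rm_scale1)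

end

end

text \<open>In \<open>nabRic_trace\<close> and \<open>trace_derivative\<close> this moves
  Christoffel terms across an endomorphism, so that a trace can be differentiated in the fixed
  coordinate basis and no frame has to be differentiated.\<close>

lemma trace_commute:
 fixes P Q :: "real^'n::finite => real^'n"
 assumes "linear P" "linear Q"
 shows "(SU k. P (Q (axis k 1)) $ k) = (SU k. Q (P (axis k 1)) $ k)"
proof -
 have *: "(SU k. P (Q (axis k 1)) $ k) = (SU k. SU l. Q (axis k 1) $ l * P (axis l 1) $ k)"
  if "linear P" for P Q :: "real^'n => real^'n"
 proof (rule sum.cong[OF refl])
  fix k
  have "P (Q (axis k 1)) = (SU l. Q (axis k 1) $ l *\<^sub>R P (axis l 1))"
   by (rule linear_axis_expand[OF that])
  then show "P (Q (axis k 1)) $ k = (SU l. Q (axis k 1) $ l * P (axis l 1) $ k)" by simp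
 qed
 show ?thesis
  unfolding *[OF assms(1)] *[OF assms(2)] by (subst sum.swap) (simp add: mult.commute)
qed

lemma dir_field_has_derivative:
 assumes f: "Cinf_on S f" "open S" and x: "x t \<in> S" "(x has_derivative x') (at t within Q)"
  and a: "(a has_derivative a') (at t within Q)"
 shows "((%t. dir f (x t) (a t)) has_derivative
  (%h. dir (%y. dir f y (a t)) (x t) (x' h) + dir f (x t) (a' h))) (at t within Q)"
proof -
 have pk: "(pd k f has_derivative dir (pd k f) (x t)) (at (x t))" for k
  by (rule dir_has_derivative[OF Cinf_on_pd[OF f(1)] f(2) x(1)])
 have pd: "((%t. pd k f (x t)) has_derivative (%h. dir (pd k f) (x t) (x' h))) (at t within Q)" for k
  using has_derivative_compose[OF x(2) pk] .
 have ai: "((%t. a t $ i) has_derivative (%h. a' h $ i)) (at t within Q)" for i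
  using bounded_linear.has_derivative[OF bounded_linear_vec_nth a] .
 have "((%y. SU k. v $ k * pd k f y) has_derivative (%h. SU k. v $ k * dir (pd k f) (x t) h)) (at (x t))" for v
  by (intro has_derivative_sum has_derivative_mult_right pk)
 then have fx: "dir (%y. dir f y v) (x t) h = (SU k. v $ k * dir (pd k f) (x t) h)" for v h
  using dir_eqI unfolding dir_def[of f] by blast
 have "((%t. SU k. a t $ k * pd k f (x t)) has_derivative
   (%h. SU k. a t $ k * dir (pd k f) (x t) (x' h) + a' h $ k * pd k f (x t))) (at t within Q)"
  by (intro has_derivative_sum has_derivative_mult ai pd)
 then show ?thesis unfolding fx by (simp add: dir_def[of f] sum.distrib)
qed

lemma dir_sum_fun:
 assumes "!!k. k \<in> I ==> Cinf_on S (f k)" "open S" "u \<in> S"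
 shows "dir (%x. \<Sum>k\<in>I. f k x) u z = (\<Sum>k\<in>I. dir (f k) u z)"
 by (rule dir_eqI) (intro has_derivative_sum dir_has_derivative[of S] assms)

section \<open>Covariant derivatives of the curvature and the Bianchi identities\<close>

context local_metric
begin

definition sharp :: "real^'n => real^'n => real^'n" where
 "sharp x w = matrix_inv (G x) *v w"

lemma gin_sharp: "u \<in> U ==> gin G u (sharp u w) y = w \<bullet> y"
proof -
 assume u: "u \<in> U"
 have "gin G u y (sharp u w) = y \<bullet> w"
  by (simp add: gin_def sharp_def matrix_vector_mul_assoc matrix_inv_mult[OF det_nz[OF u]])
 then show ?thesis using sym_G[OF u] by (simp add: inner_commute)
qed

lemma smooth_sharp: "smap U w ==> smap U (%x. sharp x (w x))"
 unfolding smap_def sharp_def matrix_vector_mult_def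
 by (auto intro!: Cinf_on_sum Cinf_on_mult Cinf_on_matrix_inv smooth_G U_open det_nz)

lemma gin_eq_imp_eq: "u \<in> U ==> (!!y. gin G u a y = gin G u b y) ==> a = b"
 using pos_G[of u "a - b"] by (force simp: gin_diff1)

lemma smooth_ricci: "Cinf_on U (ricci G j k)"
proof -
 have "ricci G j k = (%u. SU i. Rm G u (axis i 1) (axis j 1) (axis k 1) $ i)"
  using Ric_eq_trace[of G _ "axis j 1" "axis k 1"] by (simp add: Ric_def bil_axis fun_eq_iff)
 moreover have "Cinf_on U (%u. SU i. Rm G u (axis i 1) (axis j 1) (axis k 1) $ i)"
  using smooth_Rm by (intro Cinf_on_sum U_open) (auto simp: smap_def)
 ultimately show ?thesis by simp
qed

lemma smooth_scal: "Cinf_on U (scal_loc G)"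
 unfolding scal_loc_def[abs_def]
 by (intro Cinf_on_sum Cinf_on_mult Cinf_on_matrix_inv smooth_G smooth_ricci U_open det_nz)

text \<open>The covariant derivative of the curvature tensor in direction \<open>z\<close>. Constant
  fields \<open>a\<close>, \<open>b\<close>, \<open>c\<close> suffice since the expression is
  tensorial; their covariant derivatives are the Christoffel terms. \<open>nabRic\<close> is the
  same for the Ricci tensor.\<close>

definition nabR where
 "nabR u z a b c = jac (%x. Rm G x a b c) u z + Gam G u z (Rm G u a b c)
   - Rm G u (Gam G u z a) b c - Rm G u a (Gam G u z b) c - Rm G u a b (Gam G u z c)"

definition nabRic where
 "nabRic u z b c = dbil (ricci G) u z b c - Ric G u (Gam G u z b) c - Ric G u b (Gam G u z c)"

lemma ddGam_sym:
 assumes u: "u \<in> U"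
 shows "jac (%x. dGam G x a b c) u z = jac (%x. dGam G x z b c) u a"
proof -
 have "dir (%x. dGam G x a b c $ k) u z = dir (%x. dir (%y. Gam G y b c $ k) x a) u z" for a z k
  by (rule dir_cong_open[OF U_open u]) (simp add: dGam_jac jac_nth)
 moreover have "Cinf_on U (%y. Gam G y b c $ k)" for k
  using smooth_Gam[OF smap_const smap_const] by (simp add: smap_def)
 ultimately show ?thesis
  unfolding vec_eq_iff jac_nth using dir_commute[OF U_open _ u] by simp
qed

lemma jac_Rm:
 assumes u: "u \<in> U"
 shows "jac (%x. Rm G x a b c) u z = jac (%x. dGam G x a b c) u z - jac (%x. dGam G x b a c) u z
  + (dGam G u z a (Gam G u b c) + Gam G u a (dGam G u z b c))
  - (dGam G u z b (Gam G u a c) + Gam G u b (dGam G u z a c))"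
proof -
 have d: "((%x. dGam G x a b c) has_derivative jac (%x. dGam G x a b c) u) (at u)" for a b c
  by (intro smap_has_derivative[OF _ U_open u] smooth_dGam smap_const)
 have g: "((%x. Gam G x b c) has_derivative (%h. dGam G u h b c)) (at u)" for b c
  using Gam_has_derivative[where x = "%x. x" and x' = "%h. h" and t = u, OF u has_derivative_ident
    has_derivative_const has_derivative_const] by (simp add: Gam_zero1 Gam_zero2)
 have gg: "((%x. Gam G x a (Gam G x b c)) has_derivative
   (%h. dGam G u h a (Gam G u b c) + Gam G u a (dGam G u h b c))) (at u)" for a b c
  using Gam_has_derivative[where x = "%x. x" and x' = "%h. h" and t = u, OF u has_derivative_ident
    has_derivative_const g] by (simp add: Gam_zero1 Gam_zero2)
 show ?thesis
  unfolding Rm_def by (rule jac_eqI) (intro has_derivative_add has_derivative_diff d gg)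
qed

text \<open>The terms in which the connection acts on the first two slots cancel by its symmetry and
  the antisymmetry of the curvature (fact \<open>1\<close>). In the rest the second derivatives of
  the Christoffel symbols cancel because they commute (fact \<open>2\<close>).\<close>

lemma Bianchi:
 assumes u: "u \<in> U"
 shows "nabR u z a b c + nabR u a b z c + nabR u b z a c = 0"
proof -
 note s = Gam_sym[OF u, of a z] Gam_sym[OF u, of b z] Gam_sym[OF u, of b a]
 have 1: "Rm G u (Gam G u z a) b c + Rm G u a (Gam G u z b) c + (Rm G u (Gam G u a b) z c + Rm G u b (Gam G u a z) c)
   + (Rm G u (Gam G u b z) a c + Rm G u z (Gam G u b a) c) = 0"
  unfolding s by (simp add: Rm_antisym[of G u a] Rm_antisym[of G u b] Rm_antisym[of G u z])
 have 2: "jac (%x. Rm G x a b c) u z + Gam G u z (Rm G u a b c) - Rm G u a b (Gam G u z c)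
  + (jac (%x. Rm G x b z c) u a + Gam G u a (Rm G u b z c) - Rm G u b z (Gam G u a c))
  + (jac (%x. Rm G x z a c) u b + Gam G u b (Rm G u z a c) - Rm G u z a (Gam G u b c)) = 0"
  unfolding jac_Rm[OF u] ddGam_sym[OF u, of a b c z] ddGam_sym[OF u, of b a c z] ddGam_sym[OF u, of b z c a]
  by (simp add: Rm_def Gam_add1 Gam_add2 Gam_diff1 Gam_diff2 algebra_simps)
 have "nabR u z a b c + nabR u a b z c + nabR u b z a c = (jac (%x. Rm G x a b c) u z + Gam G u z (Rm G u a b c) - Rm G u a b (Gam G u z c)
  + (jac (%x. Rm G x b z c) u a + Gam G u a (Rm G u b z c) - Rm G u b z (Gam G u a c))
  + (jac (%x. Rm G x z a c) u b + Gam G u b (Rm G u z a c) - Rm G u z a (Gam G u b c))) - (Rm G u (Gam G u z a) b c + Rm G u a (Gam G u z b) c + (Rm G u (Gam G u a b) z c + Rm G u b (Gam G u a z) c)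
   + (Rm G u (Gam G u b z) a c + Rm G u z (Gam G u b a) c))"
  unfolding nabR_def by (simp only: algebra_simps)
 then show ?thesis by (simp only: 1 2 diff_self)
qed

lemma nabR_antisym:
 assumes u: "u \<in> U"
 shows "nabR u z b a c = - nabR u z a b c"
proof -
 have "jac (%x. Rm G x b a c) u z = - jac (%x. Rm G x a b c) u z"
  using jac_Rm[OF u] by simp
 then show ?thesis
  using Rm_antisym[of G u "Gam G u z b" a c] Rm_antisym[of G u b "Gam G u z a" c]
  by (simp add: nabR_def Rm_antisym[of G u b a] Gam_minus2)
qed

lemma nabR_skew:
 assumes u: "u \<in> U"
 shows "gin G u (nabR u w a b c) d = - gin G u c (nabR u w a b d)"
proof -
 have r: "((%x. Rm G x a b c) has_derivative jac (%x. Rm G x a b c) u) (at u)" for a b c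
  by (intro smap_has_derivative[OF _ U_open u] smooth_Rm)
 have "((%x. gin G x (Rm G x a b c) d + gin G x c (Rm G x a b d)) has_derivative
   (%h. (dgin G u h (Rm G u a b c) d + gin G u (jac (%x. Rm G x a b c) u h) d + gin G u (Rm G u a b c) 0)
    + (dgin G u h c (Rm G u a b d) + gin G u 0 (Rm G u a b d) + gin G u c (jac (%x. Rm G x a b d) u h)))) (at u)"
  by (intro has_derivative_add gin_has_derivative[where x = "%x. x" and x' = "%h. h"]
     has_derivative_ident has_derivative_const r u)
 from dir_eqI[OF this, of w]
 have "dgin G u w (Rm G u a b c) d + gin G u (jac (%x. Rm G x a b c) u w) d
    + (dgin G u w c (Rm G u a b d) + gin G u c (jac (%x. Rm G x a b d) u w))
   = dir (%x. gin G x (Rm G x a b c) d + gin G x c (Rm G x a b d)) u w"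
  by (simp add: gin_zero1 gin_zero2)
 also have "... = dir (%x. 0) u w"
  by (rule dir_cong_open[OF U_open u]) (simp add: Rm_skew)
 finally have "dgin G u w (Rm G u a b c) d + gin G u (jac (%x. Rm G x a b c) u w) d
    + (dgin G u w c (Rm G u a b d) + gin G u c (jac (%x. Rm G x a b d) u w)) = 0"
  by (simp add: dir_def)
 then show ?thesis
  unfolding nabR_def compat[OF u]
  using Rm_skew[OF u, of "Gam G u w a" b c d] Rm_skew[OF u, of a "Gam G u w b" c d]
   Rm_skew[OF u, of a b "Gam G u w c" d] Rm_skew[OF u, of a b c "Gam G u w d"]
  by (simp add: gin_add1 gin_add2 gin_diff1 gin_diff2)
qed

lemma dRic_dir: "u \<in> U ==> dbil (ricci G) u z b c = dir (%x. Ric G x b c) u z"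
 unfolding Ric_def by (rule dbil_eq_dir[OF U_open smooth_ricci])

context
 fixes u and E :: "'n => real^'n"
 assumes u: "u \<in> U" and E: "onb G u E"
begin

lemma nabRic_trace: "nabRic u z b c = (SU i. gin G u (nabR u z (E i) b c) (E i))"
proof -
 have jl: "jac (%x. Rm G x (a + a') b c) u z = jac (%x. Rm G x a b c) u z + jac (%x. Rm G x a' b c) u z"
  "jac (%x. Rm G x (s *\<^sub>R a) b c) u z = s *\<^sub>R jac (%x. Rm G x a b c) u z" for a a' s
 proof -
  have r: "((%x. Rm G x a b c) has_derivative jac (%x. Rm G x a b c) u) (at u)" for a
   by (intro smap_has_derivative[OF _ U_open u] smooth_Rm)
  show "jac (%x. Rm G x (a + a') b c) u z = jac (%x. Rm G x a b c) u z + jac (%x. Rm G x a' b c) u z"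
   unfolding Rm_add1 by (rule jac_eqI[OF has_derivative_add[OF r r]])
  show "jac (%x. Rm G x (s *\<^sub>R a) b c) u z = s *\<^sub>R jac (%x. Rm G x a b c) u z"
   unfolding Rm_scale1 by (rule jac_eqI[OF has_derivative_scaleR_right[OF r]])
 qed
 have "linear (%a. nabR u z a b c)"
  by (rule linearI) (simp_all add: nabR_def jl Gam_add2 Gam_scale2 Rm_add1[of G u] Rm_scale1[of G u] algebra_simps)
 from onb_trace[OF u E this]
 have "(SU i. gin G u (nabR u z (E i) b c) (E i)) = (SU k. nabR u z (axis k 1) b c $ k)" by simp
 also have "... = (SU k. jac (%x. Rm G x (axis k 1) b c) u z $ k)
   + ((SU k. Gam G u z (Rm G u (axis k 1) b c) $ k) - (SU k. Rm G u (Gam G u z (axis k 1)) b c $ k))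
   - Ric G u (Gam G u z b) c - Ric G u b (Gam G u z c)"
  by (simp add: nabR_def Ric_eq_trace sum.distrib sum_subtractf)
 also have "(SU k. Gam G u z (Rm G u (axis k 1) b c) $ k) = (SU k. Rm G u (Gam G u z (axis k 1)) b c $ k)"
  by (rule trace_commute; rule linearI) (simp_all add: Gam_add2 Gam_scale2 Rm_add1 Rm_scale1)
 also have "(SU k. jac (%x. Rm G x (axis k 1) b c) u z $ k) = dir (%x. Ric G x b c) u z"
  unfolding Ric_eq_trace jac_nth
  by (rule dir_sum_fun[symmetric, OF _ U_open u]) (use smooth_Rm in \<open>auto simp: smap_def\<close>)
 finally show ?thesis by (simp add: nabRic_def dRic_dir[OF u])
qed

text \<open>Raising an index by \<open>P\<close> turns the contraction into the trace of an
  endomorphism, which can be differentiated in the constant coordinate basis; the derivative of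
  \<open>matrix_inv\<close> is never expanded. The content is that contraction commutes with
  covariant differentiation.\<close>

lemma trace_derivative:
 assumes s: "!!i j. Cinf_on U (s i j)"
 shows "dir (%x. SU i. SU j. matrix_inv (G x) $ i $ j * s i j x) u z =
  (SU i. dbil s u z (E i) (E i) - bil s u (Gam G u z (E i)) (E i) - bil s u (E i) (Gam G u z (E i)))"
proof -
 define P where "P x c = sharp x (\<chi> l. bil s x c (axis l 1))" for x c
 have bs: "(\<chi> l. bil s x c (axis l 1)) \<bullet> y = bil s x c y" for x c y
 proof -
  have "linear (bil s x c)" by (rule linearI) (simp_all add: bil_add2 bil_scale2)
  from linear_axis_expand[OF this, of y] show ?thesis by (simp add: inner_vec_def mult.commute)
 qed
 have gP: "gin G x (P x c) y = bil s x c y" if "x \<in> U" for x c y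
  by (simp add: P_def gin_sharp[OF that] bs)
 have smP: "smap U (%x. P x c)" for c
  unfolding P_def by (rule smooth_sharp) (auto simp: smap_def intro!: Cinf_on_bil s U_open Cinf_on_const)
 have linP: "linear (P x)" for x
  unfolding P_def sharp_def
  by (rule linearI) (simp_all add: bil_add1 bil_scale1 vec_eq_iff matrix_vector_mult_def algebra_simps
    sum.distrib sum_distrib_left)
 have jlin: "linear (%c. jac (%x. P x c) u z)"
 proof (rule linearI)
  have r: "((%x. P x a) has_derivative jac (%x. P x a) u) (at u)" for a
   by (rule smap_has_derivative[OF smP U_open u])
  show "jac (%x. P x (a + b)) u z = jac (%x. P x a) u z + jac (%x. P x b) u z" for a b
   unfolding linear_add[OF linP] by (rule jac_eqI[OF has_derivative_add[OF r r]])
  show "jac (%x. P x (t *\<^sub>R a)) u z = t *\<^sub>R jac (%x. P x a) u z" for t a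
   unfolding linear_cmul[OF linP] by (rule jac_eqI[OF has_derivative_scaleR_right[OF r]])
 qed
 have j: "gin G u (jac (%x. P x c) u z) y = dbil s u z c y - bil s u c (Gam G u z y) - gin G u (Gam G u z (P u c)) y" for c y
 proof -
  have "((%x. gin G x (P x c) y) has_derivative
    (%h. dgin G u h (P u c) y + gin G u (jac (%x. P x c) u h) y + gin G u (P u c) 0)) (at u)"
   by (intro gin_has_derivative[where x = "%x. x" and x' = "%h. h"] has_derivative_ident has_derivative_const
     smap_has_derivative[OF smP U_open u] u)
  from dir_eqI[OF this, of z]
  have "dgin G u z (P u c) y + gin G u (jac (%x. P x c) u z) y = dir (%x. gin G x (P x c) y) u z"
   by (simp add: gin_zero2)
  also have "... = dbil s u z c y"
   unfolding dbil_eq_dir[OF U_open s u] by (rule dir_cong_open[OF U_open u gP])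
  finally show ?thesis by (simp add: compat[OF u] gP[OF u])
 qed
 have "dir (%x. SU i. SU j. matrix_inv (G x) $ i $ j * s i j x) u z = dir (%x. SU k. P x (axis k 1) $ k) u z"
  by (simp add: P_def sharp_def matrix_vector_mult_def bil_axis)
 also have "... = (SU k. jac (%x. P x (axis k 1)) u z $ k)"
  unfolding jac_nth by (rule dir_sum_fun[OF _ U_open u]) (use smP in \<open>auto simp: smap_def\<close>)
 also have "... = (SU i. dbil s u z (E i) (E i) - bil s u (E i) (Gam G u z (E i)))
   - (SU i. gin G u (Gam G u z (P u (E i))) (E i))"
  by (simp add: onb_trace[OF u E jlin] j sum_subtractf)
 also have "(SU i. gin G u (Gam G u z (P u (E i))) (E i)) = (SU i. bil s u (Gam G u z (E i)) (E i))"
 proof -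
  have lg: "linear (Gam G u z)" by (rule linearI) (simp_all add: Gam_add2 Gam_scale2)
  have "(SU i. gin G u (Gam G u z (P u (E i))) (E i)) = (SU k. Gam G u z (P u (axis k 1)) $ k)"
   using onb_trace[OF u E linear_compose[OF linP lg]] by (simp add: o_def)
  also have "... = (SU k. P u (Gam G u z (axis k 1)) $ k)" by (rule trace_commute[OF lg linP])
  also have "... = (SU i. gin G u (P u (Gam G u z (E i))) (E i))"
   using onb_trace[OF u E linear_compose[OF lg linP]] by (simp add: o_def)
  finally show ?thesis by (simp add: gP[OF u])
 qed
 finally show ?thesis by (simp add: sum_subtractf)
qed

lemma dscal: "dir (scal_loc G) u z = (SU i. nabRic u z (E i) (E i))"
 using trace_derivative[of "ricci G", OF smooth_ricci]
 by (simp add: scal_loc_def[abs_def] nabRic_def Ric_def)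

text \<open>Contraction of the Bianchi identity over two frame indices. One of the three cyclic
  terms is the derivative of the scalar curvature; the other two are both minus the divergence of
  Ric, one by antisymmetry in the first pair of curvature arguments and one by skewness in the
  remaining two.\<close>

lemma contracted_Bianchi: "dir (scal_loc G) u z = 2 * (SU i. nabRic u (E i) z (E i))"
proof -
 let ?g = "gin G u"
 have "0 = (SU j. SU i. ?g (nabR u z (E i) (E j) (E j) + nabR u (E i) (E j) z (E j) + nabR u (E j) z (E i) (E j)) (E i))"
  by (simp add: Bianchi[OF u] gin_zero1)
 also have "... = (SU j. SU i. ?g (nabR u z (E i) (E j) (E j)) (E i))
   + (SU j. SU i. ?g (nabR u (E i) (E j) z (E j)) (E i))
   + (SU j. SU i. ?g (nabR u (E j) z (E i) (E j)) (E i))"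
  by (simp add: gin_add1 sum.distrib)
 also have "(SU j. SU i. ?g (nabR u z (E i) (E j) (E j)) (E i)) = dir (scal_loc G) u z"
  by (simp add: dscal nabRic_trace)
 also have "(SU j. SU i. ?g (nabR u (E j) z (E i) (E j)) (E i)) = - (SU j. nabRic u (E j) z (E j))"
  unfolding nabRic_trace nabR_antisym[OF u, of _ z] by (simp add: gin_minus1 sum_negf)
 also have "(SU j. SU i. ?g (nabR u (E i) (E j) z (E j)) (E i)) = - (SU i. nabRic u (E i) z (E i))"
 proof -
  have "?g (nabR u (E i) (E j) z (E j)) (E i) = - ?g (nabR u (E i) (E j) z (E i)) (E j)" for i j
   unfolding nabR_skew[OF u, of "E i" "E j" z "E j" "E i"]
   by (subst sym_G[OF u]) (rule refl)
  then show ?thesis unfolding nabRic_trace by (subst sum.swap) (simp add: sum_negf)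
 qed
 finally show ?thesis by simp
qed

end

end

section \<open>Gram-Schmidt and the pointwise second variation formula\<close>

context local_metric
begin

text \<open>Gram-Schmidt, carried out over initial segments of the natural numbers because the index
  type \<open>'n\<close> has no order; a bijection transfers the result.\<close>

lemma onb_exists: assumes u: "u \<in> U" shows "\<exists>E. onb G u E"
proof -
 have "\<exists>f::nat => real^'n. \<forall>i<k. \<forall>j<k. gin G u (f i) (f j) = (if i = j then 1 else 0)"
  if "k <= CARD('n)" for k
  using that
 proof (induction k)
  case 0 then show ?case by auto
 next
  case (Suc k)
  then obtain f :: "nat => real^'n"
   where f: "\<forall>i<k. \<forall>j<k. gin G u (f i) (f j) = (if i = j then 1 else 0)" by auto
  have "dim (f ` {..<k}) <= card (f ` {..<k})" by (rule dim_le_card') simp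
  also have "... <= k" using card_image_le[of "{..<k}" f] by simp
  also have "k < DIM(real^'n)" using Suc.prems by simp
  finally have "span (f ` {..<k}) ~= UNIV" by (metis dim_UNIV dim_span less_irrefl)
  then obtain z where z: "z \<notin> span (f ` {..<k})" by auto
  define y where "y = z - (\<Sum>i<k. gin G u (f i) z *\<^sub>R f i)"
  have "y ~= 0"
  proof
   assume "y = 0"
   then have "z = (\<Sum>i<k. gin G u (f i) z *\<^sub>R f i)" by (simp add: y_def)
   moreover have "(\<Sum>i<k. gin G u (f i) z *\<^sub>R f i) \<in> span (f ` {..<k})"
    by (intro span_sum span_scale span_base) auto
   ultimately show False using z by simp
  qed
  then have py: "gin G u y y > 0" by (rule pos_G[OF u])
  have fy: "gin G u (f j) y = 0" if "j < k" for j
  proof -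
   have "(\<Sum>i<k. gin G u (f i) z * gin G u (f j) (f i)) = (\<Sum>i<k. if i = j then gin G u (f j) z else 0)"
    using f that by (intro sum.cong) auto
   then show ?thesis using that by (simp add: y_def gin_diff2 gin_sum2 gin_scale2)
  qed
  define e where "e = (1 / sqrt (gin G u y y)) *\<^sub>R y"
  have ee: "gin G u e e = 1" using py by (simp add: e_def gin_scale1 gin_scale2)
  have fe: "gin G u (f j) e = 0" "gin G u e (f j) = 0" if "j < k" for j
   using fy[OF that] sym_G[OF u, of "f j" y] by (auto simp: e_def gin_scale1 gin_scale2)
  show ?case
   by (rule exI[of _ "f(k := e)"]) (use f fe ee in \<open>auto simp: less_Suc_eq\<close>)
 qed
 then obtain f :: "nat => real^'n"
  where f: "\<forall>i<CARD('n). \<forall>j<CARD('n). gin G u (f i) (f j) = (if i = j then 1 else 0)" by blast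
 obtain h where h: "bij_betw h (UNIV :: 'n set) {0..<CARD('n)}"
  using ex_bij_betw_finite_nat[of "UNIV :: 'n set"] by auto
 have "h i < CARD('n)" "h i = h j \<longleftrightarrow> i = j" for i j
  using h by (auto simp: bij_betw_def inj_on_def)
 then have "onb G u (f \<circ> h)" using f by (simp add: onb_def)
 then show ?thesis by blast
qed

lemma cauchy_gin:
 assumes u: "u \<in> U"
 shows "\<bar>gin G u a b\<bar> <= sqrt (gin G u a a) * sqrt (gin G u b b)"
proof (cases "b = 0")
 case False
 let ?t = "gin G u a b / gin G u b b"
 have b: "gin G u b b > 0" using pos_G[OF u False] .
 have "0 <= gin G u (a - ?t *\<^sub>R b) (a - ?t *\<^sub>R b)" by (rule gin_nonneg[OF u])
 also have "... = gin G u a a - (gin G u a b)^2 / gin G u b b"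
  using b sym_G[OF u, of b a]
  by (simp add: gin_diff1 gin_diff2 gin_scale1 gin_scale2 power2_eq_square field_simps)
 finally have "(gin G u a b)^2 <= gin G u a a * gin G u b b"
  using b by (simp add: field_simps)
 then have "sqrt ((gin G u a b)^2) <= sqrt (gin G u a a * gin G u b b)" by (rule real_sqrt_le_mono)
 then show ?thesis by (simp add: real_sqrt_mult)
qed (simp add: gin_zero2)

definition ddgin where
 "ddgin u y z a b = dbil (%i j x. dir (%x. G x $ i $ j) x z) u y a b"

text \<open>The derivative \<open>\<partial>\<^sub>s\<partial>\<^sub>s\<close> of \<open>gin(\<gamma>', \<gamma>') / 2\<close> for a variation with velocity \<open>V\<close> and covariant
 acceleration \<open>W\<close>. It holds pointwise, for curves that need not be geodesics, because the
 covariant acceleration of the variation is prescribed.\<close>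

lemma second_variation_pointwise:
 assumes u: "u \<in> U"
  and A: "A = - Gam G u V V + W"
  and A': "A' = - (dGam G u v V V + Gam G u V' V + Gam G u V V') + W'"
 shows "ddgin u V V v v / 2 + dgin G u A v v / 2 + 2 * dgin G u V V' v + gin G u V' V' + gin G u A' v
  = gin G u (V' + Gam G u v V) (V' + Gam G u v V) + gin G u (Rm G u V v V) v + gin G u (W' + Gam G u v W) v"
proof -
 have dv: "((%x. Gam G x V v) has_derivative (%h. dGam G u h V v)) (at u)"
  using Gam_has_derivative[where x = "%x. x" and x' = "%h. h" and t = u, OF u has_derivative_ident
    has_derivative_const has_derivative_const] by (simp add: Gam_zero1 Gam_zero2)
 \<comment> \<open>Differentiating the compatibility identity dG(V; v, v) = 2 <Gam(V, v), v> once
   more in direction \<open>V\<close> expresses the second derivatives of the metric by first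
   derivatives of the Christoffel symbols.\<close>
 have "((%x. 2 * gin G x (Gam G x V v) v) has_derivative
   (%h. 2 * (dgin G u h (Gam G u V v) v + gin G u (dGam G u h V v) v + gin G u (Gam G u V v) 0))) (at u)"
  by (intro has_derivative_mult_right gin_has_derivative[where x = "%x. x" and x' = "%h. h"]
    has_derivative_ident has_derivative_const dv u)
 from dir_eqI[OF this, of V]
 have "2 * (dgin G u V (Gam G u V v) v + gin G u (dGam G u V V v) v)
   = dir (%x. 2 * gin G x (Gam G x V v) v) u V" by (simp add: gin_zero2)
 also have "... = dir (%x. dgin G x V v v) u V"
  by (rule dir_cong_open[OF U_open u]) (simp add: compat sym_G)
 also have "... = ddgin u V V v v"
 proof -
  have "((%x. dgin G x V v v) has_derivative (%h. ddgin u h V v v + dgin G u V 0 v + dgin G u V v 0)) (at u)"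
   unfolding ddgin_def
   by (rule dgin_has_derivative[where x = "%x. x" and x' = "%h. h"])
    (intro has_derivative_ident has_derivative_const u)+
  from dir_eqI[OF this, of V] show ?thesis
   using dgin_scale1[of G u V 0 0 v] dgin_scale2[of G u V v 0 0] by simp
 qed
 finally have dd: "ddgin u V V v v = 2 * (dgin G u V (Gam G u V v) v + gin G u (dGam G u V V v) v)" by simp
 note s = sym_G[OF u, of v "Gam G u V V'"] sym_G[OF u, of v "Gam G u V (Gam G u V v)"]
   sym_G[OF u, of v "Gam G u W v"] sym_G[OF u, of v "Gam G u (Gam G u V V) v"]
   sym_G[OF u, of "Gam G u V v" V'] Gam_sym[OF u, of v V] Gam_sym[OF u, of v W]
   Gam_sym[OF u, of v "Gam G u V V"] Gam_sym[OF u, of V' V] dGam_sym[OF u, of V v V]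
 show ?thesis
  unfolding dd A A' Rm_def compat[OF u]
  by (simp only: gin_add1 gin_add2 gin_diff1 gin_diff2 gin_minus1 gin_minus2
    Gam_add1 Gam_add2 Gam_diff1 Gam_diff2 Gam_minus1 Gam_minus2) (simp add: s field_simps)
qed

end

section \<open>The soliton equation and the elliptic identity for the scalar curvature\<close>

locale local_soliton = local_metric U G
 for U :: "(real^'n::finite) set" and G :: "real^'n => real^'n^'n" +
 fixes \<phi> :: "real^'n => real" and lam :: real
 assumes smooth_phi: "Cinf_on U \<phi>"
  and soliton_eq: "!!u i j. u \<in> U ==> ricci G i j u - hessian G \<phi> i j u = lam * G u $ i $ j"
begin

text \<open>The gradient of \<phi>.\<close>

definition X where "X x = sharp x (\<chi> k. pd k \<phi> x)"

lemma smooth_X: "smap U X"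
 unfolding X_def[abs_def] by (rule smooth_sharp) (simp add: smap_def Cinf_on_pd smooth_phi)

lemma gin_X: "u \<in> U ==> gin G u (X u) y = dir \<phi> u y"
 by (simp add: X_def gin_sharp inner_vec_def dir_def mult.commute)

lemma Ric_eq: "u \<in> U ==> Ric G u a b = Hess G \<phi> u a b + lam * gin G u a b"
proof -
 assume "u \<in> U"
 then have "ricci G i j u = hessian G \<phi> i j u + lam * G u $ i $ j" for i j
  using soliton_eq[of u i j] by simp
 then show ?thesis
  by (simp add: Ric_def Hess_def gin_bil bil_def algebra_simps sum.distrib sum_distrib_left)
qed

lemma Hess_sym: "u \<in> U ==> Cinf_on U f ==> Hess G f u a b = Hess G f u b a"
 by (simp add: Hess_eq[OF U_open] dir_commute[OF U_open] Gam_sym)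

lemma Ric_sym: "u \<in> U ==> Ric G u a b = Ric G u b a"
 using Hess_sym[OF _ smooth_phi] sym_G by (simp add: Ric_eq)

lemma nabRic_sym:
 assumes u: "u \<in> U"
 shows "nabRic u z a b = nabRic u z b a"
proof -
 have "dir (%x. Ric G x a b) u z = dir (%x. Ric G x b a) u z"
  by (rule dir_cong_open[OF U_open u]) (rule Ric_sym)
 then show ?thesis
  using Ric_sym[OF u, of "Gam G u z a" b] Ric_sym[OF u, of a "Gam G u z b"]
  by (simp add: nabRic_def dRic_dir[OF u])
qed

lemma nabX:
 assumes u: "u \<in> U"
 shows "gin G u (jac X u a + Gam G u a (X u)) b = Hess G \<phi> u a b"
proof -
 have "((%x. gin G x (X x) b) has_derivative
   (%h. dgin G u h (X u) b + gin G u (jac X u h) b + gin G u (X u) 0)) (at u)"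
  by (intro gin_has_derivative[where x = "%x. x" and x' = "%h. h"] has_derivative_ident has_derivative_const
    smap_has_derivative[OF smooth_X U_open u] u)
 from dir_eqI[OF this, of a]
 have "dgin G u a (X u) b + gin G u (jac X u a) b = dir (%x. gin G x (X x) b) u a" by (simp add: gin_zero2)
 also have "... = dir (%x. dir \<phi> x b) u a"
  by (rule dir_cong_open[OF U_open u]) (rule gin_X)
 finally show ?thesis
  by (simp add: Hess_eq[OF U_open smooth_phi u] compat[OF u] gin_add1 gin_X[OF u])
qed

text \<open>By the soliton equation Ric is Hess \<phi> plus a parallel tensor, so its
  antisymmetrised derivative is that of the Hessian: the third derivatives of \<phi> commute and
  only a curvature term is left (Ricci identity).\<close>

lemma nabRic_commute:
 assumes u: "u \<in> U"
 shows "nabRic u a b c - nabRic u b a c = - gin G u (Rm G u a b c) (X u)"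
proof -
 have d3: "dir (%x. dir (%y. dir \<phi> y c) x b) u a = dir (%x. dir (%y. dir \<phi> y c) x a) u b" for a b
  by (rule dir_commute[OF U_open Cinf_on_dir[OF U_open smooth_phi smap_const] u])
 have dR: "dir (%x. Ric G x b c) u a = dir (%x. dir (%y. dir \<phi> y c) x b) u a
   - (dir (%y. dir \<phi> y (Gam G u b c)) u a + dir \<phi> u (dGam G u a b c)) + lam * dgin G u a b c" for a b
 proof -
  have g: "((%x. Gam G x b c) has_derivative (%h. dGam G u h b c)) (at u)"
   using Gam_has_derivative[where x = "%x. x" and x' = "%h. h" and t = u, OF u has_derivative_ident
    has_derivative_const has_derivative_const] by (simp add: Gam_zero1 Gam_zero2)
  have gg: "((%x. gin G x b c) has_derivative (%h. dgin G u h b c)) (at u)"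
   using gin_has_derivative[where x = "%x. x" and x' = "%h. h" and t = u, OF u has_derivative_ident
    has_derivative_const has_derivative_const] by (simp add: gin_zero1 gin_zero2)
  have "dir (%x. Ric G x b c) u a = dir (%x. dir (%y. dir \<phi> y c) x b - dir \<phi> x (Gam G x b c) + lam * gin G x b c) u a"
   by (rule dir_cong_open[OF U_open u]) (simp add: Ric_eq Hess_eq[OF U_open smooth_phi])
  also have "... = dir (%x. dir (%y. dir \<phi> y c) x b) u a
   - (dir (%y. dir \<phi> y (Gam G u b c)) u a + dir \<phi> u (dGam G u a b c)) + lam * dgin G u a b c"
   by (rule dir_eqI) (intro has_derivative_add has_derivative_diff has_derivative_mult_right gg
     dir_field_has_derivative[OF smooth_phi U_open, where x = "%x. x" and x' = "%h. h"] u has_derivative_ident g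
     dir_has_derivative[OF Cinf_on_dir[OF U_open Cinf_on_dir[OF U_open smooth_phi smap_const] smap_const] U_open u])
  finally show ?thesis .
 qed
 have H: "Hess G \<phi> u p q = dir (%x. dir \<phi> x q) u p - dir \<phi> u (Gam G u p q)" for p q
  by (rule Hess_eq[OF U_open smooth_phi u])
 have s2: "dir (%x. dir \<phi> x q) u p = dir (%x. dir \<phi> x p) u q" for p q
  by (rule dir_commute[OF U_open smooth_phi u])
 have sX: "gin G u (Rm G u a b c) (X u) = dir \<phi> u (Rm G u a b c)"
  using sym_G[OF u, of "Rm G u a b c" "X u"] gin_X[OF u, of "Rm G u a b c"] by simp
 have gb: "Gam G u b a = Gam G u a b" using Gam_sym[OF u] .
 show ?thesis
  unfolding sX nabRic_def dRic_dir[OF u] dR Ric_eq[OF u] H compat[OF u] gb d3[of b a]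
   s2[of "Gam G u b c" a] s2[of "Gam G u a c" b]
  by (simp add: Rm_def dir_add dir_diff algebra_simps sym_G[OF u, of b] sym_G[OF u, of a])
qed

context
 fixes u and E :: "'n => real^'n"
 assumes u: "u \<in> U" and E: "onb G u E"
begin

text \<open>The trace of \<open>nabRic_commute\<close> says that dR minus the divergence of Ric is -
  Ric(., X); by the contracted Bianchi identity dR is twice that divergence. These two linear
  equations determine both.\<close>

lemma dscal_soliton: "dir (scal_loc G) u a = - 2 * Ric G u a (X u)"
 and div_Ric: "(SU i. nabRic u (E i) a (E i)) = - Ric G u a (X u)"
proof -
 have "gin G u (Rm G u a (E i) (E i)) (X u) = gin G u (Rm G u (E i) a (X u)) (E i)" for i
  using Rm_skew[OF u, of "E i" a "E i" "X u"] sym_G[OF u, of "E i" "Rm G u (E i) a (X u)"]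
  by (simp add: Rm_antisym[of G u a "E i"] gin_minus1)
 then have "(SU i. nabRic u a (E i) (E i) - nabRic u (E i) a (E i)) = - Ric G u a (X u)"
  by (simp add: nabRic_commute[OF u] Ric_onb[OF u E] sum_negf)
 then have "(SU i. nabRic u a (E i) (E i)) - (SU i. nabRic u (E i) a (E i)) = - Ric G u a (X u)"
  by (simp only: sum_subtractf)
 moreover have "dir (scal_loc G) u a = (SU i. nabRic u a (E i) (E i))" by (rule dscal[OF u E])
 moreover have "dir (scal_loc G) u a = 2 * (SU i. nabRic u (E i) a (E i))"
  by (rule contracted_Bianchi[OF u E])
 ultimately show "dir (scal_loc G) u a = - 2 * Ric G u a (X u)"
  "(SU i. nabRic u (E i) a (E i)) = - Ric G u a (X u)" by simp_all
qed

end

text \<open>Differentiate dR = -2 Ric(., X) and take the trace. The divergence of Ric contributes 2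
  Ric(X, X), which the drift term dR(X) cancels; the derivative of X is Ric - \<lambda> g and
  contributes the right-hand side.\<close>

lemma scal_identity:
 assumes u: "u \<in> U" and E: "onb G u E"
 shows "(SU i. Hess G (scal_loc G) u (E i) (E i)) + dir (scal_loc G) u (X u)
  = 2 * lam * scal_loc G u - 2 * ricci_norm_sq_loc G u"
proof -
 have ds: "dir (scal_loc G) x a = - 2 * Ric G x a (X x)" if "x \<in> U" for x a
  using onb_exists[OF that] dscal_soliton[OF that] by blast
 have nX: "jac X u (E i) + Gam G u (E i) (X u) = (SU j. (Ric G u (E i) (E j) - lam * (if i = j then 1 else 0)) *\<^sub>R E j)" (is "?Y i = _") for i
 proof -
  have "gin G u (E j) (?Y i) = Ric G u (E i) (E j) - lam * (if i = j then 1 else 0)" for j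
   using nabX[OF u, of "E i" "E j"] Ric_eq[OF u, of "E i" "E j"] sym_G[OF u, of "E j" "?Y i"] E
   by (simp add: onb_def)
  then show ?thesis using onb_expand[OF u E, of "?Y i"] by simp
 qed
 have Hs: "Hess G (scal_loc G) u a a = -2 * (nabRic u a a (X u) + Ric G u a (jac X u a + Gam G u a (X u)))" for a
 proof -
  have "((%x. - 2 * Ric G x a (X x)) has_derivative
    (%h. - 2 * (dbil (ricci G) u h a (X u) + bil (ricci G) u 0 (X u) + bil (ricci G) u a (jac X u h)))) (at u)"
   unfolding Ric_def
   by (intro has_derivative_mult_right bil_has_derivative[where u = "%x. x" and u' = "%h. h"]
     has_derivative_ident has_derivative_const smap_has_derivative[OF smooth_X U_open u]
     Cinf_on_differentiable_at[OF smooth_ricci U_open u])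
  from dir_eqI[OF this, of a]
  have "dir (%x. - 2 * Ric G x a (X x)) u a = - 2 * (dbil (ricci G) u a a (X u) + Ric G u a (jac X u a))"
   using bil_scale1[of "ricci G" u 0 0 "X u"] by (simp add: Ric_def)
  moreover have "dir (%x. dir (scal_loc G) x a) u a = dir (%x. - 2 * Ric G x a (X x)) u a"
   by (rule dir_cong_open[OF U_open u ds])
  ultimately show ?thesis
   unfolding Hess_eq[OF U_open smooth_scal u] ds[OF u] nabRic_def
   by (simp add: Ric_def bil_add2 algebra_simps)
 qed
 have 1: "(SU i. nabRic u (E i) (E i) (X u)) = - Ric G u (X u) (X u)"
  using div_Ric[OF u E, of "X u"] nabRic_sym[OF u, of _ "X u"] by simp
 have "Ric G u (E i) (jac X u (E i) + Gam G u (E i) (X u))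
   = (SU j. (Ric G u (E i) (E j))^2) - lam * Ric G u (E i) (E i)" for i
 proof -
  have "linear (Ric G u (E i))" by (rule linearI) (simp_all add: Ric_def bil_add2 bil_scale2)
  then have "Ric G u (E i) (jac X u (E i) + Gam G u (E i) (X u))
   = (SU j. (Ric G u (E i) (E j) - lam * (if i = j then 1 else 0)) * Ric G u (E i) (E j))"
   unfolding nX by (simp add: linear_sum linear_cmul)
  also have "... = (SU j. (Ric G u (E i) (E j))^2 - (if i = j then lam * Ric G u (E i) (E j) else 0))"
   by (intro sum.cong refl) (simp add: power2_eq_square algebra_simps)
  finally show ?thesis by (simp add: sum_subtractf)
 qed
 then have 2: "(SU i. Ric G u (E i) (jac X u (E i) + Gam G u (E i) (X u)))
   = ricci_norm_sq_loc G u - lam * scal_loc G u"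
  by (simp add: sum_subtractf sum_distrib_left[symmetric] scal_onb[OF u E] ricci_norm_onb[OF u E])
 have "(SU i. Hess G (scal_loc G) u (E i) (E i)) =
  - 2 * ((SU i. nabRic u (E i) (E i) (X u)) + (SU i. Ric G u (E i) (jac X u (E i) + Gam G u (E i) (X u))))"
  unfolding Hs by (simp only: sum_distrib_left[symmetric] sum.distrib)
 then show ?thesis unfolding 1 2 ds[OF u] by (simp add: algebra_simps)
qed

text \<open>Cauchy-Schwarz for the diagonal of Ric in an orthonormal frame. It puts a quadratic term
  in R into the identity, on which the lower bound for R rests.\<close>

lemma scal_sq_le: 
 assumes u: "u \<in> U"
 shows "(scal_loc G u)^2 <= real CARD('n) * ricci_norm_sq_loc G u"
proof -
 obtain E where E: "onb G u E" using onb_exists[OF u] by blast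
 have "(SU k. Ric G u (E k) (E k) * 1)^2 <= (SU k. (Ric G u (E k) (E k))^2) * (\<Sum>k\<in>(UNIV::'n set). 1^2)"
  by (rule Cauchy_Schwarz_ineq_sum)
 also have "(SU k. (Ric G u (E k) (E k))^2) <= (SU k. SU l. (Ric G u (E k) (E l))^2)"
  by (intro sum_mono member_le_sum) auto
 finally show ?thesis
  by (simp add: scal_onb[OF u E] ricci_norm_onb[OF u E] mult.commute mult_right_mono)
qed

end

section \<open>Changes of coordinates\<close>

lemma dir_compose:
 assumes T: "smap S T" "open S" "u \<in> S" and f: "Cinf_on S' f" "open S'" "T u \<in> S'"
 shows "dir (%x. f (T x)) u z = dir f (T u) (jac T u z)"
 using dir_eqI[OF has_derivative_compose[OF smap_has_derivative[OF T] dir_has_derivative[OF f]]] .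

locale metric_change = M: local_metric U G + M': local_metric U' G'
 for U :: "(real^'n::finite) set" and G and U' :: "(real^'n) set" and G' +
 fixes T :: "real^'n => real^'n"
 assumes smooth_T: "smap U T" and T_image: "T ` U \<subseteq> U'"
  and G_T: "!!u a b. u \<in> U ==> gin G u a b = gin G' (T u) (jac T u a) (jac T u b)"
begin

lemma T_in: "u \<in> U ==> T u \<in> U'"
 using T_image by blast

lemma jac_surj: assumes u: "u \<in> U" shows "\<exists>a. jac T u a = b"
proof -
 have "jac T u x = 0 ==> x = 0" for x
  using G_T[OF u, of x x] M.pos_G[OF u, of x] by (auto simp: gin_zero1)
 then have "inj (jac T u)"
  using linear_injective_0[OF linear_jac] by blast
 then have "surj (jac T u)" by (rule linear_injective_imp_surjective[OF linear_jac]) (rule refl)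
 then show ?thesis by (metis surj_def)
qed

lemma jac2_sym: "u \<in> U ==> jac (%x. jac T x a) u b = jac (%x. jac T x b) u a"
 unfolding vec_eq_iff jac_nth using dir_commute[OF M.U_open] smooth_T by (simp add: smap_def)

lemma dgin_change:
 assumes u: "u \<in> U"
 shows "dgin G u z a b = dgin G' (T u) (jac T u z) (jac T u a) (jac T u b)
  + gin G' (T u) (jac (%x. jac T x a) u z) (jac T u b) + gin G' (T u) (jac T u a) (jac (%x. jac T x b) u z)"
proof -
 have j: "((%x. jac T x a) has_derivative jac (%x. jac T x a) u) (at u)" for a
  by (rule smap_has_derivative[OF smap_jac[OF M.U_open smooth_T smap_const] M.U_open u])
 have "dgin G u z a b = dir (%x. gin G' (T x) (jac T x a) (jac T x b)) u z"
  unfolding M.dgin_dir[OF u] by (rule dir_cong_open[OF M.U_open u G_T])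
 also have "... = dgin G' (T u) (jac T u z) (jac T u a) (jac T u b)
  + gin G' (T u) (jac (%x. jac T x a) u z) (jac T u b) + gin G' (T u) (jac T u a) (jac (%x. jac T x b) u z)"
  by (rule dir_eqI[OF M'.gin_has_derivative[OF T_in[OF u] smap_has_derivative[OF smooth_T M.U_open u] j j]])
 finally show ?thesis .
qed

text \<open>Both sides are tested against vectors \<open>jac T u d\<close>, and every vector is of
  this form. The Koszul formula reduces the claim to first derivatives of the metrics, where the
  symmetry of the second derivatives of \<open>T\<close> cancels all such terms but one.\<close>

lemma Gam_change:
 assumes u: "u \<in> U"
 shows "jac T u (Gam G u a b) = Gam G' (T u) (jac T u a) (jac T u b) + jac (%x. jac T x b) u a"
proof (rule M'.gin_eq_imp_eq[OF T_in[OF u]])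
 fix y
 obtain d where d: "jac T u d = y" using jac_surj[OF u] by blast
 have "gin G' (T u) (jac T u (Gam G u a b)) (jac T u d) = gin G u (Gam G u a b) d"
  by (simp add: G_T[OF u])
 also have "... = gin G' (T u) (Gam G' (T u) (jac T u a) (jac T u b) + jac (%x. jac T x b) u a) (jac T u d)"
  unfolding M.Gam_lower[OF u] dgin_change[OF u] gin_add1 M'.Gam_lower[OF T_in[OF u]]
   jac2_sym[OF u, of a b] jac2_sym[OF u, of d a] jac2_sym[OF u, of d b]
   M'.sym_G[OF T_in[OF u], of "jac T u b"] M'.sym_G[OF T_in[OF u], of "jac T u a"]
  by (simp add: field_simps)
 finally show "gin G' (T u) (jac T u (Gam G u a b)) y =
   gin G' (T u) (Gam G' (T u) (jac T u a) (jac T u b) + jac (%x. jac T x b) u a) y"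
  by (simp add: d)
qed

lemma Hess_change:
 assumes u: "u \<in> U" and f: "Cinf_on U' f'" "!!x. x \<in> U ==> f x = f' (T x)" and f0: "Cinf_on U f"
 shows "Hess G f u a b = Hess G' f' (T u) (jac T u a) (jac T u b)"
proof -
 have d: "dir f x z = dir f' (T x) (jac T x z)" if "x \<in> U" for x z
  using dir_compose[OF smooth_T M.U_open that f(1) M'.U_open T_in[OF that]]
   dir_cong_open[OF M.U_open that f(2)] by simp
 have "dir (%x. dir f x b) u a = dir (%x. dir f' (T x) (jac T x b)) u a"
  by (rule dir_cong_open[OF M.U_open u d])
 also have "... = dir (%y. dir f' y (jac T u b)) (T u) (jac T u a) + dir f' (T u) (jac (%x. jac T x b) u a)"
  by (rule dir_eqI[OF dir_field_has_derivative[OF f(1) M'.U_open T_in[OF u]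
    smap_has_derivative[OF smooth_T M.U_open u]
    smap_has_derivative[OF smap_jac[OF M.U_open smooth_T smap_const] M.U_open u]]])
 finally show ?thesis
  unfolding Hess_eq[OF M.U_open f0 u] Hess_eq[OF M'.U_open f(1) T_in[OF u]]
  by (simp add: d[OF u] Gam_change[OF u] dir_add)
qed

lemma onb_change: "u \<in> U ==> onb G u E ==> onb G' (T u) (%i. jac T u (E i))"
 by (simp add: onb_def G_T)

end

locale soliton_change = S: local_soliton U G \<phi> lam + S': local_soliton U' G' \<phi>' lam + metric_change U G U' G' T
 for U :: "(real^'n::finite) set" and G \<phi> lam and U' :: "(real^'n) set" and G' \<phi>' T +
 assumes phi_T: "!!x. x \<in> U ==> \<phi> x = \<phi>' (T x)"
begin

text \<open>The soliton equation expresses Ric by the Hessian of \<phi> and the metric, so its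
  transformation law follows from theirs, without transforming the curvature tensor itself.\<close>

lemma Ric_change: "u \<in> U ==> Ric G u a b = Ric G' (T u) (jac T u a) (jac T u b)"
 using Hess_change[OF _ S'.smooth_phi phi_T S.smooth_phi]
 by (simp add: S.Ric_eq S'.Ric_eq T_in G_T)

lemma scal_change: "u \<in> U ==> scal_loc G u = scal_loc G' (T u)"
 and ricci_norm_change: "u \<in> U ==> ricci_norm_sq_loc G u = ricci_norm_sq_loc G' (T u)"
proof -
 assume u: "u \<in> U"
 obtain E where E: "onb G u E" using S.onb_exists[OF u] by blast
 note E' = onb_change[OF u E]
 show "scal_loc G u = scal_loc G' (T u)"
  by (simp add: S.scal_onb[OF u E] S'.scal_onb[OF T_in[OF u] E'] Ric_change[OF u])
 show "ricci_norm_sq_loc G u = ricci_norm_sq_loc G' (T u)"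
  by (simp add: S.ricci_norm_onb[OF u E] S'.ricci_norm_onb[OF T_in[OF u] E'] Ric_change[OF u])
qed

lemma X_change: assumes u: "u \<in> U" shows "jac T u (S.X u) = S'.X (T u)"
proof (rule S'.gin_eq_imp_eq[OF T_in[OF u]])
 fix y
 obtain d where d: "jac T u d = y" using jac_surj[OF u] by blast
 have "gin G' (T u) (jac T u (S.X u)) y = dir \<phi> u d"
  using G_T[OF u, of "S.X u" d] S.gin_X[OF u] d by simp
 also have "... = dir \<phi>' (T u) y"
  using dir_compose[OF smooth_T S.U_open u S'.smooth_phi S'.U_open T_in[OF u], of d] d
   dir_cong_open[OF S.U_open u phi_T] by simp
 finally show "gin G' (T u) (jac T u (S.X u)) y = gin G' (T u) (S'.X (T u)) y"
  by (simp add: S'.gin_X[OF T_in[OF u]])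
qed

end

section \<open>Passage from charts to the manifold\<close>

context riem_mfd
begin

lemma local_metric_chart: "c \<in> A ==> local_metric (cimg c) (G c)"
 by unfold_locales (use open_cimg G_smooth G_sym G_pos in auto)

end

lemma local_metric_subset:
 assumes "local_metric U G" "open V" "V \<subseteq> U"
 shows "local_metric V G"
proof -
 interpret local_metric U G by fact
 show ?thesis
  by unfold_locales (use assms smooth_G sym_G pos_G Cinf_on_subset in blast)+
qed

lemma local_soliton_subset:
 assumes "local_soliton U G \<phi> lam" "open V" "V \<subseteq> U"
 shows "local_soliton V G \<phi> lam"
proof -
 interpret local_soliton U G \<phi> lam by fact
 interpret V: local_metric V G
  by (rule local_metric_subset[OF local_metric_axioms assms(2,3)])
 show ?thesis
  by unfold_locales (use assms smooth_phi soliton_eq Cinf_on_subset in blast)+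
qed

context riem_mfd
begin

lemma metric_change_charts:
 assumes c: "c \<in> A" "d \<in> A"
 shows "metric_change (cmap c ` (cdom c \<inter> cdom d)) (G c) (cimg d) (G d) (trans_map c d)"
proof -
 interpret M: local_metric "cmap c ` (cdom c \<inter> cdom d)" "G c"
  by (rule local_metric_subset[OF local_metric_chart[OF c(1)] open_overlap[OF c]]) auto
 interpret M': local_metric "cimg d" "G d"
  by (rule local_metric_chart[OF c(2)])
 show ?thesis
 proof unfold_locales
  show "smap (cmap c ` (cdom c \<inter> cdom d)) (trans_map c d)" by (rule smap_trans[OF c])
  show "trans_map c d ` cmap c ` (cdom c \<inter> cdom d) \<subseteq> cimg d"
   using trans_map_image[OF c] by auto
  show "gin (G c) u a b = gin (G d) (trans_map c d u) (jac (trans_map c d) u a) (jac (trans_map c d) u b)"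
   if "u \<in> cmap c ` (cdom c \<inter> cdom d)" for u a b
   by (rule G_change[OF c that])
 qed
qed

end

locale soliton = riem_mfd A g
 for A :: "('a::{t2_space,second_countable_topology}, 'n::finite) chart set" and g +
 fixes \<phi> :: "'a => real" and lam :: real
 assumes soliton: "gradient_ricci_soliton A g \<phi> lam"
begin

lemma smooth_phi: "smooth_fun A \<phi>"
 using soliton by (simp add: gradient_ricci_soliton_def)

lemma local_soliton_chart: "c \<in> A ==> local_soliton (cimg c) (G c) (\<phi> \<circ> cinv c) lam"
proof -
 assume c: "c \<in> A"
 interpret local_metric "cimg c" "G c" by (rule local_metric_chart[OF c])
 show ?thesis
  by unfold_locales (use soliton c smooth_funD[OF smooth_phi c] in \<open>auto simp: gradient_ricci_soliton_def\<close>)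
qed

lemma soliton_change_charts:
 assumes c: "c \<in> A" "d \<in> A"
 shows "soliton_change (cmap c ` (cdom c \<inter> cdom d)) (G c) (\<phi> \<circ> cinv c) lam (cimg d) (G d) (\<phi> \<circ> cinv d) (trans_map c d)"
proof -
 interpret S: local_soliton "cmap c ` (cdom c \<inter> cdom d)" "G c" "\<phi> \<circ> cinv c" lam
  by (rule local_soliton_subset[OF local_soliton_chart[OF c(1)] open_overlap[OF c]]) auto
 interpret S': local_soliton "cimg d" "G d" "\<phi> \<circ> cinv d" lam
  by (rule local_soliton_chart[OF c(2)])
 interpret metric_change "cmap c ` (cdom c \<inter> cdom d)" "G c" "cimg d" "G d" "trans_map c d"
  by (rule metric_change_charts[OF c])
 show ?thesis
 proof unfold_locales
  fix x assume "x \<in> cmap c ` (cdom c \<inter> cdom d)"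
  then obtain p where "x = cmap c p" "p \<in> cdom c" "p \<in> cdom d" by blast
  then show "(\<phi> \<circ> cinv c) x = (\<phi> \<circ> cinv d) (trans_map c d x)" using c by simp
 qed
qed

definition R :: "'a => real" where "R = scalar_curvature A g"

lemma chart_at: "chart_at A p \<in> A" "p \<in> cdom (chart_at A p)"
 using someI_ex[of "%c. c \<in> A & p \<in> cdom c"] chart_ex[of p] unfolding chart_at_def by blast+

lemma R_chart: "c \<in> A ==> p \<in> cdom c ==> R p = scal_loc (G c) (cmap c p)"
 and ricci_norm_chart: "c \<in> A ==> p \<in> cdom c ==> ricci_norm_sq A g p = ricci_norm_sq_loc (G c) (cmap c p)"
proof -
 assume c: "c \<in> A" and p: "p \<in> cdom c"
 let ?d = "chart_at A p"
 interpret soliton_change "cmap c ` (cdom c \<inter> cdom ?d)" "G c" "\<phi> \<circ> cinv c" lam "cimg ?d" "G ?d" "\<phi> \<circ> cinv ?d" "trans_map c ?d"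
  by (rule soliton_change_charts[OF c chart_at(1)])
 have u: "cmap c p \<in> cmap c ` (cdom c \<inter> cdom ?d)" using p chart_at(2) by blast
 show "R p = scal_loc (G c) (cmap c p)"
  using scal_change[OF u] p c by (simp add: R_def scalar_curvature_def Let_def)
 show "ricci_norm_sq A g p = ricci_norm_sq_loc (G c) (cmap c p)"
  using ricci_norm_change[OF u] p c by (simp add: ricci_norm_sq_def Let_def)
qed

end

section \<open>Lengths of paths\<close>

text \<open>The constants are the square roots of the extrema of the metric over the compact set of
  pairs of a point of \<open>K\<close> and a Euclidean unit vector; homogeneity does the
  rest.\<close>

lemma chart_local_metric_bounds:
 assumes "local_metric U G" and K: "compact K" "K \<subseteq> U" "K ~= {}"
 shows "\<exists>m M. 0 < m & 0 < M & (\<forall>u\<in>K. \<forall>v. m * norm v <= sqrt (gin G u v v) & sqrt (gin G u v v) <= M * norm v)"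
proof -
 interpret local_metric U G by fact
 let ?S = "K \<times> sphere (0::real^'b) 1"
 have cs: "compact ?S" using K by (intro compact_Times) auto
 have ne: "?S ~= {}"
 proof -
  have "axis undefined 1 \<in> sphere (0::real^'b) 1" by simp
  then show ?thesis using K(3) by blast
 qed
 have cont: "continuous_on ?S (%(u, v). gin G u v v)"
  unfolding gin_sum split_beta
  by (intro continuous_intros continuous_on_compose2[OF Cinf_on_continuous[OF smooth_G] continuous_on_fst[OF continuous_on_id]])
   (use K in auto)
 obtain p where p: "p \<in> ?S" "!!q. q \<in> ?S ==> (%(u, v). gin G u v v) p <= (%(u, v). gin G u v v) q"
  using continuous_attains_inf[OF cs ne cont] by blast
 obtain p' where p': "p' \<in> ?S" "!!q. q \<in> ?S ==> (%(u, v). gin G u v v) q <= (%(u, v). gin G u v v) p'"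
  using continuous_attains_sup[OF cs ne cont] by blast
 define m where "m = (%(u, v). gin G u v v) p"
 define M where "M = (%(u, v). gin G u v v) p'"
 have "snd p ~= 0" using p(1) by auto
 then have m: "m > 0" using p(1) K pos_G by (auto simp: m_def split_beta)
 have mM: "m <= M" unfolding m_def M_def using p(2) p'(1) by blast
 have "m * (norm v)^2 <= gin G u v v & gin G u v v <= M * (norm v)^2" if "u \<in> K" for u v
 proof (cases "v = 0")
  case False
  have "(u, v /\<^sub>R norm v) \<in> ?S" using that False by simp
  then have "m <= gin G u (v /\<^sub>R norm v) (v /\<^sub>R norm v)" "gin G u (v /\<^sub>R norm v) (v /\<^sub>R norm v) <= M"
   using p(2) p'(2) unfolding m_def M_def by fastforce+
  then show ?thesis using False by (simp add: gin_scale1 gin_scale2 field_simps power2_eq_square)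
 qed (simp add: gin_zero1)
 then have "sqrt (m * (norm v)^2) <= sqrt (gin G u v v) & sqrt (gin G u v v) <= sqrt (M * (norm v)^2)" if "u \<in> K" for u v
  using that by auto
 then show ?thesis
  using m mM by (intro exI[of _ "sqrt m"] exI[of _ "sqrt M"]) (auto simp: real_sqrt_mult)
qed

context riem_mfd
begin

definition speed :: "(real => 'a) => real => real" where
 "speed \<gamma> t = sqrt (g (\<gamma> t) (velocity A \<gamma> t) (velocity A \<gamma> t))"

text \<open>Relative to an open set of parameters, not to an interval with exceptions, so that
  restriction, union and reparametrisation of curves become operations on that set.\<close>

definition regular :: "(real => 'a) => real set => bool" where
 "regular \<gamma> I \<longleftrightarrow> open I & continuous_on I \<gamma> &
   (\<forall>c\<in>A. (cmap c \<circ> \<gamma>) C1_differentiable_on {t\<in>I. \<gamma> t \<in> cdom c})"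

lemma speed_eq:
 assumes c: "c \<in> A" and x: "((cmap c \<circ> \<gamma>) has_vector_derivative x') (at t)"
  and I: "open I" "t \<in> I" "continuous_on I \<gamma>" "\<gamma> t \<in> cdom c"
 shows "speed \<gamma> t = sqrt (gin (G c) (cmap c (\<gamma> t)) x' x')"
proof -
 have "open (I \<inter> \<gamma> -` cdom c)" by (rule continuous_open_preimage[OF I(3,1) open_cdom[OF c]])
 then show ?thesis unfolding speed_def
  by (subst speed_chart[OF c x, of "I \<inter> \<gamma> -` cdom c"]) (use I in auto)
qed

lemma open_regular: "regular \<gamma> I ==> c \<in> A ==> open {t\<in>I. \<gamma> t \<in> cdom c}"
proof -
 assume r: "regular \<gamma> I" and c: "c \<in> A"
 have "open (I \<inter> \<gamma> -` cdom c)"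
  using r by (intro continuous_open_preimage open_cdom c) (auto simp: regular_def)
 moreover have "I \<inter> \<gamma> -` cdom c = {t\<in>I. \<gamma> t \<in> cdom c}" by auto
 ultimately show ?thesis by simp
qed

lemma regular_derivative:
 assumes r: "regular \<gamma> I" and c: "c \<in> A"
 obtains D where "!!t. t \<in> I ==> \<gamma> t \<in> cdom c ==> ((cmap c \<circ> \<gamma>) has_vector_derivative D t) (at t)"
  "continuous_on {t\<in>I. \<gamma> t \<in> cdom c} D"
  "!!t. t \<in> I ==> \<gamma> t \<in> cdom c ==> speed \<gamma> t = sqrt (gin (G c) (cmap c (\<gamma> t)) (D t) (D t))"
proof -
 from r c obtain D where D: "\<forall>t\<in>{t\<in>I. \<gamma> t \<in> cdom c}. ((cmap c \<circ> \<gamma>) has_vector_derivative D t) (at t)"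
  "continuous_on {t\<in>I. \<gamma> t \<in> cdom c} D"
  unfolding regular_def C1_differentiable_on_def by blast
 show ?thesis
  by (rule that[of D]) (use D r speed_eq[OF c] in \<open>auto simp: regular_def\<close>)
qed

lemma continuous_on_gin:
 assumes c: "c \<in> A" and x: "continuous_on S x" "x ` S \<subseteq> cimg c" and a: "continuous_on S a" and b: "continuous_on S b"
 shows "continuous_on S (%t. gin (G c) (x t) (a t) (b t))"
 unfolding gin_sum
 by (intro continuous_intros continuous_on_compose2[OF Cinf_on_continuous[OF G_smooth[OF c]] x] a b)

lemma continuous_on_speed:
 assumes r: "regular \<gamma> I"
 shows "continuous_on I (speed \<gamma>)"
proof (rule continuous_at_imp_continuous_on, rule ballI)
 fix t assume t: "t \<in> I"
 obtain c where c: "c \<in> A" "\<gamma> t \<in> cdom c" using chart_ex by blast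
 let ?Z = "{t\<in>I. \<gamma> t \<in> cdom c}"
 obtain D where D: "!!t. t \<in> I ==> \<gamma> t \<in> cdom c ==> ((cmap c \<circ> \<gamma>) has_vector_derivative D t) (at t)"
  "continuous_on ?Z D"
  "!!t. t \<in> I ==> \<gamma> t \<in> cdom c ==> speed \<gamma> t = sqrt (gin (G c) (cmap c (\<gamma> t)) (D t) (D t))"
  by (rule regular_derivative[OF r c(1)], rule that, auto)
 have "continuous_on ?Z (cmap c \<circ> \<gamma>)"
  using D(1)[THEN has_vector_derivative_continuous] by (intro continuous_at_imp_continuous_on) blast
 then have "continuous_on ?Z (%t. sqrt (gin (G c) (cmap c (\<gamma> t)) (D t) (D t)))"
  using c(1) D(2) by (intro continuous_on_real_sqrt continuous_on_gin) (auto simp: o_def)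
 then have "continuous_on ?Z (speed \<gamma>)"
  by (rule continuous_on_eq) (simp add: D(3))
 then show "isCont (speed \<gamma>) t"
  using continuous_on_eq_continuous_at[OF open_regular[OF r c(1)]] t c(2) by blast
qed

lemma speed_nonneg: "regular \<gamma> I ==> t \<in> I ==> speed \<gamma> t >= 0"
proof -
 assume r: "regular \<gamma> I" and t: "t \<in> I"
 obtain c where c: "c \<in> A" "\<gamma> t \<in> cdom c" using chart_ex by blast
 obtain D where "!!t. t \<in> I ==> \<gamma> t \<in> cdom c ==> ((cmap c \<circ> \<gamma>) has_vector_derivative D t) (at t)"
  "continuous_on {t\<in>I. \<gamma> t \<in> cdom c} D"
  and D: "!!t. t \<in> I ==> \<gamma> t \<in> cdom c ==> speed \<gamma> t = sqrt (gin (G c) (cmap c (\<gamma> t)) (D t) (D t))"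
  by (rule regular_derivative[OF r c(1)], rule that, auto)
 show ?thesis
  using D[OF t c(2)] local_metric.gin_nonneg[OF local_metric_chart[OF c(1)]] c by simp
qed

lemma regular_affine:
 assumes r: "regular \<gamma> I" and J: "open J" "!!t. t \<in> J ==> m * t + k \<in> I & \<delta> t = \<gamma> (m * t + k)"
 shows "regular \<delta> J" "!!t. t \<in> J ==> speed \<delta> t = \<bar>m\<bar> * speed \<gamma> (m * t + k)"
proof -
 let ?h = "%t. m * t + k"
 have co: "continuous_on J \<delta>"
 proof (rule continuous_on_eq)
  show "continuous_on J (%t. \<gamma> (?h t))"
   by (rule continuous_on_compose2[of I \<gamma>]) (use r J in \<open>auto simp: regular_def intro!: continuous_intros\<close>)
 qed (use J in simp)
 have der: "((cmap c \<circ> \<delta>) has_vector_derivative m *\<^sub>R x') (at t)"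
  if "((cmap c \<circ> \<gamma>) has_vector_derivative x') (at (?h t))" "t \<in> J" for c :: "('a, 'n) chart" and x' t
 proof -
  have "(?h has_vector_derivative m) (at t)"
   by (auto intro!: derivative_eq_intros)
  from vector_diff_chain_at[OF this that(1)]
  have "((cmap c \<circ> \<gamma>) \<circ> ?h has_vector_derivative m *\<^sub>R x') (at t)" .
  then show ?thesis
   by (rule has_vector_derivative_transform_within_open[OF _ J(1) that(2)]) (simp add: J(2))
 qed
 show "regular \<delta> J"
  unfolding regular_def
 proof (intro conjI ballI J(1) co)
  fix c assume c: "c \<in> A"
  let ?Z = "{t\<in>I. \<gamma> t \<in> cdom c}"
  obtain D where D: "!!t. t \<in> I ==> \<gamma> t \<in> cdom c ==> ((cmap c \<circ> \<gamma>) has_vector_derivative D t) (at t)"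
   "continuous_on ?Z D"
   "!!t. t \<in> I ==> \<gamma> t \<in> cdom c ==> speed \<gamma> t = sqrt (gin (G c) (cmap c (\<gamma> t)) (D t) (D t))"
   by (rule regular_derivative[OF r c], rule that, auto)
  have "continuous_on {t \<in> J. \<delta> t \<in> cdom c} (%t. m *\<^sub>R D (?h t))"
   by (intro continuous_on_scaleR continuous_on_const continuous_on_compose2[OF D(2)] continuous_intros)
    (use J in auto)
  moreover have "((cmap c \<circ> \<delta>) has_vector_derivative m *\<^sub>R D (?h t)) (at t)" if "t \<in> J" "\<delta> t \<in> cdom c" for t
   using der[OF D(1) that(1)] that J(2) by auto
  ultimately show "(cmap c \<circ> \<delta>) C1_differentiable_on {t \<in> J. \<delta> t \<in> cdom c}"
   unfolding C1_differentiable_on_def by (intro exI[of _ "%t. m *\<^sub>R D (?h t)"] conjI ballI) auto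
 qed
 fix t assume t: "t \<in> J"
 obtain c where c: "c \<in> A" "\<delta> t \<in> cdom c" using chart_ex by blast
 obtain D where D: "!!t. t \<in> I ==> \<gamma> t \<in> cdom c ==> ((cmap c \<circ> \<gamma>) has_vector_derivative D t) (at t)"
  "continuous_on {t\<in>I. \<gamma> t \<in> cdom c} D"
  "!!t. t \<in> I ==> \<gamma> t \<in> cdom c ==> speed \<gamma> t = sqrt (gin (G c) (cmap c (\<gamma> t)) (D t) (D t))"
  by (rule regular_derivative[OF r c(1)], rule that, auto)
 have h: "?h t \<in> I" "\<gamma> (?h t) \<in> cdom c" using J(2)[OF t] c by auto
 have "speed \<delta> t = sqrt (gin (G c) (cmap c (\<delta> t)) (m *\<^sub>R D (?h t)) (m *\<^sub>R D (?h t)))"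
  by (rule speed_eq[OF c(1) der[OF D(1)[OF h] t] J(1) t co c(2)])
 also have "... = \<bar>m\<bar> * speed \<gamma> (?h t)"
  using J(2)[OF t] by (simp add: D(3)[OF h] gin_scale1 gin_scale2 real_sqrt_mult flip: mult.assoc)
 finally show "speed \<delta> t = \<bar>m\<bar> * speed \<gamma> (?h t)" .
qed

lemma piecewise_C1_path_regular:
 "piecewise_C1_path A \<gamma> \<longleftrightarrow> path \<gamma> & (\<exists>S. finite S & regular \<gamma> ({0<..<1} - S))"
proof -
 have "regular \<gamma> ({0<..<1} - S) \<longleftrightarrow>
   (\<forall>c\<in>A. (cmap c \<circ> \<gamma>) C1_differentiable_on {t. 0 < t & t < 1 & t \<notin> S & \<gamma> t \<in> cdom c})"
  if "path \<gamma>" "finite S" for S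
 proof -
  have "{t \<in> {0<..<1} - S. \<gamma> t \<in> cdom c} = {t. 0 < t & t < 1 & t \<notin> S & \<gamma> t \<in> cdom c}" for c by auto
  moreover have "open ({0<..<1} - S)" using that(2) by (simp add: finite_imp_closed open_Diff)
  moreover have "continuous_on ({0<..<1} - S) \<gamma>"
   using that(1) unfolding path_def by (rule continuous_on_subset) auto
  ultimately show ?thesis by (simp add: regular_def)
 qed
 then show ?thesis unfolding piecewise_C1_path_def by blast
qed

lemma path_length_speed:
 assumes "finite S"
 shows "path_length A g \<gamma> = (\<integral>\<^sup>+ t. ennreal (speed \<gamma> t) * indicator ({0<..<1} - S) t \<partial>lborel)"
proof -
 have "AE t in lborel. t \<notin> insert 0 (insert 1 S)"
  by (rule AE_not_in) (use assms in \<open>auto intro!: finite_imp_null_set_lborel\<close>)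
 then show ?thesis
  unfolding path_length_def speed_def
  by (intro nn_integral_cong_AE, elim eventually_mono) (auto simp: indicator_def simp del: AE_conj_iff)
qed

lemma speed_measurable:
 assumes "regular \<gamma> I"
 shows "(%t. ennreal (speed \<gamma> t) * indicator I t) \<in> borel_measurable borel"
proof -
 have "open I" using assms by (simp add: regular_def)
 then have "(%t. indicator I t *\<^sub>R speed \<gamma> t) \<in> borel_measurable borel"
  by (intro borel_measurable_continuous_on_indicator continuous_on_speed[OF assms]) auto
 moreover have "(%t. ennreal (speed \<gamma> t) * indicator I t) = (%t. ennreal (indicator I t *\<^sub>R speed \<gamma> t))"
  by (auto simp: indicator_def)
 ultimately show ?thesis by simp
qed

text \<open>Reversal needs a negative factor, so \<open>m\<close> is only assumed to be nonzero.
  Concatenation, subpaths and chart curves on an interval \<open>{a..b}\<close> all reduce to this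
  substitution.\<close>

lemma length_affine:
 assumes r: "regular \<gamma> I" and m: "m ~= 0" and J: "J = {t. m * t + k \<in> I}" "!!t. t \<in> J ==> \<delta> t = \<gamma> (m * t + k)"
 shows "(\<integral>\<^sup>+ t. ennreal (speed \<delta> t) * indicator J t \<partial>lborel) = (\<integral>\<^sup>+ t. ennreal (speed \<gamma> t) * indicator I t \<partial>lborel)"
proof -
 have oJ: "open J"
 proof -
  have "open ((%t. m * t + k) -` I)"
   using r by (intro open_vimage continuous_intros) (auto simp: regular_def)
  moreover have "(%t. m * t + k) -` I = J" using J(1) by auto
  ultimately show ?thesis by simp
 qed
 have sp: "speed \<delta> t = \<bar>m\<bar> * speed \<gamma> (m * t + k)" if "t \<in> J" for t
  by (rule regular_affine(2)[OF r oJ _ that]) (use J in auto)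
 have "(\<integral>\<^sup>+ t. ennreal (speed \<gamma> t) * indicator I t \<partial>lborel)
   = \<bar>m\<bar> * (\<integral>\<^sup>+ t. ennreal (speed \<gamma> (k + m * t)) * indicator I (k + m * t) \<partial>lborel)"
  by (rule nn_integral_real_affine[OF speed_measurable[OF r] m])
 also have "... = (\<integral>\<^sup>+ t. \<bar>m\<bar> * (ennreal (speed \<gamma> (k + m * t)) * indicator I (k + m * t)) \<partial>lborel)"
  using measurable_compose[OF _ speed_measurable[OF r], of "%t. k + m * t" lborel]
  by (subst nn_integral_cmult) auto
 also have "... = (\<integral>\<^sup>+ t. ennreal (speed \<delta> t) * indicator J t \<partial>lborel)"
 proof (rule nn_integral_cong)
  fix t
  show "\<bar>m\<bar> * (ennreal (speed \<gamma> (k + m * t)) * indicator I (k + m * t)) = ennreal (speed \<delta> t) * indicator J t"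
  proof (cases "t \<in> J")
   case True
   then have "k + m * t \<in> I" using J(1) by (simp add: add.commute)
   then show ?thesis using True sp[OF True] speed_nonneg[OF r]
    by (simp add: ennreal_mult' add.commute)
  next
   case False
   then have "k + m * t \<notin> I" using J(1) by (simp add: add.commute)
   then show ?thesis using False by simp
  qed
 qed
 finally show ?thesis by simp
qed

lemma regular_subset: "regular \<gamma> I ==> open J ==> J \<subseteq> I ==> regular \<gamma> J"
 unfolding regular_def by (blast intro: continuous_on_subset C1_differentiable_on_subset)

lemma regular_Un:
 assumes "regular \<gamma> I" "regular \<gamma> J"
 shows "regular \<gamma> (I \<union> J)"
 unfolding regular_def
proof (intro conjI ballI)
 show "open (I \<union> J)" "continuous_on (I \<union> J) \<gamma>"
  using assms by (auto simp: regular_def intro!: continuous_on_open_Un)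
 fix c assume c: "c \<in> A"
 \<comment> \<open>With the canonical \<open>vector_derivative\<close> as the derivative on both
   sets, the two pieces agree on the overlap and can be glued.\<close>
 have *: "\<forall>t\<in>{t \<in> K. \<gamma> t \<in> cdom c}. ((cmap c \<circ> \<gamma>) has_vector_derivative vector_derivative (cmap c \<circ> \<gamma>) (at t)) (at t)"
  "continuous_on {t \<in> K. \<gamma> t \<in> cdom c} (%t. vector_derivative (cmap c \<circ> \<gamma>) (at t))" if "regular \<gamma> K" for K
  using that c unfolding regular_def C1_differentiable_on_eq vector_derivative_works by blast+
 have Z: "{t \<in> I \<union> J. \<gamma> t \<in> cdom c} = {t \<in> I. \<gamma> t \<in> cdom c} \<union> {t \<in> J. \<gamma> t \<in> cdom c}" by auto
 have "continuous_on ({t \<in> I. \<gamma> t \<in> cdom c} \<union> {t \<in> J. \<gamma> t \<in> cdom c}) (%t. vector_derivative (cmap c \<circ> \<gamma>) (at t))"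
  by (rule continuous_on_open_Un[OF open_regular[OF assms(1) c] open_regular[OF assms(2) c]
     *(2)[OF assms(1)] *(2)[OF assms(2)]])
 then show "(cmap c \<circ> \<gamma>) C1_differentiable_on {t \<in> I \<union> J. \<gamma> t \<in> cdom c}"
  unfolding C1_differentiable_on_def Z
  using *(1)[OF assms(1)] *(1)[OF assms(2)]
  by (intro exI[of _ "%t. vector_derivative (cmap c \<circ> \<gamma>) (at t)"] conjI ballI) (erule UnE; simp)+
qed

lemma path_join:
 assumes "piecewise_C1_path A \<gamma>1" "piecewise_C1_path A \<gamma>2" "pathfinish \<gamma>1 = pathstart \<gamma>2"
 shows "piecewise_C1_path A (\<gamma>1 +++ \<gamma>2)"
  "path_length A g (\<gamma>1 +++ \<gamma>2) = path_length A g \<gamma>1 + path_length A g \<gamma>2"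
proof -
 obtain S1 S2 where S: "finite S1" "regular \<gamma>1 ({0<..<1} - S1)" "finite S2" "regular \<gamma>2 ({0<..<1} - S2)"
  and p: "path \<gamma>1" "path \<gamma>2"
  using assms(1,2) unfolding piecewise_C1_path_regular by blast
 define J1 where "J1 = {t. 2 * t + 0 \<in> {0<..<1} - S1}"
 define J2 where "J2 = {t. 2 * t + -1 \<in> {0<..<1} - S2}"
 let ?\<gamma> = "\<gamma>1 +++ \<gamma>2"
 have e1: "?\<gamma> t = \<gamma>1 (2 * t + 0)" if "t \<in> J1" for t using that by (auto simp: J1_def joinpaths_def)
 have e2: "?\<gamma> t = \<gamma>2 (2 * t + -1)" if "t \<in> J2" for t using that by (auto simp: J2_def joinpaths_def)
 have o: "open J1" "open J2"
 proof -
  have "open ((%t. 2 * t + 0) -` ({0<..<1} - S1))" "open ((%t. 2 * t + -1) -` ({0<..<1} - S2))"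
   using S(2,4) by (auto simp only: regular_def intro!: open_vimage continuous_intros)
  then show "open J1" "open J2" by (auto simp: J1_def J2_def vimage_def)
 qed
 have r1: "regular ?\<gamma> J1" by (rule regular_affine(1)[OF S(2) o(1), where m = 2 and k = 0]) (use e1 in \<open>auto simp: J1_def\<close>)
 have r2: "regular ?\<gamma> J2" by (rule regular_affine(1)[OF S(4) o(2), where m = 2 and k = "-1"]) (use e2 in \<open>auto simp: J2_def\<close>)
 define S where "S = {1/2} \<union> (%t. 2 * t) -` S1 \<union> (%t. 2 * t - 1) -` S2"
 have fS: "finite S" using S by (auto simp: S_def inj_on_def intro!: finite_vimageI)
 have sub: "{0<..<1} - S \<subseteq> J1 \<union> J2"
  unfolding S_def J1_def J2_def by (auto simp: field_simps)
 have "regular ?\<gamma> ({0<..<1} - S)"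
  by (rule regular_subset[OF regular_Un[OF r1 r2] _ sub]) (simp add: fS finite_imp_closed open_Diff)
 then show "piecewise_C1_path A ?\<gamma>"
  unfolding piecewise_C1_path_regular using fS path_join_imp[OF p assms(3)] by blast
 have l1: "(\<integral>\<^sup>+ t. ennreal (speed ?\<gamma> t) * indicator J1 t \<partial>lborel)
   = (\<integral>\<^sup>+ t. ennreal (speed \<gamma>1 t) * indicator ({0<..<1} - S1) t \<partial>lborel)"
  by (rule length_affine[OF S(2), where m = 2 and k = 0]) (use e1 in \<open>auto simp: J1_def\<close>)
 have l2: "(\<integral>\<^sup>+ t. ennreal (speed ?\<gamma> t) * indicator J2 t \<partial>lborel)
   = (\<integral>\<^sup>+ t. ennreal (speed \<gamma>2 t) * indicator ({0<..<1} - S2) t \<partial>lborel)"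
  by (rule length_affine[OF S(4), where m = 2 and k = "-1"]) (use e2 in \<open>auto simp: J2_def\<close>)
 have dis: "J1 \<inter> J2 = {}" by (auto simp: J1_def J2_def)
 have sub2: "J1 \<union> J2 \<subseteq> {0<..<1}" by (auto simp: J1_def J2_def)
 have "AE t in lborel. t \<notin> S"
  by (rule AE_not_in) (use fS in \<open>auto intro!: finite_imp_null_set_lborel\<close>)
 then have "path_length A g ?\<gamma> = (\<integral>\<^sup>+ t. ennreal (speed ?\<gamma> t) * indicator J1 t + ennreal (speed ?\<gamma> t) * indicator J2 t \<partial>lborel)"
  unfolding path_length_speed[OF finite.emptyI]
  by (intro nn_integral_cong_AE, elim eventually_mono)
   (use sub sub2 dis in \<open>auto simp: indicator_def\<close>)
 also have "... = (\<integral>\<^sup>+ t. ennreal (speed ?\<gamma> t) * indicator J1 t \<partial>lborel) + (\<integral>\<^sup>+ t. ennreal (speed ?\<gamma> t) * indicator J2 t \<partial>lborel)"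
  by (rule nn_integral_add) (use speed_measurable[OF r1] speed_measurable[OF r2] in auto)
 also have "... = path_length A g \<gamma>1 + path_length A g \<gamma>2"
  unfolding path_length_speed[OF S(1), of \<gamma>1] path_length_speed[OF S(3), of \<gamma>2] l1 l2 ..
 finally show "path_length A g ?\<gamma> = path_length A g \<gamma>1 + path_length A g \<gamma>2" .
qed

lemma path_reverse:
 assumes "piecewise_C1_path A \<gamma>"
 shows "piecewise_C1_path A (reversepath \<gamma>)" "path_length A g (reversepath \<gamma>) = path_length A g \<gamma>"
proof -
 obtain S where S: "finite S" "regular \<gamma> ({0<..<1} - S)" and p: "path \<gamma>"
  using assms unfolding piecewise_C1_path_regular by blast
 define S' where "S' = (%s. 1 - s) ` S"
 have "t \<in> S' \<longleftrightarrow> 1 - t \<in> S" for t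
  unfolding S'_def by (auto intro!: image_eqI[of _ _ "1 - t"])
 then have J: "{0<..<1} - S' = {t. -1 * t + 1 \<in> {0<..<1} - S}"
  by auto
 have e: "reversepath \<gamma> t = \<gamma> (-1 * t + 1)" for t by (simp add: reversepath_def)
 have fS: "finite S'" using S by (simp add: S'_def)
 have "regular (reversepath \<gamma>) ({0<..<1} - S')"
 proof (rule regular_affine(1)[OF S(2), where m = "-1" and k = 1])
  show "open ({0<..<1} - S')" using fS by (simp add: finite_imp_closed open_Diff)
 qed (use J e in auto)
 then show "piecewise_C1_path A (reversepath \<gamma>)"
  unfolding piecewise_C1_path_regular using fS p by auto
 show "path_length A g (reversepath \<gamma>) = path_length A g \<gamma>"
  unfolding path_length_speed[OF S(1), of \<gamma>] path_length_speed[OF fS, of "reversepath \<gamma>"]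
  by (rule length_affine[OF S(2), where m = "-1" and k = 1]) (use J e in auto)
qed

end

context riem_mfd
begin

text \<open>The derivative may be unbounded near the exceptional parameters. For infinite length
  there is nothing to prove; for finite length the bound by the speed makes \<open>y'\<close>
  absolutely integrable, so that the gauge integral of the fundamental theorem equals the Lebesgue
  integral.\<close>

lemma length_ge_variation:
 fixes y :: "real => real"
 assumes r: "regular \<gamma> ({0<..<1} - S)" and S: "finite S" and ab: "0 <= a" "a <= b" "b <= 1"
  and y: "continuous_on {a..b} y"
  and y': "!!t. t \<in> {a<..<b} - S ==> (y has_vector_derivative y' t) (at t)" "continuous_on ({a<..<b} - S) y'"
  and le: "!!t. t \<in> {a<..<b} - S ==> \<bar>y' t\<bar> <= speed \<gamma> t"
 shows "ennreal \<bar>y b - y a\<bar> <= path_length A g \<gamma>"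
proof -
 let ?B = "{a<..<b} - S"
 have oB: "open ?B" using S by (simp add: finite_imp_closed open_Diff)
 have meas: "(%t. indicator ?B t *\<^sub>R y' t) \<in> borel_measurable borel"
  using oB y'(2) by (intro borel_measurable_continuous_on_indicator) auto
 have le2: "(\<integral>\<^sup>+ t. ennreal \<bar>indicator ?B t *\<^sub>R y' t\<bar> \<partial>lborel) <= path_length A g \<gamma>"
  unfolding path_length_speed[OF S]
 proof (rule nn_integral_mono)
  fix t show "ennreal \<bar>indicator ?B t *\<^sub>R y' t\<bar> <= ennreal (speed \<gamma> t) * indicator ({0<..<1} - S) t"
   using le[of t] ab by (auto simp: indicator_def intro!: ennreal_leI)
 qed
 show ?thesis
 proof (cases "path_length A g \<gamma> = \<infinity>")
  case False
  then have "path_length A g \<gamma> < \<infinity>" by (simp add: less_top)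
  then have fin: "(\<integral>\<^sup>+ t. ennreal (norm (indicator ?B t *\<^sub>R y' t)) \<partial>lborel) < \<infinity>"
   using le_less_trans[OF le2] by simp
  then have int: "integrable lborel (%t. indicator ?B t *\<^sub>R y' t)"
   using meas by (intro integrableI_bounded) auto
  then have si: "set_integrable lborel ?B y'" by (simp add: set_integrable_def)
  have "(y' has_integral (y b - y a)) {a..b}"
   by (rule fundamental_theorem_of_calculus_interior_strong[OF S ab(2) y'(1) y])
  moreover have "negligible {x \<in> {a..b} - ?B. y' x ~= 0}" "negligible {x \<in> ?B - {a..b}. y' x ~= 0}"
   by (rule negligible_subset[of "insert a (insert b S)"], use S in \<open>auto simp: negligible_finite\<close>)+
  ultimately have "(y' has_integral (y b - y a)) ?B"
   using has_integral_spike_set_eq[of "{a..b}" ?B y' "y b - y a"] by blast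
  then have "y b - y a = integral ?B y'" by (rule integral_unique[symmetric])
  also have "... = (LINT t:?B|lborel. y' t)"
   by (rule set_borel_integral_eq_integral(2)[OF si, symmetric])
  finally have "\<bar>y b - y a\<bar> <= (\<integral>t. \<bar>indicator ?B t *\<^sub>R y' t\<bar> \<partial>lborel)"
   unfolding set_lebesgue_integral_def using integral_abs_bound[of lborel "%t. indicator ?B t *\<^sub>R y' t"] by simp
  then have "ennreal \<bar>y b - y a\<bar> <= ennreal (\<integral>t. \<bar>indicator ?B t *\<^sub>R y' t\<bar> \<partial>lborel)"
   by (rule ennreal_leI)
  also have "... = (\<integral>\<^sup>+ t. ennreal \<bar>indicator ?B t *\<^sub>R y' t\<bar> \<partial>lborel)"
   by (rule nn_integral_eq_integral[symmetric]) (use int in auto)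
  finally show ?thesis using le2 by (rule order_trans)
 qed simp
qed

lemma regular_chart_curve:
 assumes c: "c \<in> A" and I: "open I" "x ` I \<subseteq> cimg c"
  and x: "!!t. t \<in> I ==> (x has_vector_derivative x' t) (at t)" and x': "continuous_on I x'"
 shows "regular (%t. cinv c (x t)) I"
  "!!t. t \<in> I ==> speed (%t. cinv c (x t)) t = sqrt (gin (G c) (x t) (x' t) (x' t))"
proof -
 have cx: "continuous_on I x"
  using x[THEN has_vector_derivative_continuous] by (intro continuous_at_imp_continuous_on) blast
 have cc: "continuous_on I (%t. cinv c (x t))"
  by (rule continuous_on_compose2[OF continuous_cinv[OF c] cx I(2)])
 show "regular (%t. cinv c (x t)) I"
  unfolding regular_def
 proof (intro conjI ballI I(1) cc)
  fix d assume d: "d \<in> A"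
  let ?Z = "{t \<in> I. cinv c (x t) \<in> cdom d}" and ?O = "cmap c ` (cdom c \<inter> cdom d)"
  have xO: "x t \<in> ?O" if t: "t \<in> ?Z" for t
  proof -
   have "x t \<in> cimg c" using t I(2) by auto
   then have "x t = cmap c (cinv c (x t))" "cinv c (x t) \<in> cdom c" using c by auto
   then show ?thesis using t by blast
  qed
  have "((cmap d \<circ> (%t. cinv c (x t))) has_vector_derivative jac (trans_map c d) (x t) (x' t)) (at t)" if t: "t \<in> ?Z" for t
  proof -
   have "(trans_map c d has_derivative jac (trans_map c d) (x t)) (at (x t))"
    by (rule smap_has_derivative[OF smap_trans[OF c d] open_overlap[OF c d] xO[OF t]])
   from has_derivative_compose[OF x[unfolded has_vector_derivative_def] this] t
   show ?thesis by (simp add: has_vector_derivative_def o_def jac_scale)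
  qed
  moreover have "continuous_on ?Z (%t. jac (trans_map c d) (x t) (x' t))"
  proof -
   have sub: "?Z \<subseteq> I" by auto
   have im: "x ` ?Z \<subseteq> ?O" using xO by blast
   have "Cinf_on ?O (%u. trans_map c d u $ k)" for k
    using smap_trans[OF c d] unfolding smap_def by blast
   then have "continuous_on ?Z (%t. pd i (%u. trans_map c d u $ k) (x t))" for i k
    by (intro continuous_on_compose2[OF Cinf_on_continuous[OF Cinf_on_pd] continuous_on_subset[OF cx sub] im])
   then show ?thesis unfolding jac_def
    by (intro continuous_on_vec_lambda continuous_on_sum continuous_on_mult continuous_on_component
      continuous_on_subset[OF x' sub])
  qed
  ultimately show "(cmap d \<circ> (%t. cinv c (x t))) C1_differentiable_on ?Z"
   unfolding C1_differentiable_on_def by (intro exI[of _ "%t. jac (trans_map c d) (x t) (x' t)"] conjI ballI) auto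
 qed
 fix t assume t: "t \<in> I"
 have "((cmap c \<circ> (%t. cinv c (x t))) has_vector_derivative x' t) (at t)"
  by (rule has_vector_derivative_transform_within_open[OF x[OF t] I(1) t]) (use I(2) c in auto)
 moreover have "x t \<in> cimg c" using I(2) t by auto
 ultimately show "speed (%t. cinv c (x t)) t = sqrt (gin (G c) (x t) (x' t) (x' t))"
  using speed_eq[OF c _ I(1) t cc] c by simp
qed

lemma chart_path:
 assumes c: "c \<in> A" and ab: "a < b" and im: "x ` {a..b} \<subseteq> cimg c" and cx: "continuous_on {a..b} x"
  and x: "!!t. t \<in> {a<..<b} ==> (x has_vector_derivative x' t) (at t)" and x': "continuous_on {a..b} x'"
 shows "\<exists>\<gamma>. piecewise_C1_path A \<gamma> & pathstart \<gamma> = cinv c (x a) & pathfinish \<gamma> = cinv c (x b) &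
  path_length A g \<gamma> = ennreal (integral {a..b} (%t. sqrt (gin (G c) (x t) (x' t) (x' t))))"
proof -
 let ?f = "%t. sqrt (gin (G c) (x t) (x' t) (x' t))"
 define \<delta> where "\<delta> t = cinv c (x t)" for t
 define \<gamma> where "\<gamma> s = \<delta> ((b - a) * s + a)" for s
 have sub: "{a<..<b} \<subseteq> {a..b}" by auto
 have imo: "x ` {a<..<b} \<subseteq> cimg c" using im sub by blast
 note r = regular_chart_curve[OF c open_greaterThanLessThan imo x continuous_on_subset[OF x' sub], folded \<delta>_def]
 have sp: "speed \<delta> t = ?f t" if "t \<in> {a<..<b}" for t by (rule r(2)[OF _ that])
 have h: "(b - a) * s + a < b \<longleftrightarrow> s < 1" "(b - a) * s + a <= b \<longleftrightarrow> s <= 1" for s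
 proof -
  have "(b - a) * s + a < b \<longleftrightarrow> (b - a) * s < (b - a) * 1" "(b - a) * s + a <= b \<longleftrightarrow> (b - a) * s <= (b - a) * 1"
   by (auto simp: algebra_simps)
  then show "(b - a) * s + a < b \<longleftrightarrow> s < 1" "(b - a) * s + a <= b \<longleftrightarrow> s <= 1"
   using ab by (simp_all only: mult_less_cancel_left_pos mult_le_cancel_left_pos diff_gt_0_iff_gt)
 qed
 have J: "{0<..<1} - {} = {s. (b - a) * s + a \<in> {a<..<b}}"
  using ab h by (auto simp: zero_less_mult_iff)
 have rg: "regular \<gamma> ({0<..<1} - {})"
 proof (rule regular_affine(1)[OF r(1), where m = "b - a" and k = a])
  fix s assume "s \<in> {0<..<1::real} - {}"
  then show "(b - a) * s + a \<in> {a<..<b} & \<gamma> s = \<delta> ((b - a) * s + a)"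
   using J unfolding \<gamma>_def by blast
 next
  have "open {0<..<1::real}" by (rule open_greaterThanLessThan)
  then show "open ({0<..<1::real} - {})" unfolding Diff_empty .
 qed
 have "path \<gamma>"
  unfolding path_def \<gamma>_def \<delta>_def
 proof (rule continuous_on_compose2[OF continuous_on_compose2[OF continuous_cinv[OF c] cx im]])
  show "(%s. (b - a) * s + a) ` {0..1} \<subseteq> {a..b}"
   using ab h by auto
 qed (auto intro!: continuous_intros)
 then have "piecewise_C1_path A \<gamma>" unfolding piecewise_C1_path_regular using rg by blast
 moreover have "path_length A g \<gamma> = ennreal (integral {a..b} ?f)"
 proof -
  have "path_length A g \<gamma> = (\<integral>\<^sup>+ t. ennreal (speed \<delta> t) * indicator {a<..<b} t \<partial>lborel)"
   unfolding path_length_speed[OF finite.emptyI]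
   by (rule length_affine[OF r(1) _ J]) (use ab in \<open>auto simp: \<gamma>_def\<close>)
  also have "... = (\<integral>\<^sup>+ t. ennreal (?f t) * indicator {a<..<b} t \<partial>lborel)"
  proof (rule nn_integral_cong)
   fix t show "ennreal (speed \<delta> t) * indicator {a<..<b} t = ennreal (?f t) * indicator {a<..<b} t"
    using sp[of t] by (cases "t \<in> {a<..<b}") (auto simp del: greaterThanLessThan_iff)
  qed
  also have "... = ennreal (integral {a..b} ?f)"
  proof (rule nn_integral_has_integral_lebesgue')
   show "0 <= ?f t" if "t \<in> {a<..<b}" for t
    using that imo local_metric.gin_nonneg[OF local_metric_chart[OF c]] by (simp add: image_subset_iff)
   have "?f integrable_on {a..b}"
    by (intro integrable_continuous_interval continuous_on_real_sqrt continuous_on_gin c cx im x')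
   then have "(?f has_integral (integral {a..b} ?f)) (cbox a b)"
    unfolding box_real by (rule integrable_integral)
   then show "(?f has_integral (integral {a..b} ?f)) {a<..<b}"
    using has_integral_open_interval[of ?f _ a b] unfolding box_real by blast
  qed
  finally show ?thesis .
 qed
 moreover have "pathstart \<gamma> = cinv c (x a)" "pathfinish \<gamma> = cinv c (x b)"
  by (simp_all add: pathstart_def pathfinish_def \<gamma>_def \<delta>_def)
 ultimately show ?thesis by blast
qed

end

section \<open>The Riemannian distance\<close>

context riem_mfd
begin

definition paths :: "'a => 'a => (real => 'a) set" where
 "paths p q = {\<gamma>. piecewise_C1_path A \<gamma> & pathstart \<gamma> = p & pathfinish \<gamma> = q}"

text \<open>Kept in \<open>ennreal\<close> until \<open>ed_finite\<close> is available, because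
  \<open>enn2real\<close> sends an infinite infimum to 0.\<close>

definition ed :: "'a => 'a => ennreal" where
 "ed p q = (INF \<gamma>\<in>paths p q. path_length A g \<gamma>)"

abbreviation d :: "'a => 'a => real" where "d \<equiv> riem_dist A g"

lemma d_ed: "d p q = enn2real (ed p q)"
 by (simp add: riem_dist_def ed_def paths_def)

lemma ed_le: "\<gamma> \<in> paths p q ==> ed p q <= path_length A g \<gamma>"
 unfolding ed_def by (rule INF_lower)

lemma ed_less: "ed p q < e ==> \<exists>\<gamma>\<in>paths p q. path_length A g \<gamma> < e"
 unfolding ed_def by (simp add: INF_less_iff)

lemma ed_chart:
 assumes c: "c \<in> A" and ab: "a < b" and im: "x ` {a..b} \<subseteq> cimg c" and cx: "continuous_on {a..b} x"
  and x: "!!t. t \<in> {a<..<b} ==> (x has_vector_derivative x' t) (at t)" and x': "continuous_on {a..b} x'"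
 shows "ed (cinv c (x a)) (cinv c (x b)) <= ennreal (integral {a..b} (%t. sqrt (gin (G c) (x t) (x' t) (x' t))))"
 using chart_path[OF assms] ed_le unfolding paths_def by fastforce

lemma ed_segment:
 assumes c: "c \<in> A" and K: "convex K" "K \<subseteq> cimg c" and u: "u \<in> K" "v \<in> K"
  and M: "!!x. x \<in> K ==> sqrt (gin (G c) x (v - u) (v - u)) <= M"
 shows "ed (cinv c u) (cinv c v) <= ennreal M"
proof -
 let ?x = "%t::real. u + t *\<^sub>R (v - u)"
 have xK: "?x t \<in> K" if "t \<in> {0..1}" for t
  using convexD_alt[OF K(1) u, of t] that by (simp add: algebra_simps)
 have im: "?x ` {0..1} \<subseteq> cimg c" using xK K by blast
 have cx: "continuous_on {0..1} ?x" by (intro continuous_intros)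
 have x: "(?x has_vector_derivative (v - u)) (at t)" for t
  by (auto intro!: derivative_eq_intros)
 have "ed (cinv c (?x 0)) (cinv c (?x 1)) <= ennreal (integral {0..1} (%t. sqrt (gin (G c) (?x t) (v - u) (v - u))))"
  by (rule ed_chart[OF c _ im cx x]) (auto intro: continuous_on_const)
 also have "... <= ennreal (integral {0..1::real} (%t. M))"
  by (intro ennreal_leI integral_le integrable_continuous_interval continuous_on_real_sqrt
    continuous_on_gin c cx im continuous_on_const) (use M xK in auto)
 finally show ?thesis by simp
qed

lemma ed_refl: "ed p p = 0"
proof -
 obtain c where c: "c \<in> A" "p \<in> cdom c" using chart_ex by blast
 have "ed (cinv c (cmap c p)) (cinv c (cmap c p)) <= ennreal 0"
  by (rule ed_segment[OF c(1), of "{cmap c p}"]) (use c in \<open>auto simp: gin_zero1\<close>)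
 then show ?thesis using c by simp
qed

lemma ed_sym: "ed p q = ed q p"
proof -
 have "ed p q <= ed q p" for p q
  unfolding ed_def[of q p]
 proof (rule INF_greatest)
  fix \<gamma> assume "\<gamma> \<in> paths q p"
  then have "piecewise_C1_path A \<gamma>" "reversepath \<gamma> \<in> paths p q"
   using path_reverse(1) by (auto simp: paths_def)
  then show "ed p q <= path_length A g \<gamma>" using ed_le path_reverse(2) by metis
 qed
 then show ?thesis by (metis order_antisym)
qed

lemma ed_triangle: "ed p r <= ed p q + ed q r"
proof (rule ennreal_le_epsilon)
 fix e :: real assume fin: "ed p q + ed q r < top" and e: "0 < e"
 then have f: "ed p q < top" "ed q r < top" by auto
 have "ed p q < ed p q + ennreal (e/2)" "ed q r < ed q r + ennreal (e/2)"
  using f e by (auto simp: ennreal_add_left_cancel_less[of _ 0, simplified])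
 then obtain \<gamma>1 \<gamma>2 where \<gamma>: "\<gamma>1 \<in> paths p q" "path_length A g \<gamma>1 < ed p q + ennreal (e/2)"
  "\<gamma>2 \<in> paths q r" "path_length A g \<gamma>2 < ed q r + ennreal (e/2)"
  using ed_less by meson
 have j: "piecewise_C1_path A (\<gamma>1 +++ \<gamma>2)" "path_length A g (\<gamma>1 +++ \<gamma>2) = path_length A g \<gamma>1 + path_length A g \<gamma>2"
  using path_join[of \<gamma>1 \<gamma>2] \<gamma> by (auto simp: paths_def)
 have "ed p r <= path_length A g \<gamma>1 + path_length A g \<gamma>2"
  using ed_le[of "\<gamma>1 +++ \<gamma>2" p r] \<gamma> j by (auto simp: paths_def)
 also have "... <= (ed p q + ennreal (e/2)) + (ed q r + ennreal (e/2))"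
  using \<gamma> by (intro add_mono less_imp_le)
 also have "... = ed p q + ed q r + ennreal e"
  using e by (simp add: ac_simps flip: ennreal_plus add.assoc[of "ennreal (e/2)"])
 finally show "ed p r <= ed p q + ed q r + ennreal e" .
qed

text \<open>Calibration by a linear function: pairing with the displacement \<open>w\<close> of the
  end point, normalised in the metric frozen at \<open>u0\<close>, is 1-Lipschitz for that metric,
  so \<theta> times this function changes at most as fast as arc length.\<close>

lemma length_ge_in_chart:
 assumes c: "c \<in> A" and \<gamma>: "\<gamma> \<in> paths (cinv c u0) q" and u0: "cball u0 \<rho> \<subseteq> cimg c" "0 < \<rho>"
  and \<theta>: "0 < \<theta>" "!!u v. u \<in> cball u0 \<rho> ==> \<theta> * sqrt (gin (G c) u0 v v) <= sqrt (gin (G c) u v v)"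
  and b: "0 <= b" "b <= 1" "!!t. t \<in> {0..b} ==> \<gamma> t \<in> cinv c ` cball u0 \<rho>"
 shows "ennreal (\<theta> * sqrt (gin (G c) u0 (cmap c (\<gamma> b) - u0) (cmap c (\<gamma> b) - u0))) <= path_length A g \<gamma>"
proof -
 interpret local_metric "cimg c" "G c" by (rule local_metric_chart[OF c])
 obtain S where S: "finite S" "regular \<gamma> ({0<..<1} - S)" and p: "path \<gamma>"
  using \<gamma> unfolding paths_def piecewise_C1_path_regular by blast
 let ?x = "%t. cmap c (\<gamma> t)"
 define w where "w = ?x b - u0"
 define N where "N = sqrt (gin (G c) u0 w w)"
 have uU: "u0 \<in> cimg c" using u0 by auto
 have dom: "\<gamma> t \<in> cdom c" "?x t \<in> cball u0 \<rho>" if t: "t \<in> {0..b}" for t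
 proof -
  obtain u where u: "u \<in> cball u0 \<rho>" "\<gamma> t = cinv c u" using b(3)[OF t] by blast
  then have "u \<in> cimg c" using u0(1) by blast
  then show "\<gamma> t \<in> cdom c" "?x t \<in> cball u0 \<rho>" using u c by auto
 qed
 have x0: "?x 0 = u0" using \<gamma> c uU by (simp add: paths_def pathstart_def)
 obtain D where D: "!!t. t \<in> {0<..<1} - S ==> \<gamma> t \<in> cdom c ==> ((cmap c \<circ> \<gamma>) has_vector_derivative D t) (at t)"
  "continuous_on {t\<in>{0<..<1} - S. \<gamma> t \<in> cdom c} D"
  "!!t. t \<in> {0<..<1} - S ==> \<gamma> t \<in> cdom c ==> speed \<gamma> t = sqrt (gin (G c) (?x t) (D t) (D t))"
  by (rule regular_derivative[OF S(2) c], rule that, auto)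
 show ?thesis
 proof (cases "N = 0")
  case True
  then show ?thesis by (simp add: N_def w_def)
 next
  case False
  then have N: "N > 0" using gin_nonneg[OF uU, of w] by (simp add: N_def)
  have NN: "N * N = gin (G c) u0 w w" using gin_nonneg[OF uU, of w] by (simp add: N_def)
  let ?y = "%t. \<theta> / N * gin (G c) u0 w (?x t)" and ?y' = "%t. \<theta> / N * gin (G c) u0 w (D t)"
  have lin: "bounded_linear (%v. \<theta> / N * gin (G c) u0 w v)"
   by (intro linear_conv_bounded_linear[THEN iffD1] linearI) (simp_all add: gin_add2 gin_scale2 algebra_simps)
  have sub: "{0<..<b} - S \<subseteq> {t\<in>{0<..<1} - S. \<gamma> t \<in> cdom c}"
   using dom b by auto
  have cx: "continuous_on {0..b} ?x"
   by (rule continuous_on_compose2[OF continuous_cmap[OF c]])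
    (use p dom b in \<open>auto simp: path_def intro: continuous_on_subset\<close>)
  have "ennreal \<bar>?y b - ?y 0\<bar> <= path_length A g \<gamma>"
  proof (rule length_ge_variation[OF S(2,1) order_refl b(1,2)])
   show "continuous_on {0..b} ?y" by (rule bounded_linear.continuous_on[OF lin cx])
   show "continuous_on ({0<..<b} - S) ?y'"
    by (rule bounded_linear.continuous_on[OF lin continuous_on_subset[OF D(2) sub]])
   fix t assume t: "t \<in> {0<..<b} - S"
   then have t': "t \<in> {0<..<1} - S" "\<gamma> t \<in> cdom c" "t \<in> {0..b}" using sub b(2) by auto
   show "(?y has_vector_derivative ?y' t) (at t)"
    using bounded_linear.has_vector_derivative[OF lin D(1)[OF t'(1,2)]] by (simp add: o_def)
   have "\<bar>?y' t\<bar> <= \<theta> / N * (N * sqrt (gin (G c) u0 (D t) (D t)))"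
   proof -
    have "\<bar>?y' t\<bar> = \<theta> / N * \<bar>gin (G c) u0 w (D t)\<bar>" using \<theta>(1) N by (simp add: abs_mult)
    also have "... <= \<theta> / N * (N * sqrt (gin (G c) u0 (D t) (D t)))"
     using cauchy_gin[OF uU, of w "D t"] \<theta>(1) N unfolding N_def by (intro mult_left_mono) auto
    finally show ?thesis .
   qed
   also have "... <= speed \<gamma> t"
    using \<theta>(2)[OF dom(2)[OF t'(3)], of "D t"] N by (simp add: D(3)[OF t'(1,2)])
   finally show "\<bar>?y' t\<bar> <= speed \<gamma> t" .
  qed
  moreover have "?y b - ?y 0 = \<theta> / N * gin (G c) u0 w w"
   by (simp add: x0 w_def gin_diff2 right_diff_distrib)
  moreover have "... = \<theta> * N" using N by (simp flip: NN)
  ultimately show ?thesis using N \<theta>(1) by (simp add: N_def w_def)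
 qed
qed

text \<open>First exit time: if the curve leaves the open ball, the compact set \<open>Z\<close> of
  parameters outside it has a least element \<open>b\<close>, and at \<open>b\<close> the coordinate
  lies on the sphere. Otherwise the whole curve can be used.\<close>

lemma length_ge_exit:
 assumes c: "c \<in> A" and \<gamma>: "\<gamma> \<in> paths (cinv c u0) q" and u0: "cball u0 \<rho> \<subseteq> cimg c" "0 < \<rho>"
  and \<theta>: "0 < \<theta>" "!!u v. u \<in> cball u0 \<rho> ==> \<theta> * sqrt (gin (G c) u0 v v) <= sqrt (gin (G c) u v v)"
 shows "(\<exists>v\<in>ball u0 \<rho>. q = cinv c v & ennreal (\<theta> * sqrt (gin (G c) u0 (v - u0) (v - u0))) <= path_length A g \<gamma>) \<or>
  (\<exists>w. norm w = \<rho> & ennreal (\<theta> * sqrt (gin (G c) u0 w w)) <= path_length A g \<gamma>)"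
proof -
 let ?V = "cinv c ` ball u0 \<rho>" and ?C = "cinv c ` cball u0 \<rho>"
 have p: "path \<gamma>" and \<gamma>0: "\<gamma> 0 = cinv c u0" and \<gamma>1: "\<gamma> 1 = q"
  using \<gamma> by (auto simp: paths_def piecewise_C1_path_def pathstart_def pathfinish_def)
 have oV: "open ?V" by (rule open_cinv_image[OF c]) (use u0 ball_subset_cball in auto)
 have cC: "closed ?C"
  by (intro compact_imp_closed compact_continuous_image compact_cball continuous_on_subset[OF continuous_cinv[OF c] u0(1)])
 have VC: "?V \<subseteq> ?C" using ball_subset_cball by blast
 define Z where "Z = {0..1} \<inter> \<gamma> -` (- ?V)"
 have "closed Z"
  unfolding Z_def using continuous_closed_preimage[OF p[unfolded path_def] closed_atLeastAtMost] oV by (simp add: closed_Compl)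
 then have "compact ({0..1} \<inter> Z)" by (rule compact_Int_closed[OF compact_Icc])
 then have cZ: "compact Z" by (simp add: Z_def)
 note main = length_ge_in_chart[OF c \<gamma> u0 \<theta>]
 show ?thesis
 proof (cases "Z = {}")
  case True
  then have in_V: "\<gamma> t \<in> ?V" if "t \<in> {0..1}" for t using that by (auto simp: Z_def)
  have "q \<in> ?V" using in_V[of 1] \<gamma>1 by simp
  then obtain v where v: "v \<in> ball u0 \<rho>" "q = cinv c v" by blast
  then have "v \<in> cimg c" using u0 ball_subset_cball by blast
  then have "cmap c (\<gamma> 1) = v" using v \<gamma>1 c by simp
  moreover have "\<gamma> t \<in> ?C" if "t \<in> {0..1}" for t using in_V[OF that] VC by blast
  ultimately show ?thesis using main[of 1] v by auto
 next
  case False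
  then obtain b where b: "b \<in> Z" "!!t. t \<in> Z ==> b <= t" using compact_attains_inf[OF cZ] by blast
  have b01: "0 <= b" "b <= 1" using b by (auto simp: Z_def)
  have "\<gamma> 0 \<in> ?V" using \<gamma>0 u0 by auto
  then have b0: "0 < b" using b b01 by (cases "b = 0") (auto simp: Z_def)
  have before: "\<gamma> t \<in> ?V" if "t \<in> {0..<b}" for t
   using b(2)[of t] that b01 by (auto simp: Z_def)
  have "\<gamma> t \<in> ?C" if "t \<in> {0..b}" for t
  proof -
   have cl: "closure {0..<b} = {0..b}" using b0 by (simp add: closure_atLeastLessThan)
   have sub: "{0..b} \<subseteq> {0..1}" using b01 by simp
   have cont: "continuous_on (closure {0..<b}) \<gamma>"
    unfolding cl using continuous_on_subset[OF p[unfolded path_def] sub] .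
   have "\<gamma> ` closure {0..<b} \<subseteq> ?C"
    by (rule image_closure_subset[OF cont cC]) (use before VC in blast)
   then show ?thesis unfolding cl using that by blast
  qed
  note le = main[OF _ b01 this]
  obtain v where v: "v \<in> cball u0 \<rho>" "\<gamma> b = cinv c v"
   using \<open>!!t. t \<in> {0..b} ==> \<gamma> t \<in> ?C\<close>[of b] b01 by auto
  have "v \<in> cimg c" using v u0 by blast
  then have "cmap c (\<gamma> b) = v" using v c by simp
  moreover have "v \<notin> ball u0 \<rho>" using b(1) v by (auto simp: Z_def)
  then have "norm (v - u0) = \<rho>" using v by (auto simp: dist_norm norm_minus_commute)
  ultimately show ?thesis using le by auto
 qed
qed

lemma cball_in_chart:
 assumes c: "c \<in> A" and V: "open V" "p \<in> V" "p \<in> cdom c"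
 shows "\<exists>\<rho>>0. cball (cmap c p) \<rho> \<subseteq> cimg c & cinv c ` cball (cmap c p) \<rho> \<subseteq> V"
proof -
 have "open (cmap c ` (cdom c \<inter> V))" by (intro open_cmap_image open_Int open_cdom c V) auto
 moreover have "cmap c p \<in> cmap c ` (cdom c \<inter> V)" using V by auto
 ultimately obtain \<rho> where \<rho>: "\<rho> > 0" "cball (cmap c p) \<rho> \<subseteq> cmap c ` (cdom c \<inter> V)"
  using open_contains_cball by meson
 moreover have "cinv c ` cmap c ` (cdom c \<inter> V) \<subseteq> V" using c by auto
 moreover have "cmap c ` (cdom c \<inter> V) \<subseteq> cimg c" by auto
 ultimately show ?thesis by (meson image_mono order_trans)
qed

lemma ed_small_imp_near:
 assumes V: "open V" "p \<in> V"
 shows "\<exists>e>0. \<forall>q. ed p q < ennreal e --> q \<in> V"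
proof -
 obtain c where c: "c \<in> A" "p \<in> cdom c" using chart_ex by blast
 obtain \<rho> where \<rho>: "\<rho> > 0" "cball (cmap c p) \<rho> \<subseteq> cimg c" "cinv c ` cball (cmap c p) \<rho> \<subseteq> V"
  using cball_in_chart[OF c(1) V c(2)] by blast
 let ?u = "cmap c p"
 obtain m M where mM: "0 < m" "0 < M" "!!u v. u \<in> cball ?u \<rho> ==> m * norm v <= sqrt (gin (G c) u v v)"
   "!!u v. u \<in> cball ?u \<rho> ==> sqrt (gin (G c) u v v) <= M * norm v"
  using chart_local_metric_bounds[OF local_metric_chart[OF c(1)] compact_cball \<rho>(2)] \<rho>(1) by force
 have \<theta>: "0 < m / M" "!!u v. u \<in> cball ?u \<rho> ==> m / M * sqrt (gin (G c) ?u v v) <= sqrt (gin (G c) u v v)"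
 proof -
  show "0 < m / M" using mM by simp
  fix u v assume u: "u \<in> cball ?u \<rho>"
  have "m / M * sqrt (gin (G c) ?u v v) <= m / M * (M * norm v)"
   using mM \<rho>(1) by (intro mult_left_mono) auto
  also have "... <= sqrt (gin (G c) u v v)" using mM u by simp
  finally show "m / M * sqrt (gin (G c) ?u v v) <= sqrt (gin (G c) u v v)" .
 qed
 show ?thesis
 proof (rule exI[of _ "m / M * (m * \<rho>)"], intro conjI allI impI)
  show "0 < m / M * (m * \<rho>)" using mM \<rho> by simp
  fix q assume "ed p q < ennreal (m / M * (m * \<rho>))"
  then obtain \<gamma> where \<gamma>: "\<gamma> \<in> paths (cinv c ?u) q" "path_length A g \<gamma> < ennreal (m / M * (m * \<rho>))"
   using ed_less c by force
  from length_ge_exit[OF c(1) \<gamma>(1) \<rho>(2,1) \<theta>] show "q \<in> V"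
  proof
   assume "\<exists>w. norm w = \<rho> & ennreal (m / M * sqrt (gin (G c) ?u w w)) <= path_length A g \<gamma>"
   then obtain w where w: "norm w = \<rho>" "ennreal (m / M * sqrt (gin (G c) ?u w w)) <= path_length A g \<gamma>" by blast
   have "m / M * (m * \<rho>) <= m / M * sqrt (gin (G c) ?u w w)"
    using mM(3)[of ?u w] w(1) \<rho>(1) \<theta>(1) by (intro mult_left_mono) auto
   then have "ennreal (m / M * (m * \<rho>)) <= path_length A g \<gamma>"
    using w(2) by (meson ennreal_leI order_trans)
   then show ?thesis using \<gamma>(2) by (simp add: not_less[symmetric])
  next
   assume "\<exists>v\<in>ball ?u \<rho>. q = cinv c v & ennreal (m / M * sqrt (gin (G c) ?u (v - ?u) (v - ?u))) <= path_length A g \<gamma>"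
   then obtain v where "v \<in> ball ?u \<rho>" "q = cinv c v" by blast
   then show ?thesis using \<rho>(3) ball_subset_cball by blast
  qed
 qed
qed

lemma near_imp_ed_small:
 assumes e: "0 < e"
 shows "\<exists>V. open V & p \<in> V & (\<forall>q\<in>V. ed p q < ennreal e)"
proof -
 obtain c where c: "c \<in> A" "p \<in> cdom c" using chart_ex by blast
 obtain \<rho> where \<rho>: "\<rho> > 0" "cball (cmap c p) \<rho> \<subseteq> cimg c"
  using cball_in_chart[OF c(1) open_UNIV _ c(2)] by blast
 let ?u = "cmap c p"
 obtain m M :: real where "0 < m" and mM: "0 < M" 
   "!!u v. u \<in> cball ?u \<rho> ==> m * norm v <= sqrt (gin (G c) u v v)"
   "!!u v. u \<in> cball ?u \<rho> ==> sqrt (gin (G c) u v v) <= M * norm v"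
  using chart_local_metric_bounds[OF local_metric_chart[OF c(1)] compact_cball \<rho>(2)] \<rho>(1) by force
 define r where "r = min \<rho> (e / (2 * M))"
 have r: "0 < r" "r <= \<rho>" "M * r < e" using \<rho> e mM by (auto simp: r_def min_def field_simps)
 have bsub: "ball ?u r \<subseteq> cball ?u \<rho>" using r by auto
 show ?thesis
 proof (intro exI conjI ballI)
  show "open (cinv c ` ball ?u r)" by (rule open_cinv_image[OF c(1)]) (use bsub \<rho> in auto)
  show "p \<in> cinv c ` ball ?u r" using r c by (intro image_eqI[of _ _ ?u]) auto
  fix q assume "q \<in> cinv c ` ball ?u r"
  then obtain v where v: "v \<in> ball ?u r" "q = cinv c v" by blast
  have "ed (cinv c ?u) (cinv c v) <= ennreal (M * r)"
  proof (rule ed_segment[OF c(1) convex_cball \<rho>(2)])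
   show "?u \<in> cball ?u \<rho>" "v \<in> cball ?u \<rho>" using v bsub \<rho>(1) by auto
   fix x assume "x \<in> cball ?u \<rho>"
   then have "sqrt (gin (G c) x (v - ?u) (v - ?u)) <= M * norm (v - ?u)" by (rule mM(3))
   also have "... <= M * r" using v mM by (intro mult_left_mono) (auto simp: dist_norm norm_minus_commute)
   finally show "sqrt (gin (G c) x (v - ?u) (v - ?u)) <= M * r" .
  qed
  also have "ennreal (M * r) < ennreal e" using r mM by (intro ennreal_lessI e) auto
  finally show "ed p q < ennreal e" using v c by simp
 qed
qed

text \<open>The points at finite distance from \<open>p\<close> form an open set with open
  complement, and the manifold is connected.\<close>

lemma ed_finite: "ed p q < \<infinity>"
proof -
 let ?F = "{q. ed p q < \<infinity>}"
 have nb: "\<exists>V. open V & q \<in> V & (\<forall>r\<in>V. ed q r < \<infinity>)" for q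
  using near_imp_ed_small[of 1 q] by (metis ennreal_less_top infinity_ennreal_def order_less_trans zero_less_one)
 have fin: "ed p r < \<infinity>" if "ed p q < \<infinity>" "ed q r < \<infinity>" for q r
  using ed_triangle[of p r q] that by (metis ennreal_add_less_top infinity_ennreal_def le_less_trans)
 have "open ?F"
 proof (subst open_subopen, intro ballI)
  fix q assume q: "q \<in> ?F"
  obtain V where V: "open V" "q \<in> V" "\<forall>r\<in>V. ed q r < \<infinity>" using nb by blast
  then have "V \<subseteq> ?F" using fin[of q] q by auto
  then show "\<exists>T. open T & q \<in> T & T \<subseteq> ?F" using V by blast
 qed
 moreover have "open (- ?F)"
 proof (subst open_subopen, intro ballI)
  fix q assume q: "q \<in> - ?F"
  obtain V where V: "open V" "q \<in> V" "\<forall>r\<in>V. ed q r < \<infinity>" using nb by blast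
  then have "V \<subseteq> - ?F" using fin[of _ q] q ed_sym[of q] by auto
  then show "\<exists>T. open T & q \<in> T & T \<subseteq> - ?F" using V by blast
 qed
 moreover have "T = {} \<or> T = UNIV" if "open T" "open (- T)" for T :: "'a set"
  using connected_clopen[THEN iffD1, OF connected_mfd] that by (simp add: closed_def)
 ultimately have "?F = {} \<or> ?F = UNIV" by blast
 moreover have "p \<in> ?F" by (simp add: ed_refl)
 ultimately show ?thesis by blast
qed

lemma ed_d: "ed p q = ennreal (d p q)"
 using ed_finite[of p q] by (simp add: d_ed)

end

section \<open>The Riemannian distance as a metric that induces the topology\<close>

context riem_mfd
begin

lemma metric_space_d: "Metric_space UNIV d"
proof
 show "0 <= d x y" for x y by (simp add: d_ed)
 show "d x y = d y x" for x y by (simp add: d_ed ed_sym[of x y])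
 show "d x z <= d x y + d y z" for x y z
 proof -
  have n: "0 <= d x y" "0 <= d y z" by (simp_all add: d_ed)
  have "ennreal (d x z) <= ennreal (d x y + d y z)"
   using ed_triangle[of x z y] n unfolding ed_d by simp
  then show ?thesis using n by (subst (asm) ennreal_le_iff) auto
 qed
 show "d x y = 0 \<longleftrightarrow> x = y" for x y
 proof
  assume "d x y = 0"
  then have "ed x y = 0" by (simp add: ed_d)
  show "x = y"
  proof (rule ccontr)
   assume "x ~= y"
   then obtain V where V: "open V" "x \<in> V" "y \<notin> V" using t1_space by blast
   then show False using ed_small_imp_near[OF V(1,2)] \<open>ed x y = 0\<close> by auto
  qed
 qed (simp add: d_ed ed_refl)
qed

end

sublocale riem_mfd \<subseteq> MS: Metric_space UNIV "riem_dist A g"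
 by (rule metric_space_d)

context riem_mfd
begin

lemma ed_less_iff: "ed p q < ennreal e \<longleftrightarrow> d p q < e"
 by (simp add: ed_d ennreal_less_iff)

lemma d_near: "open V ==> p \<in> V ==> \<exists>e>0. \<forall>q. d p q < e --> q \<in> V"
 using ed_small_imp_near by (simp add: ed_less_iff)

lemma d_small: "0 < e ==> \<exists>V. open V & p \<in> V & (\<forall>q\<in>V. d p q < e)"
 using near_imp_ed_small by (simp add: ed_less_iff)

lemma openin_mtop: "openin MS.mtopology U \<longleftrightarrow> open U"
proof -
 have "(\<exists>r>0. MS.mball x r \<subseteq> U) \<longleftrightarrow> (\<exists>V. open V & x \<in> V & V \<subseteq> U)" for x
 proof
  assume "\<exists>r>0. MS.mball x r \<subseteq> U"
  then obtain r where r: "r > 0" "!!y. d x y < r ==> y \<in> U" by (auto simp: MS.mball_def)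
  then show "\<exists>V. open V & x \<in> V & V \<subseteq> U" using d_small[OF r(1), of x] by blast
 next
  assume "\<exists>V. open V & x \<in> V & V \<subseteq> U"
  then obtain V where "open V" "x \<in> V" "V \<subseteq> U" by blast
  then show "\<exists>r>0. MS.mball x r \<subseteq> U" using d_near[of V x] by (auto simp: MS.mball_def)
 qed
 then show ?thesis unfolding MS.openin_mtopology open_subopen[of U] by auto
qed

lemma mtop_euclidean: "MS.mtopology = euclidean"
 by (simp add: topology_eq openin_mtop)

lemma compactin_mtop: "compactin MS.mtopology S \<longleftrightarrow> compact S"
 by (simp add: mtop_euclidean)

lemma continuous_on_d: "continuous_on S (d p)"
proof (rule continuous_at_imp_continuous_on, rule ballI)
 fix x
 show "isCont (d p) x"
  unfolding continuous_at
 proof (rule tendstoI)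
  fix e :: real assume "e > 0"
  then obtain V where V: "open V" "x \<in> V" "\<forall>q\<in>V. d x q < e" using d_small by blast
  show "\<forall>\<^sub>F y in at x. dist (d p y) (d p x) < e"
   unfolding eventually_at_topological
  proof (intro exI conjI ballI impI)
   show "open V" "x \<in> V" by fact+
   fix y assume "y \<in> V"
   then have "d x y < e" using V by blast
   then show "dist (d p y) (d p x) < e"
    using MS.triangle[of p x y] MS.triangle[of p y x] MS.commute[of x y] by (simp add: dist_real_def)
  qed
 qed
qed

lemma ed_subpath:
 assumes r: "regular \<gamma> ({0<..<1} - S)" and S: "finite S" and p: "path \<gamma>" and ab: "0 <= a" "a < b" "b <= 1"
 shows "ed (\<gamma> a) (\<gamma> b) <= (\<integral>\<^sup>+ t. ennreal (speed \<gamma> t) * indicator ({a<..<b} - S) t \<partial>lborel)"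
proof -
 define \<delta> where "\<delta> s = \<gamma> ((b - a) * s + a)" for s
 define S' where "S' = (%s. (b - a) * s + a) -` S"
 have fS: "finite S'" unfolding S'_def using ab S by (intro finite_vimageI) (auto simp: inj_on_def)
 have h: "(b - a) * s + a < b \<longleftrightarrow> s < 1" "(b - a) * s + a <= b \<longleftrightarrow> s <= 1" for s
 proof -
  have "(b - a) * s + a < b \<longleftrightarrow> (b - a) * s < (b - a) * 1" "(b - a) * s + a <= b \<longleftrightarrow> (b - a) * s <= (b - a) * 1"
   by (auto simp: algebra_simps)
  then show "(b - a) * s + a < b \<longleftrightarrow> s < 1" "(b - a) * s + a <= b \<longleftrightarrow> s <= 1"
   using ab by (simp_all only: mult_less_cancel_left_pos mult_le_cancel_left_pos diff_gt_0_iff_gt)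
 qed
 have J: "{0<..<1} - S' = {s. (b - a) * s + a \<in> {a<..<b} - S}"
  using ab h by (auto simp: zero_less_mult_iff S'_def)
 have rI: "regular \<gamma> ({a<..<b} - S)"
  by (rule regular_subset[OF r]) (use ab S in \<open>auto simp: finite_imp_closed open_Diff\<close>)
 have rd: "regular \<delta> ({0<..<1} - S')"
 proof (rule regular_affine(1)[OF rI, where m = "b - a" and k = a])
  fix s assume "s \<in> {0<..<1} - S'"
  then show "(b - a) * s + a \<in> {a<..<b} - S & \<delta> s = \<gamma> ((b - a) * s + a)"
   using J unfolding \<delta>_def by blast
 next
  show "open ({0<..<1} - S')" using fS by (simp add: finite_imp_closed open_Diff)
 qed
 have "path \<delta>"
  unfolding path_def \<delta>_def
 proof (rule continuous_on_compose2[OF p[unfolded path_def]])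
  show "(%s. (b - a) * s + a) ` {0..1} \<subseteq> {0..1}"
  proof (rule image_subsetI)
   fix s :: real assume s: "s \<in> {0..1}"
   have "(b - a) * s + a <= b" using h(2)[of s] s by simp
   moreover have "0 <= (b - a) * s" using s ab by simp
   ultimately show "(b - a) * s + a \<in> {0..1}" using ab by simp
  qed
 qed (auto intro!: continuous_intros)
 then have "\<delta> \<in> paths (\<gamma> a) (\<gamma> b)"
  unfolding paths_def piecewise_C1_path_regular using rd fS
  by (auto simp: pathstart_def pathfinish_def \<delta>_def)
 then have "ed (\<gamma> a) (\<gamma> b) <= path_length A g \<delta>" by (rule ed_le)
 also have "... = (\<integral>\<^sup>+ t. ennreal (speed \<gamma> t) * indicator ({a<..<b} - S) t \<partial>lborel)"
  unfolding path_length_speed[OF fS]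
  by (rule length_affine[OF rI _ J]) (use ab in \<open>auto simp: \<delta>_def\<close>)
 finally show ?thesis .
qed

text \<open>An almost minimizing curve passes through distance \<open>s\<close> by the intermediate
  value theorem; by additivity of length, its remaining part is not much longer than it has to
  be.\<close>

lemma almost_between:
 assumes s: "0 <= s" "s <= d p q" and e: "0 < e"
 shows "\<exists>z. d p z = s & d z q <= d p q - s + e"
proof -
 have "ed p q < ennreal (d p q + e)" unfolding ed_less_iff using e by simp
 then obtain \<gamma> where \<gamma>: "\<gamma> \<in> paths p q" "path_length A g \<gamma> < ennreal (d p q + e)" using ed_less by blast
 obtain S where S: "finite S" "regular \<gamma> ({0<..<1} - S)" and pa: "path \<gamma>" and \<gamma>01: "\<gamma> 0 = p" "\<gamma> 1 = q"
  using \<gamma>(1) unfolding paths_def piecewise_C1_path_regular pathstart_def pathfinish_def by blast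
 have cd: "continuous_on {0..1} (%t. d p (\<gamma> t))"
  by (rule continuous_on_compose2[OF continuous_on_d pa[unfolded path_def]]) auto
 have "\<exists>t\<ge>0. t <= 1 & d p (\<gamma> t) = s"
  by (rule IVT'[OF _ _ _ cd]) (use s \<gamma>01 in auto)
 then obtain t where t: "0 <= t" "t <= 1" "d p (\<gamma> t) = s" by blast
 consider "t = 0" | "t = 1" | "0 < t" "t < 1" using t by linarith
 then have "d (\<gamma> t) q <= d p q - s + e"
 proof cases
  case 3
  let ?I = "%a b. (\<integral>\<^sup>+ t. ennreal (speed \<gamma> t) * indicator ({a<..<b} - S) t \<partial>lborel)"
  have meas: "(%t. ennreal (speed \<gamma> t) * indicator ({a<..<b} - S) t) \<in> borel_measurable lborel" if "0 <= a" "b <= 1" for a b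
  proof -
   have "regular \<gamma> ({a<..<b} - S)"
   proof (rule regular_subset[OF S(2)])
    show "open ({a<..<b} - S)" using S(1) by (simp add: finite_imp_closed open_Diff)
    show "{a<..<b} - S \<subseteq> {0<..<1} - S" using that by auto
   qed
   then show ?thesis using speed_measurable by simp
  qed
  have "ed p (\<gamma> t) + ed (\<gamma> t) q <= ?I 0 t + ?I t 1"
   using ed_subpath[OF S(2,1) pa, of 0 t] ed_subpath[OF S(2,1) pa, of t 1] 3 \<gamma>01 by (intro add_mono) auto
  also have "... = (\<integral>\<^sup>+ x. ennreal (speed \<gamma> x) * indicator ({0<..<t} - S) x + ennreal (speed \<gamma> x) * indicator ({t<..<1} - S) x \<partial>lborel)"
   by (rule nn_integral_add[symmetric]) (use meas 3 in auto)
  also have "... <= path_length A g \<gamma>"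
   unfolding path_length_speed[OF S(1)]
   by (rule nn_integral_mono) (use 3 in \<open>auto simp: indicator_def\<close>)
  also have "... < ennreal (d p q + e)" by (rule \<gamma>(2))
  finally have "ennreal (s + d (\<gamma> t) q) < ennreal (d p q + e)"
   using t s by (simp add: ed_d)
  then show ?thesis using s by (subst (asm) ennreal_less_iff) auto
 qed (use t e \<gamma>01 s in auto)
 then show ?thesis using t by blast
qed

lemma locally_compact_nbhd: "\<exists>V K. open V & (p :: 'a) \<in> V & V \<subseteq> K & compact K"
proof -
 obtain c where c: "c \<in> A" "p \<in> cdom c" using chart_ex by blast
 obtain \<rho> where \<rho>: "\<rho> > 0" "cball (cmap c p) \<rho> \<subseteq> cimg c"
  using cball_in_chart[OF c(1) open_UNIV _ c(2)] by blast
 have "open (cinv c ` ball (cmap c p) \<rho>)"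
  by (rule open_cinv_image[OF c(1)]) (use \<rho> ball_subset_cball in blast)+
 moreover have "compact (cinv c ` cball (cmap c p) \<rho>)"
  by (intro compact_continuous_image compact_cball continuous_on_subset[OF continuous_cinv[OF c(1)] \<rho>(2)])
 moreover have "p \<in> cinv c ` ball (cmap c p) \<rho>"
  using c \<rho> by (intro image_eqI[of _ _ "cmap c p"]) auto
 moreover have "cinv c ` ball (cmap c p) \<rho> \<subseteq> cinv c ` cball (cmap c p) \<rho>"
  using ball_subset_cball by blast
 ultimately show ?thesis by blast
qed

lemma closed_d_ball: "closed {q. d p q <= r}"
 using closed_Collect_le[OF continuous_on_d continuous_on_const] by simp

end

section \<open>The Hopf-Rinow theorem\<close>

locale complete_riem = riem_mfd +
 assumes complete: "riem_complete A g"
begin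

text \<open>The argument for length spaces. Let \<rho> be the supremum of the radii of compact balls
  about \<open>p\<close>. By \<open>almost_between\<close> the ball of radius \<rho> lies close to
  slightly smaller compact balls, so it is totally bounded, and by completeness it is compact.
  Finitely many compact neighbourhoods of its points then cover a larger ball.\<close>

theorem Hopf_Rinow: "compact {q. d p q <= r}"
proof (rule ccontr)
 assume nc: "\<not> compact {q. d p q <= r}"
 define T where "T = {s. 0 <= s & compact {q. d p q <= s}}"
 have down: "compact {q. d p q <= s'}" if "s \<in> T" "s' <= s" for s s'
 proof -
  have "{q. d p q <= s'} = {q. d p q <= s} \<inter> {q. d p q <= s'}" using that by auto
  then show ?thesis using compact_Int_closed[OF _ closed_d_ball, of "{q. d p q <= s}" p s'] that by (simp add: T_def)
 qed
 have bound: "s <= r" if "s \<in> T" for s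
  using down[OF that, of r] nc by force
 have "d p q <= 0 \<longleftrightarrow> p = q" for q
  using MS.zero[of p q] MS.nonneg[of p q] by (simp add: order_antisym_conv[OF MS.nonneg])
 then have "{q. d p q <= 0} = {p}" by auto
 then have T0: "0 \<in> T" by (simp add: T_def)
 have bdd: "bdd_above T" using bound by (auto simp: bdd_above_def)
 define \<rho> where "\<rho> = Sup T"
 have \<rho>0: "0 <= \<rho>" using cSup_upper[OF T0 bdd] by (simp add: \<rho>_def)
 let ?B = "{q. d p q <= \<rho>}"
 have tb: "MS.mtotally_bounded ?B"
  unfolding MS.mtotally_bounded_def
 proof (intro allI impI)
  fix e :: real assume e: "0 < e"
  define s where "s = max 0 (\<rho> - e/3)"
  have s: "0 <= s" "s <= \<rho>" "\<rho> - s <= e/3" using \<rho>0 e by (auto simp: s_def max_def)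
  have "compact {q. d p q <= s}"
  proof (cases "\<rho> - e/3 <= 0")
   case True
   then show ?thesis using down[OF T0, of s] by (simp add: s_def)
  next
   case False
   have "\<rho> - e/3 < Sup T" using e by (simp add: \<rho>_def)
   then obtain t where "t \<in> T" "\<rho> - e/3 < t" using less_cSup_iff[of T "\<rho> - e/3"] T0 bdd by blast
   then show ?thesis using down[of t s] False by (simp add: s_def)
  qed
  then have "MS.mtotally_bounded {q. d p q <= s}"
   using MS.compactin_imp_mtotally_bounded compactin_mtop by blast
  then obtain K where K: "finite K" "K \<subseteq> {q. d p q <= s}" "{q. d p q <= s} \<subseteq> (\<Union>x\<in>K. MS.mball x (e/3))"
   unfolding MS.mtotally_bounded_def using e by (meson divide_pos_pos zero_less_numeral)
  show "\<exists>K. finite K & K \<subseteq> ?B & ?B \<subseteq> (\<Union>x\<in>K. MS.mball x e)"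
  proof (intro exI conjI)
   show "finite K" by fact
   show "K \<subseteq> ?B" using K(2) s(2) by auto
   show "?B \<subseteq> (\<Union>x\<in>K. MS.mball x e)"
   proof
    fix q assume q: "q \<in> ?B"
    have "\<exists>z. d p z <= s & d z q < 2 * e / 3"
    proof (cases "d p q <= s")
     case True then show ?thesis using e by (intro exI[of _ q]) auto
    next
     case False
     then obtain z where "d p z = s" "d z q <= d p q - s + e/4"
      using almost_between[of s p q "e/4"] s e by auto
     then show ?thesis using q s e by (intro exI[of _ z]) auto
    qed
    then obtain z where z: "d p z <= s" "d z q < 2 * e / 3" by blast
    then obtain x where x: "x \<in> K" "d x z < e/3" using K(3) by (auto simp: MS.mball_def)
    then have "d x q < e" using z MS.triangle[of x z q] by simp
    then show "q \<in> (\<Union>x\<in>K. MS.mball x e)" using x by (auto simp: MS.mball_def)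
   qed
  qed
 qed
 have "MS.mcomplete" using complete by (simp add: riem_complete_def)
 then have "compactin MS.mtopology (MS.mtopology closure_of ?B)"
  using tb MS.mtotally_bounded_eq_compact_closure_of by blast
 then have cB: "compact ?B"
  using closed_d_ball[of p \<rho>] by (simp add: compactin_mtop mtop_euclidean)
 have "\<exists>V K e. e > 0 & open V & x \<in> V & compact K & (\<forall>y. d x y < 2 * e --> y \<in> K) & (\<forall>y\<in>V. d x y < e)" for x
 proof -
  obtain V K where VK: "open V" "x \<in> V" "V \<subseteq> K" "compact K" using locally_compact_nbhd by blast
  obtain e where e: "e > 0" "\<forall>q. d x q < e --> q \<in> V" using d_near[OF VK(1,2)] by blast
  obtain W where "open W" "x \<in> W" "\<forall>y\<in>W. d x y < e/2" using d_small[of "e/2" x] e by auto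
  then show ?thesis using VK e by (intro exI[of _ W] exI[of _ K] exI[of _ "e/2"]) auto
 qed
 then obtain V K e where V: "!!x. e x > (0::real)" "!!x. open (V x)" "!!x. x \<in> V x" "!!x. compact (K x)"
  "!!x y. d x y < 2 * e x ==> y \<in> K x" "!!x y. y \<in> V x ==> d x y < e x" by metis
 have "?B \<subseteq> (\<Union>x\<in>?B. V x)" using V(3) by blast
 then obtain F where F: "F \<subseteq> ?B" "finite F" "?B \<subseteq> (\<Union>x\<in>F. V x)"
  using compactE_image[OF cB, of ?B V] V(2) by metis
 have "p \<in> ?B" using \<rho>0 by simp
 then have pF: "F ~= {}" using F(3) by blast
 define \<delta> where "\<delta> = Min (e ` F) / 2"
 have \<delta>: "\<delta> > 0" "!!x. x \<in> F ==> 2 * \<delta> <= e x" using F(2) pF V(1) by (auto simp: \<delta>_def)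
 have "{q. d p q <= \<rho> + \<delta>} \<subseteq> (\<Union>x\<in>F. K x)"
 proof
  fix q assume "q \<in> {q. d p q <= \<rho> + \<delta>}"
  then have q: "d p q <= \<rho> + \<delta>" by simp
  have "\<exists>z. d p z <= \<rho> & d z q < 2 * \<delta>"
  proof (cases "d p q <= \<rho>")
   case True then show ?thesis using \<delta> by (intro exI[of _ q]) auto
  next
   case False
   then obtain z where "d p z = \<rho>" "d z q <= d p q - \<rho> + \<delta>/2"
    using almost_between[of \<rho> p q "\<delta>/2"] \<rho>0 \<delta> by auto
   then show ?thesis using q \<delta> by (intro exI[of _ z]) auto
  qed
  then obtain z where z: "d p z <= \<rho>" "d z q < 2 * \<delta>" by blast
  then obtain x where x: "x \<in> F" "d x z < e x" using F(3) V(6) by blast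
  then have "d x q < 2 * e x" using z \<delta>(2)[OF x(1)] MS.triangle[of x z q] by simp
  then show "q \<in> (\<Union>x\<in>F. K x)" using V(5) x by blast
 qed
 moreover have "compact (\<Union>x\<in>F. K x)" using F(2) V(4) by blast
 ultimately have "compact {q. d p q <= \<rho> + \<delta>}"
  using compact_Int_closed[OF _ closed_d_ball, of "\<Union>x\<in>F. K x" p "\<rho> + \<delta>"] by (simp add: Int_absorb1)
 then have "\<rho> + \<delta> \<in> T" using \<rho>0 \<delta> by (simp add: T_def)
 then show False using cSup_upper[OF _ bdd] \<delta> unfolding \<rho>_def by fastforce
qed

end

section \<open>Minimizing geodesics\<close>

context complete_riem
begin

lemma between:
 assumes s: "0 <= s" "s <= d x y"
 shows "\<exists>z. d x z = s & d z y = d x y - s"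
proof -
 let ?K = "{z. d x z <= s} \<inter> {z. s <= d x z}"
 have "compact ?K"
  by (rule compact_Int_closed[OF Hopf_Rinow]) (intro closed_Collect_le continuous_on_d continuous_on_const)
 moreover have "?K ~= {}" using almost_between[OF s, of 1] by force
 ultimately have "\<exists>z\<in>?K. \<forall>w\<in>?K. d y z <= d y w"
  by (rule continuous_attains_inf) (rule continuous_on_d)
 then obtain z where z: "z \<in> ?K" "!!w. w \<in> ?K ==> d y z <= d y w" by metis
 have "d z y <= d x y - s + e" if e: "e > 0" for e
 proof -
  obtain w where w: "d x w = s" "d w y <= d x y - s + e" using almost_between[OF s e] by blast
  then show ?thesis using z(2)[of w] by (simp add: MS.commute)
 qed
 then have "d z y <= d x y - s" by (rule field_le_epsilon)
 moreover have "d x z = s" using z(1) by auto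
 ultimately show ?thesis using MS.triangle[of x z y] by (intro exI[of _ z]) auto
qed

definition mid :: "'a => 'a => 'a" where
 "mid x y = (SOME z. d x z = d x y / 2 & d z y = d x y / 2)"

lemma mid: "d x (mid x y) = d x y / 2" "d (mid x y) y = d x y / 2"
proof -
 have "\<exists>z. d x z = d x y / 2 & d z y = d x y / 2"
  using between[of "d x y / 2" x y] by simp
 from someI_ex[OF this] show "d x (mid x y) = d x y / 2" "d (mid x y) y = d x y / 2"
  by (simp_all add: mid_def)
qed

text \<open>Intended as the point at parameter k / 2^n of a geodesic. Since \<open>mid\<close> is a
  fixed choice, each level contains the previous one.\<close>

fun dyad :: "'a => 'a => nat => nat => 'a" where
 "dyad p q 0 k = (if k = 0 then p else q)"
| "dyad p q (Suc n) k = (if even k then dyad p q n (k div 2)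
   else mid (dyad p q n (k div 2)) (dyad p q n (k div 2 + 1)))"

lemma dyad_step: "k < 2 ^ n ==> d (dyad p q n k) (dyad p q n (k + 1)) = d p q / 2 ^ n"
proof (induction n arbitrary: k)
 case (Suc n)
 have k: "k div 2 < 2 ^ n" using Suc.prems by auto
 show ?case
 proof (cases "even k")
  case True
  then have "odd (k + 1)" "(k + 1) div 2 = k div 2" by auto
  then show ?thesis using True Suc.IH[OF k] by (simp add: mid)
 next
  case False
  then have "even (k + 1)" "(k + 1) div 2 = k div 2 + 1" by auto
  then show ?thesis using False Suc.IH[OF k] by (simp add: mid)
 qed
qed auto

lemma dyad_ends: "dyad p q n 0 = p" "dyad p q n (2 ^ n) = q"
 by (induction n) auto

lemma dyad_le: "j <= k ==> k <= 2 ^ n ==> d (dyad p q n j) (dyad p q n k) <= real (k - j) * d p q / 2 ^ n"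
proof (induction k)
 case (Suc k)
 show ?case
 proof (cases "j = Suc k")
  case False
  then have jk: "j <= k" using Suc.prems by simp
  then have "d (dyad p q n j) (dyad p q n (Suc k)) <= real (k - j) * d p q / 2 ^ n + d p q / 2 ^ n"
   using Suc.IH MS.triangle[of "dyad p q n j" "dyad p q n k" "dyad p q n (Suc k)"] dyad_step[of k n p q] Suc.prems
   by auto
  also have "... = real (Suc k - j) * d p q / 2 ^ n"
   using jk by (simp add: Suc_diff_le field_simps)
  finally show ?thesis .
 qed auto
qed auto

text \<open>The upper bounds of \<open>dyad_le\<close> for the three arcs from \<open>p\<close> to
  \<open>q\<close> add up to d p q, so the triangle inequality forces equality in each of
  them.\<close>

lemma dyad_dist: "j <= k ==> k <= 2 ^ n ==> d (dyad p q n j) (dyad p q n k) = real (k - j) * d p q / 2 ^ n"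
proof -
 assume jk: "j <= k" "k <= 2 ^ n"
 have "d p q <= d p (dyad p q n j) + d (dyad p q n j) (dyad p q n k) + d (dyad p q n k) q"
  using MS.triangle[of p "dyad p q n j" q] MS.triangle[of "dyad p q n j" "dyad p q n k" q] by simp
 moreover have "d p (dyad p q n j) <= real j * d p q / 2 ^ n"
  using dyad_le[of 0 j n p q] jk by (simp add: dyad_ends)
 moreover have "d (dyad p q n k) q <= real (2 ^ n - k) * d p q / 2 ^ n"
  using dyad_le[of k "2 ^ n" n p q] jk by (simp add: dyad_ends)
 moreover have "real j * d p q / 2 ^ n + real (k - j) * d p q / 2 ^ n + real (2 ^ n - k) * d p q / 2 ^ n = d p q"
  using jk by (simp add: of_nat_diff field_simps)
 ultimately show ?thesis using dyad_le[OF jk, of p q] by linarith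
qed

lemma dyad_refine: "dyad p q (n + m) (2 ^ m * k) = dyad p q n k"
 by (induction m) (auto simp: mult.assoc)

lemma dyad_dist_real:
 assumes "j <= 2 ^ n" "k <= 2 ^ m"
 shows "d (dyad p q n j) (dyad p q m k) = d p q * \<bar>real j / 2 ^ n - real k / 2 ^ m\<bar>"
proof -
 have *: "d (dyad p q n j) (dyad p q n k) = d p q * \<bar>real j / 2 ^ n - real k / 2 ^ n\<bar>"
  if "j <= 2 ^ n" "k <= 2 ^ n" for j k n
 proof (cases "j <= k")
  case True
  then show ?thesis using dyad_dist[OF True that(2), of p q]
   by (simp add: of_nat_diff field_simps flip: diff_divide_distrib)
 next
  case False
  then show ?thesis using dyad_dist[of k j n p q] that
   by (simp add: of_nat_diff field_simps MS.commute[of "dyad p q n j"] flip: diff_divide_distrib)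
 qed
 have "dyad p q n j = dyad p q (n + m) (2 ^ m * j)" "dyad p q m k = dyad p q (n + m) (2 ^ n * k)"
  using dyad_refine[of p q n m j] dyad_refine[of p q m n k] by (simp_all add: add.commute)
 moreover have "2 ^ m * j <= 2 ^ (n + m)" "2 ^ n * k <= 2 ^ (n + m)"
  using assms by (simp_all add: power_add mult.commute)
 ultimately show ?thesis
  using *[of "2 ^ m * j" "n + m" "2 ^ n * k"] by (simp add: power_add)
qed

definition dindex :: "nat => real => nat" where
 "dindex n t = nat \<lfloor>2 ^ n * t\<rfloor>"

lemma dindex:
 assumes "0 <= t" "t <= 1"
 shows "dindex n t <= 2 ^ n" "\<bar>real (dindex n t) / 2 ^ n - t\<bar> <= 1 / 2 ^ n"
proof -
 have e: "real (dindex n t) = of_int \<lfloor>2 ^ n * t\<rfloor>" using assms by (simp add: dindex_def)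
 have "real (dindex n t) <= 2 ^ n * t" unfolding e by simp
 also have "... <= 2 ^ n" using assms by (simp add: mult_left_le)
 finally show "dindex n t <= 2 ^ n" by (metis of_nat_le_iff of_nat_numeral of_nat_power)
 have "\<bar>real (dindex n t) - 2 ^ n * t\<bar> <= 1" unfolding e by linarith
 then have "\<bar>real (dindex n t) - 2 ^ n * t\<bar> / 2 ^ n <= 1 / 2 ^ n" by (intro divide_right_mono) auto
 moreover have "real (dindex n t) / 2 ^ n - t = (real (dindex n t) - 2 ^ n * t) / 2 ^ n" by (simp add: field_simps)
 ultimately show "\<bar>real (dindex n t) / 2 ^ n - t\<bar> <= 1 / 2 ^ n" by simp
qed

text \<open>The dyadic points with index floor(2^n t) have the right mutual distances up to an error
  of order 2^(-n). Hence they form a Cauchy sequence for each \<open>t\<close>, and in the limit the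
  distances are exact.\<close>

theorem metric_geodesic:
 "\<exists>\<gamma>. \<gamma> 0 = p & \<gamma> 1 = q & (\<forall>s\<in>{0..1}. \<forall>t\<in>{0..1::real}. d (\<gamma> s) (\<gamma> t) = d p q * \<bar>s - t\<bar>)"
proof -
 define z where "z n t = dyad p q n (dindex n t)" for n t
 have zd: "\<bar>d (z n s) (z m t) - d p q * \<bar>s - t\<bar>\<bar> <= d p q * (1 / 2 ^ n + 1 / 2 ^ m)"
  if "s \<in> {0..1}" "t \<in> {0..1}" for n m s t
 proof -
  have st: "0 <= s" "s <= 1" "0 <= t" "t <= 1" using that by auto
  note i = dindex[OF st(1,2), of n] dindex[OF st(3,4), of m]
  have "d (z n s) (z m t) - d p q * \<bar>s - t\<bar>
    = d p q * (\<bar>real (dindex n s) / 2 ^ n - real (dindex m t) / 2 ^ m\<bar> - \<bar>s - t\<bar>)"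
   unfolding z_def dyad_dist_real[OF i(1,3)] by (simp add: right_diff_distrib)
  then have "\<bar>d (z n s) (z m t) - d p q * \<bar>s - t\<bar>\<bar>
    = d p q * \<bar>\<bar>real (dindex n s) / 2 ^ n - real (dindex m t) / 2 ^ m\<bar> - \<bar>s - t\<bar>\<bar>"
   by (simp add: abs_mult)
  also have "... <= d p q * (1 / 2 ^ n + 1 / 2 ^ m)"
   using i(2,4) by (intro mult_left_mono) auto
  finally show ?thesis .
 qed
 have two: "(%n. d p q * (1 / 2 ^ n + 1 / 2 ^ n)) \<longlonglongrightarrow> 0"
 proof -
  have "(%n. (1/2::real) ^ n) \<longlonglongrightarrow> 0" by (rule LIMSEQ_power_zero) simp
  then have "(%n. 1 / 2 ^ n :: real) \<longlonglongrightarrow> 0" by (simp add: power_one_over)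
  then have "(%n. d p q * (1 / 2 ^ n + 1 / 2 ^ n)) \<longlonglongrightarrow> d p q * (0 + 0)" by (intro tendsto_intros)
  then show ?thesis by simp
 qed
 have "\<exists>l. (%n. d (z n t) l) \<longlonglongrightarrow> 0" if t: "t \<in> {0..1}" for t
 proof -
  have "MS.MCauchy (%n. z n t)"
   unfolding MS.MCauchy_def
  proof (intro conjI allI impI)
   fix e :: real assume e: "e > 0"
   obtain N where N: "d p q * (1 / 2 ^ N + 1 / 2 ^ N) < e"
    using order_tendstoD(2)[OF two e] by (auto simp: eventually_sequentially)
   show "\<exists>N. \<forall>n n'. N <= n --> N <= n' --> d (z n t) (z n' t) < e"
   proof (intro exI allI impI)
    fix n n' assume nn: "N <= n" "N <= n'"
    have "(1::real) / 2 ^ n <= 1 / 2 ^ N" "(1::real) / 2 ^ n' <= 1 / 2 ^ N"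
     using nn by (auto intro!: divide_left_mono power_increasing)
    then have "d p q * (1 / 2 ^ n + 1 / 2 ^ n') <= d p q * (1 / 2 ^ N + 1 / 2 ^ N)"
     by (intro mult_left_mono add_mono) auto
    then show "d (z n t) (z n' t) < e" using zd[OF t t, of n n'] N by simp
   qed
  qed auto
  then obtain l where "limitin MS.mtopology (%n. z n t) l sequentially"
   using complete unfolding riem_complete_def MS.mcomplete_def by blast
  then have "(%n. d (z n t) l) \<longlonglongrightarrow> 0" by (simp add: MS.limitin_metric_dist_null)
  then show ?thesis ..
 qed
 then obtain \<gamma> where \<gamma>: "!!t. t \<in> {0..1} ==> (%n. d (z n t) (\<gamma> t)) \<longlonglongrightarrow> 0" by metis
 have dist: "d (\<gamma> s) (\<gamma> t) = d p q * \<bar>s - t\<bar>" if st: "s \<in> {0..1}" "t \<in> {0..1}" for s t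
 proof -
  have "(%n. d (\<gamma> s) (\<gamma> t) - d p q * \<bar>s - t\<bar>) \<longlonglongrightarrow> 0"
  proof (rule tendsto_rabs_zero_cancel, rule tendsto_sandwich[OF _ _ tendsto_const])
   show "(%n. d (z n s) (\<gamma> s) + d (z n t) (\<gamma> t) + d p q * (1 / 2 ^ n + 1 / 2 ^ n)) \<longlonglongrightarrow> 0"
    using tendsto_add[OF tendsto_add[OF \<gamma>[OF st(1)] \<gamma>[OF st(2)]] two] by simp
   show "\<forall>\<^sub>F n in sequentially. \<bar>d (\<gamma> s) (\<gamma> t) - d p q * \<bar>s - t\<bar>\<bar>
     <= d (z n s) (\<gamma> s) + d (z n t) (\<gamma> t) + d p q * (1 / 2 ^ n + 1 / 2 ^ n)"
   proof (rule always_eventually, rule allI)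
    fix n
    have "d (\<gamma> s) (\<gamma> t) <= d (z n s) (\<gamma> s) + d (z n s) (z n t) + d (z n t) (\<gamma> t)"
     using MS.triangle[of "\<gamma> s" "z n s" "\<gamma> t"] MS.triangle[of "z n s" "z n t" "\<gamma> t"] MS.commute[of "\<gamma> s" "z n s"] by simp
    moreover have "d (z n s) (z n t) <= d (z n s) (\<gamma> s) + d (\<gamma> s) (\<gamma> t) + d (z n t) (\<gamma> t)"
     using MS.triangle[of "z n s" "\<gamma> s" "z n t"] MS.triangle[of "\<gamma> s" "\<gamma> t" "z n t"] MS.commute[of "\<gamma> t" "z n t"] by simp
    ultimately show "\<bar>d (\<gamma> s) (\<gamma> t) - d p q * \<bar>s - t\<bar>\<bar>
     <= d (z n s) (\<gamma> s) + d (z n t) (\<gamma> t) + d p q * (1 / 2 ^ n + 1 / 2 ^ n)"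
     using zd[OF st, of n n] by linarith
   qed
  qed auto
  then have "d (\<gamma> s) (\<gamma> t) - d p q * \<bar>s - t\<bar> = 0" by (simp add: LIMSEQ_const_iff)
  then show ?thesis by simp
 qed
 have "(%n. d (z n 0) (\<gamma> 0)) \<longlonglongrightarrow> 0" "(%n. d (z n 1) (\<gamma> 1)) \<longlonglongrightarrow> 0" using \<gamma> by auto
 moreover have "dindex n 1 = 2 ^ n" for n
  by (simp add: dindex_def nat_eq_iff) 
 then have "z n 0 = p" "z n 1 = q" for n by (simp_all add: z_def dyad_ends dindex_def[of n 0])
 ultimately have "d p (\<gamma> 0) = 0" "d q (\<gamma> 1) = 0" by (simp_all add: LIMSEQ_const_iff)
 then have "\<gamma> 0 = p" "\<gamma> 1 = q" using MS.zero by auto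
 then show ?thesis using dist by blast
qed

end

lemma has_vector_derivative_quotient:
 assumes "(x has_vector_derivative D) (at s within I)"
 shows "((%y. (x y - x s) /\<^sub>R (y - s)) \<longlongrightarrow> D) (at s within I)"
proof -
 let ?q = "%y. (x y - x s) /\<^sub>R (y - s)"
 have "((%y. norm (x y - x s - (y - s) *\<^sub>R D) / norm (y - s)) \<longlongrightarrow> 0) (at s within I)"
  using assms unfolding has_vector_derivative_def has_derivative_iff_norm by blast
 moreover have "\<forall>\<^sub>F y in at s within I. norm (x y - x s - (y - s) *\<^sub>R D) / norm (y - s) = norm (?q y - D)"
  unfolding eventually_at_filter
 proof (rule always_eventually, intro allI impI)
  fix y :: real assume "y ~= s"
  then have "?q y - D = (x y - x s - (y - s) *\<^sub>R D) /\<^sub>R (y - s)" by (simp add: scaleR_diff_right)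
  then show "norm (x y - x s - (y - s) *\<^sub>R D) / norm (y - s) = norm (?q y - D)"
   by (simp add: divide_inverse mult.commute)
 qed
 ultimately have "((%y. norm (?q y - D)) \<longlongrightarrow> 0) (at s within I)" by (rule Lim_transform_eventually)
 then show ?thesis by (simp add: tendsto_norm_zero_iff LIM_zero_iff)
qed

text \<open>The order s^(3/2) makes consecutive dyadic difference quotients differ by a multiple of
  2^(-k/2), so they converge uniformly to a continuous limit. Backward quotients are used: they keep
  the right end point \<open>b\<close>, and the interval shrinks at the left end only.\<close>

lemma C1_from_second_difference:
 fixes x :: "real => 'b::euclidean_space"
 assumes cont: "continuous_on {a..b} x" and h: "0 < h" and ah: "a + h < b"
  and C: "!!s t. a <= t - s ==> t + s <= b ==> 0 < s ==> s <= h ==>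
   norm (x (t + s) + x (t - s) - 2 *\<^sub>R x t) <= C * (s * sqrt s)"
 shows "\<exists>D. continuous_on {a+h..b} D & (\<forall>t\<in>{a+h..b}. (x has_vector_derivative D t) (at t within {a+h..b}))"
proof -
 define e where "e k = h / 2 ^ k" for k :: nat
 define Q where "Q k t = (x t - x (t - e k)) /\<^sub>R e k" for k t
 have e: "e k > 0" "e k <= h" "e (Suc k) = e k / 2" for k
  using h by (auto simp: e_def field_simps)
 have C0: "C >= 0"
 proof -
  have "0 <= C * (h/2 * sqrt (h/2))"
   by (rule order_trans[OF norm_ge_zero C[of "a + h/2" "h/2"]]) (use h ah in auto)
  moreover have "h/2 * sqrt (h/2) > 0" using h by simp
  ultimately show ?thesis by (metis mult_less_0_iff not_le)
 qed
 let ?I = "{a+h..b}"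
 have step: "norm (Q (Suc k) t - Q k t) <= C * sqrt h * (1 / sqrt 2) ^ k" if t: "t \<in> ?I" for k t
 proof -
  let ?s = "e k / 2"
  have "Q (Suc k) t - Q k t = (x t + x (t - e k) - 2 *\<^sub>R x (t - ?s)) /\<^sub>R e k"
  proof -
   have "(2 * c) *\<^sub>R (u - v) - c *\<^sub>R (u - w) = c *\<^sub>R (u + w - 2 *\<^sub>R v)" for c and u v w :: 'b
    by (simp add: algebra_simps flip: scaleR_left_distrib)
   from this[of "1 / e k"] show ?thesis by (simp add: Q_def e(3) inverse_eq_divide)
  qed
  also have "norm ... = norm (x ((t - ?s) + ?s) + x ((t - ?s) - ?s) - 2 *\<^sub>R x (t - ?s)) / e k"
  proof -
   have "(t - ?s) - ?s = t - e k" "(t - ?s) + ?s = t" by simp_all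
   moreover have "\<bar>inverse (e k)\<bar> = 1 / e k" using e(1)[of k] by (simp add: inverse_eq_divide)
   ultimately show ?thesis by simp
  qed
  also have "... <= C * (?s * sqrt ?s) / e k"
   by (intro divide_right_mono C) (use t e[of k] in auto)
  also have "... = C / 2 * sqrt ?s" using e[of k] by simp
  also have "sqrt ?s <= sqrt (e k)" using e[of k] by simp
  also have "sqrt (e k) = sqrt h * (1 / sqrt 2) ^ k"
   by (simp add: e_def real_sqrt_divide real_sqrt_power power_one_over)
  finally have "norm (Q (Suc k) t - Q k t) <= C / 2 * (sqrt h * (1 / sqrt 2) ^ k)"
   using C0 by (simp add: mult_left_mono)
  also have "... <= C * sqrt h * (1 / sqrt 2) ^ k" using C0 h by (simp add: mult_right_mono)
  finally show ?thesis .
 qed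
 have sm: "summable (%k. C * sqrt h * (1 / sqrt 2) ^ k)"
  by (intro summable_mult summable_geometric) simp
 have "uniform_limit ?I (%n t. \<Sum>k<n. Q (Suc k) t - Q k t) (%t. \<Sum>k. Q (Suc k) t - Q k t) sequentially"
  by (rule Weierstrass_m_test[OF step sm])
 then have "uniform_limit ?I (%n t. (\<Sum>k<n. Q (Suc k) t - Q k t) + Q 0 t) (%t. (\<Sum>k. Q (Suc k) t - Q k t) + Q 0 t) sequentially"
  by (intro uniform_limit_add uniform_limit_const)
 moreover have "(\<Sum>k<n. Q (Suc k) t - Q k t) + Q 0 t = Q n t" for n t
  using sum_lessThan_telescope[of "%k. Q k t" n] by simp
 ultimately obtain D where D: "uniform_limit ?I Q D sequentially"
  by (auto simp: fun_eq_iff)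
 have cQ: "continuous_on ?I (Q k)" for k
  unfolding Q_def
  by (intro continuous_intros continuous_on_subset[OF cont] continuous_on_compose2[OF cont])
   (use e[of k] h in auto)
 have cD: "continuous_on ?I D"
  by (rule uniform_limit_theorem[OF _ D]) (use cQ in auto)
 define J where "J t = integral {a..t} x" for t
 have J: "(J has_vector_derivative x t) (at t within {a..b})" if "t \<in> {a..b}" for t
  unfolding J_def by (rule integral_has_vector_derivative[OF cont that])
 \<comment> \<open>The mean of \<open>x\<close> over the interval from t - e k to t. It is
   differentiable with derivative \<open>Q k\<close>, although \<open>x\<close> is not yet known to
   be, so the theorem on uniformly convergent derivatives applies to these means.\<close>
 define f where "f k t = (J t - J (t - e k)) /\<^sub>R e k" for k t
 have df: "(f k has_derivative (%s. s *\<^sub>R Q k t)) (at t within ?I)" if t: "t \<in> ?I" for k t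
 proof -
  have "(J has_vector_derivative x t) (at t within ?I)"
   by (rule has_vector_derivative_within_subset[OF J]) (use t h in auto)
  moreover have "((%t. J (t - e k)) has_vector_derivative x (t - e k)) (at t within ?I)"
  proof -
   have "((%t. t - e k) has_derivative (%s. s)) (at t within ?I)" by (auto intro!: derivative_eq_intros)
   from has_derivative_in_compose[OF this, of J "%s. s *\<^sub>R x (t - e k)"] show ?thesis
    unfolding has_vector_derivative_def
    by (rule meta_mp, intro has_derivative_subset[OF J[unfolded has_vector_derivative_def]])
     (use t e[of k] h in auto)
  qed
  ultimately have "(f k has_vector_derivative Q k t) (at t within ?I)"
   unfolding f_def Q_def by (intro bounded_linear.has_vector_derivative[OF bounded_linear_scaleR_right] has_vector_derivative_diff)
  then show ?thesis by (simp add: has_vector_derivative_def)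
 qed
 have e0: "e \<longlonglongrightarrow> 0"
 proof -
  have "(%k. h * (1/2) ^ k) \<longlonglongrightarrow> h * 0" by (intro tendsto_intros LIMSEQ_power_zero) simp
  moreover have "e = (%k. h * (1/2) ^ k)" by (simp add: fun_eq_iff e_def power_one_over)
  ultimately show ?thesis by simp
 qed
 have fx: "(%k. f k t) \<longlonglongrightarrow> x t" if t: "t \<in> ?I" for t
 proof -
  have "(%k. t - e k) \<longlonglongrightarrow> t - 0" by (intro tendsto_intros e0)
  moreover have "t - e k \<in> {a..b} & t - e k ~= t" for k using t e(1)[of k] e(2)[of k] h by simp
  ultimately have "filterlim (%k. t - e k) (at t within {a..b}) sequentially"
   by (simp add: filterlim_at)
  moreover have "t \<in> {a..b}" using t h by simp
  ultimately have "(%k. (J (t - e k) - J t) /\<^sub>R (t - e k - t)) \<longlonglongrightarrow> x t"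
   using filterlim_compose[OF has_vector_derivative_quotient[OF J]] by blast
  moreover have "(J (t - e k) - J t) /\<^sub>R (t - e k - t) = f k t" for k
   by (simp add: f_def flip: scaleR_minus_right)
  ultimately show ?thesis by simp
 qed
 have "\<exists>G. \<forall>t\<in>?I. (%k. f k t) \<longlonglongrightarrow> G t & (G has_derivative (%s. s *\<^sub>R D t)) (at t within ?I)"
 proof (rule has_derivative_sequence[OF _ df])
  fix \<epsilon> :: real assume "0 < \<epsilon>"
  from uniform_limitD[OF D this]
  show "\<forall>\<^sub>F k in sequentially. \<forall>t\<in>?I. \<forall>s. norm (s *\<^sub>R Q k t - s *\<^sub>R D t) <= \<epsilon> * norm s"
  proof (rule eventually_mono, intro ballI allI)
   fix k t and s :: real assume "\<forall>t\<in>?I. dist (Q k t) (D t) < \<epsilon>" and t: "t \<in> ?I"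
   then have "norm s * norm (Q k t - D t) <= norm s * \<epsilon>" by (intro mult_left_mono) (auto simp: dist_norm intro: less_imp_le)
   then show "norm (s *\<^sub>R Q k t - s *\<^sub>R D t) <= \<epsilon> * norm s" by (simp add: mult.commute flip: scaleR_diff_right)
  qed
 next
  show "b \<in> ?I" "(%k. f k b) \<longlonglongrightarrow> x b" using ah fx[of b] by auto
 qed simp_all
 then obtain G where G: "!!t. t \<in> ?I ==> (%k. f k t) \<longlonglongrightarrow> G t"
  "!!t. t \<in> ?I ==> (G has_derivative (%s. s *\<^sub>R D t)) (at t within ?I)" by blast
 have "x t = G t" if "t \<in> ?I" for t by (rule LIMSEQ_unique[OF fx[OF that] G(1)[OF that]])
 then have "(x has_vector_derivative D t) (at t within ?I)" if "t \<in> ?I" for t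
  unfolding has_vector_derivative_def using has_derivative_transform[OF that _ G(2)[OF that]] by blast
 then show ?thesis using cD by blast
qed

section \<open>Uniform estimates for smooth functions\<close>

definition dir2 :: "(real^'n::finite => real) => real^'n => real^'n => real" where
 "dir2 f u h = dir (%y. dir f y h) u h"

definition bdd :: "'c set => ('c => 'b::real_normed_vector) => bool" where
 "bdd I f \<longleftrightarrow> (\<exists>B\<ge>0. \<forall>t\<in>I. norm (f t) <= B)"

lemma bdd_continuous: "compact I ==> continuous_on I f ==> bdd I f"
proof -
 assume "compact I" "continuous_on I f"
 then have "bounded (f ` I)" using compact_continuous_image compact_imp_bounded by blast
 then obtain B where "B > 0" "!!y. y \<in> f ` I ==> norm y <= B" unfolding bounded_pos by metis
 then show ?thesis unfolding bdd_def by (intro exI[of _ B]) auto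
qed

lemma dir_bound:
 assumes f: "Cinf_on U f" and K: "compact K" "K \<subseteq> U"
 shows "\<exists>B\<ge>0. \<forall>u\<in>K. \<forall>h. \<bar>dir f u h\<bar> <= B * norm h"
proof -
 have "\<exists>B\<ge>0. \<forall>u\<in>K. norm (pd l f u) <= B" for l
  using bdd_continuous[OF K(1) continuous_on_subset[OF Cinf_on_continuous[OF Cinf_on_pd[OF f]] K(2)]] unfolding bdd_def .
 then obtain B where B: "!!l. B l >= 0" "!!l u. u \<in> K ==> norm (pd l f u) <= B l" by metis
 have "\<bar>dir f u z\<bar> <= (SU l. B l) * norm z" if u: "u \<in> K" for u z
 proof -
  have "\<bar>dir f u z\<bar> <= (SU l. \<bar>z $ l * pd l f u\<bar>)" unfolding dir_def by (rule sum_abs)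
  also have "... <= (SU l. norm z * B l)"
   unfolding abs_mult using B(2)[OF u] by (intro sum_mono mult_mono component_le_norm_cart) auto
  finally show ?thesis by (simp add: sum_distrib_left mult.commute)
 qed
 then show ?thesis using B(1) by (intro exI[of _ "SU l. B l"]) (auto intro: sum_nonneg)
qed

lemma smooth_lipschitz:
 assumes f: "Cinf_on U f" "open U" and K: "compact K" "convex K" "K \<subseteq> U"
 shows "\<exists>L\<ge>0. \<forall>u\<in>K. \<forall>v\<in>K. \<bar>f u - f v\<bar> <= L * norm (u - v)"
proof -
 obtain B where B: "B >= 0" "!!u h. u \<in> K ==> \<bar>dir f u h\<bar> <= B * norm h" using dir_bound[OF f(1) K(1,3)] by blast
 have on: "onorm (dir f u) <= B" if "u \<in> K" for u
  by (rule onorm_bound[OF B(1)]) (simp add: B(2)[OF that])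
 have "norm (f u - f v) <= B * norm (u - v)" if "u \<in> K" "v \<in> K" for u v
  by (rule differentiable_bound[OF K(2) has_derivative_at_withinI[OF dir_has_derivative[OF f]] on that])
   (use K(3) in blast)
 then show ?thesis using B(1) by auto
qed

lemma dir2_expand:
 assumes "Cinf_on U f" "open U" "u \<in> U"
 shows "dir2 f u h = (SU k. SU l. h $ k * h $ l * pd l (pd k f) u)"
proof -
 have 1: "dir2 f u h = (SU k. dir (%y. h $ k * pd k f y) u h)"
  unfolding dir2_def dir_def[of f]
  by (rule dir_sum_fun[OF _ assms(2,3)]) (intro Cinf_on_mult Cinf_on_const Cinf_on_pd assms)
 have 2: "dir (%y. h $ k * pd k f y) u h = h $ k * dir (pd k f) u h" for k
 proof -
  have "((%y. h $ k * pd k f y) has_derivative (%z. h $ k * dir (pd k f) u z)) (at u)"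
   by (intro has_derivative_mult_right dir_has_derivative[OF Cinf_on_pd[OF assms(1)] assms(2,3)])
  from dir_eqI[OF this] show ?thesis .
 qed
 show ?thesis unfolding 1 2 by (simp add: dir_def sum_distrib_left mult.assoc)
qed

lemma compact_neighbourhood:
 fixes K :: "'b::euclidean_space set"
 assumes K: "compact K" "K \<subseteq> U" "open U"
 shows "\<exists>\<delta>>0. compact (\<Union>u\<in>K. cball u \<delta>) & (\<Union>u\<in>K. cball u \<delta>) \<subseteq> U"
proof -
 obtain \<delta> where \<delta>: "\<delta> > 0" "(\<Union>u\<in>K. cball u \<delta>) \<subseteq> U"
  using compact_subset_open_imp_cball_epsilon_subset[OF K(1,3,2)] by blast
 have "(\<Union>u\<in>K. cball u \<delta>) = (\<Union>x\<in>K. \<Union>y\<in>cball 0 \<delta>. {x + y})"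
 proof (intro set_eqI iffI)
  fix z assume "z \<in> (\<Union>u\<in>K. cball u \<delta>)"
  then obtain u where "u \<in> K" "dist u z <= \<delta>" by auto
  then have "z - u \<in> cball 0 \<delta>" "z = u + (z - u)" by (auto simp: dist_norm norm_minus_commute)
  then show "z \<in> (\<Union>x\<in>K. \<Union>y\<in>cball 0 \<delta>. {x + y})" using \<open>u \<in> K\<close> by blast
 next
  fix z assume "z \<in> (\<Union>x\<in>K. \<Union>y\<in>cball 0 \<delta>. {x + y})"
  then obtain x y where "x \<in> K" "norm y <= \<delta>" "z = x + y" by auto
  then have "z \<in> cball x \<delta>" by (simp add: dist_norm)
  then show "z \<in> (\<Union>u\<in>K. cball u \<delta>)" using \<open>x \<in> K\<close> by blast
 qed
 moreover have "compact (\<Union>x\<in>K. \<Union>y\<in>cball 0 \<delta>. {x + y})" by (rule compact_sums'[OF K(1) compact_cball])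
 ultimately have "compact (\<Union>u\<in>K. cball u \<delta>)" by simp
 then show ?thesis using \<delta> by blast
qed

text \<open>Taylor's formula along the segment leaves the difference of the second derivatives at
  two points at distance at most \<delta>; uniform continuity on a compact neighbourhood of
  \<open>K\<close> makes it small independently of \<open>u\<close>.\<close>

lemma uniform_taylor:
 fixes f :: "real^'n::finite => real"
 assumes f: "Cinf_on U f" "open U" and K: "compact K" "K \<subseteq> U" and e: "0 < e"
 shows "\<exists>\<delta>>0. \<forall>u\<in>K. \<forall>h. norm h <= \<delta> --> \<bar>f (u + h) - f u - dir f u h - dir2 f u h / 2\<bar> <= e * (norm h)^2"
proof -
 obtain r where r: "r > 0" "compact (\<Union>u\<in>K. cball u r)" "(\<Union>u\<in>K. cball u r) \<subseteq> U"
  using compact_neighbourhood[OF K f(2)] by blast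
 let ?K = "\<Union>u\<in>K. cball u r"
 define N where "N = real (CARD('n)) * real (CARD('n)) "
 have N: "N > 0" by (simp add: N_def)
 have "\<exists>\<delta>>0. \<forall>u\<in>?K. \<forall>v\<in>?K. dist v u < \<delta> --> \<bar>pd l (pd k f) v - pd l (pd k f) u\<bar> <= e / N" for k l
 proof -
  have "continuous_on ?K (pd l (pd k f))"
   using Cinf_on_continuous[OF Cinf_on_pd[OF Cinf_on_pd[OF f(1)]]] r(3) by (rule continuous_on_subset)
  then have "uniformly_continuous_on ?K (pd l (pd k f))" using r(2) by (rule compact_uniformly_continuous)
  then obtain \<delta> where "\<delta> > 0" "\<forall>u\<in>?K. \<forall>v\<in>?K. dist v u < \<delta> --> dist (pd l (pd k f) v) (pd l (pd k f) u) < e / N"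
   unfolding uniformly_continuous_on_def using e N by (metis divide_pos_pos)
  then show ?thesis unfolding dist_real_def by (meson less_imp_le)
 qed
 note ex = this
 define D where "D k l = (SOME \<delta>. \<delta> > 0 & (\<forall>u\<in>?K. \<forall>v\<in>?K. dist v u < \<delta> -->
   \<bar>pd l (pd k f) v - pd l (pd k f) u\<bar> <= e / N))" for k l
 have D: "D k l > 0" "u \<in> ?K ==> v \<in> ?K ==> dist v u < D k l ==> \<bar>pd l (pd k f) v - pd l (pd k f) u\<bar> <= e / N" for k l u v
  using someI_ex[OF ex[of l k]] unfolding D_def[of k l, symmetric] by blast+
 define mm where "mm = Min (range (%(k,l). D k l))"
 have mn: "0 < mm" unfolding mm_def using D(1) by (subst Min_gr_iff) auto
 have Dl: "mm <= D k l" for k l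
  unfolding mm_def by (rule Min_le) (auto intro!: image_eqI[of _ _ "(k,l)"])
 define \<delta> where "\<delta> = min r (mm / 2)"
 have \<delta>: "\<delta> > 0" "\<delta> <= r" "\<delta> < D k l" for k l
  using mn Dl[of k l] r(1) by (auto simp: \<delta>_def)
 show ?thesis
 proof (intro exI[of _ \<delta>] conjI ballI allI impI)
  fix u h :: "real^'n" assume u: "u \<in> K" and h: "norm h <= \<delta>"
  have in_K: "u + t *\<^sub>R h \<in> ?K" if t: "0 <= t" "t <= 1" for t
  proof -
   have "norm (t *\<^sub>R h) <= 1 * norm h" unfolding norm_scaleR using t by (intro mult_right_mono) auto
   then have "u + t *\<^sub>R h \<in> cball u r" using h \<delta>(2) by (simp add: dist_norm)
   then show ?thesis using u by blast
  qed
  define dd where "dd m t = (if m = 0 then f (u + t *\<^sub>R h) else if m = 1 then dir f (u + t *\<^sub>R h) h else dir2 f (u + t *\<^sub>R h) h)" for m :: nat and t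
  have line: "((%t. u + t *\<^sub>R h) has_derivative (%s. s *\<^sub>R h)) (at t)" for t :: real
   by (auto intro!: derivative_eq_intros)
  have comp: "((%t. w (u + t *\<^sub>R h)) has_real_derivative dir w (u + t *\<^sub>R h) h) (at t)"
   if w: "Cinf_on U w" and t: "0 <= t" "t <= 1" for w t
  proof -
   have "((%t. w (u + t *\<^sub>R h)) has_derivative (%s. dir w (u + t *\<^sub>R h) (s *\<^sub>R h))) (at t)"
    by (rule has_derivative_compose[OF line dir_has_derivative[OF w f(2) subsetD[OF r(3) in_K[OF t]]]])
   then show ?thesis unfolding has_field_derivative_def dir_scale
    by (rule has_derivative_eq_rhs) (auto simp: mult.commute)
  qed
  have "\<exists>t>0. t < 1 & dd 0 1 = (\<Sum>m<2. dd m 0 / fact m * 1 ^ m) + dd 2 t / fact 2 * 1 ^ 2"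
  proof (rule Maclaurin)
   show "\<forall>m t. m < 2 & 0 <= t & t <= 1 --> DERIV (dd m) t :> dd (Suc m) t"
   proof (intro allI impI)
    fix m :: nat and t :: real assume mt: "m < 2 & 0 <= t & t <= 1"
    have "Cinf_on U (%y. dir f y h)" by (rule Cinf_on_dir[OF f(2,1) smap_const])
    have m: "m = 0 \<or> m = 1" using mt by auto
    then show "DERIV (dd m) t :> dd (Suc m) t"
    proof
     assume "m = 0" then show ?thesis using comp[OF f(1)] mt by (simp add: dd_def[abs_def])
    next
     assume "m = 1" then show ?thesis
      using comp[OF \<open>Cinf_on U (%y. dir f y h)\<close>] mt
      by (simp add: dir2_def dd_def[abs_def])
    qed
   qed
  qed auto
  then obtain t where t: "0 < t" "t < 1" "f (u + h) = f u + dir f u h + dir2 f (u + t *\<^sub>R h) h / 2"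
   by (auto simp: numeral_2_eq_2 dd_def)
  have "u \<in> ?K" using in_K[of 0] by simp
  have uU: "u \<in> U" "u + t *\<^sub>R h \<in> U"
   using subsetD[OF r(3) in_K[of 0]] subsetD[OF r(3) in_K[of t]] t by simp_all
  have dt: "dist (u + t *\<^sub>R h) u <= \<delta>"
  proof -
   have "norm (t *\<^sub>R h) <= 1 * norm h" unfolding norm_scaleR using t by (intro mult_right_mono) auto
   then show ?thesis using h by (simp add: dist_norm)
  qed
  have "dir2 f (u + t *\<^sub>R h) h - dir2 f u h
    = (SU k. SU l. h $ k * h $ l * (pd l (pd k f) (u + t *\<^sub>R h) - pd l (pd k f) u))"
   unfolding dir2_expand[OF f uU(1)] dir2_expand[OF f uU(2)] by (simp add: right_diff_distrib sum_subtractf)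
  also have "\<bar>...\<bar> <= (\<Sum>k\<in>(UNIV::'n set). \<Sum>l\<in>(UNIV::'n set). norm h * norm h * (e / N))"
  proof (rule order_trans[OF sum_abs], rule sum_mono, rule order_trans[OF sum_abs], rule sum_mono)
   fix k l :: 'n
   have "\<bar>pd l (pd k f) (u + t *\<^sub>R h) - pd l (pd k f) u\<bar> <= e / N"
    by (rule D(2)[OF \<open>u \<in> ?K\<close>]) (use in_K[of t] t dt \<delta>(3)[of k l] in auto)
   then show "\<bar>h $ k * h $ l * (pd l (pd k f) (u + t *\<^sub>R h) - pd l (pd k f) u)\<bar> <= norm h * norm h * (e / N)"
    unfolding abs_mult by (intro mult_mono component_le_norm_cart) auto
  qed
  also have "... = e * (norm h)^2" using N by (simp add: N_def power2_eq_square)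
  finally show "\<bar>f (u + h) - f u - dir f u h - dir2 f u h / 2\<bar> <= e * (norm h)^2"
   unfolding t(3) using e by simp
 qed (use \<delta>(1) in auto)
qed

section \<open>Regularity of minimizing geodesics\<close>

context local_metric
begin

lemma gin_lipschitz:
 assumes K: "compact K" "convex K" "K \<subseteq> U"
 shows "\<exists>L\<ge>0. \<forall>u\<in>K. \<forall>v\<in>K. \<forall>w. \<bar>gin G u w w - gin G v w w\<bar> <= L * norm (u - v) * (norm w)^2"
proof -
 have "\<exists>L\<ge>0. \<forall>u\<in>K. \<forall>v\<in>K. \<bar>G u $ i $ j - G v $ i $ j\<bar> <= L * norm (u - v)" for i j
  by (rule smooth_lipschitz[OF smooth_G U_open K])
 then obtain L where L: "!!i j. L i j >= 0"
  "!!i j u v. u \<in> K ==> v \<in> K ==> \<bar>G u $ i $ j - G v $ i $ j\<bar> <= L i j * norm (u - v)" by metis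
 let ?L = "SU i. SU j. L i j"
 have "\<bar>gin G u w w - gin G v w w\<bar> <= ?L * norm (u - v) * (norm w)^2" if uv: "u \<in> K" "v \<in> K" for u v w
 proof -
  have "gin G u w w - gin G v w w = (SU i. SU j. w $ i * (w $ j * (G u $ i $ j - G v $ i $ j)))"
   by (simp add: gin_sum right_diff_distrib sum_subtractf)
  also have "\<bar>...\<bar> <= (\<Sum>i\<in>(UNIV::'n set). \<Sum>j\<in>(UNIV::'n set). norm w * (norm w * (L i j * norm (u - v))))"
  proof (rule order_trans[OF sum_abs], rule sum_mono, rule order_trans[OF sum_abs], rule sum_mono)
   fix i j
   show "\<bar>w $ i * (w $ j * (G u $ i $ j - G v $ i $ j))\<bar> <= norm w * (norm w * (L i j * norm (u - v)))"
    unfolding abs_mult by (intro mult_mono component_le_norm_cart L(2) uv) auto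
  qed
  also have "... = ?L * norm (u - v) * (norm w)^2"
   by (simp add: sum_distrib_left sum_distrib_right power2_eq_square mult_ac)
  finally show ?thesis .
 qed
 moreover have "?L >= 0" by (intro sum_nonneg L)
 ultimately show ?thesis by blast
qed

lemma gin_parallelogram:
 assumes "u \<in> U"
 shows "gin G u (a + b) (a + b) = 2 * gin G u a a + 2 * gin G u b b - gin G u (a - b) (a - b)"
 by (simp add: gin_add1 gin_add2 gin_diff1 gin_diff2)

end

context riem_mfd
begin

lemma d_triangle: "d p q <= d p r + d r q" and d_commute: "d p q = d q p" and d_nonneg: "0 <= d p q"
 using MS.triangle[of p r q] MS.commute[of p q] MS.nonneg[of p q] by auto

abbreviation gnorm :: "('a, 'n) chart => real^'n => real^'n => real" where
 "gnorm c u w \<equiv> sqrt (gin (G c) u w w)"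

text \<open>On a coordinate ball of radius \<delta> about \<open>u\<close>, the distance agrees with
  the norm of the metric frozen at \<open>u\<close> up to the relative error C \<delta>. Segments
  give the upper estimate, \<open>length_ge_exit\<close> the lower one.\<close>

lemma chart_distance:
 assumes c: "c \<in> A" and u0: "cball uc \<rho> \<subseteq> cimg c" "0 < \<rho>"
 shows "\<exists>C m M \<delta>0. 0 <= C & 0 < m & 0 < M & 0 < \<delta>0 & \<delta>0 <= \<rho> / 2 & C * \<delta>0 <= 1/2 &
  (\<forall>u\<in>cball uc \<rho>. \<forall>w. m * norm w <= gnorm c u w & gnorm c u w <= M * norm w) &
  (\<forall>u\<in>cball uc (\<rho>/2). \<forall>\<delta>. 0 < \<delta> --> \<delta> <= \<delta>0 -->
   (\<forall>v\<in>cball u \<delta>. \<forall>w\<in>cball u \<delta>. d (cinv c v) (cinv c w) <= (1 + C * \<delta>) * gnorm c u (w - v)) &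
   (\<forall>q. d (cinv c u) q < m * \<delta> / 2 -->
    (\<exists>v\<in>ball u \<delta>. q = cinv c v & (1 - C * \<delta>) * gnorm c u (v - u) <= d (cinv c u) q)))"
proof -
 interpret L: local_metric "cimg c" "G c" by (rule local_metric_chart[OF c])
 obtain m M where mM: "0 < m" "0 < M"
  "!!u v. u \<in> cball uc \<rho> ==> m * norm v <= gnorm c u v" "!!u v. u \<in> cball uc \<rho> ==> gnorm c u v <= M * norm v"
  using chart_local_metric_bounds[OF local_metric_chart[OF c] compact_cball u0(1)] u0(2) by force
 obtain L where L: "L >= 0" "!!u v w. u \<in> cball uc \<rho> ==> v \<in> cball uc \<rho> ==>
   \<bar>gin (G c) u w w - gin (G c) v w w\<bar> <= L * norm (u - v) * (norm w)^2"
  using L.gin_lipschitz[OF compact_cball convex_cball u0(1)] by blast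
 \<comment> \<open>\<open>L\<close> is a Lipschitz constant of the metric in terms of the Euclidean
   norm; division by m^2 makes the error relative to the metric itself.\<close>
 define C where "C = L / m^2"
 have C: "C >= 0" using L mM by (simp add: C_def)
 define \<delta>0 where "\<delta>0 = min (\<rho> / 2) (1 / (2 * (C + 1)))"
 have \<delta>0: "0 < \<delta>0" "\<delta>0 <= \<rho> / 2" using u0 C by (auto simp: \<delta>0_def)
 have C\<delta>0: "C * \<delta>0 <= 1/2"
 proof -
  have "C * \<delta>0 <= C * (1 / (2 * (C + 1)))" using C by (intro mult_left_mono) (auto simp: \<delta>0_def)
  also have "... <= 1/2" using C by (simp add: divide_simps)
  finally show ?thesis .
 qed
 have cmp: "(1 - C * \<delta>) * gnorm c u w <= gnorm c v w & gnorm c v w <= (1 + C * \<delta>) * gnorm c u w"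
  if u: "u \<in> cball uc (\<rho>/2)" and \<delta>: "0 < \<delta>" "\<delta> <= \<delta>0" and v: "v \<in> cball u \<delta>" for u \<delta> v w
 proof -
  have uc: "u \<in> cball uc \<rho>" using u u0(2) by (auto)
  have vc: "v \<in> cball uc \<rho>" using u v \<delta> \<delta>0 dist_triangle[of uc v u] by auto
  have n: "0 <= gin (G c) u w w" "0 <= gin (G c) v w w" using L.gin_nonneg uc vc u0(1) by auto
  have C1: "0 <= C * \<delta>" "C * \<delta> <= 1/2"
   using C \<delta> C\<delta>0 mult_left_mono[of \<delta> \<delta>0 C] by auto
  have "(m * norm w)^2 <= (gnorm c u w)^2" by (rule power_mono[OF mM(3)[OF uc]]) (use mM in simp)
  then have nw: "(norm w)^2 <= gin (G c) u w w / m^2"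
   using n mM by (simp add: power_mult_distrib pos_le_divide_eq mult.commute)
  have "\<bar>gin (G c) v w w - gin (G c) u w w\<bar> <= L * norm (v - u) * (norm w)^2" by (rule L(2)[OF vc uc])
  also have "... <= L * \<delta> * (gin (G c) u w w / m^2)"
   using v L \<delta> nw by (intro mult_mono) (auto simp: dist_norm norm_minus_commute)
  also have "... = C * \<delta> * gin (G c) u w w" by (simp add: C_def)
  finally have b: "\<bar>gin (G c) v w w - gin (G c) u w w\<bar> <= C * \<delta> * gin (G c) u w w" .
  have "gin (G c) v w w <= (1 + C * \<delta>) * gin (G c) u w w" using b by (simp add: algebra_simps)
  also have "... <= (1 + C * \<delta>)^2 * gin (G c) u w w"
   using C1 n(1) by (intro mult_right_mono) (auto simp: power2_eq_square)
  finally have up: "gin (G c) v w w <= ((1 + C * \<delta>) * gnorm c u w)^2"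
   using n by (simp add: power_mult_distrib)
  have "((1 - C * \<delta>) * gnorm c u w)^2 = (1 - C * \<delta>)^2 * gin (G c) u w w"
   using n by (simp add: power_mult_distrib)
  also have "... <= (1 - C * \<delta>) * gin (G c) u w w"
   using C1 n(1) by (intro mult_right_mono) (auto simp: power2_eq_square mult_left_le)
  also have "... <= gin (G c) v w w" using b by (simp add: algebra_simps)
  finally have lo: "((1 - C * \<delta>) * gnorm c u w)^2 <= gin (G c) v w w" .
  show ?thesis
   using real_le_lsqrt[OF _ up] real_le_rsqrt[OF lo] C1 n by simp
 qed
 have U: "d (cinv c v) (cinv c w) <= (1 + C * \<delta>) * gnorm c u (w - v)"
  if u: "u \<in> cball uc (\<rho>/2)" and \<delta>: "0 < \<delta>" "\<delta> <= \<delta>0" and v: "v \<in> cball u \<delta>" "w \<in> cball u \<delta>" for u \<delta> v w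
 proof -
  have "cball u \<delta> \<subseteq> cball uc \<rho>" using u \<delta> \<delta>0 by (intro cball_subset_cball_iff[THEN iffD2]) (auto simp: dist_commute)
  then have sub: "cball u \<delta> \<subseteq> cimg c" using u0(1) by blast
  have "ed (cinv c v) (cinv c w) <= ennreal ((1 + C * \<delta>) * gnorm c u (w - v))"
   by (rule ed_segment[OF c convex_cball sub v]) (use cmp[OF u \<delta>] in blast)
  then have "ennreal (d (cinv c v) (cinv c w)) <= ennreal ((1 + C * \<delta>) * gnorm c u (w - v))" by (simp only: ed_d)
  moreover have "u \<in> cimg c" using sub \<delta>(1) by (auto simp: subset_iff)
  then have "0 <= (1 + C * \<delta>) * gnorm c u (w - v)"
   using C \<delta> L.gin_nonneg[of u] by (intro mult_nonneg_nonneg) auto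
  ultimately show ?thesis by (simp add: ennreal_le_iff)
 qed
 have Lo: "\<exists>v\<in>ball u \<delta>. q = cinv c v & (1 - C * \<delta>) * gnorm c u (v - u) <= d (cinv c u) q"
  if u: "u \<in> cball uc (\<rho>/2)" and \<delta>: "0 < \<delta>" "\<delta> <= \<delta>0" and q: "d (cinv c u) q < m * \<delta> / 2" for u \<delta> q
 proof -
  have uc: "u \<in> cball uc \<rho>" using u u0(2) by auto
  have "cball u \<delta> \<subseteq> cball uc \<rho>" using u \<delta> \<delta>0 by (intro cball_subset_cball_iff[THEN iffD2]) (auto simp: dist_commute)
  then have sub: "cball u \<delta> \<subseteq> cimg c" using u0(1) by blast
  have C1: "C * \<delta> <= 1/2" using C \<delta> C\<delta>0 mult_left_mono[of \<delta> \<delta>0 C] by auto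
  then have th: "0 < 1 - C * \<delta>" by simp
  have far: "m * \<delta> / 2 <= (1 - C * \<delta>) * gnorm c u w" if "norm w = \<delta>" for w
  proof -
   have "m * \<delta> / 2 = 1/2 * (m * norm w)" using that by simp
   also have "... <= (1 - C * \<delta>) * gnorm c u w" using C1 mM(3)[OF uc, of w] mM(1) \<delta> by (intro mult_mono) auto
   finally show ?thesis .
  qed
  \<comment> \<open>First with any \<open>e\<close> above the distance. The point \<open>v\<close>
    does not depend on \<open>e\<close>, as the chart is injective, so \<open>e\<close> can
    afterwards be lowered to the distance.\<close>
  have alt: "\<exists>v\<in>ball u \<delta>. q = cinv c v & (1 - C * \<delta>) * gnorm c u (v - u) <= e"
   if e: "d (cinv c u) q < e" "e <= m * \<delta> / 2" for e
  proof -
   have "0 <= e" using e(1) d_nonneg[of "cinv c u" q] by linarith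
   have "ed (cinv c u) q < ennreal e" using e(1) by (simp add: ed_less_iff)
   then obtain \<gamma> where \<gamma>: "\<gamma> \<in> paths (cinv c u) q" "path_length A g \<gamma> < ennreal e" using ed_less by blast
   have le: "x <= e & x ~= e" if "ennreal x <= path_length A g \<gamma>" for x
   proof -
    have "ennreal x < ennreal e" using that \<gamma>(2) by (rule le_less_trans)
    then show ?thesis using ennreal_less_iff not_le by (metis ennreal_leI less_le_not_le linorder_not_less)
   qed
   from length_ge_exit[OF c \<gamma>(1) sub \<delta>(1) th] cmp[OF u \<delta>]
   have "(\<exists>v\<in>ball u \<delta>. q = cinv c v & ennreal ((1 - C * \<delta>) * gnorm c u (v - u)) <= path_length A g \<gamma>) \<or>
    (\<exists>w. norm w = \<delta> & ennreal ((1 - C * \<delta>) * gnorm c u w) <= path_length A g \<gamma>)" by blast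
   then show ?thesis
   proof
    assume "\<exists>w. norm w = \<delta> & ennreal ((1 - C * \<delta>) * gnorm c u w) <= path_length A g \<gamma>"
    then obtain w where "norm w = \<delta>" "(1 - C * \<delta>) * gnorm c u w < e" using le by fastforce
    then show ?thesis using far[of w] e(2) by linarith
   qed (use le in blast)
  qed
  obtain v where v: "v \<in> ball u \<delta>" "q = cinv c v" using alt[OF q order_refl] by blast
  have "(1 - C * \<delta>) * gnorm c u (v - u) <= d (cinv c u) q"
  proof (rule ccontr)
   assume "\<not> ?thesis"
   then have gt: "d (cinv c u) q < (1 - C * \<delta>) * gnorm c u (v - u)" by simp
   define e where "e = min ((d (cinv c u) q + (1 - C * \<delta>) * gnorm c u (v - u)) / 2) (m * \<delta> / 2)"
   have e: "d (cinv c u) q < e" "e <= m * \<delta> / 2" "e < (1 - C * \<delta>) * gnorm c u (v - u)"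
    using gt q by (auto simp: e_def min_def)
   obtain v' where v': "v' \<in> ball u \<delta>" "q = cinv c v'" "(1 - C * \<delta>) * gnorm c u (v' - u) <= e"
    using alt[OF e(1,2)] by blast
   have "v = v'" using v v' sub cmap_cinv[OF c] by (metis ball_subset_cball subsetD)
   then show False using v'(3) e(3) by simp
  qed
  then show ?thesis using v by blast
 qed
 show ?thesis
  by (rule exI[of _ C], rule exI[of _ m], rule exI[of _ M], rule exI[of _ \<delta>0]) (use C mM \<delta>0 C\<delta>0 U Lo in blast)
qed

text \<open>The parallelogram identity in the metric frozen at the midpoint, which is Euclidean.\<close>

lemma chart_second_difference:
 assumes c: "c \<in> A" and u0: "cball uc \<rho> \<subseteq> cimg c" "0 < \<rho>"
 shows "\<exists>C \<tau>0. 0 < \<tau>0 & (\<forall>\<tau> u v w. 0 < \<tau> --> \<tau> <= \<tau>0 --> u \<in> cball uc (\<rho>/2) --> v \<in> cimg c --> w \<in> cimg c -->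
  d (cinv c u) (cinv c v) = \<tau> --> d (cinv c u) (cinv c w) = \<tau> --> d (cinv c v) (cinv c w) = 2 * \<tau> -->
  norm (v + w - 2 *\<^sub>R u) <= C * (\<tau> * sqrt \<tau>))"
proof -
 interpret L: local_metric "cimg c" "G c" by (rule local_metric_chart[OF c])
 obtain C m M \<delta>0 where C: "0 <= C" "0 < m" "0 < \<delta>0" "\<delta>0 <= \<rho> / 2" "C * \<delta>0 <= 1/2"
  and m: "!!u w. u \<in> cball uc \<rho> ==> m * norm w <= gnorm c u w"
  and U: "!!u \<delta> v w. u \<in> cball uc (\<rho>/2) ==> 0 < \<delta> ==> \<delta> <= \<delta>0 ==> v \<in> cball u \<delta> ==> w \<in> cball u \<delta> ==>
   d (cinv c v) (cinv c w) <= (1 + C * \<delta>) * gnorm c u (w - v)"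
  and Lo: "!!u \<delta> q. u \<in> cball uc (\<rho>/2) ==> 0 < \<delta> ==> \<delta> <= \<delta>0 ==> d (cinv c u) q < m * \<delta> / 2 ==>
    \<exists>v\<in>ball u \<delta>. q = cinv c v & (1 - C * \<delta>) * gnorm c u (v - u) <= d (cinv c u) q"
  using chart_distance[OF assms] by auto
 define K where "K = sqrt (128 * C / m) / m"
 show ?thesis
 proof (rule exI[of _ K], rule exI[of _ "m * \<delta>0 / 4"], intro conjI allI impI)
  show "0 < m * \<delta>0 / 4" using C by simp
  fix \<tau> u v w
  assume \<tau>: "0 < \<tau>" "\<tau> <= m * \<delta>0 / 4" and u: "u \<in> cball uc (\<rho>/2)" and vw: "v \<in> cimg c" "w \<in> cimg c"
   and D: "d (cinv c u) (cinv c v) = \<tau>" "d (cinv c u) (cinv c w) = \<tau>" "d (cinv c v) (cinv c w) = 2 * \<tau>"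
  \<comment> \<open>Then m * \<delta> / 2 = 2 * \<tau> exceeds the distance \<tau>, so the lower
    estimate applies to both points, and \<delta> is still proportional to \<tau>.\<close>
  define \<delta> where "\<delta> = 4 * \<tau> / m"
  have \<delta>: "0 < \<delta>" "\<delta> <= \<delta>0" "m * \<delta> / 2 = 2 * \<tau>" using \<tau> C by (auto simp: \<delta>_def field_simps)
  define s where "s = C * \<delta>"
  have s: "0 <= s" "s <= 1/2" using C \<delta> mult_left_mono[of \<delta> \<delta>0 C] by (auto simp: s_def)
  have uc: "u \<in> cball uc \<rho>" "u \<in> cimg c" using u u0 by (auto simp: subset_iff)
  have near: "x \<in> ball u \<delta> & (1 - s) * gnorm c u (x - u) <= \<tau>" if x: "x \<in> cimg c" "d (cinv c u) (cinv c x) = \<tau>" for x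
  proof -
   obtain x' where x': "x' \<in> ball u \<delta>" "cinv c x = cinv c x'" "(1 - C * \<delta>) * gnorm c u (x' - u) <= d (cinv c u) (cinv c x)"
    using Lo[OF u \<delta>(1,2), of "cinv c x"] x \<tau> \<delta>(3) by auto
   have "cball u \<delta> \<subseteq> cball uc \<rho>" using u \<delta> C by (intro cball_subset_cball_iff[THEN iffD2]) (auto simp: dist_commute)
   then have "x' \<in> cimg c" using subsetD[OF ball_subset_cball x'(1)] u0(1) by blast
   then have "x' = x" using x'(2) x(1) cmap_cinv[OF c] by metis
   then show ?thesis using x' x by (simp add: s_def)
  qed
  note nv = near[OF vw(1) D(1)] and nw = near[OF vw(2) D(2)]
  have up: "gnorm c u (x - u) <= \<tau> * (1 + 2 * s)" if "(1 - s) * gnorm c u (x - u) <= \<tau>" for x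
  proof -
   have "1 <= (1 + 2 * s) * (1 - s)" using s mult_left_mono[of s "1/2" s] by (simp add: algebra_simps)
   then have "gnorm c u (x - u) <= (1 + 2 * s) * (1 - s) * gnorm c u (x - u)"
    using L.gin_nonneg[OF uc(2)] mult_right_mono[of 1 _ "gnorm c u (x - u)"] by auto
   also have "... <= (1 + 2 * s) * \<tau>" using that s by (simp add: mult.assoc mult_left_mono)
   finally show ?thesis by (simp add: mult.commute)
  qed
  have sq: "gin (G c) u z z = (gnorm c u z)^2" for z using L.gin_nonneg[OF uc(2)] by simp
  have sq_le: "gin (G c) u z z <= y^2" if "gnorm c u z <= y" for z y
   using power_mono[OF that, of 2] L.gin_nonneg[OF uc(2), of z] by simp
  have a: "gin (G c) u (v - u) (v - u) <= (\<tau> * (1 + 2 * s))^2" "gin (G c) u (w - u) (w - u) <= (\<tau> * (1 + 2 * s))^2"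
   using nv nw by (auto intro!: sq_le up)
  have "2 * \<tau> <= (1 + s) * gnorm c u (w - v)"
   unfolding D(3)[symmetric] s_def by (rule U[OF u \<delta>(1,2)]) (use nv nw in auto)
  then have "2 * \<tau> * (1 - s) <= (1 - s) * (1 + s) * gnorm c u (w - v)" using s by (simp add: mult.commute mult_left_mono mult.assoc)
  also have "... <= 1 * gnorm c u (w - v)"
   using L.gin_nonneg[OF uc(2)] by (intro mult_right_mono) (auto simp: algebra_simps)
  finally have "2 * \<tau> * (1 - s) <= gnorm c u (w - v)" by simp
  then have b: "(2 * \<tau> * (1 - s))^2 <= gin (G c) u (w - v) (w - v)"
   using power_mono[of "2 * \<tau> * (1 - s)" "gnorm c u (w - v)" 2] \<tau> s sq[of "w - v"] by simp
  have eqs: "(w - u) + (v - u) = v + w - 2 *\<^sub>R u" "(w - u) - (v - u) = w - v" by (simp_all add: scaleR_2)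
  have "gin (G c) u (v + w - 2 *\<^sub>R u) (v + w - 2 *\<^sub>R u)
    = 2 * gin (G c) u (w - u) (w - u) + 2 * gin (G c) u (v - u) (v - u) - gin (G c) u (w - v) (w - v)"
   using L.gin_parallelogram[OF uc(2), of "w - u" "v - u"] unfolding eqs .
  \<comment> \<open>The leading terms 4 \<tau>^2 cancel. What remains is of order s \<tau>^2 with
    \<open>s\<close> proportional to \<tau>, and the square root of \<tau>^3 is the asserted
    order.\<close>
  also have "... <= 4 * (\<tau> * (1 + 2 * s))^2 - (2 * \<tau> * (1 - s))^2" using a b by linarith
  also have "... = \<tau>^2 * (24 * s + 12 * (s * s))" by (simp add: power2_eq_square algebra_simps)
  also have "... <= \<tau>^2 * (32 * s)" using s mult_left_mono[of s "1/2" s] by (intro mult_left_mono) auto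
  also have "... = 128 * C / m * (\<tau> * sqrt \<tau>)^2" using \<tau> by (simp add: s_def \<delta>_def power_mult_distrib power2_eq_square)
  finally have "gnorm c u (v + w - 2 *\<^sub>R u) <= sqrt (128 * C / m * (\<tau> * sqrt \<tau>)^2)" by simp
  also have "... = sqrt (128 * C / m) * (\<tau> * sqrt \<tau>)" using \<tau> by (simp only: real_sqrt_mult real_sqrt_abs) simp
  finally have "m * norm (v + w - 2 *\<^sub>R u) <= sqrt (128 * C / m) * (\<tau> * sqrt \<tau>)" using m[OF uc(1), of "v + w - 2 *\<^sub>R u"] by linarith
  then show "norm (v + w - 2 *\<^sub>R u) <= K * (\<tau> * sqrt \<tau>)" using C(2) by (simp add: K_def pos_le_divide_eq mult.commute)
 qed
qed

text \<open>The points at parameters s - k, s, s + k are metrically aligned, so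
  \<open>chart_second_difference\<close> controls the second differences in the chart and
  \<open>C1_from_second_difference\<close> applies. The interval extends beyond \<open>t\<close>
  unless t = 1, so that a geodesic can be followed up to its end point.\<close>

theorem geodesic_C1:
 assumes \<gamma>: "!!s t. s \<in> {0..1} ==> t \<in> {0..1} ==> d (\<gamma> s) (\<gamma> t) = r * \<bar>s - t\<bar>"
  and c: "c \<in> A" and t: "0 < t" "t <= 1" "\<gamma> t \<in> cdom c"
 shows "\<exists>a b D. 0 < a & a < t & t <= b & b <= 1 & (t < 1 --> t < b) & \<gamma> ` {a..b} \<subseteq> cdom c &
  continuous_on {a..b} D &
  (\<forall>s\<in>{a..b}. ((%s. cmap c (\<gamma> s)) has_vector_derivative D s) (at s within {a..b}) &
   gin (G c) (cmap c (\<gamma> s)) (D s) (D s) = r^2)"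
proof -
 define x where "x s = cmap c (\<gamma> s)" for s
 have r0: "r >= 0" using \<gamma>[of 0 1] d_nonneg[of "\<gamma> 0" "\<gamma> 1"] by simp
 interpret L: local_metric "cimg c" "G c" by (rule local_metric_chart[OF c])
 define uc where "uc = x t"
 have "\<exists>\<rho>>0. cball (cmap c (\<gamma> t)) \<rho> \<subseteq> cimg c & cinv c ` cball (cmap c (\<gamma> t)) \<rho> \<subseteq> UNIV"
  by (rule cball_in_chart[OF c]) (use t in auto)
 then obtain \<rho> where \<rho>: "0 < \<rho>" "cball uc \<rho> \<subseteq> cimg c" unfolding uc_def x_def by blast
 obtain C m M \<delta>0 where C: "0 <= C" "0 < m" "0 < \<delta>0" "\<delta>0 <= \<rho> / 2" "C * \<delta>0 <= 1/2"
  and m: "!!u w. u \<in> cball uc \<rho> ==> m * norm w <= gnorm c u w"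
  and U: "!!u \<delta> v w. u \<in> cball uc (\<rho>/2) ==> 0 < \<delta> ==> \<delta> <= \<delta>0 ==> v \<in> cball u \<delta> ==> w \<in> cball u \<delta> ==>
   d (cinv c v) (cinv c w) <= (1 + C * \<delta>) * gnorm c u (w - v)"
  and Lo: "!!u \<delta> q. u \<in> cball uc (\<rho>/2) ==> 0 < \<delta> ==> \<delta> <= \<delta>0 ==> d (cinv c u) q < m * \<delta> / 2 ==>
    \<exists>v\<in>ball u \<delta>. q = cinv c v & (1 - C * \<delta>) * gnorm c u (v - u) <= d (cinv c u) q"
  using chart_distance[OF c \<rho>(2,1)] by auto
 obtain K \<tau>0 where K0: "0 < \<tau>0" "\<forall>\<tau> u v w. 0 < \<tau> --> \<tau> <= \<tau>0 --> u \<in> cball uc (\<rho>/2) --> v \<in> cimg c --> w \<in> cimg c -->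
  d (cinv c u) (cinv c v) = \<tau> --> d (cinv c u) (cinv c w) = \<tau> --> d (cinv c v) (cinv c w) = 2 * \<tau> -->
  norm (v + w - 2 *\<^sub>R u) <= K * (\<tau> * sqrt \<tau>)"
  using chart_second_difference[OF c \<rho>(2,1)] by (elim exE conjE) (rule that)
 note K = K0(1) K0(2)[rule_format]
 have uc: "uc \<in> cimg c" "cinv c uc = \<gamma> t" using t c by (auto simp: uc_def x_def)
 have "open (cinv c ` ball uc (\<rho>/2))"
  by (rule open_cinv_image[OF c open_ball]) (use \<rho> in \<open>auto simp: subset_iff\<close>)
 moreover have "\<gamma> t \<in> cinv c ` ball uc (\<rho>/2)" using uc \<rho>(1) by (metis centre_in_ball half_gt_zero imageI)
 ultimately obtain e where e: "e > 0" "!!q. d (\<gamma> t) q < e ==> q \<in> cinv c ` ball uc (\<rho>/2)" using d_near by blast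
 define \<eta> where "\<eta> = e / (r + 1)"
 have \<eta>: "\<eta> > 0" "r * \<eta> < e" using e r0 by (auto simp: \<eta>_def field_simps)
 define h where "h = min (min (\<eta> / 2) (t / 4)) (\<tau>0 / (r + 1))"
 have h: "0 < h" "h <= \<eta> / 2" "h <= t / 4" "h * (r + 1) <= \<tau>0"
 proof -
  have "h <= \<tau>0 / (r + 1)" by (simp add: h_def)
  then show "h * (r + 1) <= \<tau>0" using r0 by (simp add: pos_le_divide_eq)
  have "0 < \<tau>0 / (r + 1)" using K(1) r0 by simp
  then show "0 < h" using \<eta>(1) t(1) by (simp add: h_def)
  show "h <= \<eta> / 2" "h <= t / 4" unfolding h_def by linarith+
 qed
 \<comment> \<open>The regularity lemma gives up a length \<open>h\<close> at the left end; starting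
   at t - 2h leaves \<open>t\<close> above the new left end t - h.\<close>
 define a b where "a = t - 2 * h" and "b = min 1 (t + h)"
 have ab: "0 < a" "a + h < t" "t <= b" "b <= 1" "t < 1 ==> t < b" "b <= t + h"
  using h t by (auto simp: a_def b_def)
 have I01: "s \<in> {0..1}" if "s \<in> {a..b}" for s using that ab by auto
 have near: "\<gamma> s \<in> cinv c ` ball uc (\<rho>/2)" if s: "s \<in> {a..b}" for s
 proof (rule e(2))
  have "\<bar>t - s\<bar> <= \<eta>" using s ab(6) h(1,2) by (auto simp: a_def abs_le_iff)
  then have "r * \<bar>t - s\<bar> <= r * \<eta>" using r0 by (rule mult_left_mono)
  then show "d (\<gamma> t) (\<gamma> s) < e" using \<gamma>[of t s] I01[OF s] t \<eta>(2) by auto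
 qed
 have xs: "x s \<in> ball uc (\<rho>/2)" "cinv c (x s) = \<gamma> s" "\<gamma> s \<in> cdom c" "x s \<in> cimg c" if s: "s \<in> {a..b}" for s
 proof -
  obtain u where u: "u \<in> ball uc (\<rho>/2)" "\<gamma> s = cinv c u" using near[OF s] by blast
  have "u \<in> cball uc \<rho>" using u(1) \<rho>(1) by auto
  then have "u \<in> cimg c" using \<rho>(2) by blast
  then have "x s = u" using u(2) c by (simp add: x_def)
  then show "x s \<in> ball uc (\<rho>/2)" "cinv c (x s) = \<gamma> s" "\<gamma> s \<in> cdom c" "x s \<in> cimg c"
   using u c \<open>u \<in> cimg c\<close> by auto
 qed
 have xc: "x s \<in> cball uc (\<rho>/2)" "x s \<in> cball uc \<rho>" if s: "s \<in> {a..b}" for s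
  using xs(1)[OF s] \<rho>(1) by auto
 have close: "x s' \<in> ball (x s) \<delta> & (1 - C * \<delta>) * gnorm c (x s) (x s' - x s) <= r * \<bar>s - s'\<bar>"
  if s: "s \<in> {a..b}" "s' \<in> {a..b}" and \<delta>: "0 < \<delta>" "\<delta> <= \<delta>0" "r * \<bar>s - s'\<bar> < m * \<delta> / 2" for s s' \<delta>
 proof -
  have ds: "d (cinv c (x s)) (\<gamma> s') = r * \<bar>s - s'\<bar>" using xs(2)[OF s(1)] \<gamma>[OF I01[OF s(1)] I01[OF s(2)]] by simp
  obtain v where v: "v \<in> ball (x s) \<delta>" "\<gamma> s' = cinv c v" "(1 - C * \<delta>) * gnorm c (x s) (v - x s) <= r * \<bar>s - s'\<bar>"
   using Lo[OF xc(1)[OF s(1)] \<delta>(1,2), of "\<gamma> s'"] \<delta>(3) unfolding ds by blast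
  have "cball (x s) \<delta> \<subseteq> cball uc \<rho>"
   using xc(1)[OF s(1)] \<delta> C by (intro cball_subset_cball_iff[THEN iffD2]) (auto simp: dist_commute)
  then have "v \<in> cimg c" using subsetD[OF ball_subset_cball v(1)] \<rho>(2) by blast
  then have "x s' = v" using v(2) c by (simp add: x_def)
  then show ?thesis using v by simp
 qed
 have cx: "continuous_on {a..b} x"
  unfolding continuous_on_iff
 proof (intro ballI allI impI)
  fix s and \<epsilon> :: real assume s: "s \<in> {a..b}" and \<epsilon>: "0 < \<epsilon>"
  define \<delta> where "\<delta> = min \<epsilon> \<delta>0"
  have \<delta>: "0 < \<delta>" "\<delta> <= \<delta>0" "\<delta> <= \<epsilon>" using \<epsilon> C by (auto simp: \<delta>_def)
  show "\<exists>k>0. \<forall>s'\<in>{a..b}. dist s' s < k --> dist (x s') (x s) < \<epsilon>"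
  proof (intro exI[of _ "m * \<delta> / (2 * (r + 1))"] conjI ballI impI)
   show "0 < m * \<delta> / (2 * (r + 1))" using C \<delta> r0 by simp
   fix s' assume s': "s' \<in> {a..b}" "dist s' s < m * \<delta> / (2 * (r + 1))"
   then have "\<bar>s - s'\<bar> * (2 * (r + 1)) < m * \<delta>" using r0 by (simp add: dist_real_def pos_less_divide_eq abs_minus_commute)
   moreover have "r * y < z / 2" if "y * (2 * (r + 1)) < z" "0 <= y" for y z :: real
    using that by (simp add: algebra_simps)
   ultimately have "r * \<bar>s - s'\<bar> < m * \<delta> / 2" by simp
   from close[OF s s'(1) \<delta>(1,2) this] show "dist (x s') (x s) < \<epsilon>" using \<delta>(3) by (simp add: dist_commute)
  qed
 qed
 have sd: "norm (x (s + k) + x (s - k) - 2 *\<^sub>R x s) <= (\<bar>K\<bar> * (r * sqrt r)) * (k * sqrt k)"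
  if k: "a <= s - k" "s + k <= b" "0 < k" "k <= h" for s k
 proof (cases "r = 0")
  case True
  have "\<gamma> u = \<gamma> s" if "u \<in> {a..b}" for u
  proof -
   have "s \<in> {a..b}" using k by auto
   then have "d (\<gamma> u) (\<gamma> s) = 0" unfolding \<gamma>[OF I01[OF that] I01[OF \<open>s \<in> {a..b}\<close>]] True by simp
   then show ?thesis using MS.zero by auto
  qed
  from this[of "s + k"] this[of "s - k"] show ?thesis using k by (simp add: x_def scaleR_2 True)
 next
  case False
  have i: "s \<in> {a..b}" "s + k \<in> {a..b}" "s - k \<in> {a..b}" using k by auto
  have "norm (x (s + k) + x (s - k) - 2 *\<^sub>R x s) <= K * ((r * k) * sqrt (r * k))"
  proof (rule K(2))
   show "0 < r * k" using False r0 k by simp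
   have "r * k <= (r + 1) * h" using r0 k by (intro mult_mono) auto
   then show "r * k <= \<tau>0" using h(4) by (simp add: mult.commute)
   show "d (cinv c (x s)) (cinv c (x (s + k))) = r * k" "d (cinv c (x s)) (cinv c (x (s - k))) = r * k"
    "d (cinv c (x (s + k))) (cinv c (x (s - k))) = 2 * (r * k)"
    unfolding xs(2)[OF i(1)] xs(2)[OF i(2)] xs(2)[OF i(3)]
     \<gamma>[OF I01[OF i(1)] I01[OF i(2)]] \<gamma>[OF I01[OF i(1)] I01[OF i(3)]] \<gamma>[OF I01[OF i(2)] I01[OF i(3)]]
    using k by simp_all
  qed (rule xc(1)[OF i(1)] xs(4)[OF i(2)] xs(4)[OF i(3)])+
  also have "... = K * (r * sqrt r) * (k * sqrt k)" by (simp add: real_sqrt_mult)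
  also have "... <= \<bar>K\<bar> * (r * sqrt r) * (k * sqrt k)" using r0 k by (intro mult_right_mono) auto
  finally show ?thesis .
 qed
 have "a + h < b" using ab by linarith
 from C1_from_second_difference[OF cx h(1) this sd]
 obtain D where D: "continuous_on {a+h..b} D" "!!s. s \<in> {a+h..b} ==> (x has_vector_derivative D s) (at s within {a+h..b})"
  by blast
 let ?I = "{a+h..b}"
 have sub: "s \<in> ?I ==> s \<in> {a..b}" for s using h(1) by auto
 have "gin (G c) (x s) (D s) (D s) = r^2" if s: "s \<in> ?I" for s
 proof -
  let ?F = "at s within ?I"
  have F: "?F ~= bot" using s \<open>a + h < b\<close> by (simp add: trivial_limit_within islimpt_Icc)
  let ?q = "%y. (x y - x s) /\<^sub>R (y - s)"
  have "(?q \<longlongrightarrow> D s) ?F" by (rule has_vector_derivative_quotient[OF D(2)[OF s]])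
  then have lim: "((%y. gnorm c (x s) (?q y)) \<longlongrightarrow> gnorm c (x s) (D s)) ?F"
   unfolding gin_sum by (intro tendsto_intros)
  \<comment> \<open>A radius proportional to the parameter difference and large enough for the ball
    about \<open>x s\<close> to contain \<open>x y\<close>. The distortion factors 1 - C \<delta>
    and 1 + C \<delta> then tend to 1, which yields the speed.\<close>
  define \<delta> where "\<delta> y = 4 * (r + 1) * \<bar>y - s\<bar> / m" for y
  have d0: "(\<delta> \<longlongrightarrow> 0) ?F"
   unfolding \<delta>_def by (rule tendsto_eq_intros refl | simp)+ (use C in auto)
  have ev: "\<forall>\<^sub>F y in ?F. (1 - C * \<delta> y) * gnorm c (x s) (?q y) <= r & r <= (1 + C * \<delta> y) * gnorm c (x s) (?q y)"
  proof -
   have "\<forall>\<^sub>F y in ?F. y \<in> ?I & y ~= s & \<delta> y < \<delta>0"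
    using order_tendstoD(2)[OF d0 C(3)] by (auto simp: eventually_at_filter elim: eventually_mono)
   then show ?thesis
   proof eventually_elim
    case (elim y)
    have y: "y \<in> {a..b}" "s \<in> {a..b}" using elim sub s by auto
    have ys: "\<bar>y - s\<bar> > 0" using elim by simp
    have \<delta>y: "0 < \<delta> y" "\<delta> y <= \<delta>0" using ys C r0 elim by (auto simp: \<delta>_def)
    have "m * \<delta> y / 2 = 2 * (r + 1) * \<bar>y - s\<bar>" using C by (simp add: \<delta>_def)
    moreover have "r * \<bar>y - s\<bar> < 2 * (r + 1) * \<bar>y - s\<bar>" using ys r0 by (intro mult_strict_right_mono) auto
    ultimately have lt: "r * \<bar>s - y\<bar> < m * \<delta> y / 2" by (simp add: abs_minus_commute)
    note cl = close[OF y(2,1) \<delta>y lt]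
    have g: "gnorm c (x s) (?q y) = gnorm c (x s) (x y - x s) / \<bar>y - s\<bar>"
     by (simp add: gin_scale1 gin_scale2 real_sqrt_mult divide_inverse)
    have "d (cinv c (x s)) (cinv c (x y)) <= (1 + C * \<delta> y) * gnorm c (x s) (x y - x s)"
     by (rule U[OF xc(1)[OF y(2)] \<delta>y]) (use cl \<delta>y in auto)
    then have "r * \<bar>y - s\<bar> <= (1 + C * \<delta> y) * gnorm c (x s) (x y - x s)"
     using xs(2)[OF y(1)] xs(2)[OF y(2)] \<gamma>[OF I01[OF y(2)] I01[OF y(1)]] by (simp add: abs_minus_commute)
    then show ?case unfolding g using cl ys by (simp add: pos_divide_le_eq pos_le_divide_eq abs_minus_commute)
   qed
  qed
  have l1: "((%y. (1 - C * \<delta> y) * gnorm c (x s) (?q y)) \<longlongrightarrow> (1 - C * 0) * gnorm c (x s) (D s)) ?F"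
   by (intro tendsto_intros d0 lim)
  have l2: "((%y. (1 + C * \<delta> y) * gnorm c (x s) (?q y)) \<longlongrightarrow> (1 + C * 0) * gnorm c (x s) (D s)) ?F"
   by (intro tendsto_intros d0 lim)
  have "(1 - C * 0) * gnorm c (x s) (D s) <= r"
   by (rule tendsto_upperbound[OF l1 _ F]) (rule eventually_mono[OF ev], blast)
  moreover have "r <= (1 + C * 0) * gnorm c (x s) (D s)"
   by (rule tendsto_lowerbound[OF l2 _ F]) (rule eventually_mono[OF ev], blast)
  ultimately have "gnorm c (x s) (D s) = r" by simp
  then show ?thesis using L.gin_nonneg[OF xs(4)[OF sub[OF s]]] by (metis real_sqrt_pow2)
 qed
 then show ?thesis
  using D ab h(1) xs(3) sub unfolding x_def
  by (intro exI[of _ "a + h"] exI[of _ b] exI[of _ D]) (auto simp: )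
qed

end

section \<open>Parallel frames\<close>

text \<open>Picard iteration written as a series: the terms \<open>T k\<close> are iterated
  integrals and decay like 2^(-k) because K (b - a) <= 1/2. Only such short intervals occur, since
  frames are transported in small steps.\<close>

lemma linear_ode:
 fixes L :: "real => 'b::euclidean_space => 'b"
 assumes ab: "a <= b" and lin: "!!t. linear (L t)"
  and K: "!!t v. t \<in> {a..b} ==> norm (L t v) <= K * norm v" "0 <= K" "K * (b - a) <= 1/2"
  and cont: "!!z. continuous_on {a..b} z ==> continuous_on {a..b} (%t. L t (z t))"
 shows "\<exists>y. y a = y0 & (\<forall>t\<in>{a..b}. (y has_vector_derivative L t (y t)) (at t within {a..b}))"
proof -
 define T where "T = rec_nat (%t. y0) (%_ f t. integral {a..t} (%s. L s (f s)))"
 have T0: "T 0 = (%t. y0)" and TS: "T (Suc k) = (%t. integral {a..t} (%s. L s (T k s)))" for k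
  by (simp_all add: T_def)
 have int: "(%s. L s (z s)) integrable_on {a..t}" if "continuous_on {a..b} z" "t \<in> {a..b}" for z t
  by (rule integrable_continuous_interval[OF continuous_on_subset[OF cont[OF that(1)]]]) (use that in auto)
 have bound: "norm (integral {a..t} (%s. L s (z s))) <= B / 2"
  if z: "continuous_on {a..b} z" and t: "t \<in> {a..b}" and B: "!!s. s \<in> {a..b} ==> norm (z s) <= B" for z t B
 proof -
  have B0: "0 <= B" using order_trans[OF norm_ge_zero B[of a]] ab by simp
  have "norm (integral {a..t} (%s. L s (z s))) <= (K * B) * (t - a)"
  proof (rule integral_bound)
   show "continuous_on {a..t} (%s. L s (z s))" by (rule continuous_on_subset[OF cont[OF z]]) (use t in auto)
   fix s assume s: "s \<in> {a..t}"
   then have s': "s \<in> {a..b}" using t by auto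
   show "norm (L s (z s)) <= K * B"
    by (rule order_trans[OF K(1)[OF s'] mult_left_mono[OF B[OF s'] K(2)]])
  qed (use t in auto)
  also have "... <= (K * B) * (b - a)" using t K(2) B0 by (intro mult_left_mono) auto
  also have "... = (K * (b - a)) * B" by simp
  also have "... <= 1/2 * B" by (rule mult_right_mono[OF K(3) B0])
  finally show ?thesis by simp
 qed
 have cT: "continuous_on {a..b} (T k)" for k
 proof (induction k)
  case (Suc k)
  show ?case unfolding TS by (rule indefinite_integral_continuous_1[OF int[OF Suc]]) (use ab in auto)
 qed (simp add: T0)
 have bT: "t \<in> {a..b} ==> norm (T k t) <= norm y0 * (1/2) ^ k" for k t
 proof (induction k arbitrary: t)
  case (Suc k)
  show ?case unfolding TS using bound[OF cT Suc.prems Suc.IH] by simp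
 qed (simp add: T0)
 define S where "S n t = (\<Sum>k<n. T k t)" for n t
 define y where "y t = (\<Sum>k. T k t)" for t
 have "summable (%k. norm y0 * (1/2) ^ k)" by (intro summable_mult summable_geometric) simp
 from Weierstrass_m_test[OF bT this]
 have ul: "uniform_limit {a..b} S y sequentially" unfolding S_def[abs_def] y_def[abs_def] .
 have cS: "continuous_on {a..b} (S n)" for n unfolding S_def by (intro continuous_on_sum cT)
 have cy: "continuous_on {a..b} y" by (rule uniform_limit_theorem[OF _ ul]) (use cS in auto)
 have S_Suc: "S (Suc n) t = y0 + integral {a..t} (%s. L s (S n s))" if t: "t \<in> {a..b}" for n t
 proof -
  have "S (Suc n) t = y0 + (\<Sum>k<n. integral {a..t} (%s. L s (T k s)))"
   unfolding S_def sum.lessThan_Suc_shift T0 TS by simp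
  also have "(\<Sum>k<n. integral {a..t} (%s. L s (T k s))) = integral {a..t} (%s. \<Sum>k<n. L s (T k s))"
   by (rule integral_sum[symmetric]) (auto intro: int[OF cT t])
  also have "(%s. \<Sum>k<n. L s (T k s)) = (%s. L s (S n s))"
   by (simp add: S_def linear_sum[OF lin])
  finally show ?thesis .
 qed
 have ye: "y t = y0 + integral {a..t} (%s. L s (y s))" if t: "t \<in> {a..b}" for t
 proof -
  have "norm (y t - (y0 + integral {a..t} (%s. L s (y s)))) <= 0"
  proof (rule field_le_epsilon)
   fix e :: real assume e: "0 < e"
   have "\<forall>\<^sub>F n in sequentially. \<forall>s\<in>{a..b}. dist (S n s) (y s) < e / 2" by (rule uniform_limitD[OF ul]) (use e in simp)
   then obtain n where n: "!!m s. m >= n ==> s \<in> {a..b} ==> norm (S m s - y s) < e / 2"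
    unfolding eventually_sequentially dist_norm by blast
   have "integral {a..t} (%s. L s (S n s)) - integral {a..t} (%s. L s (y s)) = integral {a..t} (%s. L s (S n s - y s))"
    unfolding linear_diff[OF lin] by (rule Henstock_Kurzweil_Integration.integral_diff[symmetric]; rule int[OF _ t]; rule cS cy)
   moreover have "norm (integral {a..t} (%s. L s (S n s - y s))) <= (e / 2) / 2"
    by (rule bound[OF _ t]) (use n[of n] cS cy in \<open>auto intro!: continuous_intros less_imp_le\<close>)
   ultimately have 1: "norm (integral {a..t} (%s. L s (S n s)) - integral {a..t} (%s. L s (y s))) <= e / 4" by simp
   define P Q where "P = integral {a..t} (%s. L s (S n s)) - integral {a..t} (%s. L s (y s))" and "Q = S (Suc n) t - y t"
   have "y t - (y0 + integral {a..t} (%s. L s (y s))) = P - Q"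
    unfolding P_def Q_def S_Suc[OF t] by simp
   then have "norm (y t - (y0 + integral {a..t} (%s. L s (y s)))) <= e / 4 + norm (S (Suc n) t - y t)"
    using norm_triangle_ineq4[of P Q] 1[folded P_def] unfolding Q_def[symmetric] by simp
   then show "norm (y t - (y0 + integral {a..t} (%s. L s (y s)))) <= 0 + e"
    using n[of "Suc n" t] t e by auto
  qed
  then show ?thesis by simp
 qed
 have "(y has_vector_derivative L t (y t)) (at t within {a..b})" if t: "t \<in> {a..b}" for t
 proof -
  have "((%t. y0 + integral {a..t} (%s. L s (y s))) has_vector_derivative 0 + L t (y t)) (at t within {a..b})"
   by (intro has_vector_derivative_add has_vector_derivative_const integral_has_vector_derivative cont cy t)
  then have "((%t. y0 + integral {a..t} (%s. L s (y s))) has_vector_derivative L t (y t)) (at t within {a..b})" by simp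
  then show ?thesis by (rule has_vector_derivative_transform[OF t, rotated]) (rule ye)
 qed
 moreover have "y a = y0" using ye[of a] ab by simp
 ultimately show ?thesis by blast
qed

lemma continuous_on_smooth_compose:
 "Cinf_on U f ==> continuous_on I x ==> x ` I \<subseteq> U ==> continuous_on I (%t. f (x t))"
 using continuous_on_compose2 Cinf_on_continuous by blast

lemma continuous_on_bil:
 assumes "!!i j. Cinf_on U (c i j)" "continuous_on I x" "x ` I \<subseteq> U" "continuous_on I a" "continuous_on I b"
 shows "continuous_on I (%t. bil c (x t) (a t) (b t))"
 unfolding bil_def
 by (intro continuous_on_sum continuous_on_mult continuous_on_component
   continuous_on_smooth_compose[OF assms(1)] assms(2-5))

context local_metric
begin

lemma continuous_on_Gam:
 assumes "continuous_on I x" "x ` I \<subseteq> U" "continuous_on I a" "continuous_on I b"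
 shows "continuous_on I (%t. Gam G (x t) (a t) (b t))"
 unfolding Gam_def by (intro continuous_on_vec_lambda continuous_on_bil[OF smooth_christoffel] assms)

lemma Gam_bound:
 assumes "compact I" "continuous_on I x" "x ` I \<subseteq> U" "continuous_on I v"
 shows "\<exists>K\<ge>0. \<forall>t\<in>I. \<forall>w. norm (Gam G (x t) (v t) w) <= K * norm w"
proof -
 have "\<exists>B\<ge>0. \<forall>t\<in>I. norm (Gam G (x t) (v t) (axis k 1)) <= B" for k
 proof -
  have "bdd I (%t. Gam G (x t) (v t) (axis k 1))"
   by (intro bdd_continuous continuous_on_Gam assms continuous_on_const)
  then show ?thesis unfolding bdd_def .
 qed
 then obtain B where B: "!!k. B k >= 0" "!!k t. t \<in> I ==> norm (Gam G (x t) (v t) (axis k 1)) <= B k" by metis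
 have "norm (Gam G (x t) (v t) w) <= (SU k. B k) * norm w" if t: "t \<in> I" for t w
 proof -
  have "linear (Gam G (x t) (v t))" by (intro linearI Gam_add2 Gam_scale2)
  from linear_axis_expand[OF this] have "Gam G (x t) (v t) w = (SU k. w $ k *\<^sub>R Gam G (x t) (v t) (axis k 1))" .
  also have "norm ... <= (SU k. norm w * B k)"
  proof (rule order_trans[OF norm_sum], rule sum_mono)
   fix k show "norm (w $ k *\<^sub>R Gam G (x t) (v t) (axis k 1)) <= norm w * B k"
    unfolding norm_scaleR by (intro mult_mono component_le_norm_cart B t) auto
  qed
  also have "... = (SU k. B k) * norm w" by (simp add: sum_distrib_left mult.commute)
  finally show ?thesis .
 qed
 moreover have "0 <= (SU k. B k)" by (intro sum_nonneg B)
 ultimately show ?thesis by blast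
qed

text \<open>By metric compatibility the inner products of parallel fields have derivative zero, so
  orthonormality is transported along with the fields.\<close>

lemma parallel_frame:
 assumes ab: "a <= b" and x: "!!t. t \<in> {a..b} ==> (x has_vector_derivative v t) (at t within {a..b})"
  and im: "x ` {a..b} \<subseteq> U" and v: "continuous_on {a..b} v"
  and K: "!!t w. t \<in> {a..b} ==> norm (Gam G (x t) (v t) w) <= K * norm w" "0 <= K" "K * (b - a) <= 1/2"
  and E0: "onb G (x a) E0"
 shows "\<exists>E. E a = E0 & (\<forall>t\<in>{a..b}. onb G (x t) (E t) &
  (\<forall>i. ((%t. E t i) has_vector_derivative - Gam G (x t) (v t) (E t i)) (at t within {a..b})))"
proof -
 have cx: "continuous_on {a..b} x" by (rule continuous_on_vector_derivative[OF x])
 have "\<exists>y. y a = y0 & (\<forall>t\<in>{a..b}. (y has_vector_derivative - Gam G (x t) (v t) (y t)) (at t within {a..b}))" for y0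
 proof (rule linear_ode[OF ab _ _ K(2,3)])
  show "linear (%w. - Gam G (x t) (v t) w)" for t by (intro linearI) (simp_all add: Gam_add2 Gam_scale2)
  show "norm (- Gam G (x t) (v t) w) <= K * norm w" if "t \<in> {a..b}" for t w using K(1)[OF that] by simp
  show "continuous_on {a..b} (%t. - Gam G (x t) (v t) (z t))" if "continuous_on {a..b} z" for z
   by (intro continuous_on_minus continuous_on_Gam cx im v that)
 qed
 then have "\<exists>y. y a = E0 i & (\<forall>t\<in>{a..b}. (y has_vector_derivative - Gam G (x t) (v t) (y t)) (at t within {a..b}))" for i by blast
 then obtain F where F: "!!i. F i a = E0 i"
  "!!i t. t \<in> {a..b} ==> (F i has_vector_derivative - Gam G (x t) (v t) (F i t)) (at t within {a..b})" by metis
 have "gin G (x t) (F i t) (F j t) = gin G (x a) (F i a) (F j a)" if t: "t \<in> {a..b}" for i j t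
 proof (rule has_derivative_zero_unique[where f = "%t. gin G (x t) (F i t) (F j t)"])
  fix s assume s: "s \<in> {a..b}"
  have xs: "x s \<in> U" using im s by auto
  have "((%t. gin G (x t) (F i t) (F j t)) has_derivative
   (%h. dgin G (x s) (h *\<^sub>R v s) (F i s) (F j s) + gin G (x s) (h *\<^sub>R - Gam G (x s) (v s) (F i s)) (F j s)
    + gin G (x s) (F i s) (h *\<^sub>R - Gam G (x s) (v s) (F j s)))) (at s within {a..b})"
   by (rule gin_has_derivative[where x = x and t = s, OF xs]) (use x[OF s] F(2)[OF s] in \<open>auto simp: has_vector_derivative_def\<close>)
  then show "((%t. gin G (x t) (F i t) (F j t)) has_derivative (%h. 0)) (at s within {a..b})"
   by (rule has_derivative_eq_rhs)
    (simp add: fun_eq_iff compat[OF xs] gin_minus1 gin_minus2 gin_scale1 gin_scale2 Gam_scale1)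
 qed (use ab t in auto)
 then have "onb G (x t) (%i. F i t)" if "t \<in> {a..b}" for t
  using E0 that F(1) unfolding onb_def by simp
 moreover have "(%i. F i a) = E0" using F(1) by auto
 ultimately show ?thesis using F(2) by (intro exI[of _ "%t i. F i t"]) auto
qed

end

section \<open>Uniform expansions of second order\<close>

definition usmall :: "'c set => (real => 'c => 'b::real_normed_vector) => bool" where
 "usmall I e \<longleftrightarrow> (\<forall>\<epsilon>>0. \<forall>\<^sub>F s in nhds 0. \<forall>t\<in>I. norm (e s t) <= \<epsilon> * s^2)"

text \<open>A second order expansion at s = 0 with remainder o(s^2), uniform in \<open>t\<close>, of
  a function that need not be differentiable in \<open>s\<close>. Such expansions pass through sums,
  products and smooth maps, and second derivative tests need no more.\<close>

definition uj :: "'c set => (real => 'c => 'b::real_normed_vector) => ('c => 'b) => ('c => 'b) => ('c => 'b) => bool" where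
 "uj I f f0 f1 f2 \<longleftrightarrow> bdd I f0 & bdd I f1 & bdd I f2 &
  usmall I (%s t. f s t - (f0 t + s *\<^sub>R f1 t + (s^2 / 2) *\<^sub>R f2 t))"

lemma eventually_small: "0 < e ==> \<forall>\<^sub>F s in nhds (0::real). \<bar>s\<bar> <= e"
 unfolding eventually_nhds_metric by (rule exI[of _ e]) auto

lemma usmallD: "usmall I e ==> 0 < \<epsilon> ==> \<forall>\<^sub>F s in nhds 0. \<forall>t\<in>I. norm (e s t) <= \<epsilon> * s^2"
 unfolding usmall_def by blast

lemma usmall_add: assumes "usmall I e" "usmall I f" shows "usmall I (%s t. e s t + f s t)"
 unfolding usmall_def
proof (intro allI impI)
 fix \<epsilon> :: real assume "0 < \<epsilon>"
 then have e: "0 < \<epsilon> / 2" by simp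
 from usmallD[OF assms(1) e] usmallD[OF assms(2) e]
 show "\<forall>\<^sub>F s in nhds 0. \<forall>t\<in>I. norm (e s t + f s t) <= \<epsilon> * s^2"
 proof eventually_elim
  case (elim s)
  show ?case
  proof
   fix t assume t: "t \<in> I"
   have "norm (e s t + f s t) <= \<epsilon> / 2 * s^2 + \<epsilon> / 2 * s^2"
    by (rule norm_triangle_le[OF add_mono]) (use elim t in auto)
   then show "norm (e s t + f s t) <= \<epsilon> * s^2" by simp
  qed
 qed
qed

lemma usmall_le:
 assumes "usmall I e" "0 <= C" "\<forall>\<^sub>F s in nhds 0. \<forall>t\<in>I. norm (f s t) <= C * norm (e s t)"
 shows "usmall I f"
 unfolding usmall_def
proof (intro allI impI)
 fix \<epsilon> :: real assume "0 < \<epsilon>"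
 then have e: "0 < \<epsilon> / (C + 1)" using assms(2) by simp
 from usmallD[OF assms(1) e] assms(3)
 show "\<forall>\<^sub>F s in nhds 0. \<forall>t\<in>I. norm (f s t) <= \<epsilon> * s^2"
 proof eventually_elim
  case (elim s)
  show ?case
  proof
   fix t assume t: "t \<in> I"
   have "norm (f s t) <= C * norm (e s t)" using elim t by blast
   also have "... <= (C + 1) * norm (e s t)" by (simp add: mult_right_mono)
   also have "... <= (C + 1) * (\<epsilon> / (C + 1) * s^2)" using elim t assms(2) by (intro mult_left_mono) auto
   also have "... = \<epsilon> * s^2" using assms(2) by simp
   finally show "norm (f s t) <= \<epsilon> * s^2" .
  qed
 qed
qed

lemma usmall_cube:
 assumes "0 <= C" "\<forall>\<^sub>F s in nhds 0. \<forall>t\<in>I. norm (f s t) <= C * \<bar>s\<bar> ^ 3"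
 shows "usmall I f"
 unfolding usmall_def
proof (intro allI impI)
 fix \<epsilon> :: real assume "0 < \<epsilon>"
 then have e: "0 < \<epsilon> / (C + 1)" using assms(1) by simp
 from eventually_small[OF e] assms(2)
 show "\<forall>\<^sub>F s in nhds 0. \<forall>t\<in>I. norm (f s t) <= \<epsilon> * s^2"
 proof eventually_elim
  case (elim s)
  have "\<bar>s\<bar> * (C + 1) <= \<epsilon>" using elim(1) assms(1) by (simp add: pos_le_divide_eq)
  moreover have "C * \<bar>s\<bar> <= \<bar>s\<bar> * (C + 1)" by (simp add: algebra_simps)
  ultimately have "C * \<bar>s\<bar> * s^2 <= \<epsilon> * s^2" by (intro mult_right_mono) auto
  moreover have "\<bar>s\<bar> ^ 3 = \<bar>s\<bar> * s^2" by (simp add: power3_eq_cube power2_eq_square)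
  ultimately show ?case using elim(2) by (fastforce simp: mult.assoc)
 qed
qed

lemma usmall_cong: "usmall I e ==> (!!s t. t \<in> I ==> e s t = f s t) ==> usmall I f"
 unfolding usmall_def by simp

lemma usmall_eq: "usmall I e ==> (\<forall>\<^sub>F s in nhds 0. \<forall>t\<in>I. f s t = e s t) ==> usmall I f"
 by (rule usmall_le[of I e 1]) (auto elim: eventually_mono)

lemma bdd_add: "bdd I f ==> bdd I h ==> bdd I (%t. f t + h t)"
proof -
 assume "bdd I f" "bdd I h"
 then obtain B C where "B >= 0" "\<forall>t\<in>I. norm (f t) <= B" "C >= 0" "\<forall>t\<in>I. norm (h t) <= C" unfolding bdd_def by blast
 then show ?thesis unfolding bdd_def by (intro exI[of _ "B + C"]) (auto intro!: norm_triangle_le add_mono)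
qed

lemma bdd_mult: "bdd I f ==> bdd I h ==> bdd I (%t. f t * h t :: real)"
proof -
 assume "bdd I f" "bdd I h"
 then obtain B C where "B >= 0" "\<forall>t\<in>I. norm (f t) <= B" "C >= 0" "\<forall>t\<in>I. norm (h t) <= C" unfolding bdd_def by blast
 then show ?thesis unfolding bdd_def by (intro exI[of _ "B * C"]) (auto simp: abs_mult intro!: mult_mono)
qed

lemma bdd_const: "bdd I (%t. c)"
 unfolding bdd_def by (intro exI[of _ "norm c"]) auto

lemma uj_add:
 assumes "uj I f f0 f1 f2" "uj I h h0 h1 h2"
 shows "uj I (%s t. f s t + h s t) (%t. f0 t + h0 t) (%t. f1 t + h1 t) (%t. f2 t + h2 t)"
 unfolding uj_def
proof (intro conjI)
 show "usmall I (%s t. f s t + h s t - (f0 t + h0 t + s *\<^sub>R (f1 t + h1 t) + (s^2 / 2) *\<^sub>R (f2 t + h2 t)))"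
  by (rule usmall_cong[OF usmall_add[OF assms(1)[unfolded uj_def, THEN conjunct2, THEN conjunct2, THEN conjunct2]
    assms(2)[unfolded uj_def, THEN conjunct2, THEN conjunct2, THEN conjunct2]]]) (simp add: scaleR_add_right)
qed (use assms in \<open>auto simp: uj_def intro!: bdd_add\<close>)

lemma uj_const: "bdd I f ==> uj I (%s t. f t) f (%t. 0) (%t. 0)"
 unfolding uj_def usmall_def by (simp add: bdd_const)

lemma uj_sum:
 "(!!i. i \<in> S ==> uj I (f i) (f0 i) (f1 i) (f2 i)) ==>
  uj I (%s t. \<Sum>i\<in>S. f i s t) (%t. \<Sum>i\<in>S. f0 i t) (%t. \<Sum>i\<in>S. f1 i t) (%t. \<Sum>i\<in>S. f2 i t)"
proof (induction S rule: infinite_finite_induct)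
 case (insert i S)
 then show ?case by (simp add: uj_add)
qed (simp_all add: uj_const bdd_const)

definition evb :: "'c set => (real => 'c => real) => bool" where
 "evb I f \<longleftrightarrow> (\<exists>B\<ge>0. \<forall>\<^sub>F s in nhds 0. \<forall>t\<in>I. \<bar>f s t\<bar> <= B)"

lemma evbE:
 assumes "evb I f"
 obtains B where "B >= 0" "\<forall>\<^sub>F s in nhds 0. \<forall>t\<in>I. \<bar>f s t\<bar> <= B"
 using assms unfolding evb_def by blast

lemma evb_s: "evb I (%s t. s)"
 unfolding evb_def using eventually_small[OF zero_less_one] by (intro exI[of _ 1]) (simp add: eventually_mono)

lemma evb_bdd: "bdd I f ==> evb I (%s. f)"
 unfolding bdd_def evb_def by auto

lemma evb_usmall: "usmall I e ==> evb I e"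
proof -
 assume "usmall I e"
 from usmallD[OF this zero_less_one] eventually_small[OF zero_less_one]
 have "\<forall>\<^sub>F s in nhds 0. \<forall>t\<in>I. \<bar>e s t\<bar> <= 1"
 proof eventually_elim
  case (elim s)
  have "s^2 <= 1" using elim(2) abs_square_le_1 by blast
  then show ?case using elim(1) by force
 qed
 then show ?thesis unfolding evb_def by (intro exI[of _ 1]) simp
qed

lemma evb_add: assumes "evb I f" "evb I h" shows "evb I (%s t. f s t + h s t)"
proof -
 obtain B C where BC: "B >= 0" "C >= 0" and b: "\<forall>\<^sub>F s in nhds 0. \<forall>t\<in>I. \<bar>f s t\<bar> <= B" "\<forall>\<^sub>F s in nhds 0. \<forall>t\<in>I. \<bar>h s t\<bar> <= C"
  using assms by (elim evbE)
 from b have "\<forall>\<^sub>F s in nhds 0. \<forall>t\<in>I. \<bar>f s t + h s t\<bar> <= B + C"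
  by eventually_elim (auto intro!: order_trans[OF abs_triangle_ineq] add_mono)
 then show ?thesis unfolding evb_def using BC by (intro exI[of _ "B + C"]) simp
qed

lemma evb_mult: assumes "evb I f" "evb I h" shows "evb I (%s t. f s t * h s t)"
proof -
 obtain B C where BC: "B >= 0" "C >= 0" and b: "\<forall>\<^sub>F s in nhds 0. \<forall>t\<in>I. \<bar>f s t\<bar> <= B" "\<forall>\<^sub>F s in nhds 0. \<forall>t\<in>I. \<bar>h s t\<bar> <= C"
  using assms by (elim evbE)
 from b have "\<forall>\<^sub>F s in nhds 0. \<forall>t\<in>I. \<bar>f s t * h s t\<bar> <= B * C"
  by eventually_elim (use BC in \<open>auto simp: abs_mult intro!: mult_mono\<close>)
 then show ?thesis unfolding evb_def using BC by (intro exI[of _ "B * C"]) simp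
qed

lemma usmall_mult:
 assumes "evb I f" "usmall I e"
 shows "usmall I (%s t. f s t * e s t :: real)"
proof -
 obtain B where B: "B >= 0" "\<forall>\<^sub>F s in nhds 0. \<forall>t\<in>I. \<bar>f s t\<bar> <= B" using assms(1) by (rule evbE)
 from B(2) have "\<forall>\<^sub>F s in nhds 0. \<forall>t\<in>I. norm (f s t * e s t) <= B * norm (e s t)"
  by eventually_elim (auto simp: abs_mult intro!: mult_right_mono)
 then show ?thesis by (rule usmall_le[OF assms(2) B(1)])
qed

lemma usmall_cubic:
 assumes "evb I f"
 shows "usmall I (%s t. f s t * s ^ 3)"
proof -
 obtain B where B: "B >= 0" "\<forall>\<^sub>F s in nhds 0. \<forall>t\<in>I. \<bar>f s t\<bar> <= B" using assms by (rule evbE)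
 from B(2) have "\<forall>\<^sub>F s in nhds 0. \<forall>t\<in>I. norm (f s t * s ^ 3) <= B * \<bar>s\<bar> ^ 3"
  by eventually_elim (auto simp: abs_mult power_abs intro!: mult_right_mono)
 then show ?thesis by (rule usmall_cube[OF B(1)])
qed

lemma uj_mult:
 fixes f h :: "real => 'c => real"
 assumes f: "uj I f f0 f1 f2" and h: "uj I h h0 h1 h2"
 shows "uj I (%s t. f s t * h s t) (%t. f0 t * h0 t) (%t. f0 t * h1 t + f1 t * h0 t)
  (%t. f0 t * h2 t + 2 * (f1 t * h1 t) + f2 t * h0 t)"
proof -
 let ?p = "%s t. f0 t + s * f1 t + s * s * f2 t * (1/2)" and ?q = "%s t. h0 t + s * h1 t + s * s * h2 t * (1/2)"
 have b: "bdd I f0" "bdd I f1" "bdd I f2" "bdd I h0" "bdd I h1" "bdd I h2"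
  and u: "usmall I (%s t. f s t - ?p s t)" "usmall I (%s t. h s t - ?q s t)"
  using f h by (simp_all add: uj_def power2_eq_square)
 note ev = evb_add evb_mult evb_bdd evb_s bdd_const b
 have p: "evb I ?p" and q: "evb I ?q" by (intro ev)+
 have f': "evb I (%s t. (f s t - ?p s t) + ?p s t)" by (intro evb_add evb_usmall u p)
 \<comment> \<open>With p and q the quadratic parts, f h - p q = f (h - q) + q (f - p), and p q
   differs from its own second order part by terms that contain s^3.\<close>
 have "usmall I (%s t. f s t * h s t - (f0 t * h0 t + s * (f0 t * h1 t + f1 t * h0 t)
  + s^2 / 2 * (f0 t * h2 t + 2 * (f1 t * h1 t) + f2 t * h0 t)))"
  by (rule usmall_cong[OF usmall_add[OF usmall_add[OF usmall_mult[OF f' u(2)] usmall_mult[OF q u(1)]]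
     usmall_cubic[where f = "%s t. (f1 t * h2 t + f2 t * h1 t) * (1/2) + s * (f2 t * h2 t) * (1/4)"]]])
   (intro ev, simp add: power2_eq_square power3_eq_cube algebra_simps)
 then show ?thesis unfolding uj_def using b by (simp add: bdd_add bdd_mult bdd_const)
qed

lemma dir2_diff_bound:
 fixes f :: "real^'n::finite => real"
 assumes f: "Cinf_on U f" "open U" and K: "compact K" "K \<subseteq> U"
 shows "\<exists>B\<ge>0. \<forall>u\<in>K. \<forall>h k. \<bar>dir2 f u h - dir2 f u k\<bar> <= B * ((norm h + norm k) * norm (h - k))"
proof -
 have "\<exists>B\<ge>0. \<forall>u\<in>K. norm (pd l (pd k f) u) <= B" for k l
  using bdd_continuous[OF K(1) continuous_on_subset[OF Cinf_on_continuous[OF Cinf_on_pd[OF Cinf_on_pd[OF f(1)]]] K(2)]] unfolding bdd_def .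
 then have "\<forall>k l. \<exists>B. 0 <= B & (\<forall>u\<in>K. norm (pd l (pd k f) u) <= B)" by blast
 then obtain B where B: "!!k l. B k l >= 0" "!!k l u. u \<in> K ==> norm (pd l (pd k f) u) <= B k l"
  unfolding choice_iff by blast
 have "\<bar>dir2 f u h - dir2 f u k\<bar> <= (SU i. SU j. B i j) * ((norm h + norm k) * norm (h - k))" if u: "u \<in> K" for u h k
 proof -
  have uU: "u \<in> U" using u K by blast
  have "dir2 f u h - dir2 f u k = (SU i. SU j. (h $ i * h $ j - k $ i * k $ j) * pd j (pd i f) u)"
   unfolding dir2_expand[OF f uU] by (simp add: left_diff_distrib sum_subtractf)
  also have "\<bar>...\<bar> <= (\<Sum>i\<in>(UNIV::'n set). \<Sum>j\<in>(UNIV::'n set). ((norm h + norm k) * norm (h - k)) * B i j)"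
  proof (rule order_trans[OF sum_abs], rule sum_mono, rule order_trans[OF sum_abs], rule sum_mono)
   fix i j :: 'n
   have "h $ i * h $ j - k $ i * k $ j = (h - k) $ i * h $ j + k $ i * (h - k) $ j" by (simp add: algebra_simps)
   also have "\<bar>...\<bar> <= norm (h - k) * norm h + norm k * norm (h - k)"
    by (rule order_trans[OF abs_triangle_ineq add_mono]; unfold abs_mult; intro mult_mono component_le_norm_cart) auto
   finally have "\<bar>h $ i * h $ j - k $ i * k $ j\<bar> <= (norm h + norm k) * norm (h - k)" by (simp add: algebra_simps)
   then show "\<bar>(h $ i * h $ j - k $ i * k $ j) * pd j (pd i f) u\<bar> <= ((norm h + norm k) * norm (h - k)) * B i j"
    unfolding abs_mult using B(2)[OF u, of j i] by (intro mult_mono) auto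
  qed
  also have "... = (SU i. SU j. B i j) * ((norm h + norm k) * norm (h - k))"
   by (simp add: sum_distrib_right sum_distrib_left mult_ac)
  finally show ?thesis .
 qed
 moreover have "(SU i. SU j. B i j) >= 0" by (intro sum_nonneg B)
 ultimately show ?thesis by blast
qed

lemma dir2_zero: "dir2 f u 0 = 0"
proof -
 have "(%y. dir f y 0) = (%y. 0)" by (simp add: dir_zero)
 then show ?thesis by (simp add: dir2_def dir_zero)
qed

lemma dir2_scale: "Cinf_on U f ==> open U ==> u \<in> U ==> dir2 f u (c *\<^sub>R h) = c^2 * dir2 f u h"
 by (simp add: dir2_expand power2_eq_square sum_distrib_left mult_ac)

text \<open>Three errors are estimated: the Taylor remainder at the displacement
  \<open>h s t\<close>, which is O(s); the first derivative applied to the remainder of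
  \<open>y\<close>; and the replacement of the displacement by \<open>s *\<^sub>R V t\<close> in the
  quadratic term, which is O(s^3).\<close>

lemma uj_compose:
 fixes y :: "real => 'c => real^'n::finite"
 assumes f: "Cinf_on U f" "open U" and K: "compact K" "K \<subseteq> U" "x ` I \<subseteq> K" and y: "uj I y x V A"
 shows "uj I (%s t. f (y s t)) (%t. f (x t)) (%t. dir f (x t) (V t)) (%t. dir f (x t) (A t) + dir2 f (x t) (V t))"
proof -
 define \<rho> where "\<rho> s t = y s t - (x t + s *\<^sub>R V t + (s^2 / 2) *\<^sub>R A t)" for s t
 have b: "bdd I V" "bdd I A" and u: "usmall I \<rho>" using y by (simp_all add: uj_def \<rho>_def[abs_def])
 obtain BV BA where BV0: "BV >= 0" "BA >= 0" "\<forall>t\<in>I. norm (V t) <= BV" "\<forall>t\<in>I. norm (A t) <= BA"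
  using b unfolding bdd_def by blast
 define B where "B = BV + BA + 1"
 have B: "B >= 1" "!!t. t \<in> I ==> norm (V t) <= B" "!!t. t \<in> I ==> norm (A t) <= B"
  using BV0 by (force simp: B_def)+
 obtain B1 where B1: "B1 >= 0" "!!u h. u \<in> K ==> \<bar>dir f u h\<bar> <= B1 * norm h" using dir_bound[OF f(1) K(1,2)] by blast
 obtain B2 where B2: "B2 >= 0" "!!u h k. u \<in> K ==> \<bar>dir2 f u h - dir2 f u k\<bar> <= B2 * ((norm h + norm k) * norm (h - k))"
  using dir2_diff_bound[OF f K(1,2)] by blast
 have xK: "t \<in> I ==> x t \<in> K" "t \<in> I ==> x t \<in> U" for t using K by auto
 define h where "h s t = s *\<^sub>R V t + (s^2 / 2) *\<^sub>R A t + \<rho> s t" for s t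
 have yh: "y s t = x t + h s t" for s t by (simp add: h_def \<rho>_def)
 have hb: "\<forall>\<^sub>F s in nhds 0. \<forall>t\<in>I. norm (h s t) <= 3 * B * \<bar>s\<bar> & norm (h s t - s *\<^sub>R V t) <= 2 * B * s^2"
  using eventually_small[OF zero_less_one] usmallD[OF u zero_less_one]
 proof eventually_elim
  case (elim s)
  show ?case
  proof
   fix t assume t: "t \<in> I"
   have s2: "s^2 <= \<bar>s\<bar>" using elim(1) mult_left_le[of "\<bar>s\<bar>" "\<bar>s\<bar>"] by (simp add: power2_eq_square abs_mult_self_eq flip: abs_mult)
   have "norm ((s^2 / 2) *\<^sub>R A t) <= s^2 * B" unfolding norm_scaleR using B t by (intro mult_mono) auto
   moreover have "norm (\<rho> s t) <= s^2 * B" using elim(2) t B(1) mult_left_mono[of 1 B "s^2"] by fastforce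
   moreover have "h s t - s *\<^sub>R V t = (s^2 / 2) *\<^sub>R A t + \<rho> s t" by (simp add: h_def)
   ultimately have "norm (h s t - s *\<^sub>R V t) <= s^2 * B + s^2 * B"
    using norm_triangle_mono by metis
   then have 1: "norm (h s t - s *\<^sub>R V t) <= 2 * B * s^2" by (simp add: mult.commute)
   have "norm (s *\<^sub>R V t) <= \<bar>s\<bar> * B" unfolding norm_scaleR using B t by (intro mult_left_mono) auto
   moreover have "2 * B * s^2 <= 2 * B * \<bar>s\<bar>" using s2 B(1) by (intro mult_left_mono) auto
   ultimately have "norm (h s t) <= 3 * B * \<bar>s\<bar>"
    using 1 norm_triangle_ineq[of "h s t - s *\<^sub>R V t" "s *\<^sub>R V t"] by (simp add: algebra_simps)
   then show "norm (h s t) <= 3 * B * \<bar>s\<bar> & norm (h s t - s *\<^sub>R V t) <= 2 * B * s^2" using 1 by simp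
  qed
 qed
 have u1: "usmall I (%s t. f (x t + h s t) - f (x t) - dir f (x t) (h s t) - dir2 f (x t) (h s t) / 2)"
  unfolding usmall_def
 proof (intro allI impI)
  fix \<epsilon> :: real assume "0 < \<epsilon>"
  then have e: "0 < \<epsilon> / (9 * B^2)" using B(1) by simp
  obtain \<delta> where \<delta>: "\<delta> > 0" "!!u h. u \<in> K ==> norm h <= \<delta> ==> \<bar>f (u + h) - f u - dir f u h - dir2 f u h / 2\<bar> <= \<epsilon> / (9 * B^2) * (norm h)^2"
   using uniform_taylor[OF f K(1,2) e] by blast
  have "0 < \<delta> / (3 * B)" using \<delta> B(1) by simp
  from eventually_small[OF this] hb
  show "\<forall>\<^sub>F s in nhds 0. \<forall>t\<in>I. norm (f (x t + h s t) - f (x t) - dir f (x t) (h s t) - dir2 f (x t) (h s t) / 2) <= \<epsilon> * s^2"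
  proof eventually_elim
   case (elim s)
   show ?case
   proof
    fix t assume t: "t \<in> I"
    have hs: "norm (h s t) <= 3 * B * \<bar>s\<bar>" using elim(2) t by blast
    moreover have "3 * B * \<bar>s\<bar> <= \<delta>" using elim(1) B(1) by (simp add: pos_le_divide_eq mult.commute)
    ultimately have "\<bar>f (x t + h s t) - f (x t) - dir f (x t) (h s t) - dir2 f (x t) (h s t) / 2\<bar> <= \<epsilon> / (9 * B^2) * (norm (h s t))^2"
     by (intro \<delta>(2) xK t) simp
    also have "... <= \<epsilon> / (9 * B^2) * (3 * B * \<bar>s\<bar>)^2" using hs e by (intro mult_left_mono power_mono) auto
    also have "... = \<epsilon> * s^2" using B(1) by (simp add: power_mult_distrib)
    finally show "norm (f (x t + h s t) - f (x t) - dir f (x t) (h s t) - dir2 f (x t) (h s t) / 2) <= \<epsilon> * s^2" by simp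
   qed
  qed
 qed
 have u2: "usmall I (%s t. dir f (x t) (\<rho> s t))"
  by (rule usmall_le[OF u B1(1)]) (auto intro!: always_eventually B1(2) xK)
 have u3: "usmall I (%s t. (dir2 f (x t) (h s t) - dir2 f (x t) (s *\<^sub>R V t)) / 2)"
 proof (rule usmall_cube[of "B2 * (4 * B * (2 * B))"])
  show "\<forall>\<^sub>F s in nhds 0. \<forall>t\<in>I. norm ((dir2 f (x t) (h s t) - dir2 f (x t) (s *\<^sub>R V t)) / 2) <= B2 * (4 * B * (2 * B)) * \<bar>s\<bar> ^ 3"
   using hb
  proof eventually_elim
   case (elim s)
   show ?case
   proof
    fix t assume t: "t \<in> I"
    have "norm (s *\<^sub>R V t) <= \<bar>s\<bar> * B" unfolding norm_scaleR using B t by (intro mult_left_mono) auto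
    then have "norm (h s t) + norm (s *\<^sub>R V t) <= 4 * B * \<bar>s\<bar>" using elim t by (fastforce simp: algebra_simps)
    then have "(norm (h s t) + norm (s *\<^sub>R V t)) * norm (h s t - s *\<^sub>R V t) <= (4 * B * \<bar>s\<bar>) * (2 * B * s^2)"
     using elim t B(1) by (intro mult_mono) auto
    then have "B2 * ((norm (h s t) + norm (s *\<^sub>R V t)) * norm (h s t - s *\<^sub>R V t)) <= B2 * ((4 * B * \<bar>s\<bar>) * (2 * B * s^2))"
     using B2(1) by (rule mult_left_mono)
    with B2(2)[OF xK(1)[OF t], of "h s t" "s *\<^sub>R V t"]
    have "\<bar>dir2 f (x t) (h s t) - dir2 f (x t) (s *\<^sub>R V t)\<bar> <= B2 * ((4 * B * \<bar>s\<bar>) * (2 * B * s^2))" by linarith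
    also have "... = B2 * (4 * B * (2 * B)) * \<bar>s\<bar> ^ 3" by (simp add: power3_eq_cube power2_eq_square)
    finally show "norm ((dir2 f (x t) (h s t) - dir2 f (x t) (s *\<^sub>R V t)) / 2) <= B2 * (4 * B * (2 * B)) * \<bar>s\<bar> ^ 3" by simp
   qed
  qed
 qed (use B2 B in simp)
 have "usmall I (%s t. f (y s t) - (f (x t) + s *\<^sub>R dir f (x t) (V t) + (s^2 / 2) *\<^sub>R (dir f (x t) (A t) + dir2 f (x t) (V t))))"
 proof (rule usmall_cong[OF usmall_add[OF usmall_add[OF u1 u2] u3]])
  fix s t assume t: "t \<in> I"
  have 1: "dir f (x t) (h s t) = s * dir f (x t) (V t) + s^2 / 2 * dir f (x t) (A t) + dir f (x t) (\<rho> s t)"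
   by (simp add: h_def dir_add dir_scale)
  show "f (x t + h s t) - f (x t) - dir f (x t) (h s t) - dir2 f (x t) (h s t) / 2 + dir f (x t) (\<rho> s t)
    + (dir2 f (x t) (h s t) - dir2 f (x t) (s *\<^sub>R V t)) / 2
   = f (y s t) - (f (x t) + s *\<^sub>R dir f (x t) (V t) + (s^2 / 2) *\<^sub>R (dir f (x t) (A t) + dir2 f (x t) (V t)))"
   unfolding 1 yh dir2_scale[OF f xK(2)[OF t]] by (simp add: field_simps)
 qed
 moreover have "bdd I (%t. f (x t))"
 proof -
  have "bdd K f" by (rule bdd_continuous[OF K(1) continuous_on_subset[OF Cinf_on_continuous[OF f(1)] K(2)]])
  then show ?thesis unfolding bdd_def using xK(1) by blast
 qed
 moreover have db: "bdd I (%t. dir f (x t) (Z t))" if "!!t. t \<in> I ==> norm (Z t) <= B" for Z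
  unfolding bdd_def
 proof (intro exI[of _ "B1 * B"] conjI ballI)
  fix t assume t: "t \<in> I"
  show "norm (dir f (x t) (Z t)) <= B1 * B"
   using order_trans[OF B1(2)[OF xK(1)[OF t]] mult_left_mono[OF that[OF t] B1(1)]] by simp
 qed (use B1 B in simp)
 moreover have "bdd I (%t. dir2 f (x t) (V t))"
  unfolding bdd_def
 proof (intro exI[of _ "B2 * (B * B)"] conjI ballI)
  fix t assume t: "t \<in> I"
  have "\<bar>dir2 f (x t) (V t)\<bar> <= B2 * (norm (V t) * norm (V t))"
   using B2(2)[OF xK(1)[OF t], of "V t" 0] by (simp add: dir2_zero)
  also have "... <= B2 * (B * B)" using B2 B t by (intro mult_left_mono mult_mono) auto
  finally show "norm (dir2 f (x t) (V t)) <= B2 * (B * B)" by simp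
 qed (use B2 B in simp)
 ultimately show ?thesis unfolding uj_def using B by (intro conjI bdd_add) auto
qed

lemma uj_component:
 fixes y :: "real => 'c => real^'n::finite"
 assumes "uj I y x V A"
 shows "uj I (%s t. y s t $ i) (%t. x t $ i) (%t. V t $ i) (%t. A t $ i)"
proof -
 have b: "bdd I (%t. Z t $ i)" if "bdd I Z" for Z :: "'c => real^'n"
  using that component_le_norm_cart order_trans unfolding bdd_def real_norm_def by metis
 have "usmall I (%s t. (y s t - (x t + s *\<^sub>R V t + (s^2 / 2) *\<^sub>R A t)) $ i)"
  by (rule usmall_le[of I "%s t. y s t - (x t + s *\<^sub>R V t + (s^2 / 2) *\<^sub>R A t)" 1])
   (use assms in \<open>auto simp: uj_def component_le_norm_cart simp del: vector_minus_component\<close>)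
 then show ?thesis using assms b by (simp add: uj_def)
qed

section \<open>Second variation of the energy\<close>

lemma uj_cong:
 assumes "uj I f f0 f1 f2" "!!t. t \<in> I ==> f0 t = g0 t" "!!t. t \<in> I ==> f1 t = g1 t" "!!t. t \<in> I ==> f2 t = g2 t"
 shows "uj I f g0 g1 g2"
 using assms unfolding uj_def bdd_def usmall_def by simp

lemma uj_quadratic:
 "bdd I f0 ==> bdd I f1 ==> bdd I f2 ==> usmall I (%s t. \<rho> s) ==>
  uj I (%s t. f0 t + s *\<^sub>R f1 t + (s^2 / 2) *\<^sub>R f2 t + \<rho> s) f0 f1 f2"
 unfolding uj_def by simp

lemma usmall_zero: "usmall I (%s t. 0)"
 unfolding usmall_def by simp

lemma uj_near:
 assumes y: "uj I y x V A" and \<delta>: "0 < \<delta>"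
 shows "\<forall>\<^sub>F s in nhds 0. \<forall>t\<in>I. norm (y s t - x t) <= \<delta>"
proof -
 obtain B C where B: "B >= 0" "\<forall>t\<in>I. norm (V t) <= B" "C >= 0" "\<forall>t\<in>I. norm (A t) <= C"
  using y unfolding uj_def bdd_def by blast
 have u: "usmall I (%s t. y s t - (x t + s *\<^sub>R V t + (s^2 / 2) *\<^sub>R A t))" using y by (simp add: uj_def)
 have e: "0 < \<delta> / (B + C + 1)" using \<delta> B by simp
 from eventually_small[OF e] eventually_small[OF zero_less_one] usmallD[OF u zero_less_one]
 show ?thesis
 proof eventually_elim
  case (elim s)
  show ?case
  proof
   fix t assume t: "t \<in> I"
   have s2: "s^2 <= \<bar>s\<bar>" using elim(2) mult_left_le[of "\<bar>s\<bar>" "\<bar>s\<bar>"] by (simp add: power2_eq_square abs_mult_self_eq flip: abs_mult)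
   let ?r = "y s t - (x t + s *\<^sub>R V t + (s^2 / 2) *\<^sub>R A t)"
   have 1: "norm (s *\<^sub>R V t) <= \<bar>s\<bar> * B" unfolding norm_scaleR using B t by (intro mult_left_mono) auto
   have 2: "norm ((s^2 / 2) *\<^sub>R A t) <= \<bar>s\<bar> * C" unfolding norm_scaleR using B t s2 by (intro mult_mono) auto
   have 3: "norm ?r <= \<bar>s\<bar> * 1" using elim(3) t s2 by fastforce
   have "y s t - x t = s *\<^sub>R V t + (s^2 / 2) *\<^sub>R A t + ?r" by simp
   then have "norm (y s t - x t) <= \<bar>s\<bar> * B + \<bar>s\<bar> * C + \<bar>s\<bar> * 1"
    using norm_triangle_mono[OF norm_triangle_mono[OF 1 2] 3] by simp
   also have "... = \<bar>s\<bar> * (B + C + 1)" by (simp add: algebra_simps)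
   also have "... <= \<delta>" using elim(1) B by (simp add: pos_le_divide_eq)
   finally show "norm (y s t - x t) <= \<delta>" .
  qed
 qed
qed

context local_metric
begin

lemma energy_expansion:
 assumes K: "compact K" "K \<subseteq> U" "x ` I \<subseteq> K" and y: "uj I y x V A" and w: "uj I w v V' A'"
 shows "uj I (%s t. gin G (y s t) (w s t) (w s t)) (%t. gin G (x t) (v t) (v t))
  (%t. dgin G (x t) (V t) (v t) (v t) + 2 * gin G (x t) (V' t) (v t))
  (%t. 2 * (ddgin (x t) (V t) (V t) (v t) (v t) / 2 + dgin G (x t) (A t) (v t) (v t) / 2
   + 2 * dgin G (x t) (V t) (V' t) (v t) + gin G (x t) (V' t) (V' t) + gin G (x t) (A' t) (v t)))"
 unfolding gin_sum[of G "y _ _"]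
proof (rule uj_cong[OF uj_sum[OF uj_sum[OF uj_mult[OF uj_component[OF w] uj_mult[OF uj_component[OF w]
  uj_compose[OF smooth_G U_open K y]]]]]])
 fix t assume t: "t \<in> I"
 then have u: "x t \<in> U" using K by auto
 show "(SU i. SU j. v t $ i * (v t $ j * G (x t) $ i $ j)) = gin G (x t) (v t) (v t)"
  by (simp add: gin_sum)
 have "(SU i. SU j. v t $ i * (v t $ j * dir (%u. G u $ i $ j) (x t) (V t) + V' t $ j * G (x t) $ i $ j)
   + V' t $ i * (v t $ j * G (x t) $ i $ j))
  = dgin G (x t) (V t) (v t) (v t) + gin G (x t) (v t) (V' t) + gin G (x t) (V' t) (v t)"
  unfolding gin_sum dgin_def dbil_def bil_def sum.distrib[symmetric]
  by (intro sum.cong refl) (simp add: algebra_simps)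
 then show "(SU i. SU j. v t $ i * (v t $ j * dir (%u. G u $ i $ j) (x t) (V t) + V' t $ j * G (x t) $ i $ j)
   + V' t $ i * (v t $ j * G (x t) $ i $ j)) = dgin G (x t) (V t) (v t) (v t) + 2 * gin G (x t) (V' t) (v t)"
  using sym_G[OF u, of "v t" "V' t"] by simp
 let ?S = "SU i. SU j. v t $ i * (v t $ j * (dir (%u. G u $ i $ j) (x t) (A t) + dir2 (%u. G u $ i $ j) (x t) (V t))
    + 2 * (V' t $ j * dir (%u. G u $ i $ j) (x t) (V t)) + A' t $ j * G (x t) $ i $ j)
   + 2 * (V' t $ i * (v t $ j * dir (%u. G u $ i $ j) (x t) (V t) + V' t $ j * G (x t) $ i $ j))
   + A' t $ i * (v t $ j * G (x t) $ i $ j)"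
 have "?S = ddgin (x t) (V t) (V t) (v t) (v t) + dgin G (x t) (A t) (v t) (v t)
   + 2 * dgin G (x t) (V t) (v t) (V' t) + 2 * dgin G (x t) (V t) (V' t) (v t)
   + gin G (x t) (v t) (A' t) + gin G (x t) (A' t) (v t) + 2 * gin G (x t) (V' t) (V' t)"
  unfolding gin_sum dgin_def ddgin_def dir2_def dbil_def bil_def sum_distrib_left sum.distrib[symmetric]
  by (intro sum.cong refl) (simp add: algebra_simps)
 then show "?S = 2 * (ddgin (x t) (V t) (V t) (v t) (v t) / 2 + dgin G (x t) (A t) (v t) (v t) / 2
   + 2 * dgin G (x t) (V t) (V' t) (v t) + gin G (x t) (V' t) (V' t) + gin G (x t) (A' t) (v t))"
  using sym_G[OF u, of "v t" "A' t"] dgin_sym[OF u, of "V t" "v t" "V' t"] by simp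
qed

end

context local_soliton
begin

text \<open>The variation field along a curve with velocity \<open>v\<close> is \<open>H E\<close> with \<open>E\<close> parallel. Adding the multiple
 of the drift \<open>X\<close> to the covariant acceleration turns the sum over an orthonormal frame of the second
 derivatives into the drift Laplacian.\<close>

definition accel :: "real => real^'n => real^'n => real^'n" where
 "accel h u e = - Gam G u (h *\<^sub>R e) (h *\<^sub>R e) + (h^2 / CARD('n)) *\<^sub>R X u"

text \<open>\<open>dvar\<close> and \<open>daccel\<close> are the derivatives along the curve of h E
  and of \<open>accel\<close>, for a factor h with derivative \<eta> and a parallel E; see
  \<open>dvar_derivative\<close> and \<open>daccel_derivative\<close>.\<close>

definition dvar :: "real => real => real^'n => real^'n => real^'n => real^'n" where
 "dvar h \<eta> u v e = \<eta> *\<^sub>R e - h *\<^sub>R Gam G u v e"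

definition daccel :: "real => real => real^'n => real^'n => real^'n => real^'n" where
 "daccel h \<eta> u v e = - (dGam G u v (h *\<^sub>R e) (h *\<^sub>R e) + Gam G u (dvar h \<eta> u v e) (h *\<^sub>R e) + Gam G u (h *\<^sub>R e) (dvar h \<eta> u v e))
  + ((2 * h * \<eta> / CARD('n)) *\<^sub>R X u + (h^2 / CARD('n)) *\<^sub>R jac X u v)"

lemma dvar_derivative:
 assumes "x t \<in> U" and H: "(H has_real_derivative \<eta>) (at t within S)"
  and E: "(E has_vector_derivative - Gam G (x t) v (E t)) (at t within S)"
 shows "((%t. H t *\<^sub>R E t) has_vector_derivative dvar (H t) \<eta> (x t) v (E t)) (at t within S)"
proof -
 have "((%t. H t *\<^sub>R E t) has_vector_derivative H t *\<^sub>R - Gam G (x t) v (E t) + \<eta> *\<^sub>R E t) (at t within S)"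
  by (rule has_vector_derivative_scaleR[OF H E])
 then show ?thesis by (simp add: dvar_def)
qed

lemma daccel_derivative:
 assumes u: "x t \<in> U" and H: "(H has_real_derivative \<eta>) (at t within S)"
  and x: "(x has_vector_derivative v) (at t within S)"
  and E: "(E has_vector_derivative - Gam G (x t) v (E t)) (at t within S)"
 shows "((%t. accel (H t) (x t) (E t)) has_vector_derivative daccel (H t) \<eta> (x t) v (E t)) (at t within S)"
proof -
 note V = dvar_derivative[where x = x and t = t and E = E and H = H, OF u H E, unfolded has_vector_derivative_def]
 have "((%t. Gam G (x t) (H t *\<^sub>R E t) (H t *\<^sub>R E t)) has_derivative
  (%s. dGam G (x t) (s *\<^sub>R v) (H t *\<^sub>R E t) (H t *\<^sub>R E t) + Gam G (x t) (s *\<^sub>R dvar (H t) \<eta> (x t) v (E t)) (H t *\<^sub>R E t)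
   + Gam G (x t) (H t *\<^sub>R E t) (s *\<^sub>R dvar (H t) \<eta> (x t) v (E t)))) (at t within S)"
  by (rule Gam_has_derivative[where x = x and t = t, OF u x[unfolded has_vector_derivative_def] V V])
 then have 1: "((%t. Gam G (x t) (H t *\<^sub>R E t) (H t *\<^sub>R E t)) has_vector_derivative
  dGam G (x t) v (H t *\<^sub>R E t) (H t *\<^sub>R E t) + Gam G (x t) (dvar (H t) \<eta> (x t) v (E t)) (H t *\<^sub>R E t)
   + Gam G (x t) (H t *\<^sub>R E t) (dvar (H t) \<eta> (x t) v (E t))) (at t within S)"
  unfolding has_vector_derivative_def
  by (rule has_derivative_eq_rhs) (simp add: fun_eq_iff dGam_scale0 Gam_scale1 Gam_scale2 scaleR_add_right)
 have 2: "((%t. X (x t)) has_vector_derivative jac X (x t) v) (at t within S)"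
  using has_derivative_compose[OF x[unfolded has_vector_derivative_def] smap_has_derivative[OF smooth_X U_open u]]
  unfolding has_vector_derivative_def by (simp add: jac_scale)
 have 3: "((%t. (H t)^2 / CARD('n)) has_real_derivative 2 * H t * \<eta> / CARD('n)) (at t within S)"
  by (auto intro!: derivative_eq_intros H)
 have "((%t. - Gam G (x t) (H t *\<^sub>R E t) (H t *\<^sub>R E t) + ((H t)^2 / CARD('n)) *\<^sub>R X (x t)) has_vector_derivative
  - (dGam G (x t) v (H t *\<^sub>R E t) (H t *\<^sub>R E t) + Gam G (x t) (dvar (H t) \<eta> (x t) v (E t)) (H t *\<^sub>R E t)
   + Gam G (x t) (H t *\<^sub>R E t) (dvar (H t) \<eta> (x t) v (E t)))
  + (((H t)^2 / CARD('n)) *\<^sub>R jac X (x t) v + (2 * H t * \<eta> / CARD('n)) *\<^sub>R X (x t))) (at t within S)"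
  by (intro has_vector_derivative_add has_vector_derivative_minus 1 has_vector_derivative_scaleR[OF 3 2])
 then show ?thesis unfolding accel_def daccel_def by (simp add: add.commute)
qed

text \<open>Half the second derivative of the energy density in
  \<open>energy_expansion\<close>.\<close>

definition var2 :: "real => real => real^'n => real^'n => real^'n => real" where
 "var2 h \<eta> u v e = ddgin u (h *\<^sub>R e) (h *\<^sub>R e) v v / 2 + dgin G u (accel h u e) v v / 2
   + 2 * dgin G u (h *\<^sub>R e) (dvar h \<eta> u v e) v + gin G u (dvar h \<eta> u v e) (dvar h \<eta> u v e) + gin G u (daccel h \<eta> u v e) v"

lemma var1:
 assumes u: "u \<in> U"
 shows "dgin G u (h *\<^sub>R e) v v + 2 * gin G u (dvar h \<eta> u v e) v = 2 * \<eta> * gin G u e v"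
 unfolding compat[OF u] using sym_G[OF u, of v "Gam G u (h *\<^sub>R e) v"] Gam_sym[OF u, of v e]
 by (simp add: dvar_def gin_diff1 gin_scale1 Gam_scale1 algebra_simps)

text \<open>Each frame vector carries the share 1/n of the drift, so after summation h^2 Hess
  \<phi>(v, v) appears with coefficient one. The curvature terms add up to -h^2 Ric(v, v), and the
  soliton equation leaves - \<open>lam\<close> h^2 |v|^2. The last term comes from the derivative of
  the factor h^2 in front of \<open>X\<close>.\<close>

lemma sum_var2:
 fixes h \<eta> :: real
 assumes u: "u \<in> U" and E: "onb G u E"
 shows "(SU i. var2 h \<eta> u v (E i)) = real CARD('n) * \<eta>^2 - lam * h^2 * gin G u v v + 2 * h * \<eta> * dir \<phi> u v"
proof -
 let ?n = "real CARD('n)"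
 have one: "var2 h \<eta> u v (E i) = \<eta>^2 + h^2 * gin G u (Rm G u (E i) v v) (E i) * (-1)
   + (2 * h * \<eta> / ?n * dir \<phi> u v + h^2 / ?n * Hess G \<phi> u v v)" for i
 proof -
  let ?V = "h *\<^sub>R E i" and ?W = "(h^2 / ?n) *\<^sub>R X u" and ?W' = "(2 * h * \<eta> / ?n) *\<^sub>R X u + (h^2 / ?n) *\<^sub>R jac X u v"
  let ?V' = "dvar h \<eta> u v (E i)"
  have "var2 h \<eta> u v (E i) = gin G u (?V' + Gam G u v ?V) (?V' + Gam G u v ?V) + gin G u (Rm G u ?V v ?V) v
    + gin G u (?W' + Gam G u v ?W) v"
   unfolding var2_def by (rule second_variation_pointwise[OF u]) (simp_all add: accel_def daccel_def)
  moreover have "?V' + Gam G u v ?V = \<eta> *\<^sub>R E i" by (simp add: dvar_def Gam_scale2)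
  then have "gin G u (?V' + Gam G u v ?V) (?V' + Gam G u v ?V) = \<eta>^2"
   using E by (simp add: gin_scale1 gin_scale2 onb_def power2_eq_square)
  moreover have "gin G u (Rm G u ?V v ?V) v = h^2 * gin G u (Rm G u (E i) v v) (E i) * (-1)"
   using Rm_skew[OF u, of "E i" v "E i" v] sym_G[OF u, of "E i" "Rm G u (E i) v v"] by (simp add: Rm_scale1 Rm_scale3 gin_scale1 power2_eq_square)
  moreover have "?W' + Gam G u v ?W = (2 * h * \<eta> / ?n) *\<^sub>R X u + (h^2 / ?n) *\<^sub>R (jac X u v + Gam G u v (X u))"
   by (simp add: Gam_scale2 scaleR_add_right)
  then have "gin G u (?W' + Gam G u v ?W) v = 2 * h * \<eta> / ?n * dir \<phi> u v + h^2 / ?n * Hess G \<phi> u v v"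
   by (simp only: gin_add1[of G u "(2 * h * \<eta> / ?n) *\<^sub>R X u"] gin_scale1 nabX[OF u] gin_X[OF u])
  ultimately show ?thesis by simp
 qed
 have ric: "(SU i. gin G u (Rm G u (E i) v v) (E i)) = Ric G u v v" by (rule Ric_onb[OF u E, symmetric])
 have "(SU i. var2 h \<eta> u v (E i)) = ?n * \<eta>^2 - h^2 * (SU i. gin G u (Rm G u (E i) v v) (E i))
   + ?n * (2 * h * \<eta> / ?n * dir \<phi> u v + h^2 / ?n * Hess G \<phi> u v v)"
  unfolding one by (simp add: sum.distrib sum_subtractf sum_negf flip: sum_distrib_left)
 also have "... = ?n * \<eta>^2 - lam * h^2 * gin G u v v + 2 * h * \<eta> * dir \<phi> u v"
  unfolding ric Ric_eq[OF u] by (simp add: field_simps)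
 finally show ?thesis .
qed

end

section \<open>Comparison along minimizing geodesics\<close>

lemma continuous_on_dir:
 assumes "Cinf_on U f" "continuous_on I x" "x ` I \<subseteq> U" "continuous_on I z"
 shows "continuous_on I (%t. dir f (x t) (z t))"
 unfolding dir_def
 by (intro continuous_on_sum continuous_on_mult continuous_on_component
   continuous_on_smooth_compose[OF Cinf_on_pd[OF assms(1)]] assms(2-4))

lemma continuous_on_dir2:
 assumes f: "Cinf_on U f" "open U" and "continuous_on I x" "x ` I \<subseteq> U" "continuous_on I z"
 shows "continuous_on I (%t. dir2 f (x t) (z t))"
proof -
 have "continuous_on I (%t. SU k. SU l. z t $ k * z t $ l * pd l (pd k f) (x t))"
  by (intro continuous_on_sum continuous_on_mult continuous_on_component
   continuous_on_smooth_compose[OF Cinf_on_pd[OF Cinf_on_pd[OF f(1)]]] assms(3-5))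
 then show ?thesis
  by (rule continuous_on_cong[THEN iffD1, OF refl, rotated]) (use dir2_expand[OF f] assms(4) in auto)
qed

context local_metric
begin

lemma continuous_on_gin':
 assumes "continuous_on I x" "x ` I \<subseteq> U" "continuous_on I a" "continuous_on I b"
 shows "continuous_on I (%t. gin G (x t) (a t) (b t))"
 unfolding gin_bil by (rule continuous_on_bil[OF smooth_G assms])

lemma continuous_on_dgin:
 assumes "continuous_on I x" "x ` I \<subseteq> U" "continuous_on I z" "continuous_on I a" "continuous_on I b"
 shows "continuous_on I (%t. dgin G (x t) (z t) (a t) (b t))"
 unfolding dgin_def dbil_def bil_def
 by (intro continuous_on_sum continuous_on_mult continuous_on_component continuous_on_dir[OF smooth_G] assms)

lemma continuous_on_ddgin:
 assumes "continuous_on I x" "x ` I \<subseteq> U" "continuous_on I z" "continuous_on I a" "continuous_on I b"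
 shows "continuous_on I (%t. ddgin (x t) (z t) (z t) (a t) (b t))"
 unfolding ddgin_def dbil_def bil_def dir2_def[symmetric]
 by (intro continuous_on_sum continuous_on_mult continuous_on_component continuous_on_dir2[OF smooth_G U_open] assms)

end

context riem_mfd
begin

lemma dist_sq_le_energy:
 assumes c: "c \<in> A" and ab: "a < b" and im: "x ` {a..b} \<subseteq> cimg c" and cx: "continuous_on {a..b} x"
  and x: "!!t. t \<in> {a<..<b} ==> (x has_vector_derivative w t) (at t)" and w: "continuous_on {a..b} w"
 shows "(d (cinv c (x a)) (cinv c (x b)))^2 <= (b - a) * integral {a..b} (%t. gin (G c) (x t) (w t) (w t))"
proof -
 interpret L: local_metric "cimg c" "G c" by (rule local_metric_chart[OF c])
 let ?f = "%t. gin (G c) (x t) (w t) (w t)"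
 let ?D = "d (cinv c (x a)) (cinv c (x b))"
 have f0: "0 <= ?f t" if "t \<in> {a..b}" for t by (rule L.gin_nonneg) (use im that in blast)
 have cf: "continuous_on {a..b} ?f" by (rule L.continuous_on_gin'[OF cx im w w])
 have i1: "(%t. sqrt (?f t)) integrable_on {a..b}"
  by (rule integrable_continuous_interval) (intro continuous_on_real_sqrt cf)
 have i2: "?f integrable_on {a..b}" by (rule integrable_continuous_interval[OF cf])
 let ?L = "integral {a..b} (%t. sqrt (?f t))" and ?P = "integral {a..b} ?f"
 have L0: "0 <= ?L" by (rule integral_nonneg[OF i1]) (use f0 in auto)
 have P0: "0 <= ?P" by (rule integral_nonneg[OF i2]) (use f0 in auto)
 have "ennreal ?D <= ennreal ?L" using ed_chart[OF c ab im cx x w] by (simp only: ed_d)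
 then have DL: "?D <= ?L" using L0 by (simp add: ennreal_le_iff)
 \<comment> \<open>The inequality between arithmetic and geometric mean, integrated with a free
   weight \<open>k\<close>. The choice k = L / (b - a), with L the length, turns it into the
   Cauchy-Schwarz inequality.\<close>
 have kk: "?L <= (k * (b - a) + ?P / k) / 2" if k: "0 < k" for k
 proof -
  have "?L <= integral {a..b} (%t. k / 2 + ?f t * (1 / (2 * k)))"
  proof (rule integral_le[OF i1])
   show "(%t. k / 2 + ?f t * (1 / (2 * k))) integrable_on {a..b}"
    by (intro integrable_add integrable_on_mult_left i2) (simp add: integrable_const_ivl)
   fix t assume t: "t \<in> {a..b}"
   have "0 <= (k - sqrt (?f t))^2" by simp
   then have "2 * k * sqrt (?f t) <= k * k + ?f t" using f0[OF t] by (simp add: power2_eq_square algebra_simps)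
   then show "sqrt (?f t) <= k / 2 + ?f t * (1 / (2 * k))" using k by (simp add: field_simps)
  qed
  also have "... = integral {a..b} (%t. k / 2) + ?P * (1 / (2 * k))"
  proof -
   have "(%t. ?f t * (1 / (2 * k))) integrable_on {a..b}" by (rule integrable_on_mult_left[OF i2])
   then have "integral {a..b} (%t. k / 2 + ?f t * (1 / (2 * k))) = integral {a..b} (%t. k / 2) + integral {a..b} (%t. ?f t * (1 / (2 * k)))"
    by (intro Henstock_Kurzweil_Integration.integral_add) (simp_all add: integrable_const_ivl)
   then show ?thesis by (simp only: integral_mult_left)
  qed
  also have "... = (k * (b - a) + ?P / k) / 2" using ab by (simp add: field_simps)
  finally show ?thesis .
 qed
 have "?L^2 <= (b - a) * ?P"
 proof (cases "?L = 0")
  case False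
  then have L: "0 < ?L" using L0 by simp
  have "?L <= (?L + ?P * (b - a) / ?L) / 2" using kk[of "?L / (b - a)"] L ab by simp
  then have "?L * ?L <= ?P * (b - a)" using L by (simp add: pos_le_divide_eq)
  then show ?thesis by (simp add: power2_eq_square mult.commute)
 qed (use P0 ab in simp)
 moreover have "?D^2 <= ?L^2" using DL d_nonneg by (intro power_mono) auto
 ultimately show ?thesis by linarith
qed

text \<open>A remainder \<open>\<rho> s\<close> that does not depend on \<open>t\<close> leaves the
  velocity of the varied curve unchanged and alters the energy by o(s^2) only. It lets the end point
  of the variation run along any curve with the given 2-jet.\<close>

lemma dist_expansion:
 fixes V :: "real => real^'n"
 assumes c: "c \<in> A" and ab: "a < b" and im: "x ` {a..b} \<subseteq> cimg c"
  and x: "!!t. t \<in> {a..b} ==> (x has_vector_derivative v t) (at t within {a..b})"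
  and V: "!!t. t \<in> {a..b} ==> (V has_vector_derivative V' t) (at t within {a..b})"
  and Z: "!!t. t \<in> {a..b} ==> (Z has_vector_derivative Z' t) (at t within {a..b})"
  and cont: "continuous_on {a..b} v" "continuous_on {a..b} V'" "continuous_on {a..b} Z'"
  and \<rho>: "usmall {a..b} (%s t. \<rho> s)"
  and f1: "f1 = (%t. dgin (G c) (x t) (V t) (v t) (v t) + 2 * gin (G c) (x t) (V' t) (v t))"
  and f2: "f2 = (%t. 2 * (local_metric.ddgin (G c) (x t) (V t) (V t) (v t) (v t) / 2 + dgin (G c) (x t) (Z t) (v t) (v t) / 2
   + 2 * dgin (G c) (x t) (V t) (V' t) (v t) + gin (G c) (x t) (V' t) (V' t) + gin (G c) (x t) (Z' t) (v t)))"
  and y: "y = (%s t. x t + s *\<^sub>R V t + (s^2 / 2) *\<^sub>R Z t + \<rho> s)"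
  and \<epsilon>: "0 < \<epsilon>"
 shows "f1 integrable_on {a..b}" "f2 integrable_on {a..b}"
  "\<forall>\<^sub>F s in nhds 0. (\<forall>t\<in>{a..b}. y s t \<in> cimg c) & (d (cinv c (y s a)) (cinv c (y s b)))^2
   <= (b - a) * (integral {a..b} (%t. gin (G c) (x t) (v t) (v t)) + s * integral {a..b} f1 + s^2 / 2 * integral {a..b} f2 + \<epsilon> * s^2)"
proof -
 interpret L: local_metric "cimg c" "G c" by (rule local_metric_chart[OF c])
 let ?I = "{a..b}"
 have cc: "continuous_on ?I x" "continuous_on ?I V" "continuous_on ?I Z"
  using continuous_on_vector_derivative x V Z by blast+
 let ?f0 = "%t. gin (G c) (x t) (v t) (v t)"
 have i0: "?f0 integrable_on ?I"
  by (intro integrable_continuous_interval L.continuous_on_gin' cc im cont)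
 show i1: "f1 integrable_on ?I" unfolding f1
  by (intro integrable_continuous_interval continuous_on_add continuous_on_mult continuous_on_const
    L.continuous_on_gin' L.continuous_on_dgin cc im cont)
 show i2: "f2 integrable_on ?I" unfolding f2
  by (intro integrable_continuous_interval continuous_on_add continuous_on_mult continuous_on_const continuous_on_divide
    L.continuous_on_gin' L.continuous_on_dgin L.continuous_on_ddgin cc im cont) simp_all
 define w where "w s t = v t + s *\<^sub>R V' t + (s^2 / 2) *\<^sub>R Z' t" for s t
 have ujy: "uj ?I y x V Z" unfolding y
  by (intro uj_quadratic bdd_continuous cc compact_Icc \<rho>)
 have ujw: "uj ?I w v V' Z'"
  using uj_quadratic[OF bdd_continuous[OF compact_Icc cont(1)] bdd_continuous[OF compact_Icc cont(2)]
   bdd_continuous[OF compact_Icc cont(3)] usmall_zero] unfolding w_def by simp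
 have K: "compact (x ` ?I)" by (rule compact_continuous_image[OF cc(1) compact_Icc])
 have "uj ?I (%s t. gin (G c) (y s t) (w s t) (w s t)) ?f0 f1 f2"
  unfolding f1 f2 by (rule L.energy_expansion[OF K im order_refl ujy ujw])
 then have us: "usmall ?I (%s t. gin (G c) (y s t) (w s t) (w s t) - (?f0 t + s *\<^sub>R f1 t + (s^2 / 2) *\<^sub>R f2 t))"
  unfolding uj_def by blast
 obtain \<delta> where \<delta>: "\<delta> > 0" "(\<Union>u\<in>x ` ?I. cball u \<delta>) \<subseteq> cimg c" using compact_neighbourhood[OF K im open_cimg[OF c]] by blast
 have e: "0 < \<epsilon> / (b - a)" using \<epsilon> ab by simp
 from usmallD[OF us e] uj_near[OF ujy \<delta>(1)]
 show "\<forall>\<^sub>F s in nhds 0. (\<forall>t\<in>{a..b}. y s t \<in> cimg c) & (d (cinv c (y s a)) (cinv c (y s b)))^2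
   <= (b - a) * (integral {a..b} ?f0 + s * integral {a..b} f1 + s^2 / 2 * integral {a..b} f2 + \<epsilon> * s^2)"
 proof eventually_elim
  case (elim s)
  have yc: "y s t \<in> cimg c" if t: "t \<in> ?I" for t
  proof -
   have "y s t \<in> cball (x t) \<delta>" using elim(2) t by (simp add: dist_norm norm_minus_commute)
   then show ?thesis using \<delta>(2) t by blast
  qed
  have dy: "(y s has_vector_derivative w s t) (at t within ?I)" if t: "t \<in> ?I" for t
  proof -
   have "((%t. x t + s *\<^sub>R V t + (s^2 / 2) *\<^sub>R Z t + \<rho> s) has_vector_derivative (v t + s *\<^sub>R V' t + (s^2 / 2) *\<^sub>R Z' t + 0)) (at t within ?I)"
    by (intro has_vector_derivative_add has_vector_derivative_const x V Z t
      bounded_linear.has_vector_derivative[OF bounded_linear_scaleR_right])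
   then show ?thesis by (simp add: y w_def)
  qed
  have cy: "continuous_on ?I (y s)" by (rule continuous_on_vector_derivative[OF dy])
  have cw: "continuous_on ?I (w s)" unfolding w_def by (intro continuous_intros cont)
  have "(d (cinv c (y s a)) (cinv c (y s b)))^2 <= (b - a) * integral ?I (%t. gin (G c) (y s t) (w s t) (w s t))"
  proof (rule dist_sq_le_energy[OF c ab _ cy _ cw])
   show "y s ` ?I \<subseteq> cimg c" using yc by blast
   show "(y s has_vector_derivative w s t) (at t)" if t: "t \<in> {a<..<b}" for t
    using dy[of t] t at_within_Icc_at[of a t b] by simp
  qed
  also have "... <= (b - a) * (integral ?I ?f0 + s * integral ?I f1 + s^2 / 2 * integral ?I f2 + \<epsilon> * s^2)"
  proof (rule mult_left_mono)
   let ?g = "%t. ((?f0 t + s * f1 t) + s^2 / 2 * f2 t) + \<epsilon> / (b - a) * s^2"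
   have c1: "(%t. s * f1 t) integrable_on ?I" "(%t. s^2 / 2 * f2 t) integrable_on ?I"
    "(%t. \<epsilon> / (b - a) * s^2) integrable_on ?I"
    using integrable_cmul[OF i1, of s] integrable_cmul[OF i2, of "s^2 / 2"] by (simp_all add: integrable_const_ivl)
   have ig: "?g integrable_on ?I"
    by (intro integrable_add i0 c1)
   have iy: "(%t. gin (G c) (y s t) (w s t) (w s t)) integrable_on ?I"
    by (intro integrable_continuous_interval L.continuous_on_gin' cy cw) (use yc in blast)
   have "integral ?I (%t. gin (G c) (y s t) (w s t) (w s t)) <= integral ?I ?g"
   proof (rule integral_le[OF iy ig])
    fix t assume "t \<in> ?I"
    then have "\<bar>gin (G c) (y s t) (w s t) (w s t) - (?f0 t + s *\<^sub>R f1 t + (s^2 / 2) *\<^sub>R f2 t)\<bar> <= \<epsilon> / (b - a) * s^2"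
     using elim(1) by auto
    then show "gin (G c) (y s t) (w s t) (w s t) <= ?g t" by (simp add: abs_le_iff)
   qed
   also have "... = integral ?I ?f0 + s * integral ?I f1 + s^2 / 2 * integral ?I f2 + \<epsilon> * s^2"
   proof -
    have "integral ?I ?g = integral ?I ?f0 + integral ?I (%t. s * f1 t) + integral ?I (%t. s^2 / 2 * f2 t)
      + integral ?I (%t. \<epsilon> / (b - a) * s^2)"
     by (subst Henstock_Kurzweil_Integration.integral_add,
       intro integrable_add i0 c1, rule c1,
       subst Henstock_Kurzweil_Integration.integral_add, intro integrable_add i0 c1, rule c1,
       subst Henstock_Kurzweil_Integration.integral_add, rule i0, rule c1, rule refl)
    also have "integral ?I (%t. \<epsilon> / (b - a) * s^2) = \<epsilon> * s^2" using ab by simp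
    finally show ?thesis by simp
   qed
   finally show "integral ?I (%t. gin (G c) (y s t) (w s t) (w s t))
    <= integral ?I ?f0 + s * integral ?I f1 + s^2 / 2 * integral ?I f2 + \<epsilon> * s^2" .
  qed (use ab in simp)
  finally show ?case using yc by blast
 qed
qed

end

lemma uj_vec:
 fixes y :: "real => 'c => real^'n::finite"
 assumes "!!i. uj I (%s t. y s t $ i) (%t. x t $ i) (%t. V t $ i) (%t. Z t $ i)"
 shows "uj I y x V Z"
proof -
 have b: "bdd I W" if "!!i. bdd I (%t. W t $ i)" for W :: "'c => real^'n"
 proof -
  have "\<forall>i. \<exists>B. 0 <= B & (\<forall>t\<in>I. \<bar>W t $ i\<bar> <= B)" using that unfolding bdd_def by auto
  then obtain B where B: "!!i. 0 <= B i" "!!i t. t \<in> I ==> \<bar>W t $ i\<bar> <= B i" unfolding choice_iff by blast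
  show ?thesis unfolding bdd_def
  proof (intro exI[of _ "SU i. B i"] conjI ballI)
   fix t assume t: "t \<in> I"
   show "norm (W t) <= (SU i. B i)"
    by (rule order_trans[OF norm_le_l1_cart]) (use B(2)[OF t] in \<open>simp add: sum_mono\<close>)
  qed (use B(1) in \<open>simp add: sum_nonneg\<close>)
 qed
 let ?e = "%s t. y s t - (x t + s *\<^sub>R V t + (s^2 / 2) *\<^sub>R Z t)"
 have sm: "usmall I (%s t. \<Sum>i\<in>S. \<bar>?e s t $ i\<bar>)" if "finite S" for S :: "'n set"
  using that
 proof induction
  case (insert i S)
  have "usmall I (%s t. ?e s t $ i)" using assms[of i] by (simp add: uj_def)
  then have "usmall I (%s t. \<bar>?e s t $ i\<bar>)" by (rule usmall_le[of _ _ 1]) simp_all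
  from usmall_add[OF this insert.IH] show ?case using insert by simp
 qed (simp add: usmall_zero)
 have "usmall I ?e"
  by (rule usmall_le[OF sm[OF finite], of 1])
   (auto intro!: always_eventually order_trans[OF norm_le_l1_cart] simp: sum_nonneg)
 then show ?thesis unfolding uj_def using assms by (auto simp: uj_def intro!: b)
qed

text \<open>With \<open>a\<close> and \<delta> the lengths of two consecutive parameter intervals,
  this makes bounds of the form "length of the interval times energy" for squared distances
  additive.\<close>

lemma cauchy_split:
 fixes x y a \<delta> :: real
 assumes "0 < a" "0 < \<delta>"
 shows "(x + y)^2 <= (a + \<delta>) * (x^2 / a + y^2 / \<delta>)"
proof -
 have "(a + \<delta>) * (x^2 / a + y^2 / \<delta>) - (x + y)^2 = (\<delta> * x - a * y)^2 / (a * \<delta>)"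
  using assms by (simp add: field_simps power2_eq_square)
 also have "... >= 0" using assms by simp
 finally show ?thesis by simp
qed

text \<open>The second derivative of \<open>T\<close> in the transformation law of the Christoffel
  symbols is exactly the one that a change of coordinates adds to the second order term of a curve.
  So a prescribed covariant acceleration means the same in all charts.\<close>

lemma (in soliton_change) accel_change:
 assumes u: "u \<in> U"
 shows "jac T u (S.accel h u e) + jac (%y. jac T y (h *\<^sub>R e)) u (h *\<^sub>R e) = S'.accel h (T u) (jac T u e)"
 unfolding S.accel_def S'.accel_def jac_add jac_minus Gam_change[OF u]
 by (simp add: jac_scale X_change[OF u])

section \<open>Barriers for the squared distance and one step of their propagation\<close>

context soliton
begin

text \<open>A curve through \<open>x\<close> with coordinate velocity \<open>V\<close> and
  coordinate acceleration \<open>Z\<close>, up to o(s^2). The one-point index set makes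
  \<open>uj\<close> an expansion of a function of \<open>s\<close> alone.\<close>

definition has_jet :: "('a, 'n) chart => (real => 'a) => real^'n => real^'n => real^'n => bool" where
 "has_jet c \<sigma> x V Z \<longleftrightarrow> (\<forall>\<^sub>F s in nhds 0. \<sigma> s \<in> cdom c) &
  uj {()} (%s _. cmap c (\<sigma> s)) (%_. x) (%_. V) (%_. Z)"

abbreviation acc :: "('a, 'n) chart => real => real^'n => real^'n => real^'n" where
 "acc c \<equiv> local_soliton.accel (G c) (\<phi> \<circ> cinv c)"

lemma jet_change:
 assumes c: "c \<in> A" "c' \<in> A" and q: "q \<in> cdom c" "q \<in> cdom c'" and j: "has_jet c' \<sigma> (cmap c' q) V Z"
 shows "has_jet c \<sigma> (cmap c q) (jac (trans_map c' c) (cmap c' q) V)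
  (jac (trans_map c' c) (cmap c' q) Z + jac (%y. jac (trans_map c' c) y V) (cmap c' q) V)"
proof -
 let ?T = "trans_map c' c" and ?U = "cmap c' ` (cdom c' \<inter> cdom c)" and ?u = "cmap c' q"
 have U: "open ?U" "?u \<in> ?U" using open_overlap[OF c(2,1)] q by auto
 have ev: "\<forall>\<^sub>F s in nhds 0. \<sigma> s \<in> cdom c'" and uj: "uj {()} (%s _. cmap c' (\<sigma> s)) (%_. ?u) (%_. V) (%_. Z)"
  using j by (simp_all add: has_jet_def)
 obtain e where e: "e > 0" "cball ?u e \<subseteq> ?U" using U open_contains_cball by blast
 have ev2: "\<forall>\<^sub>F s in nhds 0. \<sigma> s \<in> cdom c & ?T (cmap c' (\<sigma> s)) = cmap c (\<sigma> s)"
  using ev uj_near[OF uj e(1)]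
 proof eventually_elim
  case (elim s)
  have "cmap c' (\<sigma> s) \<in> cball ?u e" using elim(2) by (simp add: dist_norm norm_minus_commute)
  then have "cmap c' (\<sigma> s) \<in> ?U" using e(2) by blast
  then obtain q' where q': "q' \<in> cdom c' \<inter> cdom c" "cmap c' (\<sigma> s) = cmap c' q'" by blast
  then have "\<sigma> s = q'" using elim(1) c(2) cinv_cmap by (metis IntD1)
  then show ?case using q' c elim(1) by auto
 qed
 have sm: "Cinf_on ?U (%u. ?T u $ k)" for k using smap_trans[OF c(2,1)] unfolding smap_def by blast
 have "uj {()} (%s _. ?T (cmap c' (\<sigma> s))) (%_. ?T ?u) (%_. jac ?T ?u V)
  (%_. jac ?T ?u Z + jac (%y. jac ?T y V) ?u V)"
 proof (rule uj_vec)
  fix k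
  have "uj {()} (%s _. ?T (cmap c' (\<sigma> s)) $ k) (%_. ?T ?u $ k) (%_. dir (%u. ?T u $ k) ?u V)
    (%_. dir (%u. ?T u $ k) ?u Z + dir2 (%u. ?T u $ k) ?u V)"
   by (rule uj_compose[OF sm U(1) _ _ _ uj, of "{?u}"]) (use U(2) in auto)
  then show "uj {()} (%s _. ?T (cmap c' (\<sigma> s)) $ k) (%_. ?T ?u $ k) (%_. jac ?T ?u V $ k)
    (%_. (jac ?T ?u Z + jac (%y. jac ?T y V) ?u V) $ k)"
   by (simp add: jac_nth dir2_def)
 qed
 then have *: "uj {()} (%s _. ?T (cmap c' (\<sigma> s))) (%_. cmap c q) (%_. jac ?T ?u V)
  (%_. jac ?T ?u Z + jac (%y. jac ?T y V) ?u V)" using c q by simp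
 have "uj {()} (%s _. cmap c (\<sigma> s)) (%_. cmap c q) (%_. jac ?T ?u V)
  (%_. jac ?T ?u Z + jac (%y. jac ?T y V) ?u V)"
  using * unfolding uj_def
  by (elim conjE, intro conjI) (assumption | erule usmall_eq, rule eventually_mono[OF ev2], simp)+
 moreover have "\<forall>\<^sub>F s in nhds 0. \<sigma> s \<in> cdom c" using ev2 by (rule eventually_mono) simp
 ultimately show ?thesis by (simp add: has_jet_def)
qed

text \<open>The induction hypothesis of the comparison argument: along the curves issuing from \<open>q = \<gamma> t\<close> with
 velocity \<open>h E\<^sub>i\<close> and the prescribed covariant acceleration, the squared distance from \<open>p\<close> has quadratic
 upper barriers, and the sum of their second order coefficients is controlled by \<open>\<kappa>\<close>. All curves with
 the given second order jet are admitted, which makes the statement independent of the chart.\<close>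

definition state :: "'a => real => 'a => ('a, 'n) chart => real => real => real => bool" where
 "state p r q c t h \<kappa> \<longleftrightarrow> c \<in> A & q \<in> cdom c & (\<exists>E e1 e2. onb (G c) (cmap c q) E &
  (\<forall>i. \<bar>e1 i\<bar> <= 2 * r * h) & (SU i. e2 i) <= 2 * \<kappa> &
  (\<forall>i \<sigma>. has_jet c \<sigma> (cmap c q) (h *\<^sub>R E i) (acc c h (cmap c q) (E i)) -->
   (\<forall>\<epsilon>>0. \<forall>\<^sub>F s in nhds 0. (d p (\<sigma> s))^2 <= t * (r^2 * t + s * e1 i + s^2 / 2 * e2 i) + \<epsilon> * s^2)))"

lemma state_change:
 assumes st: "state p r q c t h \<kappa>" and c': "c' \<in> A" "q \<in> cdom c'"
 shows "state p r q c' t h \<kappa>"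
proof -
 have c: "c \<in> A" "q \<in> cdom c" using st by (auto simp: state_def)
 obtain E e1 e2 where E: "onb (G c) (cmap c q) E" and e: "\<forall>i. \<bar>e1 i\<bar> <= 2 * r * h" "(SU i. e2 i) <= 2 * \<kappa>"
  and b: "!!i \<sigma>. has_jet c \<sigma> (cmap c q) (h *\<^sub>R E i) (acc c h (cmap c q) (E i)) ==>
   (\<forall>\<epsilon>>0. \<forall>\<^sub>F s in nhds 0. (d p (\<sigma> s))^2 <= t * (r^2 * t + s * e1 i + s^2 / 2 * e2 i) + \<epsilon> * s^2)"
  using st unfolding state_def by blast
 let ?T = "trans_map c' c" and ?U = "cmap c' ` (cdom c' \<inter> cdom c)" and ?u = "cmap c' q"
 interpret C: soliton_change ?U "G c'" "\<phi> \<circ> cinv c'" lam "cimg c" "G c" "\<phi> \<circ> cinv c" ?T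
  by (rule soliton_change_charts[OF c'(1) c(1)])
 have u: "?u \<in> ?U" "?T ?u = cmap c q" using c c' by auto
 have "\<forall>i. \<exists>a. jac ?T ?u a = E i" using C.jac_surj[OF u(1)] by blast
 then obtain E' where E': "!!i. jac ?T ?u (E' i) = E i" unfolding choice_iff by blast
 have "onb (G c') ?u E'" using E unfolding onb_def C.G_T[OF u(1)] E' u(2) .
 moreover have "has_jet c \<sigma> (cmap c q) (h *\<^sub>R E i) (acc c h (cmap c q) (E i))"
  if "has_jet c' \<sigma> ?u (h *\<^sub>R E' i) (acc c' h ?u (E' i))" for i \<sigma>
  using jet_change[OF c(1) c'(1) c(2) c'(2) that] C.accel_change[OF u(1), of h "E' i"]
  by (simp add: jac_scale E' u(2))
 ultimately show ?thesis unfolding state_def using c' e b by blast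
qed

lemma state_init:
 assumes c: "c \<in> A" "q \<in> cdom c" and q: "d p q = r * t" and r: "0 <= r" "0 <= t"
 shows "state p r q c t 0 0"
proof -
 interpret S: local_soliton "cimg c" "G c" "\<phi> \<circ> cinv c" lam by (rule local_soliton_chart[OF c(1)])
 let ?x = "cmap c q"
 have x: "?x \<in> cimg c" using c by simp
 obtain E where E: "onb (G c) ?x E" using S.onb_exists[OF x] by blast
 obtain \<rho> where \<rho>: "0 < \<rho>" "cball ?x \<rho> \<subseteq> cimg c" using open_cimg[OF c(1)] x open_contains_cball by blast
 obtain C m M \<delta>0 where C: "0 <= C" "0 < M" "0 < \<delta>0" "\<delta>0 <= \<rho> / 2" "C * \<delta>0 <= 1/2"
  and M: "!!u w. u \<in> cball ?x \<rho> ==> gnorm c u w <= M * norm w"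
  and U: "!!u \<delta> v w. u \<in> cball ?x (\<rho>/2) ==> 0 < \<delta> ==> \<delta> <= \<delta>0 ==> v \<in> cball u \<delta> ==> w \<in> cball u \<delta> ==>
   d (cinv c v) (cinv c w) <= (1 + C * \<delta>) * gnorm c u (w - v)"
  using chart_distance[OF c(1) \<rho>(2,1)] by auto
 have dM: "d q (cinv c w) <= 2 * M * norm (w - ?x)" if w: "norm (w - ?x) <= \<delta>0" for w
 proof -
  have "d (cinv c ?x) (cinv c w) <= (1 + C * \<delta>0) * gnorm c ?x (w - ?x)"
   by (rule U[OF _ C(3) order_refl]) (use w C \<rho> in \<open>auto simp: dist_norm norm_minus_commute\<close>)
  also have "... <= 2 * (M * norm (w - ?x))" using C M[of ?x "w - ?x"] \<rho> S.gin_nonneg[OF x] by (intro mult_mono) auto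
  finally show ?thesis using c by simp
 qed
 have "\<forall>\<^sub>F s in nhds 0. (d p (\<sigma> s))^2 <= t * (r^2 * t + s * 0 + s^2 / 2 * 0) + \<epsilon> * s^2"
  if j: "has_jet c \<sigma> ?x (0 *\<^sub>R E i) (acc c 0 ?x (E i))" and \<epsilon>: "0 < \<epsilon>" for \<sigma> i \<epsilon>
 proof -
  have "acc c 0 ?x (E i) = 0" by (simp add: S.accel_def Gam_zero1)
  then have uj: "uj {()} (%s _. cmap c (\<sigma> s)) (%_. ?x) (%_. 0) (%_. 0)" and ev: "\<forall>\<^sub>F s in nhds 0. \<sigma> s \<in> cdom c"
   using j by (simp_all add: has_jet_def)
  have us: "usmall {()} (%s _. cmap c (\<sigma> s) - ?x)" using uj by (simp add: uj_def)
  \<comment> \<open>Collects the coefficients of k s^2 in the expansion of (r t + 2 M k s^2)^2, the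
    square of k s^2 being estimated by k s^2. Then \<open>k\<close> is chosen with D k <=
    \<epsilon>.\<close>
  define D where "D = 4 * (r * t) * M + 4 * M^2"
  have D: "0 <= D" using r C by (simp add: D_def)
  define k where "k = min 1 (\<epsilon> / (D + 1))"
  have k: "0 < k" "k <= 1" "D * k <= \<epsilon>"
  proof -
   show k0: "0 < k" using \<epsilon> D by (simp add: k_def)
   have "k <= \<epsilon> / (D + 1)" by (simp add: k_def)
   then have "k * (D + 1) <= \<epsilon>" using D by (simp add: pos_le_divide_eq)
   then show "D * k <= \<epsilon>" using k0 by (simp add: algebra_simps)
  qed (simp add: k_def)
  from usmallD[OF us k(1)] uj_near[OF uj C(3)] ev eventually_small[OF zero_less_one]
  show ?thesis
  proof eventually_elim
   case (elim s)
   have s2: "s^2 <= 1" using elim(4) abs_square_le_1 by blast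
   have n: "norm (cmap c (\<sigma> s) - ?x) <= k * s^2" using elim(1) by simp
   have "d q (\<sigma> s) <= 2 * M * norm (cmap c (\<sigma> s) - ?x)" using dM[of "cmap c (\<sigma> s)"] elim(2,3) c by simp
   also have "... <= 2 * M * (k * s^2)" using n C by (intro mult_left_mono) auto
   finally have 1: "d q (\<sigma> s) <= 2 * M * (k * s^2)" .
   have "d p (\<sigma> s) <= r * t + 2 * M * (k * s^2)" using d_triangle[of p "\<sigma> s" q] q 1 by simp
   then have "(d p (\<sigma> s))^2 <= (r * t + 2 * M * (k * s^2))^2" by (rule power_mono) (rule d_nonneg)
   also have "... = (r * t)^2 + 4 * (r * t) * M * (k * s^2) + 4 * M^2 * ((k * s^2) * (k * s^2))"
    by (simp add: power2_eq_square algebra_simps)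
   also have "... <= (r * t)^2 + 4 * (r * t) * M * (k * s^2) + 4 * M^2 * (k * s^2)"
   proof -
    have "(k * s^2) * (k * s^2) <= k * s^2" using k s2 by (intro mult_left_le) (auto intro: mult_le_one)
    then show ?thesis by (intro add_left_mono mult_left_mono) auto
   qed
   also have "... = (r * t)^2 + D * k * s^2" by (simp add: D_def algebra_simps)
   also have "... <= (r * t)^2 + \<epsilon> * s^2" using k(3) by (simp add: mult_right_mono)
   finally show ?case by (simp add: power2_eq_square mult_ac)
  qed
 qed
 then show ?thesis unfolding state_def using c E
  by (intro conjI exI[of _ E] exI[of _ "%i. 0"]) auto
qed

text \<open>The arc over \<open>{a..b}\<close> is varied inside one chart. The end of the variation
  runs along the given curve, its start along a curve to which the barrier at \<gamma> a applies.
  The triangle inequality and \<open>cauchy_split\<close> add the barrier at the start to the energy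
  bound for the arc.\<close>

lemma state_step:
 assumes c: "c \<in> A" and ab: "0 < a" "a < b" and im: "\<gamma> ` {a..b} \<subseteq> cdom c"
  and x: "!!t. t \<in> {a..b} ==> ((%t. cmap c (\<gamma> t)) has_vector_derivative v t) (at t within {a..b})"
  and v: "continuous_on {a..b} v" "!!t. t \<in> {a..b} ==> gin (G c) (cmap c (\<gamma> t)) (v t) (v t) = r^2"
  and K: "!!t w. t \<in> {a..b} ==> norm (Gam (G c) (cmap c (\<gamma> t)) (v t) w) <= K * norm w" "0 <= K" "K * (b - a) <= 1/2"
  and r: "0 <= r" and \<eta>: "0 <= \<eta>"
  and k: "!!t. t \<in> {a..b} ==> real CARD('n) * \<eta>^2 - lam * (h + \<eta> * (t - a))^2 * r^2
   + 2 * (h + \<eta> * (t - a)) * \<eta> * dir (\<phi> \<circ> cinv c) (cmap c (\<gamma> t)) (v t) <= k"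
  and st: "state p r (\<gamma> a) c a h \<kappa>"
 shows "state p r (\<gamma> b) c b (h + \<eta> * (b - a)) (\<kappa> + k * (b - a))"
proof -
 interpret S: local_soliton "cimg c" "G c" "\<phi> \<circ> cinv c" lam by (rule local_soliton_chart[OF c])
 define x where "x t = cmap c (\<gamma> t)" for t
 let ?I = "{a..b}"
 have x': "(x has_vector_derivative v t) (at t within ?I)" if "t \<in> ?I" for t using x[OF that] unfolding x_def .
 have xim: "x ` ?I \<subseteq> cimg c" using im by (auto simp: x_def)
 have xU: "x t \<in> cimg c" if "t \<in> ?I" for t using xim that by blast
 have cx: "continuous_on ?I x" by (rule continuous_on_vector_derivative[OF x'])
 obtain E0 e1 e2 where E0: "onb (G c) (x a) E0" and e: "!!i. \<bar>e1 i\<bar> <= 2 * r * h" "(SU i. e2 i) <= 2 * \<kappa>"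
  and barrier: "!!i \<sigma> \<epsilon>. has_jet c \<sigma> (x a) (h *\<^sub>R E0 i) (acc c h (x a) (E0 i)) ==> \<epsilon> > 0 ==>
   \<forall>\<^sub>F s in nhds 0. (d p (\<sigma> s))^2 <= a * (r^2 * a + s * e1 i + s^2 / 2 * e2 i) + \<epsilon> * s^2"
  using st unfolding state_def x_def by blast
 have "\<exists>E. E a = E0 & (\<forall>t\<in>?I. onb (G c) (x t) (E t) &
  (\<forall>i. ((%t. E t i) has_vector_derivative - Gam (G c) (x t) (v t) (E t i)) (at t within ?I)))"
  by (rule S.parallel_frame[OF less_imp_le[OF ab(2)] x' xim v(1) K(1)[folded x_def] K(2,3) E0])
 then obtain E where E: "E a = E0" "!!t. t \<in> ?I ==> onb (G c) (x t) (E t)"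
  "!!t i. t \<in> ?I ==> ((%t. E t i) has_vector_derivative - Gam (G c) (x t) (v t) (E t i)) (at t within ?I)" by blast
 define H where "H t = h + \<eta> * (t - a)" for t
 have Hd: "(H has_real_derivative \<eta>) (at t within ?I)" for t
  unfolding H_def by (auto intro!: derivative_eq_intros)
 have cH: "continuous_on ?I H" unfolding H_def by (intro continuous_intros)
 have cE: "continuous_on ?I (%t. E t i)" for i by (rule continuous_on_vector_derivative[OF E(3)])
 have cX: "continuous_on ?I (%t. S.X (x t))"
  by (rule continuous_on_compose2[OF smap_continuous_on[OF S.smooth_X] cx xim])
 define V where "V i t = H t *\<^sub>R E t i" for i t
 define V' where "V' i t = S.dvar (H t) \<eta> (x t) (v t) (E t i)" for i t
 define Z where "Z i t = S.accel (H t) (x t) (E t i)" for i t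
 define Z' where "Z' i t = S.daccel (H t) \<eta> (x t) (v t) (E t i)" for i t
 have dV: "(V i has_vector_derivative V' i t) (at t within ?I)" if t: "t \<in> ?I" for i t
  unfolding V_def V'_def by (rule S.dvar_derivative[where x = x and t = t, OF xU[OF t] Hd E(3)[OF t]])
 have dZ: "(Z i has_vector_derivative Z' i t) (at t within ?I)" if t: "t \<in> ?I" for i t
  unfolding Z_def Z'_def by (rule S.daccel_derivative[where x = x and t = t, OF xU[OF t] Hd x'[OF t] E(3)[OF t]])
 have cV: "continuous_on ?I (V i)" for i by (rule continuous_on_vector_derivative[OF dV])
 have cV': "continuous_on ?I (V' i)" for i
  unfolding V'_def S.dvar_def
  by (intro continuous_on_diff continuous_on_scaleR continuous_on_const cH cE S.continuous_on_Gam cx xim v(1))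
 have cjX: "continuous_on ?I (%t. jac S.X (x t) (v t))"
 proof -
  have eq: "jac S.X u w = (\<chi> k. dir (%u. S.X u $ k) u w)" for u w
   by (simp add: vec_eq_iff jac_nth)
  show ?thesis unfolding eq
   by (intro continuous_on_vec_lambda continuous_on_dir[OF _ cx xim v(1)]) (use S.smooth_X in \<open>auto simp: smap_def\<close>)
 qed
 have cdG: "continuous_on ?I (%t. dGam (G c) (x t) (v t) (a t) (a t))" if "continuous_on ?I a" for a
  unfolding dGam_def dbil_def bil_def
  by (intro continuous_on_vec_lambda continuous_on_sum continuous_on_mult continuous_on_component
    continuous_on_dir[OF S.smooth_christoffel cx xim v(1)] that)
 have cZ': "continuous_on ?I (Z' i)" for i
  unfolding Z'_def S.daccel_def V'_def[symmetric] V_def[symmetric]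
  by (intro continuous_on_add continuous_on_minus continuous_on_scaleR continuous_on_const continuous_on_mult continuous_on_divide
    continuous_on_power cH cV cV' cdG cjX cX S.continuous_on_Gam cx xim) auto
 define f1 where "f1 i t = dgin (G c) (x t) (V i t) (v t) (v t) + 2 * gin (G c) (x t) (V' i t) (v t)" for i t
 define f2 where "f2 i t = 2 * S.var2 (H t) \<eta> (x t) (v t) (E t i)" for i t
 have f1: "f1 i = (%t. dgin (G c) (x t) (V i t) (v t) (v t) + 2 * gin (G c) (x t) (V' i t) (v t))" for i
  by (simp add: f1_def fun_eq_iff)
 have f2: "f2 i = (%t. 2 * (S.ddgin (x t) (V i t) (V i t) (v t) (v t) / 2 + dgin (G c) (x t) (Z i t) (v t) (v t) / 2
   + 2 * dgin (G c) (x t) (V i t) (V' i t) (v t) + gin (G c) (x t) (V' i t) (V' i t) + gin (G c) (x t) (Z' i t) (v t)))" for i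
  by (simp add: f2_def fun_eq_iff S.var2_def V_def V'_def Z_def Z'_def)
 have int1: "f1 i integrable_on ?I" for i
  by (rule dist_expansion(1)[OF c ab(2) xim x' dV dZ v(1) cV' cZ' usmall_zero f1 f2 refl zero_less_one])
 have int2: "f2 i integrable_on ?I" for i
  by (rule dist_expansion(2)[OF c ab(2) xim x' dV dZ v(1) cV' cZ' usmall_zero f1 f2 refl zero_less_one])
 have "\<bar>f1 i t\<bar> <= 2 * r * \<eta>" if t: "t \<in> ?I" for i t
 proof -
  have "f1 i t = 2 * \<eta> * gin (G c) (x t) (E t i) (v t)"
   unfolding f1_def V_def V'_def by (rule S.var1[OF xU[OF t]])
  moreover have "\<bar>gin (G c) (x t) (E t i) (v t)\<bar> <= r"
   using S.cauchy_gin[OF xU[OF t], of "E t i" "v t"] E(2)[OF t] v(2)[OF t] r by (simp add: onb_def x_def)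
  then have "2 * \<eta> * \<bar>gin (G c) (x t) (E t i) (v t)\<bar> <= 2 * \<eta> * r" using \<eta> by (intro mult_left_mono) auto
  ultimately show ?thesis using \<eta> by (simp add: abs_mult mult_ac)
 qed
 then have I1: "\<bar>integral ?I (f1 i)\<bar> <= 2 * r * \<eta> * (b - a)" for i
  using integral_norm_bound_integral[OF int1[of i], of "%t. 2 * r * \<eta>"] ab
  by (simp add: integrable_const_ivl mult_ac)
 have I2: "(SU i. integral ?I (f2 i)) <= 2 * k * (b - a)"
 proof -
  have "(SU i. integral ?I (f2 i)) = integral ?I (%t. SU i. f2 i t)"
   by (rule integral_sum[symmetric]) (simp_all add: int2)
  also have "... <= integral ?I (%t. 2 * k)"
  proof (rule integral_le)
   show "(%t. SU i. f2 i t) integrable_on ?I" by (intro integrable_sum int2) simp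
   fix t assume t: "t \<in> ?I"
   have "(SU i. f2 i t) = 2 * (SU i. S.var2 (H t) \<eta> (x t) (v t) (E t i))"
    by (simp add: f2_def sum_distrib_left)
   also have "... <= 2 * k"
    using k[OF t] v(2)[OF t] unfolding S.sum_var2[OF xU[OF t] E(2)[OF t]] by (simp add: x_def H_def)
   finally show "(SU i. f2 i t) <= 2 * k" .
  qed (simp add: integrable_const_ivl)
  also have "... = 2 * k * (b - a)" using ab by simp
  finally show ?thesis .
 qed
 have fin: "\<forall>\<^sub>F s in nhds 0. (d p (\<sigma> s))^2 <= b * (r^2 * b + s * (e1 i + integral ?I (f1 i)) + s^2 / 2 * (e2 i + integral ?I (f2 i))) + \<epsilon> * s^2"
  if j: "has_jet c \<sigma> (x b) (V i b) (Z i b)" and \<epsilon>: "0 < \<epsilon>" for i \<sigma> \<epsilon>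
 proof -
  \<comment> \<open>The deviation of the given curve from its quadratic part, added to the whole
    variation so that the end point is exactly \<sigma> s.\<close>
  define \<rho> where "\<rho> s = cmap c (\<sigma> s) - (x b + s *\<^sub>R V i b + (s^2 / 2) *\<^sub>R Z i b)" for s
  have "usmall {()} (%s _. \<rho> s)" using j unfolding has_jet_def uj_def \<rho>_def by blast
  then have us: "usmall J (%s t. \<rho> s)" for J :: "'z set" unfolding usmall_def by (auto elim: eventually_mono)
  define y where "y = (%s t. x t + s *\<^sub>R V i t + (s^2 / 2) *\<^sub>R Z i t + \<rho> s)"
  have ev: "\<forall>\<^sub>F s in nhds 0. (\<forall>t\<in>{a..b}. y s t \<in> cimg c) & (d (cinv c (y s a)) (cinv c (y s b)))^2
   <= (b - a) * (integral {a..b} (%t. gin (G c) (x t) (v t) (v t)) + s * integral {a..b} (f1 i) + s^2 / 2 * integral {a..b} (f2 i) + \<epsilon>' * s^2)"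
   if "\<epsilon>' > 0" for \<epsilon>'
   by (rule dist_expansion(3)[OF c ab(2) xim x' dV dZ v(1) cV' cZ' us f1 f2 y_def that])
  have I0: "integral {a..b} (%t. gin (G c) (x t) (v t) (v t)) = r^2 * (b - a)"
  proof -
   have "integral {a..b} (%t. gin (G c) (x t) (v t) (v t)) = integral {a..b} (%t. r^2)"
    by (rule integral_cong) (use v(2) in \<open>simp add: x_def\<close>)
   then show ?thesis using ab by simp
  qed
  have yb: "cinv c (y s b) = \<sigma> s" if "\<sigma> s \<in> cdom c" for s using that c by (simp add: y_def \<rho>_def)
  \<comment> \<open>Being o(s^2), the shift by \<rho> does not affect the 2-jet at the start, so the
    barrier at \<gamma> a covers this curve.\<close>
  have jc: "has_jet c (%s. cinv c (y s a)) (x a) (h *\<^sub>R E0 i) (acc c h (x a) (E0 i))"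
  proof -
   have "V i a = h *\<^sub>R E0 i" "Z i a = acc c h (x a) (E0 i)" by (simp_all add: V_def Z_def H_def E(1))
   moreover have "uj {()} (%s _. y s a) (%_. x a) (%_. V i a) (%_. Z i a)"
    unfolding y_def by (intro uj_quadratic bdd_const us)
   moreover have evc: "\<forall>\<^sub>F s in nhds 0. y s a \<in> cimg c"
    using ev[OF zero_less_one] by (rule eventually_mono) (use ab in auto)
   then have "uj {()} (%s _. cmap c (cinv c (y s a))) (%_. x a) (%_. V i a) (%_. Z i a)
     \<longleftrightarrow> uj {()} (%s _. y s a) (%_. x a) (%_. V i a) (%_. Z i a)"
    unfolding uj_def using c
    by (intro conj_cong refl iffI; elim usmall_eq) (auto elim!: eventually_mono)
   moreover have "\<forall>\<^sub>F s in nhds 0. cinv c (y s a) \<in> cdom c" using evc by (rule eventually_mono) (use c in auto)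
   ultimately show ?thesis by (simp add: has_jet_def)
  qed
  have ba: "0 < b - a" "0 < b" using ab by auto
  \<comment> \<open>After division by \<open>a\<close> and by b - a both errors are \<epsilon> s^2 /
    (2 b); the factor \<open>b\<close> of \<open>cauchy_split\<close> turns their sum into
    \<epsilon> s^2.\<close>
  have "0 < a * (\<epsilon> / (2 * b))" "0 < \<epsilon> / (2 * b)" using \<epsilon> ab by auto
  from barrier[OF jc this(1)] ev[OF this(2)] j[unfolded has_jet_def, THEN conjunct1]
  show ?thesis
  proof eventually_elim
   case (elim s)
   define D1 where "D1 = d p (cinv c (y s a))"
   define D2 where "D2 = d (cinv c (y s a)) (cinv c (y s b))"
   have D1: "D1^2 / a <= r^2 * a + s * e1 i + s^2 / 2 * e2 i + \<epsilon> / (2 * b) * s^2"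
   proof -
    have "D1^2 <= (r^2 * a + s * e1 i + s^2 / 2 * e2 i + \<epsilon> / (2 * b) * s^2) * a"
     using elim(1) by (simp add: D1_def algebra_simps)
    then show ?thesis by (simp only: pos_divide_le_eq[OF ab(1)])
   qed
   have D2: "D2^2 / (b - a) <= r^2 * (b - a) + s * integral ?I (f1 i) + s^2 / 2 * integral ?I (f2 i) + \<epsilon> / (2 * b) * s^2"
   proof -
    have "D2^2 <= (r^2 * (b - a) + s * integral ?I (f1 i) + s^2 / 2 * integral ?I (f2 i) + \<epsilon> / (2 * b) * s^2) * (b - a)"
     using elim(2) unfolding I0 by (simp add: D2_def mult.commute)
    then show ?thesis by (simp only: pos_divide_le_eq[OF ba(1)])
   qed
   have "d p (\<sigma> s) <= D1 + D2" using d_triangle[of p "\<sigma> s" "cinv c (y s a)"] yb[OF elim(3)] by (simp add: D1_def D2_def)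
   then have "(d p (\<sigma> s))^2 <= (D1 + D2)^2" by (rule power_mono) (rule d_nonneg)
   also have "... <= (a + (b - a)) * (D1^2 / a + D2^2 / (b - a))" by (rule cauchy_split[OF ab(1) ba(1)])
   also have "... <= b * ((r^2 * a + s * e1 i + s^2 / 2 * e2 i + \<epsilon> / (2 * b) * s^2)
     + (r^2 * (b - a) + s * integral ?I (f1 i) + s^2 / 2 * integral ?I (f2 i) + \<epsilon> / (2 * b) * s^2))"
    using D1 D2 ba by (simp add: mult_left_mono add_mono)
   also have "... = b * (r^2 * b + s * (e1 i + integral ?I (f1 i)) + s^2 / 2 * (e2 i + integral ?I (f2 i))) + \<epsilon> * s^2"
   proof -
    have 1: "b * (\<epsilon> / (2 * b) * s^2) = \<epsilon> / 2 * s^2" using ba by simp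
    have 2: "b * ((P + e) + (Q + e)) = b * (P + Q) + 2 * (b * e)" for P Q e :: real by (simp add: algebra_simps)
    show ?thesis unfolding 2 1 by (simp add: algebra_simps)
   qed
   finally show ?case .
  qed
 qed
 have "\<gamma> b \<in> cdom c" using im ab by auto
 moreover have "onb (G c) (x b) (E b)" using E(2) ab by auto
 moreover have "\<bar>e1 i + integral ?I (f1 i)\<bar> <= 2 * r * (h + \<eta> * (b - a))" for i
  using e(1)[of i] I1[of i] abs_triangle_ineq[of "e1 i" "integral ?I (f1 i)"] by (simp add: algebra_simps)
 moreover have "(SU i. e2 i + integral ?I (f2 i)) <= 2 * (\<kappa> + k * (b - a))"
  using e(2) I2 by (simp add: sum.distrib)
 moreover have "H b = h + \<eta> * (b - a)" by (simp add: H_def)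
 ultimately show ?thesis
  unfolding state_def x_def[symmetric] using c fin unfolding V_def Z_def
  by (intro conjI exI[of _ "E b"] exI[of _ "%i. e1 i + integral ?I (f1 i)"] exI[of _ "%i. e2 i + integral ?I (f2 i)"]) auto
qed

end

section \<open>Propagation along a whole geodesic and gradient bounds for the potential\<close>

context soliton
begin

lemma state_mono:
 assumes "state p r q c t h \<kappa>" "\<kappa> <= \<kappa>'"
 shows "state p r q c t h \<kappa>'"
proof -
 have "x <= 2 * \<kappa> ==> x <= 2 * \<kappa>'" for x using assms(2) by linarith
 then show ?thesis using assms(1) unfolding state_def by blast
qed

text \<open>Induction by bisection: near each \<open>t\<close> the geodesic lies in one chart with
  bounded Christoffel terms, so \<open>state_step\<close> applies to every short interval containing
  \<open>t\<close>, after \<open>state_change\<close> has moved the barriers to that chart.\<close>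

lemma state_chain:
 assumes \<gamma>: "!!s t. s \<in> {0..1} ==> t \<in> {0..1} ==> d (\<gamma> s) (\<gamma> t) = r * \<bar>s - t\<bar>"
  and ab: "0 < a" "a <= b" "b <= 1" and \<eta>: "0 <= \<eta>"
  and k: "!!t c v. t \<in> {a..b} ==> c \<in> A ==> \<gamma> t \<in> cdom c ==> gin (G c) (cmap c (\<gamma> t)) v v = r^2 ==>
   real CARD('n) * \<eta>^2 - lam * (h + \<eta> * (t - a))^2 * r^2
   + 2 * (h + \<eta> * (t - a)) * \<eta> * dir (\<phi> \<circ> cinv c) (cmap c (\<gamma> t)) v <= k"
  and st: "state p r (\<gamma> a) c0 a h \<kappa>"
 shows "\<exists>c. state p r (\<gamma> b) c b (h + \<eta> * (b - a)) (\<kappa> + k * (b - a))"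
proof -
 have r0: "r >= 0" using \<gamma>[of 0 1] d_nonneg[of "\<gamma> 0" "\<gamma> 1"] by simp
 define Q where "Q s \<longleftrightarrow> (\<exists>c. state p r (\<gamma> s) c s (h + \<eta> * (s - a)) (\<kappa> + k * (s - a)))" for s
 define P where "P s s' \<longleftrightarrow> (a <= s & s <= s' & s' <= b --> Q s --> Q s')" for s s'
 have "P a b"
  using ab(2)
 proof (induction rule: Bolzano)
  case (trans s t u)
  then show ?case unfolding P_def by auto
 next
  case (local t)
  have t: "0 < t" "t <= 1" using local ab by auto
  obtain c where c: "c \<in> A" "\<gamma> t \<in> cdom c" using chart_ex by blast
  obtain a1 b1 v where a1: "0 < a1" "a1 < t" "t <= b1" "b1 <= 1" "t < 1 --> t < b1" "\<gamma> ` {a1..b1} \<subseteq> cdom c"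
   and v: "continuous_on {a1..b1} v" "!!s. s \<in> {a1..b1} ==> ((%s. cmap c (\<gamma> s)) has_vector_derivative v s) (at s within {a1..b1})"
    "!!s. s \<in> {a1..b1} ==> gin (G c) (cmap c (\<gamma> s)) (v s) (v s) = r^2"
   using geodesic_C1[of \<gamma> r c t, OF \<gamma> c(1) t c(2)] by auto
  interpret S: local_soliton "cimg c" "G c" "\<phi> \<circ> cinv c" lam by (rule local_soliton_chart[OF c(1)])
  have cx: "continuous_on {a1..b1} (%s. cmap c (\<gamma> s))" by (rule continuous_on_vector_derivative[OF v(2)])
  have im: "(%s. cmap c (\<gamma> s)) ` {a1..b1} \<subseteq> cimg c" using a1(6) by auto
  obtain K where K: "K >= 0" "!!s w. s \<in> {a1..b1} ==> norm (Gam (G c) (cmap c (\<gamma> s)) (v s) w) <= K * norm w"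
   using S.Gam_bound[OF compact_Icc cx im v(1)] by blast
  \<comment> \<open>At t = 1 there are no parameters to the right, hence the dummy value 1. The last
    bound ensures K (s' - s) <= 1/2, as the transport of the frame requires.\<close>
  define \<delta> where "\<delta> = min (min (t - a1) (if t < 1 then b1 - t else 1)) (1 / (2 * (K + 1)))"
  have \<delta>: "0 < \<delta>" "\<delta> <= t - a1" "t < 1 ==> \<delta> <= b1 - t" "\<delta> <= 1 / (2 * (K + 1))"
   using a1 K by (auto simp: \<delta>_def)
  show ?case
  proof (intro exI[of _ \<delta>] conjI allI impI)
   fix s s' assume ss: "s <= t & t <= s' & s' - s < \<delta>"
   show "P s s'"
    unfolding P_def
   proof (intro impI)
    assume ord: "a <= s & s <= s' & s' <= b" and Q: "Q s"
    show "Q s'"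
    proof (cases "s = s'")
     case False
     then have lt: "s < s'" using ord by simp
     have in1: "a1 <= s" using ss \<delta>(2) by linarith
     have in2: "s' <= b1"
     proof (cases "t < 1")
      case True then show ?thesis using ss \<delta>(3) by linarith
     next
      case False then show ?thesis using ord ab(3) a1(3) t(2) by linarith
     qed
     have sub: "{s..s'} \<subseteq> {a1..b1}" using in1 in2 by auto
     have Ks: "K * (s' - s) <= 1/2"
     proof -
      have "K * (s' - s) <= (K + 1) * (1 / (2 * (K + 1)))" using K(1) ss \<delta>(4) lt by (intro mult_mono) auto
      also have "... = 1/2" using K(1) by simp
      finally show ?thesis .
     qed
     obtain c1 where "state p r (\<gamma> s) c1 s (h + \<eta> * (s - a)) (\<kappa> + k * (s - a))" using Q unfolding Q_def by blast
     moreover have "\<gamma> s \<in> cdom c" using a1(6) in1 in2 lt by auto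
     ultimately have st: "state p r (\<gamma> s) c s (h + \<eta> * (s - a)) (\<kappa> + k * (s - a))" using state_change c(1) by blast
     have "state p r (\<gamma> s') c s' (h + \<eta> * (s - a) + \<eta> * (s' - s)) (\<kappa> + k * (s - a) + k * (s' - s))"
     proof (rule state_step[where \<gamma> = \<gamma> and v = v and a = s and b = s', OF c(1) _ lt _ _ _ _ _ K(1) Ks r0 \<eta> _ st])
      show "0 < s" using ord ab by linarith
      show "\<gamma> ` {s..s'} \<subseteq> cdom c" using a1(6) sub by blast
      show "continuous_on {s..s'} v" by (rule continuous_on_subset[OF v(1) sub])
      fix u assume u: "u \<in> {s..s'}"
      then have u1: "u \<in> {a1..b1}" using sub by blast
      show "((%t. cmap c (\<gamma> t)) has_vector_derivative v u) (at u within {s..s'})"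
       by (rule has_vector_derivative_within_subset[OF v(2)[OF u1] sub])
      show "gin (G c) (cmap c (\<gamma> u)) (v u) (v u) = r^2" by (rule v(3)[OF u1])
      show "norm (Gam (G c) (cmap c (\<gamma> u)) (v u) w) <= K * norm w" for w by (rule K(2)[OF u1])
      have eq: "h + \<eta> * (s - a) + \<eta> * (u - s) = h + \<eta> * (u - a)" by (simp add: algebra_simps)
      show "real CARD('n) * \<eta>^2 - lam * (h + \<eta> * (s - a) + \<eta> * (u - s))^2 * r^2
       + 2 * (h + \<eta> * (s - a) + \<eta> * (u - s)) * \<eta> * dir (\<phi> \<circ> cinv c) (cmap c (\<gamma> u)) (v u) <= k"
       unfolding eq by (rule k[OF _ c(1) _ v(3)[OF u1]]) (use u ord a1(6) u1 in auto)
     qed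
     moreover have "h + \<eta> * (s - a) + \<eta> * (s' - s) = h + \<eta> * (s' - a)" "\<kappa> + k * (s - a) + k * (s' - s) = \<kappa> + k * (s' - a)"
      by (simp_all add: algebra_simps)
     ultimately show ?thesis unfolding Q_def by metis
    qed (use Q in simp)
   qed
  qed (rule \<delta>(1))
 qed
 moreover have "state p r (\<gamma> a) c0 a (h + \<eta> * (a - a)) (\<kappa> + k * (a - a))" using st by simp
 then have "Q a" unfolding Q_def by blast
 ultimately show ?thesis using ab unfolding P_def Q_def by simp
qed

text \<open>The bound |grad \<phi>| <= M at \<open>q\<close>, tested on vectors. Asking for it in
  every chart makes it usable in whichever chart the geodesic is being followed.\<close>

definition grad_le :: "'a => real => bool" where
 "grad_le q M \<longleftrightarrow> (\<forall>c\<in>A. q \<in> cdom c --> (\<forall>v. \<bar>dir (\<phi> \<circ> cinv c) (cmap c q) v\<bar> <= M * gnorm c (cmap c q) v))"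

lemma grad_le_local: "\<exists>V M. open V & q0 \<in> V & 0 <= M & (\<forall>q\<in>V. grad_le q M)"
proof -
 obtain c where c: "c \<in> A" "q0 \<in> cdom c" using chart_ex by blast
 obtain \<rho> where \<rho>: "0 < \<rho>" "cball (cmap c q0) \<rho> \<subseteq> cimg c" using open_cimg[OF c(1)] c open_contains_cball by (metis imageI)
 let ?K = "cball (cmap c q0) \<rho>"
 interpret S: local_soliton "cimg c" "G c" "\<phi> \<circ> cinv c" lam by (rule local_soliton_chart[OF c(1)])
 obtain m M :: real where m: "0 < m" "0 < M" "!!u v. u \<in> ?K ==> m * norm v <= gnorm c u v" "!!u v. u \<in> ?K ==> gnorm c u v <= M * norm v"
  using chart_local_metric_bounds[OF local_metric_chart[OF c(1)] compact_cball \<rho>(2)] \<rho>(1) by force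
 obtain B where B: "B >= 0" "!!u h. u \<in> ?K ==> \<bar>dir (\<phi> \<circ> cinv c) u h\<bar> <= B * norm h"
  using dir_bound[OF S.smooth_phi compact_cball \<rho>(2)] by blast
 have b: "\<bar>dir (\<phi> \<circ> cinv c) u h\<bar> <= (B / m) * gnorm c u h" if u: "u \<in> ?K" for u h
 proof -
  have "B * norm h = (B / m) * (m * norm h)" using m by simp
  also have "... <= (B / m) * gnorm c u h" using m B u by (intro mult_left_mono) auto
  finally show ?thesis using B(2)[OF u, of h] by linarith
 qed
 have "grad_le q (B / m)" if q: "q \<in> cinv c ` ball (cmap c q0) \<rho>" for q
  unfolding grad_le_def
 proof (intro ballI impI allI)
  fix c' v assume c': "c' \<in> A" "q \<in> cdom c'"
  obtain w where w: "w \<in> ball (cmap c q0) \<rho>" "q = cinv c w" using q by blast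
  have wK: "w \<in> ?K" using w(1) by auto
  then have wc: "w \<in> cimg c" using \<rho>(2) by blast
  then have qc: "q \<in> cdom c" "cmap c q = w" using w c by auto
  let ?T = "trans_map c' c" and ?U = "cmap c' ` (cdom c' \<inter> cdom c)" and ?u = "cmap c' q"
  interpret C: soliton_change ?U "G c'" "\<phi> \<circ> cinv c'" lam "cimg c" "G c" "\<phi> \<circ> cinv c" ?T
   by (rule soliton_change_charts[OF c'(1) c(1)])
  have u: "?u \<in> ?U" "?T ?u = w" using qc c' by auto
  have "dir (\<phi> \<circ> cinv c') ?u v = dir (\<phi> \<circ> cinv c) w (jac ?T ?u v)"
   using dir_compose[OF C.smooth_T C.S.U_open u(1) S.smooth_phi S.U_open C.T_in[OF u(1)], of v]
    dir_cong_open[of ?U ?u "\<phi> \<circ> cinv c'" "%x. (\<phi> \<circ> cinv c) (?T x)" v, OF C.S.U_open u(1) C.phi_T] u(2) by simp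
  then show "\<bar>dir (\<phi> \<circ> cinv c') ?u v\<bar> <= (B / m) * gnorm c' ?u v"
   using b[OF wK, of "jac ?T ?u v"] C.G_T[OF u(1), of v v] u(2) by simp
 qed
 moreover have "open (cinv c ` ball (cmap c q0) \<rho>)"
  by (rule open_cinv_image[OF c(1) open_ball]) (use \<rho>(2) ball_subset_cball in blast)
 moreover have "q0 \<in> cinv c ` ball (cmap c q0) \<rho>"
  using c \<rho>(1) by (intro image_eqI[of _ _ "cmap c q0"]) auto
 moreover have "0 <= B / m" using B m by simp
 ultimately show ?thesis by blast
qed

lemma grad_le_mono:
 assumes "grad_le q M" "M <= M'"
 shows "grad_le q M'"
 unfolding grad_le_def
proof (intro ballI impI allI)
 fix c v assume c: "c \<in> A" "q \<in> cdom c"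
 interpret L: local_metric "cimg c" "G c" by (rule local_metric_chart[OF c(1)])
 have "0 <= gnorm c (cmap c q) v" using L.gin_nonneg[of "cmap c q" v] c by simp
 from mult_right_mono[OF assms(2) this]
 show "\<bar>dir (\<phi> \<circ> cinv c) (cmap c q) v\<bar> <= M' * gnorm c (cmap c q) v"
  using assms(1) c unfolding grad_le_def by (meson order_trans)
qed

lemma grad_le_compact:
 assumes "compact K"
 shows "\<exists>M\<ge>0. \<forall>q\<in>K. grad_le q M"
proof -
 have "\<forall>q. \<exists>VM. open (fst VM) & q \<in> fst VM & 0 <= snd VM & (\<forall>q'\<in>fst VM. grad_le q' (snd VM))"
  using grad_le_local by fastforce
 then obtain VM where VM: "!!q. open (fst (VM q))" "!!q. q \<in> fst (VM q)" "!!q. 0 <= snd (VM q)"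
  "!!q q'. q' \<in> fst (VM q) ==> grad_le q' (snd (VM q))" unfolding choice_iff by blast
 have "K \<subseteq> (\<Union>q\<in>K. fst (VM q))" using VM(2) by blast
 then obtain F where F: "F \<subseteq> K" "finite F" "K \<subseteq> (\<Union>q\<in>F. fst (VM q))"
  using compactE_image[OF assms, of K "%q. fst (VM q)"] VM(1) by blast
 let ?M = "\<Sum>q\<in>F. snd (VM q)"
 have "grad_le q ?M" if q: "q \<in> K" for q
 proof -
  obtain q' where q': "q' \<in> F" "q \<in> fst (VM q')" using F(3) q by blast
  have "snd (VM q') <= ?M" using F(2) VM(3) q'(1) by (intro member_le_sum) auto
  then show ?thesis using grad_le_mono VM(4)[OF q'(2)] by blast
 qed
 then show ?thesis using VM(3) by (intro exI[of _ ?M]) (auto intro: sum_nonneg)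
qed

end

section \<open>The comparison estimate for the squared distance\<close>

locale complete_soliton = soliton A g \<phi> lam + complete_riem A g
 for A :: "('a::{t2_space,second_countable_topology}, 'n::finite) chart set" and g \<phi> lam +
 assumes shrinking: "lam > 0"
begin

text \<open>Uniformity in \<open>q\<close> is the point. The potential enters only through a bound
  \<open>M\<close> for its gradient on the unit ball about \<open>p\<close>: outside of that ball
  the variation factor is constant, and a constant factor produces no gradient term.\<close>

theorem comparison:
 "\<exists>a0 a1. 0 <= a0 & 0 <= a1 & (\<forall>q. \<exists>c. state p (d p q) q c 1 1 (a0 + a1 * d p q - lam * (d p q)^2))"
proof -
 obtain M where M: "M >= 0" "!!q. d p q <= 1 ==> grad_le q M"
  using grad_le_compact[OF Hopf_Rinow[of p 1]] by blast
 let ?n = "real CARD('n)"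
 have "\<exists>c. state p (d p q) q c 1 1 (2 * ?n + (2 * ?n + 2 * M + lam) * d p q - lam * (d p q)^2)" for q
 proof -
  define r where "r = d p q"
  have r: "0 <= r" by (simp add: r_def d_nonneg)
  obtain \<gamma> where \<gamma>0: "\<gamma> 0 = p" "\<gamma> 1 = q" and \<gamma>1: "!!s t. s \<in> {0..1} ==> t \<in> {0..1} ==> d (\<gamma> s) (\<gamma> t) = r * \<bar>s - t\<bar>"
   using metric_geodesic[of p q] unfolding r_def by blast
  have dp: "d p (\<gamma> t) = r * t" if "t \<in> {0..1}" for t using \<gamma>1[of 0 t] that \<gamma>0 by simp
  \<comment> \<open>The arc up to parameter \<open>T\<close> has length r T <= 1, so it stays in the
    unit ball even if r > 1.\<close>
  define T where "T = 1 / max 1 r"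
  have T: "0 < T" "T <= 1" "r * T <= 1" "1 / T <= 1 + r" using r by (auto simp: T_def divide_le_eq max_def)
  \<comment> \<open>The factor rises from 0 to 1 between T/2 and T. It does not start at 0 because
    \<open>state_step\<close> divides by the initial parameter.\<close>
  define \<eta> where "\<eta> = 2 / T"
  have \<eta>: "0 < \<eta>" "\<eta> * (T / 2) = 1" using T by (simp_all add: \<eta>_def)
  obtain c0 where c0: "c0 \<in> A" "\<gamma> (T/2) \<in> cdom c0" using chart_ex by blast
  have s0: "state p r (\<gamma> (T/2)) c0 (T/2) 0 0"
   by (rule state_init[OF c0 dp r]) (use T in auto)
  define k1 where "k1 = ?n * \<eta>^2 + 2 * \<eta> * (M * r)"
  have "\<exists>c. state p r (\<gamma> T) c T (0 + \<eta> * (T - T/2)) (0 + k1 * (T - T/2))"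
  proof (rule state_chain[OF \<gamma>1 _ _ T(2) less_imp_le[OF \<eta>(1)] _ s0])
   fix t c v assume t: "t \<in> {T/2..T}" and c: "c \<in> A" "\<gamma> t \<in> cdom c" and v: "gin (G c) (cmap c (\<gamma> t)) v v = r^2"
   define H where "H = 0 + \<eta> * (t - T/2)"
   have H: "0 <= H" "H <= 1"
   proof -
    show "0 <= H" using t \<eta> by (simp add: H_def)
    have "\<eta> * (t - T/2) <= \<eta> * (T / 2)" using t \<eta> by (intro mult_left_mono) auto
    then show "H <= 1" using \<eta>(2) by (simp add: H_def)
   qed
   have "t \<in> {0..1}" using t T by auto
   then have "d p (\<gamma> t) <= 1" using dp[of t] t r T(3) mult_left_mono[of t T r] by auto
   from M(2)[OF this] have "\<bar>dir (\<phi> \<circ> cinv c) (cmap c (\<gamma> t)) v\<bar> <= M * r"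
    using c v r unfolding grad_le_def by (metis real_sqrt_abs abs_of_nonneg)
   then have "H * dir (\<phi> \<circ> cinv c) (cmap c (\<gamma> t)) v <= 1 * (M * r)"
    using order_trans[OF mult_left_mono[OF abs_le_D1 H(1)] mult_right_mono[OF H(2)]] M(1) r by simp
   then have "2 * \<eta> * (H * dir (\<phi> \<circ> cinv c) (cmap c (\<gamma> t)) v) <= 2 * \<eta> * (M * r)"
    using \<eta>(1) by (intro mult_left_mono) auto
   moreover have "0 <= lam * H^2 * r^2" using shrinking by simp
   ultimately show "?n * \<eta>^2 - lam * (0 + \<eta> * (t - T/2))^2 * r^2
    + 2 * (0 + \<eta> * (t - T/2)) * \<eta> * dir (\<phi> \<circ> cinv c) (cmap c (\<gamma> t)) v <= k1"
    unfolding H_def[symmetric] k1_def by (simp add: mult_ac)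
  qed (use T in auto)
  then obtain c1 where s1: "state p r (\<gamma> T) c1 T 1 (k1 * (T/2))" using \<eta>(2) by auto
  \<comment> \<open>From \<open>T\<close> on the factor is 1 and \<eta> = 0, so the bound changes at
    the constant rate - \<open>lam\<close> r^2.\<close>
  have "\<exists>c. state p r (\<gamma> 1) c 1 (1 + 0 * (1 - T)) (k1 * (T/2) + (- lam * r^2) * (1 - T))"
   by (rule state_chain[OF \<gamma>1 T(1,2) order_refl order_refl _ s1]) simp_all
  then obtain c where s2: "state p r q c 1 1 (k1 * (T/2) + (- lam * r^2) * (1 - T))" using \<gamma>0 by auto
  have "k1 * (T/2) = 2 * ?n * (1 / T) + 2 * (M * r)"
   using T(1) by (simp add: k1_def \<eta>_def power2_eq_square field_simps)
  also have "... <= 2 * ?n * (1 + r) + 2 * (M * r)" using T(4) by (intro add_right_mono mult_left_mono) auto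
  finally have "k1 * (T/2) <= 2 * ?n * (1 + r) + 2 * (M * r)" .
  moreover have "lam * r * (r * T) <= lam * r * 1" using shrinking r T(3) by (intro mult_left_mono) auto
  ultimately have "k1 * (T/2) + (- lam * r^2) * (1 - T) <= 2 * ?n + (2 * ?n + 2 * M + lam) * r - lam * r^2"
   by (simp add: algebra_simps power2_eq_square)
  from state_mono[OF s2 this] show ?thesis unfolding r_def by blast
 qed
 then show ?thesis using M(1) shrinking
  by (intro exI[of _ "2 * ?n"] exI[of _ "2 * ?n + 2 * M + lam"]) auto
qed

end

section \<open>The minimum of the scalar curvature\<close>

text \<open>\<open>q\<close> is the second order Taylor polynomial of 1/h. The product rule gives h
  q = 1 + o(s^2), and division by \<open>h\<close>, which stays above h0/2, transfers the error to
  1/h - q.\<close>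

lemma uj_inverse:
 fixes h :: "real => unit => real"
 assumes h: "uj {()} h (%_. h0) (%_. h1) (%_. h2)" and h0: "0 < h0"
 shows "uj {()} (%s t. 1 / h s t) (%_. 1 / h0) (%_. - h1 / h0^2) (%_. 2 * h1^2 / h0 ^ 3 - h2 / h0^2)"
proof -
 define q where "q = (%s (t::unit). 1 / h0 + s *\<^sub>R (- h1 / h0^2) + (s^2 / 2) *\<^sub>R (2 * h1^2 / h0 ^ 3 - h2 / h0^2) + (0::real))"
 have q: "uj {()} q (%_. 1 / h0) (%_. - h1 / h0^2) (%_. 2 * h1^2 / h0 ^ 3 - h2 / h0^2)"
  unfolding q_def by (intro uj_quadratic bdd_const usmall_zero)
 have "uj {()} (%s t. h s t * q s t) (%_. 1) (%_. 0) (%_. 0)"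
  by (rule uj_cong[OF uj_mult[OF h q]]) (use h0 in \<open>simp_all add: field_simps power2_eq_square power3_eq_cube\<close>)
 then have us: "usmall {()} (%s t. h s t * q s t - 1)" by (simp add: uj_def)
 have "0 < h0 / 2" using h0 by simp
 from uj_near[OF h this] have hn: "\<forall>\<^sub>F s in nhds 0. h0 / 2 <= h s ()"
 proof (rule eventually_mono)
  fix s assume "\<forall>t\<in>{()}. norm (h s t - h0) <= h0 / 2"
  then have "\<bar>h s () - h0\<bar> <= h0 / 2" by simp
  then show "h0 / 2 <= h s ()" using abs_le_D2 by fastforce
 qed
 have "usmall {()} (%s t. 1 / h s t - q s t)"
 proof (rule usmall_le[OF us, of "2 / h0"])
  show "\<forall>\<^sub>F s in nhds 0. \<forall>t\<in>{()}. norm (1 / h s t - q s t) <= 2 / h0 * norm (h s t * q s t - 1)"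
   using hn
  proof eventually_elim
   case (elim s)
   have p: "0 < h s ()" using elim h0 by linarith
   have "1 / h s () - q s () = - ((h s () * q s () - 1) / h s ())" using p by (simp add: field_simps)
   then have "\<bar>1 / h s () - q s ()\<bar> = \<bar>h s () * q s () - 1\<bar> * (1 / h s ())" using p by simp
   also have "... <= \<bar>h s () * q s () - 1\<bar> * (2 / h0)"
    using elim h0 p by (intro mult_left_mono) (auto simp: field_simps)
   finally show ?case by (simp add: mult.commute)
  qed
 qed (use h0 in simp)
 then show ?thesis by (simp add: uj_def bdd_const q_def)
qed

text \<open>Adding the lower bounds at s and -s removes the first order term, so \<open>f1\<close>
  does not have to be shown to vanish first.\<close>

lemma uj_nonneg:
 fixes f :: "real => unit => real"
 assumes f: "uj {()} f (%_. f0) (%_. f1) (%_. f2)" and pos: "\<forall>\<^sub>F s in nhds 0. f0 <= f s ()"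
 shows "0 <= f2"
proof (rule field_le_epsilon)
 fix e :: real assume "0 < e"
 then have e: "0 < e / 2" by simp
 have us: "usmall {()} (%s t. f s t - (f0 + s *\<^sub>R f1 + (s^2 / 2) *\<^sub>R f2))" using f by (simp add: uj_def)
 have "\<forall>\<^sub>F s in nhds 0. f0 <= f s () & \<bar>f s () - (f0 + s * f1 + s^2 / 2 * f2)\<bar> <= e / 2 * s^2"
  using pos usmallD[OF us e] by eventually_elim simp
 then obtain \<delta> where \<delta>: "\<delta> > 0" "!!s. \<bar>s\<bar> < \<delta> ==> f0 <= f s () & \<bar>f s () - (f0 + s * f1 + s^2 / 2 * f2)\<bar> <= e / 2 * s^2"
  unfolding eventually_nhds_metric by (auto simp: dist_real_def)
 have low: "0 <= s * f1 + s^2 / 2 * f2 + e / 2 * s^2" if "\<bar>s\<bar> < \<delta>" for s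
  using abs_le_D1[OF conjunct2[OF \<delta>(2)[OF that]]] conjunct1[OF \<delta>(2)[OF that]] by linarith
 let ?s = "\<delta> / 2"
 have "0 <= ?s * f1 + ?s^2 / 2 * f2 + e / 2 * ?s^2" using low[of ?s] \<delta>(1) by simp
 moreover have "0 <= - ?s * f1 + ?s^2 / 2 * f2 + e / 2 * ?s^2" using low[of "- ?s"] \<delta>(1) by simp
 ultimately have "0 <= ?s^2 * (f2 + e)" by (simp add: algebra_simps)
 then show "0 <= f2 + e" using \<delta>(1) by (simp add: zero_le_mult_iff)
qed

text \<open>For an orthonormal frame \<open>E\<close> this is the drift Laplacian:
  \<open>accel 1\<close> consists of - Gam(E i, E i), which completes \<open>dir2\<close> to the
  Hessian, and of a share 1/n of \<open>X\<close>.\<close>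

definition (in local_soliton) drift_lap :: "(real^'n => real) => real^'n => ('n => real^'n) => real" where
 "drift_lap f u E = (SU i. dir2 f u (E i) + dir f u (accel 1 u (E i)))"

lemma (in local_soliton) drift_lap_scal:
 assumes u: "u \<in> U" and E: "onb G u E"
 shows "drift_lap (scal_loc G) u E = 2 * lam * scal_loc G u - 2 * ricci_norm_sq_loc G u"
proof -
 have "dir2 (scal_loc G) u (E i) + dir (scal_loc G) u (accel 1 u (E i))
  = Hess G (scal_loc G) u (E i) (E i) + dir (scal_loc G) u (X u) / CARD('n)" for i
  using Hess_eq[OF U_open smooth_scal u, of G "E i" "E i"] by (simp add: dir2_def accel_def dir_diff dir_scale)
 then show ?thesis using scal_identity[OF u E] by (simp add: drift_lap_def sum.distrib)
qed

context soliton
begin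

lemma jet_exists:
 assumes c: "c \<in> A" "q \<in> cdom c"
 shows "\<exists>\<sigma>. has_jet c \<sigma> (cmap c q) V Z"
proof -
 let ?x = "cmap c q"
 define y where "y = (%s (t::unit). ?x + s *\<^sub>R V + (s^2 / 2) *\<^sub>R Z + 0)"
 have y: "uj {()} y (%_. ?x) (%_. V) (%_. Z)" unfolding y_def by (intro uj_quadratic bdd_const usmall_zero)
 obtain \<rho> where \<rho>: "0 < \<rho>" "cball ?x \<rho> \<subseteq> cimg c" using open_cimg[OF c(1)] c open_contains_cball by (metis imageI)
 have ev: "\<forall>\<^sub>F s in nhds 0. y s () \<in> cimg c"
  using uj_near[OF y \<rho>(1)]
 proof eventually_elim
  case (elim s)
  then have "y s () \<in> cball ?x \<rho>" by (simp add: dist_norm norm_minus_commute)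
  then show ?case using \<rho>(2) by blast
 qed
 have "uj {()} (%s t. cmap c (cinv c (y s t))) (%_. ?x) (%_. V) (%_. Z)"
  using y unfolding uj_def
  by (elim conjE, intro conjI) (assumption | erule usmall_eq, rule eventually_mono[OF ev], use c in simp)+
 moreover have "\<forall>\<^sub>F s in nhds 0. cinv c (y s ()) \<in> cdom c" using ev by (rule eventually_mono) (use c in auto)
 ultimately show ?thesis unfolding has_jet_def by (intro exI[of _ "%s. cinv c (y s ())"]) simp
qed

lemma scal_jet:
 assumes c: "c \<in> A" "q \<in> cdom c" and j: "has_jet c \<sigma> (cmap c q) V Z"
 shows "uj {()} (%s _. R (\<sigma> s)) (%_. R q) (%_. dir (scal_loc (G c)) (cmap c q) V)
  (%_. dir (scal_loc (G c)) (cmap c q) Z + dir2 (scal_loc (G c)) (cmap c q) V)"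
proof -
 interpret S: local_soliton "cimg c" "G c" "\<phi> \<circ> cinv c" lam by (rule local_soliton_chart[OF c(1)])
 have "uj {()} (%s t. scal_loc (G c) (cmap c (\<sigma> s))) (%_. scal_loc (G c) (cmap c q)) (%_. dir (scal_loc (G c)) (cmap c q) V)
  (%_. dir (scal_loc (G c)) (cmap c q) Z + dir2 (scal_loc (G c)) (cmap c q) V)"
  by (rule uj_compose[OF S.smooth_scal S.U_open _ _ _ j[unfolded has_jet_def, THEN conjunct2], of "{cmap c q}"])
   (use c in auto)
 moreover have "\<forall>\<^sub>F s in nhds 0. \<forall>t\<in>{()}. R (\<sigma> s) = scal_loc (G c) (cmap c (\<sigma> s))"
  using j[unfolded has_jet_def, THEN conjunct1] by (rule eventually_mono) (use R_chart[OF c(1)] in simp)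
 ultimately show ?thesis using R_chart[OF c] unfolding uj_def
  by (elim conjE, intro conjI) (simp, assumption, assumption, erule usmall_eq, erule eventually_mono, simp)
qed

lemma drift_lap_R:
 assumes c: "c \<in> A" "q \<in> cdom c" and E: "onb (G c) (cmap c q) E"
 shows "(SU i. dir (scal_loc (G c)) (cmap c q) (acc c 1 (cmap c q) (E i)) + dir2 (scal_loc (G c)) (cmap c q) (E i))
  = 2 * lam * R q - 2 * ricci_norm_sq A g q"
proof -
 interpret S: local_soliton "cimg c" "G c" "\<phi> \<circ> cinv c" lam by (rule local_soliton_chart[OF c(1)])
 show ?thesis using S.drift_lap_scal[OF _ E] c R_chart[OF c] ricci_norm_chart[OF c]
  by (simp add: S.drift_lap_def add.commute)
qed

lemma continuous_on_R: "continuous_on S R"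
proof (rule continuous_at_imp_continuous_on, rule ballI)
 fix q
 obtain c where c: "c \<in> A" "q \<in> cdom c" using chart_ex by blast
 interpret S: local_soliton "cimg c" "G c" "\<phi> \<circ> cinv c" lam by (rule local_soliton_chart[OF c(1)])
 have "continuous_on (cdom c) (%p. scal_loc (G c) (cmap c p))"
  by (rule continuous_on_compose2[OF Cinf_on_continuous[OF S.smooth_scal] continuous_cmap[OF c(1)]]) auto
 then have "continuous_on (cdom c) R"
  by (rule continuous_on_cong[THEN iffD1, OF refl, rotated]) (use R_chart[OF c(1)] in auto)
 then show "isCont R q" using continuous_on_eq_continuous_at[OF open_cdom[OF c(1)]] c(2) by blast
qed

lemma scal_sq_bound: "(R q)^2 <= real CARD('n) * ricci_norm_sq A g q"
proof -
 obtain c where c: "c \<in> A" "q \<in> cdom c" using chart_ex by blast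
 interpret S: local_soliton "cimg c" "G c" "\<phi> \<circ> cinv c" lam by (rule local_soliton_chart[OF c(1)])
 show ?thesis using S.scal_sq_le[of "cmap c q"] c R_chart[OF c] ricci_norm_chart[OF c] by simp
qed

end

section \<open>Second derivative tests at a minimum\<close>

context complete_soliton
begin

text \<open>The error \<epsilon> s^2 is moved into the second order coefficient, which leaves
  exactly quadratic barriers along one chosen curve for each frame vector.\<close>

lemma barrier_data:
 assumes st: "state p r q c 1 1 \<kappa>"
 shows "\<exists>E e1 e2 \<sigma>. c \<in> A & q \<in> cdom c & onb (G c) (cmap c q) E & (\<forall>i. \<bar>e1 i\<bar> <= 2 * r) & (SU i. e2 i) <= 2 * \<kappa> &
  (\<forall>i. has_jet c (\<sigma> i) (cmap c q) (E i) (acc c 1 (cmap c q) (E i))) &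
  (\<forall>i. \<forall>\<epsilon>>0. \<forall>\<^sub>F s in nhds 0. (d p (\<sigma> i s))^2 <= r^2 + s * e1 i + s^2 / 2 * (e2 i + 2 * \<epsilon>))"
proof -
 have c: "c \<in> A" "q \<in> cdom c" using st by (auto simp: state_def)
 obtain E e1 e2 where E0: "onb (G c) (cmap c q) E" "\<forall>i. \<bar>e1 i\<bar> <= 2 * r * 1" "(SU i. e2 i) <= 2 * \<kappa>"
  and b0: "!!i \<sigma> \<epsilon>. has_jet c \<sigma> (cmap c q) (1 *\<^sub>R E i) (acc c 1 (cmap c q) (E i)) ==> \<epsilon> > 0 ==>
   \<forall>\<^sub>F s in nhds 0. (d p (\<sigma> s))^2 <= 1 * (r^2 * 1 + s * e1 i + s^2 / 2 * e2 i) + \<epsilon> * s^2"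
  using st unfolding state_def by blast
 have E: "onb (G c) (cmap c q) E" "!!i. \<bar>e1 i\<bar> <= 2 * r" "(SU i. e2 i) <= 2 * \<kappa>" using E0 by auto
 have b: "\<forall>\<^sub>F s in nhds 0. (d p (\<sigma> s))^2 <= (r^2 + s * e1 i + s^2 / 2 * e2 i) + \<epsilon> * s^2"
  if "has_jet c \<sigma> (cmap c q) (E i) (acc c 1 (cmap c q) (E i))" "\<epsilon> > 0" for i \<sigma> \<epsilon>
  using b0[of \<sigma> i \<epsilon>] that by simp
 have "\<forall>i. \<exists>\<sigma>. has_jet c \<sigma> (cmap c q) (E i) (acc c 1 (cmap c q) (E i))" using jet_exists[OF c] by blast
 then obtain \<sigma> where \<sigma>: "!!i. has_jet c (\<sigma> i) (cmap c q) (E i) (acc c 1 (cmap c q) (E i))" unfolding choice_iff by blast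
 have "\<forall>\<^sub>F s in nhds 0. (d p (\<sigma> i s))^2 <= r^2 + s * e1 i + s^2 / 2 * (e2 i + 2 * \<epsilon>)" if "\<epsilon> > 0" for i \<epsilon>
  using b[OF \<sigma> that, of i] by (rule eventually_mono) (simp add: algebra_simps add_divide_distrib)
 then show ?thesis using c E \<sigma> by blast
qed

text \<open>Replacing d^2 along each curve by its quadratic barrier keeps the value at s = 0 and
  does not lower the others, so the minimum persists and the second derivative test applies; the
  tests are summed over the frame.\<close>

lemma linear_barrier:
 assumes min: "!!q'. R q + \<delta> * (d p q)^2 <= R q' + \<delta> * (d p q')^2" and \<delta>: "0 < \<delta>"
  and st: "state p (d p q) q c 1 1 \<kappa>"
 shows "0 <= (2 * lam * R q - 2 * ricci_norm_sq A g q) + 2 * \<delta> * (\<kappa> + 1)"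
proof -
 obtain E e1 e2 \<sigma> where c: "c \<in> A" "q \<in> cdom c" and E: "onb (G c) (cmap c q) E"
  and e1: "!!i. \<bar>e1 i\<bar> <= 2 * d p q" and e2: "(SU i. e2 i) <= 2 * \<kappa>"
  and j: "!!i. has_jet c (\<sigma> i) (cmap c q) (E i) (acc c 1 (cmap c q) (E i))"
  and b: "!!i \<epsilon>. \<epsilon> > 0 ==> \<forall>\<^sub>F s in nhds 0. (d p (\<sigma> i s))^2 <= (d p q)^2 + s * e1 i + s^2 / 2 * (e2 i + 2 * \<epsilon>)"
  using barrier_data[OF st] by blast
 let ?f = "scal_loc (G c)" and ?x = "cmap c q" and ?n = "real CARD('n)"
 let ?R2 = "%i. dir ?f ?x (acc c 1 ?x (E i)) + dir2 ?f ?x (E i)"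
 \<comment> \<open>Summation over the n curves turns 2 \<epsilon> into 2, the origin of the
   \<open>+ 1\<close> in the conclusion.\<close>
 define \<epsilon> where "\<epsilon> = 1 / ?n"
 have \<epsilon>: "\<epsilon> > 0" by (simp add: \<epsilon>_def)
 have "0 <= ?R2 i + \<delta> * (e2 i + 2 * \<epsilon>)" for i
 proof -
  define w where "w = (%s (t::unit). \<delta> * (d p q)^2 + s *\<^sub>R (\<delta> * e1 i) + (s^2 / 2) *\<^sub>R (\<delta> * (e2 i + 2 * \<epsilon>)) + 0)"
  have w: "uj {()} w (%_. \<delta> * (d p q)^2) (%_. \<delta> * e1 i) (%_. \<delta> * (e2 i + 2 * \<epsilon>))"
   unfolding w_def by (intro uj_quadratic bdd_const usmall_zero)
  show ?thesis
  proof (rule uj_nonneg[OF uj_add[OF scal_jet[OF c j] w]])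
   show "\<forall>\<^sub>F s in nhds 0. R q + \<delta> * (d p q)^2 <= R (\<sigma> i s) + w s ()"
    using b[OF \<epsilon>, of i]
   proof eventually_elim
    case (elim s)
    have "\<delta> * (d p (\<sigma> i s))^2 <= \<delta> * ((d p q)^2 + s * e1 i + s^2 / 2 * (e2 i + 2 * \<epsilon>))"
     using elim \<delta> by (intro mult_left_mono) auto
    also have "... = w s ()" by (simp add: w_def algebra_simps)
    finally show ?case using min[of "\<sigma> i s"] by linarith
   qed
  qed
 qed
 then have "0 <= (SU i. ?R2 i + \<delta> * (e2 i + 2 * \<epsilon>))" by (intro sum_nonneg)
 also have "... = (2 * lam * R q - 2 * ricci_norm_sq A g q) + \<delta> * ((SU i. e2 i) + 2)"
  using drift_lap_R[OF c E] by (simp add: sum.distrib sum_distrib_left[symmetric] \<epsilon>_def)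
 also have "... <= (2 * lam * R q - 2 * ricci_norm_sq A g q) + \<delta> * (2 * \<kappa> + 2)"
  using e2 \<delta> by (intro add_left_mono mult_left_mono) auto
 finally show ?thesis by (simp add: algebra_simps)
qed

text \<open>An upper barrier for d^2 gives a lower barrier \<open>h\<close> for 1 - d^2/a^2, and
  because 1/y^2 decreases for y > 0 also an upper barrier 1/h^2 for the blow-up term. The second
  derivative test is applied with the latter; the last summand comes from the squares of
  \<open>e1\<close>.\<close>

lemma blowup_barrier:
 assumes a: "d p q < a"
  and min: "!!q'. d p q' < a ==> R q + 1 / (1 - (d p q)^2 / a^2)^2 <= R q' + 1 / (1 - (d p q')^2 / a^2)^2"
  and st: "state p (d p q) q c 1 1 \<kappa>" and \<kappa>: "0 <= \<kappa>" and h0: "h0 = 1 - (d p q)^2 / a^2"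
 shows "0 <= (2 * lam * R q - 2 * ricci_norm_sq A g q) + 2 * (2 * \<kappa> + 2) / (a^2 * h0 ^ 3) + 24 * real CARD('n) / (a^2 * h0 ^ 4)"
proof -
 obtain E e1 e2 \<sigma> where c: "c \<in> A" "q \<in> cdom c" and E: "onb (G c) (cmap c q) E"
  and e1: "!!i. \<bar>e1 i\<bar> <= 2 * d p q" and e2: "(SU i. e2 i) <= 2 * \<kappa>"
  and j: "!!i. has_jet c (\<sigma> i) (cmap c q) (E i) (acc c 1 (cmap c q) (E i))"
  and b: "!!i \<epsilon>. \<epsilon> > 0 ==> \<forall>\<^sub>F s in nhds 0. (d p (\<sigma> i s))^2 <= (d p q)^2 + s * e1 i + s^2 / 2 * (e2 i + 2 * \<epsilon>)"
  using barrier_data[OF st] by blast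
 let ?f = "scal_loc (G c)" and ?x = "cmap c q" and ?n = "real CARD('n)" and ?r = "d p q"
 let ?R2 = "%i. dir ?f ?x (acc c 1 ?x (E i)) + dir2 ?f ?x (E i)"
 have a0: "0 < a" using a d_nonneg[of p q] by linarith
 have ra: "?r^2 < a^2" using a d_nonneg[of p q] by (intro power_strict_mono) auto
 have h0p: "0 < h0" using ra a0 by (simp add: h0)
 define \<epsilon> where "\<epsilon> = 1 / ?n"
 have \<epsilon>: "\<epsilon> > 0" by (simp add: \<epsilon>_def)
 have one: "0 <= ?R2 i + (2 * (e2 i + 2 * \<epsilon>) / (a^2 * h0 ^ 3) + 6 * (e1 i)^2 / (a ^ 4 * h0 ^ 4))" for i
 proof -
  define h where "h = (%s (t::unit). h0 + s *\<^sub>R (- e1 i / a^2) + (s^2 / 2) *\<^sub>R (- (e2 i + 2 * \<epsilon>) / a^2) + 0)"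
  have h: "uj {()} h (%_. h0) (%_. - e1 i / a^2) (%_. - (e2 i + 2 * \<epsilon>) / a^2)"
   unfolding h_def by (intro uj_quadratic bdd_const usmall_zero)
  note hi = uj_inverse[OF h h0p]
  have "0 <= ?R2 i + (1 / h0 * (2 * (- e1 i / a^2)^2 / h0 ^ 3 - - (e2 i + 2 * \<epsilon>) / a^2 / h0^2)
    + 2 * ((- (- e1 i / a^2) / h0^2) * (- (- e1 i / a^2) / h0^2))
    + (2 * (- e1 i / a^2)^2 / h0 ^ 3 - - (e2 i + 2 * \<epsilon>) / a^2 / h0^2) * (1 / h0))"
  proof (rule uj_nonneg[OF uj_add[OF scal_jet[OF c j] uj_mult[OF hi hi]]])
   have "0 < h0 / 2" using h0p by simp
   from uj_near[OF h this] b[OF \<epsilon>, of i]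
   show "\<forall>\<^sub>F s in nhds 0. R q + 1 / h0 * (1 / h0) <= R (\<sigma> i s) + 1 / h s () * (1 / h s ())"
   proof eventually_elim
    case (elim s)
    have "\<bar>h s () - h0\<bar> <= h0 / 2" using elim(1) by simp
    then have hs: "0 < h s ()" using abs_le_D2[of "h s () - h0" "h0 / 2"] h0p by linarith
    have "h s () = 1 - (?r^2 + s * e1 i + s^2 / 2 * (e2 i + 2 * \<epsilon>)) / a^2"
     by (simp add: h_def h0 add_divide_distrib diff_divide_distrib algebra_simps)
    moreover have "(d p (\<sigma> i s))^2 / a^2 <= (?r^2 + s * e1 i + s^2 / 2 * (e2 i + 2 * \<epsilon>)) / a^2"
     using elim(2) by (intro divide_right_mono) auto
    ultimately have le: "h s () <= 1 - (d p (\<sigma> i s))^2 / a^2" by linarith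
    then have "(d p (\<sigma> i s))^2 / a^2 < 1" using hs by linarith
    then have "(d p (\<sigma> i s))^2 < a^2" using pos_divide_less_eq[of "a^2" "(d p (\<sigma> i s))^2" 1] a0 by simp
    then have "d p (\<sigma> i s) < a" by (rule power_less_imp_less_base) (use a0 in simp)
    from min[OF this] have 1: "R q + 1 / h0^2 <= R (\<sigma> i s) + 1 / (1 - (d p (\<sigma> i s))^2 / a^2)^2" unfolding h0 .
    have inv: "1 / k^2 <= 1 / y^2" if "0 < y" "y <= k" for k y :: real
     using that by (intro divide_left_mono power_mono mult_pos_pos) auto
    have "1 / (1 - (d p (\<sigma> i s))^2 / a^2)^2 <= 1 / (h s ())^2" by (rule inv[OF hs le])
    then show ?case using 1 by (simp add: power2_eq_square)
   qed
  qed
  moreover have "1 / h0 * (2 * (- e1 i / a^2)^2 / h0 ^ 3 - - (e2 i + 2 * \<epsilon>) / a^2 / h0^2)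
    + 2 * ((- (- e1 i / a^2) / h0^2) * (- (- e1 i / a^2) / h0^2))
    + (2 * (- e1 i / a^2)^2 / h0 ^ 3 - - (e2 i + 2 * \<epsilon>) / a^2 / h0^2) * (1 / h0)
   = 2 * (e2 i + 2 * \<epsilon>) / (a^2 * h0 ^ 3) + 6 * (e1 i)^2 / (a ^ 4 * h0 ^ 4)"
  proof -
   \<comment> \<open>Naming the reciprocals turns the rational identity into a polynomial
     one.\<close>
   define u v where "u = inverse h0" and "v = inverse (a^2)"
   have uv: "1 / h0 = u" "x / h0^2 = x * u^2" "x / h0 ^ 3 = x * u ^ 3" "x / a^2 = x * v"
    "x / (a^2 * h0 ^ 3) = x * (v * u ^ 3)" "x / (a ^ 4 * h0 ^ 4) = x * (v^2 * u ^ 4)" for x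
    by (simp_all add: u_def v_def divide_inverse power_inverse flip: power_mult)
   show ?thesis unfolding uv
    by (simp add: power2_eq_square power3_eq_cube power4_eq_xxxx algebra_simps)
  qed
  ultimately show ?thesis by simp
 qed
 have e1': "6 * (e1 i)^2 / (a ^ 4 * h0 ^ 4) <= 24 / (a^2 * h0 ^ 4)" for i
 proof -
  have "(e1 i)^2 <= (2 * ?r)^2" using e1[of i] power_mono[of "\<bar>e1 i\<bar>" "2 * ?r" 2] by simp
  also have "... <= 4 * a^2" using ra by (simp add: power_mult_distrib)
  finally have "6 * (e1 i)^2 / (a ^ 4 * h0 ^ 4) <= 24 * a^2 / (a ^ 4 * h0 ^ 4)"
   using a0 h0p by (intro divide_right_mono) auto
  also have "... = 24 / (a^2 * h0 ^ 4)" using a0 by (simp add: power2_eq_square power4_eq_xxxx)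
  finally show ?thesis .
 qed
 have "0 <= (SU i. ?R2 i + (2 * (e2 i + 2 * \<epsilon>) / (a^2 * h0 ^ 3) + 24 / (a^2 * h0 ^ 4)))"
  by (rule sum_nonneg) (use one e1' in \<open>meson add_left_mono order_trans\<close>)
 also have "... = (2 * lam * R q - 2 * ricci_norm_sq A g q) + 2 * ((SU i. e2 i) + 2) / (a^2 * h0 ^ 3) + ?n * (24 / (a^2 * h0 ^ 4))"
 proof -
  have "(SU i. 2 * (e2 i + 2 * \<epsilon>) / (a^2 * h0 ^ 3)) = 2 * ((SU i. e2 i) + 2) / (a^2 * h0 ^ 3)"
   by (simp add: sum_divide_distrib[symmetric] sum_distrib_left[symmetric] sum.distrib \<epsilon>_def)
  then show ?thesis using drift_lap_R[OF c E] by (simp only: sum.distrib[of "%i. ?R2 i"] sum.distrib[of "%i. 2 * (e2 i + 2 * \<epsilon>) / (a^2 * h0 ^ 3)"]) simp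
 qed
 also have "2 * ((SU i. e2 i) + 2) / (a^2 * h0 ^ 3) <= 2 * (2 * \<kappa> + 2) / (a^2 * h0 ^ 3)"
  using e2 a0 h0p by (intro divide_right_mono) auto
 finally show ?thesis by (simp add: mult.commute)
qed

end

section \<open>Lower bound and attained minimum of the scalar curvature\<close>

context complete_soliton
begin

text \<open>Minimize \<open>R + 1 / (1 - d\<^sup>2 / a\<^sup>2)\<^sup>2\<close> over the ball of radius \<open>a\<close>. As the drift Laplacian of \<open>R\<close> is at
 most \<open>2 \<lambda> R - 2 R\<^sup>2 / n\<close>, the minimum is nonnegative if \<open>a\<close> is large.\<close>

lemma scal_lower_bound: "-1 <= R p"
proof -
 obtain a0 a1 where a: "0 <= a0" "0 <= a1"
  and st: "!!q. \<exists>c. state p (d p q) q c 1 1 (a0 + a1 * d p q - lam * (d p q)^2)" using comparison[of p] by blast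
 \<comment> \<open>Here a1^2 / (4 \<open>lam\<close>) is the maximum of a1 x - \<open>lam\<close>
   x^2 over x.\<close>
 define \<kappa> where "\<kappa> = a0 + a1^2 / (4 * lam)"
 have \<kappa>: "0 <= \<kappa>" using a shrinking by (simp add: \<kappa>_def)
 have st': "\<exists>c. state p (d p q) q c 1 1 \<kappa>" for q
 proof -
  have "0 <= (a1 - 2 * lam * d p q)^2" by simp
  then have "(a1 * d p q - lam * (d p q)^2) * (4 * lam) <= a1^2"
   by (simp add: power2_eq_square algebra_simps)
  then have "a1 * d p q - lam * (d p q)^2 <= a1^2 / (4 * lam)"
   using pos_le_divide_eq[of "4 * lam"] shrinking by simp
  then show ?thesis using st[of q] state_mono unfolding \<kappa>_def by (metis add_diff_eq add_left_mono)
 qed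
 let ?n = "real CARD('n)"
 define K where "K = 4 * \<kappa> + 4 + 24 * ?n"
 have K: "0 < K" using \<kappa> by (simp add: K_def add_nonneg_pos)
 \<comment> \<open>Large enough for n K / 2 <= a^2, which below absorbs all constants and leaves R^2
   <= h^(-4) at the minimum.\<close>
 define a where "a = sqrt (?n * K / 2 + 1)"
 have a2: "a^2 = ?n * K / 2 + 1" "0 < a" using K by (simp_all add: a_def add_nonneg_pos)
 define h where "h q = 1 - (d p q)^2 / a^2" for q
 define F where "F q = R q + 1 / (h q)^2" for q
 have hp: "h p = 1" by (simp add: h_def)
 have cd: "continuous_on S (d p)" for S by (rule continuous_on_d)
 have ch: "continuous_on S h" for S unfolding h_def
  by (intro continuous_intros cd) (use a2 in auto)
 have h1: "h q <= 1" for q by (simp add: h_def)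
 have h_pos: "0 < h q" if "d p q < a" for q
 proof -
  have "(d p q)^2 < a^2" using that d_nonneg by (intro power_strict_mono) auto
  then show ?thesis using a2(2) by (simp add: h_def)
 qed
 have lt_a: "d p q < a" if "0 < h q" for q
 proof -
  have "(d p q)^2 / a^2 < 1" using that by (simp add: h_def)
  then have "(d p q)^2 < a^2" using pos_divide_less_eq[of "a^2" "(d p q)^2" 1] a2(2) by simp
  then show ?thesis by (rule power_less_imp_less_base) (use a2 in simp)
 qed
 have cK: "compact {q. d p q <= a}" by (rule Hopf_Rinow)
 obtain B where B: "0 < B" "!!q. d p q <= a ==> - B <= R q"
 proof -
  have "bdd {q. d p q <= a} R" by (rule bdd_continuous[OF cK continuous_on_R])
  then obtain B where "\<forall>q\<in>{q. d p q <= a}. norm (R q) <= B" "0 <= B" unfolding bdd_def by blast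
  then show thesis by (intro that[of "B + 1"]) (force simp: abs_le_iff)+
 qed
 \<comment> \<open>Where h^2 < 1/T the blow-up term exceeds \<open>T\<close>, which makes F larger
   there than at \<open>p\<close>. So it suffices to minimize over the compact set
   \<open>?K\<close>, on which F is continuous.\<close>
 define T where "T = B + \<bar>R p\<bar> + 2"
 have T: "1 < T" using B by (simp add: T_def)
 let ?K = "{q. d p q <= a} \<inter> {q. 1 / T <= (h q)^2 & 0 <= h q}"
 have "compact ?K"
 proof (rule compact_Int_closed[OF cK])
  have "closed ({q. 1 / T <= (h q)^2} \<inter> {q. 0 <= h q})"
   by (intro closed_Int closed_Collect_le continuous_on_const continuous_on_power ch)
  then show "closed {q. 1 / T <= (h q)^2 & 0 <= h q}" by (simp add: Collect_conj_eq)
 qed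
 moreover have pK: "p \<in> ?K" using a2 T hp by simp
 moreover have "continuous_on ?K F"
  unfolding F_def
 proof (intro continuous_on_add continuous_on_R continuous_on_divide continuous_on_const continuous_on_power ch ballI)
  fix q assume "q \<in> ?K"
  moreover have "0 < 1 / T" using T by simp
  ultimately show "(h q)^2 ~= 0" by auto
 qed
 ultimately have "\<exists>q\<in>?K. \<forall>q'\<in>?K. F q <= F q'" by (intro continuous_attains_inf; blast)
 then obtain q where q: "q \<in> ?K" "!!q'. q' \<in> ?K ==> F q <= F q'" by blast
 have "0 < 1 / T" using T by simp
 then have "0 < (h q)^2" "0 <= h q" using q(1) by auto
 then have hq: "0 < h q" by simp
 have min: "F q <= F q'" if q': "d p q' < a" for q'
 proof (cases "q' \<in> ?K")
  case False
  have hq': "0 < h q'" by (rule h_pos[OF q'])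
  then have "(h q')^2 < 1 / T" using False q' by auto
  then have "T < 1 / (h q')^2" using hq' T by (simp add: field_simps)
  then have "F p <= F q'" using B(2)[of q'] q' by (simp add: F_def hp T_def abs_if split: if_splits)
  then show ?thesis using q(2)[OF pK] by linarith
 qed (use q in blast)
 obtain c where c: "state p (d p q) q c 1 1 \<kappa>" using st' by blast
 have bar: "0 <= (2 * lam * R q - 2 * ricci_norm_sq A g q) + 2 * (2 * \<kappa> + 2) / (a^2 * (h q) ^ 3) + 24 * ?n / (a^2 * (h q) ^ 4)"
  by (rule blowup_barrier[OF lt_a[OF hq] min[unfolded F_def h_def] c \<kappa> h_def])
 have "0 <= F q"
 proof (cases "R q < 0")
  case True
  have a2p: "0 < a^2" using a2(2) by simp
  have "2 * (2 * \<kappa> + 2) / (a^2 * (h q) ^ 3) <= 2 * (2 * \<kappa> + 2) / (a^2 * (h q) ^ 4)"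
  proof (rule divide_left_mono)
   have "(h q) ^ 4 <= (h q) ^ 3" using hq h1[of q] by (intro power_decreasing) auto
   then show "a^2 * (h q) ^ 4 <= a^2 * (h q) ^ 3" by (intro mult_left_mono) auto
  qed (use \<kappa> a2p hq in auto)
  then have "2 * ricci_norm_sq A g q <= 2 * (2 * \<kappa> + 2) / (a^2 * (h q) ^ 4) + 24 * ?n / (a^2 * (h q) ^ 4)"
   using bar True shrinking mult_pos_neg[of lam "R q"] by linarith
  also have "... = K / (a^2 * (h q) ^ 4)" by (simp add: K_def add_divide_distrib[symmetric])
  finally have "2 * ricci_norm_sq A g q <= K / (a^2 * (h q) ^ 4)" .
  then have "?n * ricci_norm_sq A g q <= ?n * (K / (a^2 * (h q) ^ 4) / 2)" by (intro mult_left_mono) auto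
  also have "... = (?n * K / 2) / (a^2 * (h q) ^ 4)" by simp
  also have "... <= a^2 / (a^2 * (h q) ^ 4)" 
  proof (rule divide_right_mono)
   show "?n * K / 2 <= a^2" using a2(1) by linarith
   show "0 <= a^2 * (h q) ^ 4" using hq by simp
  qed
  also have "... = (1 / (h q)^2)^2" using a2p by (simp add: power_divide flip: power_mult)
  finally have "(R q)^2 <= (1 / (h q)^2)^2" using scal_sq_bound[of q] by linarith
  then have "\<bar>R q\<bar> <= \<bar>1 / (h q)^2\<bar>" by (simp only: abs_le_square_iff)
  then show ?thesis using True by (simp add: F_def)
 qed (simp add: F_def)
 then have "0 <= F p" using q(2)[OF pK] by linarith
 then show ?thesis by (simp add: F_def hp)
qed

text \<open>A minimizer of \<open>R + \<delta> d\<^sup>2\<close> stays in a ball that does not depend on \<open>\<delta>\<close>, since the drift Laplacian of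
 \<open>d\<^sup>2\<close> is negative far away.\<close>

lemma scal_attains_min:
 assumes pinch: "!!q. lam * R q <= ricci_norm_sq A g q"
 shows "\<exists>q0. \<forall>q. R q0 <= R q"
proof -
 obtain p :: 'a where True by blast
 obtain a0 a1 where a: "0 <= a0" "0 <= a1"
  and st: "!!q. \<exists>c. state p (d p q) q c 1 1 (a0 + a1 * d p q - lam * (d p q)^2)" using comparison[of p] by blast
 \<comment> \<open>Beyond this radius \<open>lam\<close> d^2 exceeds a0 + 1 + a1 d, so the last
   factor in \<open>linear_barrier\<close> is negative, whatever \<delta> is.\<close>
 define \<rho> where "\<rho> = (a0 + 1 + a1) / lam + 1"
 have \<rho>: "1 <= \<rho>" "lam * \<rho> = a0 + 1 + a1 + lam" using a shrinking by (simp_all add: \<rho>_def field_simps)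
 have near: "\<exists>q. d p q <= \<rho> & (\<forall>x. R q <= R x + \<delta> * (d p x)^2)" if \<delta>: "0 < \<delta>" for \<delta>
 proof -
  let ?F = "%x. R x + \<delta> * (d p x)^2"
  \<comment> \<open>Outside the ball of radius \<open>b\<close> the penalty is at least R p + 2
    while R >= -1, so the penalized function is larger there than at \<open>p\<close>.\<close>
  define b where "b = sqrt ((R p + 2) / \<delta>)"
  have b2: "\<delta> * b^2 = R p + 2" "0 <= b" using scal_lower_bound[of p] \<delta> by (simp_all add: b_def)
  let ?K = "{q. d p q <= b}"
  have "\<exists>q\<in>?K. \<forall>q'\<in>?K. ?F q <= ?F q'"
  proof (rule continuous_attains_inf[OF Hopf_Rinow])
   show "?K ~= {}" using b2 by (auto intro: exI[of _ p])
   show "continuous_on ?K ?F" by (intro continuous_intros continuous_on_R continuous_on_d)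
  qed
  then obtain q where q: "q \<in> ?K" "!!q'. q' \<in> ?K ==> ?F q <= ?F q'" by blast
  have min: "?F q <= ?F q'" for q'
  proof (cases "q' \<in> ?K")
   case False
   then have "b^2 <= (d p q')^2" using b2 by (intro power_mono) auto
   then have "\<delta> * b^2 <= \<delta> * (d p q')^2" using \<delta> by (intro mult_left_mono) auto
   moreover have "?F q <= ?F p" using q(2)[of p] b2 by simp
   ultimately show ?thesis using b2 scal_lower_bound[of q'] by simp
  qed (use q in blast)
  obtain c where c: "state p (d p q) q c 1 1 (a0 + a1 * d p q - lam * (d p q)^2)" using st by blast
  have "0 <= (2 * lam * R q - 2 * ricci_norm_sq A g q) + 2 * \<delta> * ((a0 + a1 * d p q - lam * (d p q)^2) + 1)"
   by (rule linear_barrier[OF min \<delta> c])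
  then have "0 <= 2 * \<delta> * ((a0 + a1 * d p q - lam * (d p q)^2) + 1)" using pinch[of q] by linarith
  then have pos: "0 <= (a0 + a1 * d p q - lam * (d p q)^2) + 1" using \<delta> by (simp add: zero_le_mult_iff)
  have "d p q <= \<rho>"
  proof (rule ccontr)
   assume "\<not> d p q <= \<rho>"
   then have r: "\<rho> < d p q" "1 <= d p q" using \<rho> by auto
   have "a0 + 1 <= (a0 + 1) * d p q" using a r by (simp add: mult_left_mono[of 1 "d p q" "a0 + 1", simplified])
   moreover have "(a0 + 1 + a1 + lam) * d p q <= (lam * d p q) * d p q"
    using r shrinking \<rho>(2) mult_left_mono[of \<rho> "d p q" lam] by (intro mult_right_mono) auto
   moreover have "0 < lam * d p q" by (rule mult_pos_pos) (use r shrinking in linarith)+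
   ultimately show False using pos by (simp add: power2_eq_square algebra_simps)
  qed
  moreover have "0 <= \<delta> * (d p q)^2" using \<delta> by simp
  then have "R q <= ?F x" for x using min[of x] by linarith
  ultimately show ?thesis by blast
 qed
 have "\<exists>q0\<in>{q. d p q <= \<rho>}. \<forall>q\<in>{q. d p q <= \<rho>}. R q0 <= R q"
  by (rule continuous_attains_inf[OF Hopf_Rinow _ continuous_on_R]) (use \<rho> in \<open>auto intro: exI[of _ p]\<close>)
 then obtain q0 where q0: "!!q. d p q <= \<rho> ==> R q0 <= R q" by blast
 \<comment> \<open>The penalized minimizers all lie in the fixed compact ball on which
   \<open>q0\<close> is minimal, so \<delta> may tend to 0.\<close>
 have "R q0 <= R x" for x
 proof (rule field_le_epsilon)
  fix e :: real assume e: "0 < e"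
  define \<delta> where "\<delta> = e / ((d p x)^2 + 1)"
  have \<delta>: "0 < \<delta>" using e by (simp add: \<delta>_def add_nonneg_pos)
  have "\<delta> * ((d p x)^2 + 1) = e" by (simp add: \<delta>_def add_nonneg_eq_0_iff)
  then have "\<delta> * (d p x)^2 <= e" using \<delta> by (simp add: algebra_simps)
  moreover obtain q where "d p q <= \<rho>" "R q <= R x + \<delta> * (d p x)^2" using near[OF \<delta>] by blast
  ultimately show "R q0 <= R x + e" using q0[of q] by linarith
 qed
 then show ?thesis by blast
qed

end

section \<open>The strong maximum principle\<close>

text \<open>Hopf's barrier centred at \<open>y\<close>, up to an additive constant.\<close>

definition gauss :: "real => real^'n::finite => real^'n => real" where
 "gauss \<alpha> y x = exp (- \<alpha> * ((x - y) \<bullet> (x - y)))"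

lemma gauss_has_derivative:
 "(gauss \<alpha> y has_derivative (%h. - 2 * \<alpha> * ((x - y) \<bullet> h) * gauss \<alpha> y x)) (at x)"
proof -
 have "((%x. exp (- \<alpha> * ((x - y) \<bullet> (x - y)))) has_derivative
  (%h. exp (- \<alpha> * ((x - y) \<bullet> (x - y))) * (- \<alpha> * ((x - y) \<bullet> h + h \<bullet> (x - y))))) (at x)"
  by (auto intro!: derivative_eq_intros)
 then show ?thesis unfolding gauss_def[abs_def]
  by (rule has_derivative_eq_rhs) (simp add: fun_eq_iff inner_commute algebra_simps)
qed

lemma dir_gauss: "dir (gauss \<alpha> y) x h = - 2 * \<alpha> * ((x - y) \<bullet> h) * gauss \<alpha> y x"
 by (rule dir_eqI[OF gauss_has_derivative])

lemma dir2_gauss: "dir2 (gauss \<alpha> y) x h = gauss \<alpha> y x * (4 * \<alpha>^2 * ((x - y) \<bullet> h)^2 - 2 * \<alpha> * (h \<bullet> h))"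
proof -
 have "((%x. - 2 * \<alpha> * ((x - y) \<bullet> h) * gauss \<alpha> y x) has_derivative
  (%k. - 2 * \<alpha> * ((x - y) \<bullet> h) * (- 2 * \<alpha> * ((x - y) \<bullet> k) * gauss \<alpha> y x) + (- 2 * \<alpha> * (k \<bullet> h)) * gauss \<alpha> y x)) (at x)"
  by (rule has_derivative_mult[OF _ gauss_has_derivative]) (auto intro!: derivative_eq_intros)
 from dir_eqI[OF this, of h] show ?thesis
  unfolding dir2_def dir_gauss by (simp add: power2_eq_square algebra_simps)
qed

lemma Cinf_on_gauss: "open S ==> Cinf_on S (gauss \<alpha> y)"
proof -
 assume S: "open S"
 have p: "Cinf_on S (%x. - \<alpha> * (SU i. (x $ i - y $ i) * (x $ i - y $ i)))"
  by (intro Cinf_on_mult Cinf_on_const Cinf_on_sum Cinf_on_diff Cinf_on_component S)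
 have "Cinf_on S (%x. (%n. exp) (0::nat) (- \<alpha> * (SU i. (x $ i - y $ i) * (x $ i - y $ i))))"
  by (rule Cinf_on_real_compose[OF S p, of UNIV]) (auto intro: DERIV_exp)
 moreover have "gauss \<alpha> y = (%x. exp (- \<alpha> * (SU i. (x $ i - y $ i) * (x $ i - y $ i))))"
  by (simp add: fun_eq_iff gauss_def inner_vec_def)
 ultimately show ?thesis by simp
qed

text \<open>Uniform ellipticity: expanding \<open>w\<close> in the frame, Cauchy-Schwarz bounds its
  Euclidean norm by its Euclidean products with the frame vectors. This is why the \<alpha>^2 term
  of the barrier dominates.\<close>

lemma (in local_metric) onb_inner_lower:
 assumes u: "u \<in> U" and E: "onb G u E" and M: "gin G u w w <= M^2 * (w \<bullet> w)"
 shows "w \<bullet> w <= M^2 * (SU i. (w \<bullet> E i)^2)"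
proof (cases "w = 0")
 case False
 then have w: "0 < w \<bullet> w" by simp
 let ?c = "%i. gin G u (E i) w"
 note ex = onb_expand[OF u E, of w]
 have "gin G u w w = gin G u (SU i. ?c i *\<^sub>R E i) w" using ex by simp
 also have "... = (SU i. (?c i)^2)" by (simp add: gin_sum1 gin_scale1 power2_eq_square)
 finally have 1: "(SU i. (?c i)^2) <= M^2 * (w \<bullet> w)" using M by simp
 have "w \<bullet> w = w \<bullet> (SU i. ?c i *\<^sub>R E i)" using ex by simp
 also have "... = (SU i. ?c i * (w \<bullet> E i))" by (simp add: inner_sum_right)
 finally have "(w \<bullet> w)^2 = (SU i. ?c i * (w \<bullet> E i))^2" by simp
 also have "... <= (SU i. (?c i)^2) * (SU i. (w \<bullet> E i)^2)" by (rule Cauchy_Schwarz_ineq_sum)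
 also have "... <= (M^2 * (w \<bullet> w)) * (SU i. (w \<bullet> E i)^2)" using 1 by (intro mult_right_mono sum_nonneg) auto
 finally have "(w \<bullet> w) * (w \<bullet> w) <= (w \<bullet> w) * (M^2 * (SU i. (w \<bullet> E i)^2))" by (simp add: power2_eq_square mult_ac)
 then show ?thesis using w by (simp only: mult_le_cancel_left_pos)
qed (simp add: sum_nonneg)

context local_soliton
begin

text \<open>The drift Laplacian of the Gaussian is a positive factor times a term quadratic in
  \<alpha>, with coefficient bounded below away from \<open>y\<close>, minus a term linear in
  \<alpha>. Orthonormal frames over \<open>K\<close> stay in a compact set, so one \<alpha> serves
  all of them.\<close>

lemma hopf_barrier:
 assumes K: "compact K" "K \<subseteq> U" "y \<notin> K"
 shows "\<exists>\<alpha>>0. \<forall>u\<in>K. \<forall>E. onb G u E --> 0 < drift_lap (gauss \<alpha> y) u E"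
proof (cases "K = {}")
 case False
 obtain m M where mM: "0 < m" "0 < M" "!!u v. u \<in> K ==> m * norm v <= sqrt (gin G u v v)"
   "!!u v. u \<in> K ==> sqrt (gin G u v v) <= M * norm v"
  using chart_local_metric_bounds[OF local_metric_axioms K(1,2) False] by blast
 obtain k where k: "0 < k" "!!u. u \<in> K ==> k <= dist y u" using separate_point_closed[OF compact_imp_closed[OF K(1)] K(3)] by blast
 let ?J = "K \<times> cball (0::real^'n) (1 / m)"
 let ?b = "%z. snd z \<bullet> snd z + (fst z - y) \<bullet> accel 1 (fst z) (snd z)"
 have fs: "continuous_on ?J fst" "continuous_on ?J snd" "fst ` ?J \<subseteq> U"
  using K(2) by (auto intro!: continuous_intros)
 have "continuous_on ?J ?b"
  unfolding accel_def
  by (intro continuous_intros continuous_on_Gam fs continuous_on_compose2[OF smap_continuous_on[OF smooth_X] fs(1,3)])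
 then have "bdd ?J ?b" by (intro bdd_continuous compact_Times K compact_cball)
 then obtain C where C: "0 <= C" "!!z. z \<in> ?J ==> norm (?b z) <= C" unfolding bdd_def by blast
 let ?n = "real CARD('n)"
 \<comment> \<open>Chosen to make 2 \<alpha> k^2 larger than n C M^2, where \<open>C\<close> bounds
   the contribution of one frame vector to the linear term.\<close>
 define \<alpha> where "\<alpha> = ?n * C * M^2 / (2 * k^2) + 1"
 have \<alpha>: "0 < \<alpha>" using C(1) by (simp add: \<alpha>_def add_nonneg_pos)
 have "0 < drift_lap (gauss \<alpha> y) u E" if u: "u \<in> K" and E: "onb G u E" for u E
 proof -
  have uU: "u \<in> U" using u K by blast
  let ?w = "u - y" and ?S = "SU i. ((u - y) \<bullet> E i)^2"
  have Eb: "(u, E i) \<in> ?J" for i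
  proof -
   have "m * norm (E i) <= 1" using mM(3)[OF u, of "E i"] E by (simp add: onb_def)
   then show ?thesis using u mM(1) by (simp add: pos_le_divide_eq mult.commute)
  qed
  have "k^2 <= (norm ?w)^2" using k(2)[OF u] k(1) by (intro power_mono) (auto simp: dist_norm norm_minus_commute)
  then have kw: "k^2 <= ?w \<bullet> ?w" by (simp add: power2_norm_eq_inner)
  have "gin G u ?w ?w <= (M * norm ?w)^2" using mM(4)[OF u, of ?w] gin_nonneg[OF uU, of ?w] by (simp add: sqrt_le_D)
  then have "gin G u ?w ?w <= M^2 * (?w \<bullet> ?w)" by (simp add: power_mult_distrib power2_norm_eq_inner)
  from onb_inner_lower[OF uU E this] kw have S: "k^2 <= M^2 * ?S" by linarith
  have "(SU i. ?b (u, E i)) <= (\<Sum>i\<in>(UNIV::'n set). C)"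
   using C(2)[OF Eb] by (intro sum_mono) (auto intro: order_trans[OF abs_ge_self])
  then have b: "(SU i. ?b (u, E i)) <= ?n * C" by simp
  have "drift_lap (gauss \<alpha> y) u E = gauss \<alpha> y u * (4 * \<alpha>^2 * ?S - 2 * \<alpha> * (SU i. ?b (u, E i)))"
  proof -
   have "dir2 (gauss \<alpha> y) u (E i) + dir (gauss \<alpha> y) u (accel 1 u (E i))
    = gauss \<alpha> y u * (4 * \<alpha>^2 * (?w \<bullet> E i)^2 - 2 * \<alpha> * ?b (u, E i))" for i
    unfolding dir2_gauss dir_gauss by (simp add: algebra_simps)
   then show ?thesis unfolding drift_lap_def
    by (simp only: sum_distrib_left[symmetric] sum_subtractf)
  qed
  moreover have "0 < 4 * \<alpha>^2 * ?S - 2 * \<alpha> * (SU i. ?b (u, E i))"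
  proof -
   have "2 * \<alpha> * k^2 = ?n * C * M^2 + 2 * k^2" using k(1) by (simp add: \<alpha>_def field_simps)
   then have "?n * C * M^2 < 2 * \<alpha> * k^2" using k(1) by simp
   also have "2 * \<alpha> * k^2 <= 2 * \<alpha> * (M^2 * ?S)" using S \<alpha> by (intro mult_left_mono) auto
   finally have "M^2 * (?n * C) < M^2 * (2 * \<alpha> * ?S)" by (simp add: mult_ac)
   then have "?n * C < 2 * \<alpha> * ?S" using mM(2) by (simp only: mult_less_cancel_left_pos zero_less_power)
   then have "(SU i. ?b (u, E i)) < 2 * \<alpha> * ?S" using b by linarith
   then have "2 * \<alpha> * (SU i. ?b (u, E i)) < 2 * \<alpha> * (2 * \<alpha> * ?S)" using \<alpha> by (intro mult_strict_left_mono) auto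
   then show ?thesis by (simp add: power2_eq_square mult_ac)
  qed
  moreover have "0 < gauss \<alpha> y u" by (simp add: gauss_def)
  ultimately show ?thesis by simp
 qed
 then show ?thesis using \<alpha> by blast
qed (auto intro: exI[of _ 1])

lemma drift_lap_interior_min:
 assumes f: "Cinf_on U f" and v: "Cinf_on U v" and x: "x \<in> U" and E: "onb G x E"
  and S: "open S" "x \<in> S" "!!u. u \<in> S ==> f x - \<epsilon> * v x <= f u - \<epsilon> * v u"
 shows "\<epsilon> * drift_lap v x E <= drift_lap f x E"
proof -
 have "0 <= (dir f x (accel 1 x (E i)) + dir2 f x (E i)) + (- \<epsilon>) * (dir v x (accel 1 x (E i)) + dir2 v x (E i))" for i
 proof -
  define y where "y = (%s (t::unit). x + s *\<^sub>R E i + (s^2 / 2) *\<^sub>R accel 1 x (E i) + 0)"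
  have y: "uj {()} y (%_. x) (%_. E i) (%_. accel 1 x (E i))"
   unfolding y_def by (intro uj_quadratic bdd_const usmall_zero)
  have K: "compact {x}" "{x} \<subseteq> U" "(%_::unit. x) ` {()} \<subseteq> {x}" using x by auto
  note uf = uj_compose[OF f U_open K y] and uv = uj_compose[OF v U_open K y]
  have uc: "uj {()} (%s t. - \<epsilon>) (%_. - \<epsilon>) (%_. 0) (%_. 0)" by (rule uj_const[OF bdd_const])
  have "0 <= (dir f x (accel 1 x (E i)) + dir2 f x (E i)) + ((- \<epsilon>) * (dir v x (accel 1 x (E i)) + dir2 v x (E i))
    + 2 * (0 * dir v x (E i)) + 0 * v x)"
  proof (rule uj_nonneg[OF uj_add[OF uf uj_mult[OF uc uv]]])
   obtain e where e: "0 < e" "cball x e \<subseteq> S" using S open_contains_cball by blast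
   show "\<forall>\<^sub>F s in nhds 0. f x + - \<epsilon> * v x <= f (y s ()) + - \<epsilon> * v (y s ())"
    using uj_near[OF y e(1)]
   proof eventually_elim
    case (elim s)
    then have "y s () \<in> cball x e" by (simp add: dist_norm norm_minus_commute)
    then show ?case using S(3)[of "y s ()"] e(2) by auto
   qed
  qed
  then show ?thesis by simp
 qed
 then have "0 <= (SU i. (dir f x (accel 1 x (E i)) + dir2 f x (E i)) + (- \<epsilon>) * (dir v x (accel 1 x (E i)) + dir2 v x (E i)))"
  by (intro sum_nonneg)
 also have "... = drift_lap f x E + (- \<epsilon>) * drift_lap v x E"
  by (simp only: drift_lap_def sum.distrib[of "%i. dir f x (accel 1 x (E i)) + dir2 f x (E i)"] sum_distrib_left[symmetric] add.commute[of "dir2 _ _ _"])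
 finally show ?thesis by simp
qed

text \<open>Hopf's argument. Near the minimum point \<open>z\<close> closest to a point
  \<open>y1\<close> with a larger value, subtracting a small multiple of the Gaussian
  \<open>v\<close> from \<open>f\<close> creates an interior minimum. There the drift Laplacian of
  \<open>f\<close> is at least that of \<epsilon> v, which is positive.\<close>

lemma strong_minimum:
 assumes f: "Cinf_on U f" and sup: "!!u E. u \<in> U ==> onb G u E ==> drift_lap f u E <= 0"
  and m: "!!u. u \<in> U ==> m <= f u" "f z0 = m" and \<rho>: "0 < \<rho>" "cball z0 (3 * \<rho>) \<subseteq> U"
  and y1: "y1 \<in> ball z0 \<rho>"
 shows "f y1 = m"
proof (rule ccontr)
 assume ne: "f y1 ~= m"
 have sub: "u \<in> U" if "dist z0 u <= 3 * \<rho>" for u using that \<rho> by auto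
 have cf: "continuous_on S f" if "S \<subseteq> U" for S using Cinf_on_continuous[OF f] that by (rule continuous_on_subset)
 define Z where "Z = {u \<in> cball z0 (2 * \<rho>). f u = m}"
 have cZ: "closed Z" unfolding Z_def
  by (rule continuous_closed_preimage_constant[OF cf closed_cball]) (use sub \<rho>(1) in auto)
 have z0: "z0 \<in> Z" using m(2) \<rho>(1) by (simp add: Z_def)
 obtain z where z: "z \<in> Z" "!!u. u \<in> Z ==> dist y1 z <= dist y1 u"
  using distance_attains_inf[OF cZ, of y1] z0 by blast
 define t where "t = dist y1 z / 2"
 have fz: "f z = m" using z(1) by (simp add: Z_def)
 have t: "0 < t" using ne fz by (auto simp: t_def)
 have d1: "dist y1 z < \<rho>" using z(2)[OF z0] y1 by (simp add: dist_commute)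
 have dz: "dist z0 z < 2 * \<rho>" using d1 y1 dist_triangle[of z0 z y1] by simp
 have inner: "m < f u" if u: "dist y1 u < dist y1 z" for u
 proof -
  have "dist z0 u <= 2 * \<rho>" using u d1 y1 dist_triangle[of z0 u y1] by simp
  then have "u \<notin> Z ==> f u ~= m" by (simp add: Z_def)
  moreover have "u \<notin> Z" using z(2)[of u] u by auto
  ultimately show ?thesis using m(1)[of u] sub[of u] \<open>dist z0 u <= 2 * \<rho>\<close> \<rho>(1) by fastforce
 qed
 \<comment> \<open>The ball whose diameter runs from \<open>y1\<close> to \<open>z\<close> meets the
   minimum set at \<open>z\<close> only, whereas the sphere about \<open>y1\<close> might touch it
   at several points.\<close>
 define y where "y = (1/2) *\<^sub>R (y1 + z)"
 have yz: "z - y = y - y1" "norm (y - y1) = t"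
 proof -
  have "y - y1 = (1/2) *\<^sub>R (z - y1)" by (simp add: y_def vec_eq_iff field_simps)
  then show "norm (y - y1) = t" by (simp add: t_def dist_norm norm_minus_commute)
  show "z - y = y - y1" by (simp add: y_def vec_eq_iff field_simps)
 qed
 have par: "(norm (a + b))^2 = 2 * (norm a)^2 + 2 * (norm b)^2 - (norm (a - b))^2" for a b :: "real^'n"
  by (simp add: power2_norm_eq_inner inner_add_left inner_add_right inner_diff_left inner_diff_right inner_commute)
 have touch: "m < f u" if u: "norm (u - y) <= t" "u ~= z" for u
 proof (rule inner, rule ccontr)
  assume "\<not> dist y1 u < dist y1 z"
  then have "2 * t <= norm (u - y1)" by (simp add: t_def dist_norm norm_minus_commute)
  then have "(2 * t)^2 <= (norm (u - y1))^2" using t by (intro power_mono) auto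
  also have "u - y1 = (u - y) + (y - y1)" by simp
  also have "(norm ((u - y) + (y - y1)))^2 = 2 * (norm (u - y))^2 + 2 * (norm (y - y1))^2 - (norm ((u - y) - (y - y1)))^2"
   by (rule par)
  finally have 1: "(2 * t)^2 <= 2 * (norm (u - y))^2 + 2 * t^2 - (norm ((u - y) - (y - y1)))^2" unfolding yz(2) .
  have "(norm (u - y))^2 <= t^2" using u(1) by (intro power_mono) auto
  moreover define D where "D = (u - y) - (y - y1)"
  moreover have "(2 * t)^2 = 4 * t^2" by (simp add: power_mult_distrib)
  ultimately have "(norm D)^2 <= 0" using 1 unfolding D_def[symmetric] by linarith
  then have "D = 0" by simp
  then have "u - y = y - y1" unfolding D_def by (simp only: right_minus_eq)
  then have "u = z" using yz(1) by (metis diff_add_cancel)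
  then show False using u(2) by simp
 qed
 define s where "s = t / 2"
 have s: "0 < s" "s < \<rho>" using t d1 zero_le_dist[of y1 z] unfolding s_def t_def by linarith+
 let ?N = "cball z s"
 have NU: "?N \<subseteq> U"
 proof
  fix u assume "u \<in> ?N"
  then have "dist z0 u <= 3 * \<rho>" using dz s(2) dist_triangle[of z0 u z] by simp
  then show "u \<in> U" by (rule sub)
 qed
 have "y \<notin> ?N" using yz t by (simp add: s_def dist_norm)
 then obtain \<alpha> where \<alpha>: "0 < \<alpha>" "!!u E. u \<in> ?N ==> onb G u E ==> 0 < drift_lap (gauss \<alpha> y) u E"
  using hopf_barrier[OF compact_cball NU] by blast
 define v where "v = gauss \<alpha> y"
 have vU: "Cinf_on U v" unfolding v_def by (rule Cinf_on_gauss[OF U_open])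
 have v_exp: "v u = exp (- \<alpha> * (norm (u - y))^2)" for u by (simp add: v_def gauss_def power2_norm_eq_inner)
 have v01: "0 < v u" "v u <= 1" for u using \<alpha>(1) by (simp_all add: v_exp)
 have v_out: "v u < v z" if "t < norm (u - y)" for u
 proof -
  have "t^2 < (norm (u - y))^2" using that t by (intro power_strict_mono) auto
  then show ?thesis using \<alpha>(1) yz by (simp add: v_exp)
 qed
 have "compact (sphere z s \<inter> cball y t)" by (intro compact_Int_closed) auto
 moreover have "continuous_on (sphere z s \<inter> cball y t) f" by (rule cf) (use NU in auto)
 moreover have pos: "m < f u" if "u \<in> sphere z s \<inter> cball y t" for u
  by (rule touch) (use that s in \<open>auto simp: dist_norm norm_minus_commute\<close>)
 ultimately obtain c0 where c0: "0 < c0" "!!u. u \<in> sphere z s \<inter> cball y t ==> m + c0 <= f u"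
 proof (cases "sphere z s \<inter> cball y t = {}")
  case False
  assume c: "compact (sphere z s \<inter> cball y t)" "continuous_on (sphere z s \<inter> cball y t) f"
  from continuous_attains_inf[OF c(1) False c(2)] obtain u0 where u0: "u0 \<in> sphere z s \<inter> cball y t"
   "!!u. u \<in> sphere z s \<inter> cball y t ==> f u0 <= f u" by blast
  show ?thesis by (rule that[of "f u0 - m"]) (use pos[OF u0(1)] u0(2) in auto)
 qed (auto intro: that[of 1])
 \<comment> \<open>On the part of the small sphere inside the ball about \<open>y\<close>, f exceeds
   \<open>m\<close> by \<open>c0\<close> and v <= 1, so half of \<open>c0\<close> is small enough;
   on the rest v is smaller than at \<open>z\<close> and f >= m.\<close>
 define \<epsilon> where "\<epsilon> = c0 / 2"
 have \<epsilon>: "0 < \<epsilon>" using c0 by (simp add: \<epsilon>_def)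
 let ?F = "%u. f u - \<epsilon> * v u"
 have bd: "?F z < ?F u" if u: "u \<in> sphere z s" for u
 proof (cases "norm (u - y) <= t")
  case True
  then have "m + c0 <= f u" using c0(2)[of u] u by (simp add: dist_norm norm_minus_commute)
  moreover have "\<epsilon> * v u <= \<epsilon> * 1" using \<epsilon> v01(2)[of u] by (intro mult_left_mono) auto
  moreover have "0 < \<epsilon> * v z" using \<epsilon> v01(1)[of z] by simp
  moreover have "\<epsilon> * 1 < c0" using c0(1) by (simp add: \<epsilon>_def)
  ultimately show ?thesis using fz by linarith
 next
  case False
  then have "\<epsilon> * v u < \<epsilon> * v z" using \<epsilon> v_out[of u] by simp
  moreover have "m <= f u" using m(1) NU u by auto
  ultimately show ?thesis using fz by simp
 qed
 have "\<exists>x\<in>?N. \<forall>u\<in>?N. ?F x <= ?F u"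
 proof (rule continuous_attains_inf[OF compact_cball])
  show "?N ~= {}" using s by simp
  show "continuous_on ?N ?F"
   using NU by (intro continuous_on_diff continuous_on_mult continuous_on_const cf continuous_on_subset[OF Cinf_on_continuous[OF vU]])
 qed
 then obtain x where x: "x \<in> ?N" "!!u. u \<in> ?N ==> ?F x <= ?F u" by blast
 have "x \<notin> sphere z s"
 proof
  assume "x \<in> sphere z s"
  then have "?F z < ?F x" by (rule bd)
  then show False using x(2)[of z] s by simp
 qed
 then have xb: "x \<in> ball z s" using x(1) by auto
 have xU: "x \<in> U" using x(1) NU by blast
 obtain E where E: "onb G x E" using onb_exists[OF xU] by blast
 have "\<epsilon> * drift_lap v x E <= drift_lap f x E"
  by (rule drift_lap_interior_min[OF f vU xU E open_ball xb]) (use x(2) in auto)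
 moreover have "0 < \<epsilon> * drift_lap v x E" using \<epsilon> \<alpha>(2)[OF x(1) E] by (simp add: v_def)
 ultimately show False using sup[OF xU E] by linarith
qed

end

context soliton
begin

text \<open>The set where the minimum is attained is closed by continuity and open by the strong
  maximum principle in a chart, and the manifold is connected.\<close>

lemma scal_min_constant:
 assumes pinch: "!!q. lam * R q <= ricci_norm_sq A g q" and min: "!!q. R q0 <= R q"
 shows "R q = R q0"
proof -
 let ?Z = "{q \<in> UNIV. R q = R q0}"
 have cl: "closed ?Z" by (rule continuous_closed_preimage_constant[OF continuous_on_R closed_UNIV])
 have "\<exists>T. open T & q \<in> T & T \<subseteq> ?Z" if q: "q \<in> ?Z" for q
 proof -
  obtain c where c: "c \<in> A" "q \<in> cdom c" using chart_ex by blast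
  interpret S: local_soliton "cimg c" "G c" "\<phi> \<circ> cinv c" lam by (rule local_soliton_chart[OF c(1)])
  obtain e where e: "0 < e" "cball (cmap c q) e \<subseteq> cimg c" using open_cimg[OF c(1)] c open_contains_cball by (metis imageI)
  define \<rho> where "\<rho> = e / 3"
  have \<rho>: "0 < \<rho>" "cball (cmap c q) (3 * \<rho>) \<subseteq> cimg c" using e by (simp_all add: \<rho>_def)
  have Rc: "R (cinv c u) = scal_loc (G c) u" if "u \<in> cimg c" for u
   using R_chart[OF c(1), of "cinv c u"] that c(1) by simp
  have eq: "scal_loc (G c) u = R q0" if u: "u \<in> ball (cmap c q) \<rho>" for u
  proof (rule S.strong_minimum[OF S.smooth_scal _ _ _ \<rho> u])
   fix w E assume w: "w \<in> cimg c" "onb (G c) w E"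
   have "S.drift_lap (scal_loc (G c)) w E = 2 * lam * R (cinv c w) - 2 * ricci_norm_sq A g (cinv c w)"
    using S.drift_lap_scal[OF w] Rc[OF w(1)] ricci_norm_chart[OF c(1), of "cinv c w"] w(1) c(1) by simp
   then show "S.drift_lap (scal_loc (G c)) w E <= 0" using pinch[of "cinv c w"] by linarith
  next
   fix w assume w: "w \<in> cimg c"
   show "R q0 <= scal_loc (G c) w" using min[of "cinv c w"] Rc[OF w] by simp
  next
   show "scal_loc (G c) (cmap c q) = R q0" using q R_chart[OF c] by simp
  qed
  have bs: "ball (cmap c q) \<rho> \<subseteq> cimg c" using \<rho> by (auto simp: subset_iff)
  have "open (cinv c ` ball (cmap c q) \<rho>)" by (rule open_cinv_image[OF c(1) open_ball bs])
  moreover have "q \<in> cinv c ` ball (cmap c q) \<rho>" using c \<rho>(1) by (intro image_eqI[of _ _ "cmap c q"]) auto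
  moreover have "cinv c ` ball (cmap c q) \<rho> \<subseteq> ?Z" using eq Rc bs by auto
  ultimately show ?thesis by blast
 qed
 then have op: "open ?Z" by (subst open_subopen) blast
 have "?Z = {} \<or> ?Z = UNIV"
  using connected_mfd cl op unfolding connected_clopen by (auto simp: )
 then show ?thesis by blast
qed

lemma scal_constant_equality:
 assumes const: "!!q. R q = m"
 shows "lam * R q = ricci_norm_sq A g q"
proof -
 obtain c where c: "c \<in> A" "q \<in> cdom c" using chart_ex by blast
 interpret S: local_soliton "cimg c" "G c" "\<phi> \<circ> cinv c" lam by (rule local_soliton_chart[OF c(1)])
 have x: "cmap c q \<in> cimg c" using c by simp
 obtain E where E: "onb (G c) (cmap c q) E" using S.onb_exists[OF x] by blast
 have sm: "scal_loc (G c) u = m" if "u \<in> cimg c" for u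
  using const[of "cinv c u"] R_chart[OF c(1), of "cinv c u"] that c(1) by simp
 have d0: "dir (scal_loc (G c)) u h = 0" if "u \<in> cimg c" for u h
  using dir_cong_open[OF S.U_open that sm] by (simp add: dir_def)
 have "dir2 (scal_loc (G c)) (cmap c q) h = 0" for h
  unfolding dir2_def using dir_cong_open[OF S.U_open x d0] by (simp add: dir_def)
 then show ?thesis using drift_lap_R[OF c E] d0[OF x] by simp
qed

end

theorem theorem5p4:
  fixes A :: "('a::{t2_space,second_countable_topology}, 'n::finite) chart set"
    and g :: "'a metric_tensor"
    and \<phi> :: "'a \<Rightarrow> real"
    and lam :: real
    and \<psi> :: "nat \<Rightarrow> 'a \<Rightarrow> real"
  assumes dim: "CARD('n) \<ge> 3"
    and soliton: "gradient_ricci_soliton A g \<phi> lam"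
    and complete: "riem_complete A g"
    and shrinking: "lam > 0"
    and pinch: "\<forall>p. lam * scalar_curvature A g p \<le> ricci_norm_sq A g p"
    and psi_test: "\<forall>i. compactly_supported (\<psi> i) \<and> piecewise_smooth A (\<psi> i)"
    and psi_range: "\<forall>i p. 0 \<le> \<psi> i p \<and> \<psi> i p \<le> 1"
    and exhaustion_mono: "incseq (\<lambda>i. \<psi> i -` {1})"
    and exhaustion_cover: "(\<Union>i. \<psi> i -` {1}) = UNIV"
    and energy_bounded: "\<exists>C::real. \<forall>i. weighted_energy A g \<phi> (\<psi> i) \<le> ennreal C"
  shows "(\<exists>c. \<forall>p. scalar_curvature A g p = c) \<and>
         (\<forall>p. lam * scalar_curvature A g p = ricci_norm_sq A g p)"
proof -
 interpret complete_soliton A g \<phi> lam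
  by unfold_locales (use soliton complete shrinking in \<open>auto simp: gradient_ricci_soliton_def\<close>)
 have pin: "lam * R q <= ricci_norm_sq A g q" for q using pinch by (simp add: R_def)
 obtain q0 where "!!q. R q0 <= R q" using scal_attains_min[OF pin] by blast
 then have const: "R q = R q0" for q using scal_min_constant[OF pin] by blast
 then show ?thesis using scal_constant_equality[OF const] unfolding R_def by blast
qed

end
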